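(* Let $K$ be a kernel on $\mathbb R^n\setminus\{0\}$ satisfying, for some $c>0$ and $\varepsilon>0$: $|K(x)|\le c|x|^{-n}$; $\int_{r<|x|<R}K(x)\,dx=0$ for all $0<r<R<\infty$; and $|K(x)-K(x-y)|\le c|y|^\varepsilon/|x|^{n+\varepsilon}$ whenever $|y|\le|x|/2$. Let $K_\delta=K\chi_{\{|x|>\delta\}}$, $Tf(x)=\lim_{\delta\to0}f*K_\delta(x)$ and $T^*f(x)=\sup_{\delta>0}|f*K_\delta(x)|$. Then there is a constant $c(T,n,p)$ such that for every weight $w$ with $\|w\|_{A_p}<\infty$ and all $f\in L^p(w)$: (a) $\|Tf\|_{L^p(w)}\le c(T,n,p)\|w\|_{A_p}^{\max(1,\frac1{p-1})}\|f\|_{L^p(w)}$ for every $p\in(1,3/2]\cup[3,\infty)$; (b) $\|T^*f\|_{L^p(w)}\le c(T,n,p)\|w\|_{A_p}\|f\|_{L^p(w)}$ for every $p\ge3$.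
   Context: A weight is a non-negative locally integrable function $w$ on $\mathbb R^n$; $\|f\|_{L^p(w)}=(\int_{\mathbb R^n}|f|^pw\,dx)^{1/p}$. For $1<p<\infty$, $\|w\|_{A_p}=\sup_Q\big(\frac1{|Q|}\int_Qw\big)\big(\frac1{|Q|}\int_Qw^{-1/(p-1)}\big)^{p-1}$, the supremum over all cubes $Q\subset\mathbb R^n$. *)

theory Defs
  imports "HOL-Analysis.Analysis"
begin

text \<open>Power of an extended nonnegative real with a positive real exponent
  (infinity stays infinity).\<close>
definition epowr :: "ennreal \<Rightarrow> real \<Rightarrow> ennreal" where
  "epowr x a = (if x = \<infinity> then \<infinity> else ennreal (enn2real x powr a))"

definition is_cube :: "'a::euclidean_space set \<Rightarrow> bool" where
  "is_cube Q \<longleftrightarrow> (\<exists>a h. h > 0 \<and> Q = cbox a (a + h *\<^sub>R One))"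

definition is_weight :: "('a::euclidean_space \<Rightarrow> real) \<Rightarrow> bool" where
  "is_weight w \<longleftrightarrow> (\<forall>x. 0 \<le> w x) \<and> w \<in> borel_measurable lebesgue \<and>
     (\<forall>S. compact S \<longrightarrow> set_integrable lebesgue S w)"

definition dual_weight :: "real \<Rightarrow> ('a \<Rightarrow> real) \<Rightarrow> 'a \<Rightarrow> ennreal" where
  "dual_weight p w x = (if w x = 0 then \<infinity> else ennreal (w x powr (- 1 / (p - 1))))"

definition Ap_norm :: "real \<Rightarrow> ('a::euclidean_space \<Rightarrow> real) \<Rightarrow> ennreal" where
  "Ap_norm p w = (SUP Q\<in>{Q. is_cube Q}.
      ((\<integral>\<^sup>+x\<in>Q. ennreal (w x) \<partial>lebesgue) / emeasure lebesgue Q) *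
      epowr ((\<integral>\<^sup>+x\<in>Q. dual_weight p w x \<partial>lebesgue) / emeasure lebesgue Q) (p - 1))"

definition Lpw_nn :: "real \<Rightarrow> ('a::euclidean_space \<Rightarrow> real) \<Rightarrow> ('a \<Rightarrow> ennreal) \<Rightarrow> ennreal" where
  "Lpw_nn p w g = epowr (\<integral>\<^sup>+x. epowr (g x) p * ennreal (w x) \<partial>lebesgue) (1 / p)"

definition Lpw :: "real \<Rightarrow> ('a::euclidean_space \<Rightarrow> real) \<Rightarrow> ('a \<Rightarrow> real) \<Rightarrow> ennreal" where
  "Lpw p w f = Lpw_nn p w (\<lambda>x. ennreal \<bar>f x\<bar>)"

definition in_Lpw :: "real \<Rightarrow> ('a::euclidean_space \<Rightarrow> real) \<Rightarrow> ('a \<Rightarrow> real) \<Rightarrow> bool" where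
  "in_Lpw p w f \<longleftrightarrow> f \<in> borel_measurable lebesgue \<and> Lpw p w f < \<infinity>"

definition trunc_kernel :: "('a::real_normed_vector \<Rightarrow> real) \<Rightarrow> real \<Rightarrow> 'a \<Rightarrow> real" where
  "trunc_kernel K \<delta> x = (if norm x > \<delta> then K x else 0)"

definition trunc_conv :: "('a::euclidean_space \<Rightarrow> real) \<Rightarrow> real \<Rightarrow> ('a \<Rightarrow> real) \<Rightarrow> 'a \<Rightarrow> real" where
  "trunc_conv K \<delta> f x = (\<integral>y. f y * trunc_kernel K \<delta> (x - y) \<partial>lebesgue)"

definition max_trunc :: "('a::euclidean_space \<Rightarrow> real) \<Rightarrow> ('a \<Rightarrow> real) \<Rightarrow> 'a \<Rightarrow> ennreal" where
  "max_trunc K f x = (SUP \<delta>\<in>{0<..}. ennreal \<bar>trunc_conv K \<delta> f x\<bar>)"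

definition CZ_kernel :: "('a::euclidean_space \<Rightarrow> real) \<Rightarrow> real \<Rightarrow> real \<Rightarrow> bool" where
  "CZ_kernel K c \<epsilon> \<longleftrightarrow> c > 0 \<and> \<epsilon> > 0 \<and> K \<in> borel_measurable lebesgue \<and>
     (\<forall>x. x \<noteq> 0 \<longrightarrow> \<bar>K x\<bar> \<le> c * norm x powr (- real DIM('a))) \<and>
     (\<forall>r R. 0 < r \<and> r < R \<longrightarrow>
        (LINT x:{x. r < norm x \<and> norm x < R}|lebesgue. K x) = 0) \<and>
     (\<forall>x y. x \<noteq> 0 \<and> norm y \<le> norm x / 2 \<longrightarrow>
        \<bar>K x - K (x - y)\<bar> \<le> c * norm y powr \<epsilon> / norm x powr (real DIM('a) + \<epsilon>))"

end

theory Submission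
  imports Defs
begin

text \<open>Splitting \<open>K\<close> into dyadic annuli, Cotlar's almost orthogonality bounds the truncated operators
  on \<open>L\<^sup>2\<close>, and a Calderon-Zygmund decomposition along dyadic stopping cubes gives the weak type \<open>(1,1)\<close>
  bound, first for these operators and then for the grand maximal operator
  \<open>sup\<^bsub>Q \<ni> x\<^esub> sup\<^bsub>\<xi> \<in> Q, \<delta>\<^esub> |K\<^sub>\<delta> * (f 1\<^bsub>- 3Q\<^esub>)(\<xi>)|\<close>. Stopping when either this operator or the average of \<open>f\<close> is
  large dominates the maximal truncation pointwise by a sparse sum of averages \<open>\<Sum>\<^sub>Q 1\<^sub>Q \<langle>|f|\<rangle>\<^bsub>3Q\<^esub>\<close>. A sparse
  operator is bounded on \<open>L\<^sup>p(w)\<close> by a multiple of the \<open>max(1, 1/(p-1))\<close>-th power of the \<open>A\<^sub>p\<close> constant: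
  by duality with \<open>\<sigma> = w\<^bsup>-1/(p-1)\<^esup>\<close> the bilinear form reduces to two Carleson embeddings with respect to
  the measures \<open>w\<close> and \<open>\<sigma>\<close>. Both estimates then follow for all \<open>p > 1\<close> by Fatou's lemma. Almost everywhere
  convergence follows from the weak type bound and from the convergence for indicators of finite unions of
  balls; where \<open>f\<close> is not locally integrable, the truncated integrals do not exist and take the value \<open>0\<close>.\<close>

section \<open>Convolution of bounded integrable functions\<close>

text \<open>For truncations at \<open>\<delta>\<close> \<ge> \<open>\<eta>\<close> the stopping may
  end at a level \<open>N\<close> whose tripled cubes have diameter below \<open>\<eta>\<close>,
  where nothing is left to estimate. All families of cubes are therefore finite, and since no
  constant depends on \<open>\<eta>\<close>, on \<open>N\<close> or on the number of cubes, one
  passage to the limit at the end gives the weighted bounds. The exponent of the A_p constant is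
  decided in one place: for p \<ge> 2 the A_p product on a tripled cube is played against |E| \<le>
  2 w(E)^(1/p) \<sigma>(E)^(1/q) on the private part E of the cube, which is disjoint from the parts
  of the other members. This costs the first power of the A_p constant, and the two embeddings that
  remain have constants independent of the weights. Functions that are not locally integrable do
  occur: w = 0 has A_p constant 0, because 0 times infinity is 0, so every measurable f lies in its
  space, and convergence almost everywhere is claimed for it too.\<close>

lemma lborel_distr_reflect: "distr lborel borel (\<lambda>y. t - y) = (lborel :: 'a::euclidean_space measure)"
  using lborel_affine[of "-1::real" t] by (simp add: density_1)

lemma lborel_integral_reflect:
  fixes f :: "'a::euclidean_space \<Rightarrow> real"
  assumes [measurable]: "f \<in> borel_measurable borel"
  shows "(\<integral>y. f (t - y) \<partial>lborel) = (\<integral>y. f y \<partial>lborel)"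
  by (subst (2) lborel_distr_reflect[of t, symmetric], subst integral_distr) auto

lemma lborel_integrable_reflect:
  fixes f :: "'a::euclidean_space \<Rightarrow> real"
  assumes "integrable lborel f"
  shows "integrable lborel (\<lambda>y. f (t - y))"
proof -
  have "integrable (distr lborel borel (\<lambda>y. t - y)) f"
    using assms by (simp add: lborel_distr_reflect)
  then show ?thesis by (subst (asm) integrable_distr_eq) (use assms in auto)
qed

lemma lborel_integrable_translate:
  fixes f :: "'a::euclidean_space \<Rightarrow> real"
  assumes "integrable lborel f"
  shows "integrable lborel (\<lambda>y. f (y - t))"
  using lborel_integrable_reflect[OF lborel_integrable_reflect[OF assms, of 0], of t] by simp

lemma lborel_integral_translate:
  fixes f :: "'a::euclidean_space \<Rightarrow> real"
  assumes [measurable]: "f \<in> borel_measurable borel"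
  shows "(\<integral>y. f (y - t) \<partial>lborel) = (\<integral>y. f y \<partial>lborel)"
  using lborel_integral_reflect[of "\<lambda>z. f (0 - z)" t] lborel_integral_reflect[of f 0] by simp

text \<open>Working class for the L^2 theory: bounded integrable functions are square integrable and
  stable under sums, products and convolution, so Fubini, associativity and Cauchy-Schwarz apply to
  everything built from them.\<close>

definition bint :: "('a::euclidean_space \<Rightarrow> real) \<Rightarrow> bool" where
  "bint u \<longleftrightarrow> integrable lborel u \<and> (\<exists>B. \<forall>x. \<bar>u x\<bar> \<le> B)"

definition conv :: "('a::euclidean_space \<Rightarrow> real) \<Rightarrow> ('a \<Rightarrow> real) \<Rightarrow> 'a \<Rightarrow> real" where
  "conv k u x = (\<integral>y. k (x - y) * u y \<partial>lborel)"

text \<open>Kernel of the adjoint: the transpose of convolution with \<open>k\<close> is convolution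
  with \<open>reflect k\<close>, see \<open>ip_adjoint\<close>.\<close>

definition reflect :: "('a::euclidean_space \<Rightarrow> real) \<Rightarrow> 'a \<Rightarrow> real" where
  "reflect u x = u (- x)"

definition ip :: "('a::euclidean_space \<Rightarrow> real) \<Rightarrow> ('a \<Rightarrow> real) \<Rightarrow> real" where
  "ip u v = (\<integral>x. u x * v x \<partial>lborel)"

lemma bint_integrable: "bint u \<Longrightarrow> integrable lborel u"
  by (simp add: bint_def)

lemma bint_measurable: "bint u \<Longrightarrow> u \<in> borel_measurable borel"
  by (auto simp: bint_def)

lemma bint_bounded:
  assumes "bint u" shows "\<exists>B\<ge>0. \<forall>x. \<bar>u x\<bar> \<le> B"
proof -
  from assms obtain B where "\<forall>x. \<bar>u x\<bar> \<le> B" by (auto simp: bint_def)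
  then have "\<bar>u x\<bar> \<le> \<bar>B\<bar>" for x by (meson abs_ge_self order_trans)
  then show ?thesis by (intro exI[of _ "\<bar>B\<bar>"]) simp
qed

lemma integrable_mult_bounded:
  fixes u v :: "'a \<Rightarrow> real"
  assumes "integrable M u" "v \<in> borel_measurable M" "\<And>x. \<bar>v x\<bar> \<le> B"
  shows "integrable M (\<lambda>x. v x * u x)"
proof (rule Bochner_Integration.integrable_bound[of M "\<lambda>x. B * u x"])
  have "norm (v x * u x) \<le> norm (B * u x)" for x
    using order_trans[OF assms(3)[of x] abs_ge_self] by (simp add: abs_mult mult_right_mono)
  then show "AE x in M. norm (v x * u x) \<le> norm (B * u x)" by simp
qed (use assms in auto)

lemma bint_mult: "bint u \<Longrightarrow> bint v \<Longrightarrow> bint (\<lambda>x. u x * v x)"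
proof -
  assume u: "bint u" and v: "bint v"
  obtain B where B: "B \<ge> 0" "\<And>x. \<bar>u x\<bar> \<le> B" using bint_bounded[OF u] by blast
  obtain C where C: "C \<ge> 0" "\<And>x. \<bar>v x\<bar> \<le> C" using bint_bounded[OF v] by blast
  have "\<bar>u x * v x\<bar> \<le> B * C" for x using B C by (simp add: abs_mult mult_mono)
  then show ?thesis unfolding bint_def
    using integrable_mult_bounded[OF bint_integrable[OF v] _ B(2)] bint_measurable[OF u] by auto
qed

lemma bint_add: "bint u \<Longrightarrow> bint v \<Longrightarrow> bint (\<lambda>x. u x + v x)"
proof -
  assume u: "bint u" and v: "bint v"
  obtain B where B: "B \<ge> 0" "\<And>x. \<bar>u x\<bar> \<le> B" using bint_bounded[OF u] by blast
  obtain C where C: "C \<ge> 0" "\<And>x. \<bar>v x\<bar> \<le> C" using bint_bounded[OF v] by blast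
  have "\<bar>u x + v x\<bar> \<le> B + C" for x using B(2)[of x] C(2)[of x] by linarith
  then show ?thesis unfolding bint_def using u v by (auto simp: bint_def)
qed

lemma bint_cmult: "bint u \<Longrightarrow> bint (\<lambda>x. a * u x)"
proof -
  assume u: "bint u"
  obtain B where B: "B \<ge> 0" "\<And>x. \<bar>u x\<bar> \<le> B" using bint_bounded[OF u] by blast
  have "\<bar>a * u x\<bar> \<le> \<bar>a\<bar> * B" for x using B by (simp add: abs_mult mult_left_mono)
  then show ?thesis unfolding bint_def using u by (auto simp: bint_def)
qed

lemma bint_zero: "bint (\<lambda>x. 0)" by (auto simp: bint_def)

lemma bint_sum: "(\<And>i. i \<in> I \<Longrightarrow> bint (u i)) \<Longrightarrow> bint (\<lambda>x. \<Sum>i\<in>I. u i x)"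
  by (induction I rule: infinite_finite_induct) (auto intro: bint_add bint_zero)

lemma bint_abs: "bint u \<Longrightarrow> bint (\<lambda>x. \<bar>u x\<bar>)"
  by (auto simp: bint_def)

lemma bint_reflect: "bint u \<Longrightarrow> bint (reflect u)"
  using lborel_integrable_reflect[of u 0] by (auto simp: bint_def reflect_def[abs_def])

lemma reflect_reflect: "reflect (reflect u) = u" by (auto simp: reflect_def)

lemma conv_pair_integrable:
  fixes k u :: "'a::euclidean_space \<Rightarrow> real"
  assumes k: "integrable lborel k" and u: "integrable lborel u"
  shows "integrable (lborel \<Otimes>\<^sub>M lborel) (\<lambda>(x, y). k (x - y) * u y)"
proof -
  have [measurable]: "k \<in> borel_measurable borel" "u \<in> borel_measurable borel" using k u by auto
  have "integrable (lborel \<Otimes>\<^sub>M lborel) (\<lambda>(y, x). k (x - y) * u y)"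
  proof (rule lborel_pair.Fubini_integrable)
    have "(\<integral>x. norm (k (x - y) * u y) \<partial>lborel) = (\<integral>x. \<bar>k x\<bar> \<partial>lborel) * \<bar>u y\<bar>" for y
      using lborel_integral_translate[of "\<lambda>x. \<bar>k x\<bar>" y] by (simp add: abs_mult)
    then show "integrable lborel (\<lambda>y. \<integral>x. norm (case (y, x) of (y, x) \<Rightarrow> k (x - y) * u y) \<partial>lborel)"
      using u by simp
    show "AE y in lborel. integrable lborel (\<lambda>x. case (y, x) of (y, x) \<Rightarrow> k (x - y) * u y)"
      using lborel_integrable_translate[OF k] by simp
  qed measurable
  from lborel_pair.integrable_product_swap[OF this] show ?thesis by simp
qed

lemma conv_integrable:
  assumes k: "integrable lborel k" and u: "integrable lborel u"
  shows "integrable lborel (conv k u)"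
  using lborel_pair.integrable_fst[OF conv_pair_integrable[OF k u]] by (simp add: conv_def[abs_def])

lemma conv_L1:
  fixes k u :: "'a::euclidean_space \<Rightarrow> real"
  assumes k: "integrable lborel k" and u: "integrable lborel u"
  shows "(\<integral>x. \<bar>conv k u x\<bar> \<partial>lborel) \<le> (\<integral>x. \<bar>k x\<bar> \<partial>lborel) * (\<integral>x. \<bar>u x\<bar> \<partial>lborel)"
proof -
  have p: "integrable (lborel \<Otimes>\<^sub>M lborel) (\<lambda>(x, y). \<bar>k (x - y)\<bar> * \<bar>u y\<bar>)"
    using conv_pair_integrable[of "\<lambda>x. \<bar>k x\<bar>" "\<lambda>x. \<bar>u x\<bar>"] k u by auto
  have m: "k \<in> borel_measurable borel" using k by auto
  have "(\<integral>x. \<bar>conv k u x\<bar> \<partial>lborel) \<le> (\<integral>x. (\<integral>y. \<bar>k (x - y)\<bar> * \<bar>u y\<bar> \<partial>lborel) \<partial>lborel)"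
    unfolding conv_def
    using lborel_pair.integrable_fst[OF p] conv_integrable[OF k u]
    by (intro integral_mono) (auto simp: abs_mult[symmetric] conv_def[abs_def])
  also have "\<dots> = (\<integral>y. (\<integral>x. \<bar>k (x - y)\<bar> * \<bar>u y\<bar> \<partial>lborel) \<partial>lborel)"
    using lborel_pair.Fubini_integral[OF p] by simp
  also have "\<dots> = (\<integral>y. (\<integral>x. \<bar>k x\<bar> \<partial>lborel) * \<bar>u y\<bar> \<partial>lborel)"
    using lborel_integral_translate[of "\<lambda>x. \<bar>k x\<bar>"] m by simp
  finally show ?thesis by simp
qed

lemma conv_bound:
  fixes k u :: "'a::euclidean_space \<Rightarrow> real"
  assumes k: "k \<in> borel_measurable borel" "\<And>x. \<bar>k x\<bar> \<le> B" and u: "integrable lborel u"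
  shows "\<bar>conv k u x\<bar> \<le> B * (\<integral>x. \<bar>u x\<bar> \<partial>lborel)" "integrable lborel (\<lambda>y. k (x - y) * u y)"
proof -
  have [measurable]: "k \<in> borel_measurable borel" by fact
  show i: "integrable lborel (\<lambda>y. k (x - y) * u y)"
    by (rule integrable_mult_bounded[OF u]) (auto intro: k)
  have "\<bar>conv k u x\<bar> \<le> (\<integral>y. \<bar>k (x - y) * u y\<bar> \<partial>lborel)"
    unfolding conv_def using integral_abs_bound[of lborel "\<lambda>y. k (x - y) * u y"] by simp
  also have "\<dots> \<le> (\<integral>y. B * \<bar>u y\<bar> \<partial>lborel)"
    using integrable_abs[OF i] u k(2) by (intro integral_mono) (auto simp: abs_mult mult_right_mono)
  finally show "\<bar>conv k u x\<bar> \<le> B * (\<integral>x. \<bar>u x\<bar> \<partial>lborel)" by simp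
qed

lemma bint_conv: "bint k \<Longrightarrow> bint u \<Longrightarrow> bint (conv k u)"
  using conv_bound(1)[of k _ u] conv_integrable[of k u] bint_measurable[of k]
  by (auto simp: bint_def)

lemma conv_commute:
  fixes k u :: "'a::euclidean_space \<Rightarrow> real"
  assumes [measurable]: "k \<in> borel_measurable borel" "u \<in> borel_measurable borel"
  shows "conv k u = conv u k"
proof
  fix x
  show "conv k u x = conv u k x"
    using lborel_integral_reflect[of "\<lambda>y. u (x - y) * k y" x] by (simp add: conv_def mult.commute)
qed

lemma conv_assoc:
  fixes k l u :: "'a::euclidean_space \<Rightarrow> real"
  assumes k: "bint k" and l: "bint l" and u: "bint u"
  shows "conv k (conv l u) = conv (conv k l) u"
proof
  fix x
  have [measurable]: "k \<in> borel_measurable borel" "u \<in> borel_measurable borel" "l \<in> borel_measurable borel"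
    using assms bint_measurable by auto
  obtain B where B: "B \<ge> 0" "\<And>x. \<bar>k x\<bar> \<le> B" using bint_bounded[OF k] by blast
  have i: "integrable (lborel \<Otimes>\<^sub>M lborel) (\<lambda>(y, z). k (x - y) * (l (y - z) * u z))"
    using integrable_mult_bounded[OF conv_pair_integrable[of l u], of "\<lambda>(y, z). k (x - y)" B]
      B l u bint_integrable by (auto simp: split_beta')
  have "conv k (conv l u) x = (\<integral>y. (\<integral>z. k (x - y) * (l (y - z) * u z) \<partial>lborel) \<partial>lborel)"
    by (simp add: conv_def)
  also have "\<dots> = (\<integral>z. (\<integral>y. k (x - y) * (l (y - z) * u z) \<partial>lborel) \<partial>lborel)"
    using lborel_pair.Fubini_integral[OF i] by simp
  also have "\<dots> = (\<integral>z. conv k l (x - z) * u z \<partial>lborel)"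
  proof (rule Bochner_Integration.integral_cong[OF refl])
    fix z
    have "(\<integral>y. k (x - y) * (l (y - z) * u z) \<partial>lborel) = (\<integral>y. k (x - y) * l (y - z) \<partial>lborel) * u z"
      by (simp flip: mult.assoc)
    also have "(\<integral>y. k (x - y) * l (y - z) \<partial>lborel) = conv k l (x - z)"
      using lborel_integral_translate[of "\<lambda>y. k (x - z - y) * l y" z] by (simp add: conv_def)
    finally show "(\<integral>y. k (x - y) * (l (y - z) * u z) \<partial>lborel) = conv k l (x - z) * u z" .
  qed
  finally show "conv k (conv l u) x = conv (conv k l) u x" by (simp add: conv_def)
qed

lemma reflect_conv:
  fixes k u :: "'a::euclidean_space \<Rightarrow> real"
  assumes [measurable]: "k \<in> borel_measurable borel" "u \<in> borel_measurable borel"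
  shows "reflect (conv k u) = conv (reflect k) (reflect u)"
proof
  fix x
  show "reflect (conv k u) x = conv (reflect k) (reflect u) x"
    using lborel_integral_reflect[of "\<lambda>y. k (- x - y) * u y" 0]
    by (simp add: conv_def reflect_def minus_diff_commute algebra_simps)
qed

lemma ip_conv_reflect: "ip u v = conv (reflect u) v 0"
  by (simp add: ip_def conv_def reflect_def)

text \<open>By \<open>ip_conv_reflect\<close> an inner product is a convolution evaluated at 0, so
  the adjoint formula becomes associativity and commutativity of convolution.\<close>

lemma ip_adjoint:
  assumes k: "bint k" and u: "bint u" and v: "bint v"
  shows "ip (conv k u) v = ip u (conv (reflect k) v)"
proof -
  note r = bint_reflect[OF k] bint_reflect[OF u]
  have "reflect (conv k u) = conv (reflect u) (reflect k)"
    by (simp add: reflect_conv conv_commute[of "reflect k" "reflect u"] r k u bint_measurable)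
  then show ?thesis
    by (simp add: ip_conv_reflect conv_assoc[OF r(2) r(1) v])
qed

text \<open>The integral of (s f + t g)^2 is a nonnegative quadratic form in s and t. The choice s =
  c, t = -b gives the claim after division by c; if c = 0, the form is linear in t for fixed s and
  forces b = 0.\<close>

lemma Cauchy_Schwarz_integral:
  fixes f g :: "'a \<Rightarrow> real"
  assumes f: "integrable M (\<lambda>x. f x * f x)" and g: "integrable M (\<lambda>x. g x * g x)"
    and fg: "integrable M (\<lambda>x. f x * g x)"
  shows "(\<integral>x. f x * g x \<partial>M)\<^sup>2 \<le> (\<integral>x. f x * f x \<partial>M) * (\<integral>x. g x * g x \<partial>M)"
proof -
  let ?a = "\<integral>x. f x * f x \<partial>M" and ?b = "\<integral>x. f x * g x \<partial>M" and ?c = "\<integral>x. g x * g x \<partial>M"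
  have q: "0 \<le> ?a * s\<^sup>2 + 2 * s * t * ?b + ?c * t\<^sup>2" for s t
  proof -
    have "0 \<le> (\<integral>x. (s * f x + t * g x)\<^sup>2 \<partial>M)" by simp
    also have "(\<lambda>x. (s * f x + t * g x)\<^sup>2) =
        (\<lambda>x. s\<^sup>2 * (f x * f x) + (2 * s * t) * (f x * g x) + t\<^sup>2 * (g x * g x))"
      by (auto simp: power2_eq_square algebra_simps)
    also have "(\<integral>x. \<dots> x \<partial>M) = s\<^sup>2 * ?a + (2 * s * t) * ?b + t\<^sup>2 * ?c"
      using f g fg by simp
    finally show ?thesis by (simp add: mult.commute)
  qed
  have a0: "?a \<ge> 0" by simp
  have c0: "?c \<ge> 0" by simp
  show ?thesis
  proof (cases "?c = 0")
    case True
    have "?b = 0"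
    proof (rule ccontr)
      assume b: "?b \<noteq> 0"
      define t where "t = - (?a + 1) / (2 * ?b)"
      have "2 * t * ?b = - (?a + 1)" using b by (simp add: t_def)
      then show False using q[of 1 t] unfolding True by simp
    qed
    then show ?thesis using True by simp
  next
    case False
    then have "?c > 0" using c0 by linarith
    have "0 \<le> ?c * (?a * ?c - ?b\<^sup>2)"
      using q[of "?c" "- ?b"] by (simp add: power2_eq_square algebra_simps)
    then show ?thesis using \<open>?c > 0\<close> by (simp add: zero_le_mult_iff)
  qed
qed

section \<open>Norm bounds for convolution operators on L^2\<close>

lemma ip_nonneg: "ip u u \<ge> 0" by (simp add: ip_def)

lemma ip_Cauchy_Schwarz: "bint u \<Longrightarrow> bint v \<Longrightarrow> (ip u v)\<^sup>2 \<le> ip u u * ip v v"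
  unfolding ip_def by (intro Cauchy_Schwarz_integral) (auto intro: bint_integrable bint_mult)

text \<open>An upper bound for the operator norm on L^2, tested on \<open>bint\<close> functions.
  Nonnegativity of \<open>B\<close> is included so that bounds can be squared, compared and
  multiplied.\<close>

definition L2_bound :: "('a::euclidean_space \<Rightarrow> real) \<Rightarrow> real \<Rightarrow> bool" where
  "L2_bound k B \<longleftrightarrow> B \<ge> 0 \<and> (\<forall>u. bint u \<longrightarrow> ip (conv k u) (conv k u) \<le> B\<^sup>2 * ip u u)"

lemma L2_bound_mono: "L2_bound k A \<Longrightarrow> A \<le> B \<Longrightarrow> L2_bound k B"
  unfolding L2_bound_def
  by (meson ip_nonneg mult_right_mono order_trans power_mono)

text \<open>Young's inequality for L^1 kernels: pointwise Cauchy-Schwarz for the splitting of |k|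
  |u| into sqrt |k| and sqrt |k| |u|, followed by the L^1 estimate for the convolution of |k| and
  u^2.\<close>

lemma L2_bound_L1:
  assumes k: "bint k" shows "L2_bound k (\<integral>x. \<bar>k x\<bar> \<partial>lborel)"
  unfolding L2_bound_def
proof (intro conjI allI impI)
  let ?A = "\<integral>x. \<bar>k x\<bar> \<partial>lborel"
  fix u :: "'a \<Rightarrow> real" assume u: "bint u"
  have [measurable]: "k \<in> borel_measurable borel" "u \<in> borel_measurable borel"
    using assms u bint_measurable by auto
  obtain B where B: "B \<ge> 0" "\<And>x. \<bar>k x\<bar> \<le> B" using bint_bounded[OF k] by blast
  obtain C where C: "C \<ge> 0" "\<And>x. \<bar>u x\<bar> \<le> C" using bint_bounded[OF u] by blast
  have uu: "bint (\<lambda>x. u x * u x)" using bint_mult[OF u u] .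
  note ak = bint_abs[OF k] and au = bint_abs[OF u]
  have pt: "(conv k u x)\<^sup>2 \<le> ?A * conv (\<lambda>x. \<bar>k x\<bar>) (\<lambda>x. u x * u x) x" for x
  proof -
    have sq: "(sqrt \<bar>k (x - y)\<bar> * \<bar>u y\<bar>) * (sqrt \<bar>k (x - y)\<bar> * \<bar>u y\<bar>) = \<bar>k (x - y)\<bar> * (u y * u y)" for y
    proof -
      have "(sqrt \<bar>k (x - y)\<bar> * \<bar>u y\<bar>) * (sqrt \<bar>k (x - y)\<bar> * \<bar>u y\<bar>)
         = (sqrt \<bar>k (x - y)\<bar> * sqrt \<bar>k (x - y)\<bar>) * (\<bar>u y\<bar> * \<bar>u y\<bar>)" by (simp only: ac_simps)
      then show ?thesis by simp
    qed
    have "\<bar>conv k u x\<bar> \<le> conv (\<lambda>x. \<bar>k x\<bar>) (\<lambda>x. \<bar>u x\<bar>) x"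
      unfolding conv_def using integral_abs_bound[of lborel "\<lambda>y. k (x - y) * u y"]
      by (simp add: abs_mult)
    then have "(conv k u x)\<^sup>2 \<le> (conv (\<lambda>x. \<bar>k x\<bar>) (\<lambda>x. \<bar>u x\<bar>) x)\<^sup>2"
      using abs_le_square_iff by fastforce
    also have "conv (\<lambda>x. \<bar>k x\<bar>) (\<lambda>x. \<bar>u x\<bar>) x
        = (\<integral>y. sqrt \<bar>k (x - y)\<bar> * (sqrt \<bar>k (x - y)\<bar> * \<bar>u y\<bar>) \<partial>lborel)"
      unfolding conv_def by (simp flip: mult.assoc)
    also have "\<dots>\<^sup>2 \<le> (\<integral>y. sqrt \<bar>k (x - y)\<bar> * sqrt \<bar>k (x - y)\<bar> \<partial>lborel) *
       (\<integral>y. (sqrt \<bar>k (x - y)\<bar> * \<bar>u y\<bar>) * (sqrt \<bar>k (x - y)\<bar> * \<bar>u y\<bar>) \<partial>lborel)"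
    proof (rule Cauchy_Schwarz_integral)
      show "integrable lborel (\<lambda>y. sqrt \<bar>k (x - y)\<bar> * sqrt \<bar>k (x - y)\<bar>)"
        using lborel_integrable_reflect[OF bint_integrable[OF ak]] by simp
      show "integrable lborel (\<lambda>y. sqrt \<bar>k (x - y)\<bar> * \<bar>u y\<bar> * (sqrt \<bar>k (x - y)\<bar> * \<bar>u y\<bar>))"
        unfolding sq using conv_bound(2)[of "\<lambda>x. \<bar>k x\<bar>" B "\<lambda>x. u x * u x" x] B uu
        by (simp add: bint_def)
      show "integrable lborel (\<lambda>y. sqrt \<bar>k (x - y)\<bar> * (sqrt \<bar>k (x - y)\<bar> * \<bar>u y\<bar>))"
        using conv_bound(2)[of "\<lambda>x. \<bar>k x\<bar>" B "\<lambda>x. \<bar>u x\<bar>" x] B au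
        by (simp add: bint_def flip: mult.assoc)
    qed
    also have "(\<integral>y. sqrt \<bar>k (x - y)\<bar> * sqrt \<bar>k (x - y)\<bar> \<partial>lborel) = ?A"
      using lborel_integral_reflect[of "\<lambda>x. \<bar>k x\<bar>" x] by simp
    finally show ?thesis by (simp add: conv_def sq)
  qed
  have "ip (conv k u) (conv k u) = (\<integral>x. (conv k u x)\<^sup>2 \<partial>lborel)" by (simp add: ip_def power2_eq_square)
  also have "\<dots> \<le> (\<integral>x. ?A * conv (\<lambda>x. \<bar>k x\<bar>) (\<lambda>x. u x * u x) x \<partial>lborel)"
    using bint_integrable[OF bint_mult[OF bint_conv[OF k u] bint_conv[OF k u]]]
      bint_integrable[OF bint_conv[OF ak uu]] pt
    by (intro integral_mono) (auto simp: power2_eq_square)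
  also have "\<dots> \<le> ?A * (?A * ip u u)"
  proof -
    have "(\<integral>x. conv (\<lambda>x. \<bar>k x\<bar>) (\<lambda>x. u x * u x) x \<partial>lborel)
       \<le> (\<integral>x. \<bar>conv (\<lambda>x. \<bar>k x\<bar>) (\<lambda>x. u x * u x) x\<bar> \<partial>lborel)"
      using integral_abs_bound[of lborel "conv (\<lambda>x. \<bar>k x\<bar>) (\<lambda>x. u x * u x)"] by linarith
    also have "\<dots> \<le> ?A * ip u u"
      using conv_L1[OF bint_integrable[OF ak] bint_integrable[OF uu]] by (simp add: ip_def)
    finally show ?thesis by (simp add: mult_left_mono)
  qed
  finally show "ip (conv k u) (conv k u) \<le> ?A\<^sup>2 * ip u u" by (simp add: power2_eq_square)
qed simp

lemma L2_boundD: "L2_bound k B \<Longrightarrow> bint u \<Longrightarrow> ip (conv k u) (conv k u) \<le> B\<^sup>2 * ip u u"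
  by (simp add: L2_bound_def)

lemma L2_bound_nonneg: "L2_bound k B \<Longrightarrow> 0 \<le> B"
  by (simp add: L2_bound_def)

lemma L2_bound_conv:
  assumes "bint k" "bint l" "L2_bound k A" "L2_bound l B"
  shows "L2_bound (conv k l) (A * B)"
  unfolding L2_bound_def
proof (intro conjI allI impI)
  show "0 \<le> A * B"
    by (intro mult_nonneg_nonneg L2_bound_nonneg[OF assms(3)] L2_bound_nonneg[OF assms(4)])
  fix u :: "'a \<Rightarrow> real" assume u: "bint u"
  have "ip (conv (conv k l) u) (conv (conv k l) u) \<le> A\<^sup>2 * ip (conv l u) (conv l u)"
    unfolding conv_assoc[OF assms(1,2) u, symmetric]
    by (rule L2_boundD[OF assms(3) bint_conv[OF assms(2) u]])
  also have "\<dots> \<le> A\<^sup>2 * (B\<^sup>2 * ip u u)"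
    by (intro mult_left_mono L2_boundD[OF assms(4) u]) simp
  finally show "ip (conv (conv k l) u) (conv (conv k l) u) \<le> (A * B)\<^sup>2 * ip u u"
    by (simp add: power_mult_distrib mult.assoc)
qed

lemma conv_add_left:
  assumes "bint k" "bint l" "bint u"
  shows "conv (\<lambda>x. k x + l x) u = (\<lambda>x. conv k u x + conv l u x)"
proof
  fix x
  obtain B where B: "B \<ge> 0" "\<And>x. \<bar>k x\<bar> \<le> B" using bint_bounded[OF assms(1)] by blast
  obtain C where C: "C \<ge> 0" "\<And>x. \<bar>l x\<bar> \<le> C" using bint_bounded[OF assms(2)] by blast
  show "conv (\<lambda>x. k x + l x) u x = conv k u x + conv l u x"
    using conv_bound(2)[of k B u x] conv_bound(2)[of l C u x] B C assms
    by (simp add: conv_def distrib_right bint_measurable bint_integrable)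
qed

lemma conv_cmult_left: "conv (\<lambda>x. a * k x) u = (\<lambda>x. a * conv k u x)"
  by (auto simp: conv_def mult.assoc)

lemma conv_cmult_right: "conv k (\<lambda>x. a * u x) = (\<lambda>x. a * conv k u x)"
  by (auto simp: conv_def mult.left_commute)

lemma L2_bound_add:
  assumes "bint k" "bint l" "L2_bound k A" "L2_bound l B"
  shows "L2_bound (\<lambda>x. k x + l x) (A + B)"
  unfolding L2_bound_def
proof (intro conjI allI impI)
  have AB: "A \<ge> 0" "B \<ge> 0" using assms(3,4) by (auto dest: L2_bound_nonneg)
  then show "0 \<le> A + B" by simp
  fix u :: "'a \<Rightarrow> real" assume u: "bint u"
  let ?f = "conv k u" and ?g = "conv l u"
  have b: "bint ?f" "bint ?g" using assms(1,2) u by (auto intro: bint_conv)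
  have f: "ip ?f ?f \<le> A\<^sup>2 * ip u u" and g: "ip ?g ?g \<le> B\<^sup>2 * ip u u"
    using assms(3,4) u by (auto dest: L2_boundD)
  have "(ip ?f ?g)\<^sup>2 \<le> ip ?f ?f * ip ?g ?g" using ip_Cauchy_Schwarz[OF b] .
  also have "\<dots> \<le> (A\<^sup>2 * ip u u) * (B\<^sup>2 * ip u u)"
    using f g by (intro mult_mono) (auto simp: ip_nonneg)
  also have "\<dots> = (A * B * ip u u)\<^sup>2" by (simp add: power2_eq_square algebra_simps)
  finally have fg: "ip ?f ?g \<le> A * B * ip u u"
    by (rule power2_le_imp_le) (simp add: AB ip_nonneg)
  have "ip (conv (\<lambda>x. k x + l x) u) (conv (\<lambda>x. k x + l x) u)
     = (\<integral>x. ?f x * ?f x + 2 * (?f x * ?g x) + ?g x * ?g x \<partial>lborel)"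
    unfolding conv_add_left[OF assms(1,2) u] ip_def
    by (intro Bochner_Integration.integral_cong) (auto simp: algebra_simps)
  also have "\<dots> = ip ?f ?f + 2 * ip ?f ?g + ip ?g ?g"
    unfolding ip_def
    using bint_integrable[OF bint_mult[OF b(1,1)]] bint_integrable[OF bint_mult[OF b]]
      bint_integrable[OF bint_mult[OF b(2,2)]] by simp
  also have "\<dots> \<le> A\<^sup>2 * ip u u + 2 * (A * B * ip u u) + B\<^sup>2 * ip u u"
    using f g fg by linarith
  finally show "ip (conv (\<lambda>x. k x + l x) u) (conv (\<lambda>x. k x + l x) u) \<le> (A + B)\<^sup>2 * ip u u"
    by (simp add: power2_eq_square algebra_simps)
qed

lemma L2_bound_zero: "L2_bound (\<lambda>x. 0) 0"
  by (auto simp: L2_bound_def conv_def ip_def)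

lemma L2_bound_sum:
  assumes "\<And>i. i \<in> I \<Longrightarrow> bint (k i)" "\<And>i. i \<in> I \<Longrightarrow> L2_bound (k i) (A i)"
  shows "L2_bound (\<lambda>x. \<Sum>i\<in>I. k i x) (\<Sum>i\<in>I. A i)"
  using assms
  by (induction I rule: infinite_finite_induct)
     (auto intro!: L2_bound_add L2_bound_zero bint_sum)

lemma ip_cmult: "ip (\<lambda>x. a * u x) (\<lambda>x. a * u x) = a\<^sup>2 * ip u u"
  by (simp add: ip_def power2_eq_square algebra_simps flip: integral_mult_right_zero)

lemma L2_bound_cmult: "L2_bound k A \<Longrightarrow> L2_bound (\<lambda>x. a * k x) (\<bar>a\<bar> * A)"
  by (auto simp: L2_bound_def conv_cmult_left ip_cmult power_mult_distrib mult_left_mono mult.assoc)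

text \<open>The squared norm of T u is the inner product of u with (adjoint T) T u; Cauchy-Schwarz
  then bounds it by A times the squared norm of u.\<close>

lemma L2_bound_sqrt:
  assumes k: "bint k" and A: "L2_bound (conv (reflect k) k) A"
  shows "L2_bound k (sqrt A)"
  unfolding L2_bound_def
proof (intro conjI allI impI)
  have A0: "A \<ge> 0" using A by (auto simp: L2_bound_def)
  show "0 \<le> sqrt A" using A0 by simp
  fix u :: "'a \<Rightarrow> real" assume u: "bint u"
  let ?h = "conv (conv (reflect k) k) u"
  have h: "bint ?h" by (intro bint_conv bint_reflect k u)
  have eq: "ip (conv k u) (conv k u) = ip u ?h"
    by (subst ip_adjoint[OF k u bint_conv[OF k u]])
       (simp add: conv_assoc[OF bint_reflect[OF k] k u])
  have "(ip u ?h)\<^sup>2 \<le> ip u u * ip ?h ?h" using ip_Cauchy_Schwarz[OF u h] .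
  also have "\<dots> \<le> ip u u * (A\<^sup>2 * ip u u)"
    by (intro mult_left_mono L2_boundD[OF A u] ip_nonneg)
  also have "\<dots> = (A * ip u u)\<^sup>2" by (simp add: power2_eq_square)
  finally have "ip u ?h \<le> A * ip u u" by (rule power2_le_imp_le) (simp add: A0 ip_nonneg)
  then show "ip (conv k u) (conv k u) \<le> (sqrt A)\<^sup>2 * ip u u" using eq A0 by simp
qed

text \<open>An operator and its adjoint have the same bound: with h the adjoint applied to u, the
  squared norm of h is the inner product of u and T h, and one factor of that squared norm cancels
  after Cauchy-Schwarz.\<close>

lemma L2_bound_reflect:
  assumes k: "bint k" and A: "L2_bound k A"
  shows "L2_bound (reflect k) A"
  unfolding L2_bound_def
proof (intro conjI allI impI)
  show A0: "A \<ge> 0" using A by (auto simp: L2_bound_def)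
  fix u :: "'a \<Rightarrow> real" assume u: "bint u"
  let ?h = "conv (reflect k) u"
  have h: "bint ?h" by (intro bint_conv bint_reflect k u)
  have "ip ?h ?h = ip u (conv k ?h)"
    using ip_adjoint[OF bint_reflect[OF k] u h] by (simp add: reflect_reflect)
  then have "(ip ?h ?h)\<^sup>2 \<le> ip u u * ip (conv k ?h) (conv k ?h)"
    using ip_Cauchy_Schwarz[OF u bint_conv[OF k h]] by simp
  also have "\<dots> \<le> ip u u * (A\<^sup>2 * ip ?h ?h)"
    by (intro mult_left_mono L2_boundD[OF A h] ip_nonneg)
  finally have "ip ?h ?h * ip ?h ?h \<le> (A\<^sup>2 * ip u u) * ip ?h ?h"
    by (simp add: power2_eq_square algebra_simps)
  then show "ip ?h ?h \<le> A\<^sup>2 * ip u u"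
    using ip_nonneg[of ?h] ip_nonneg[of u] by (cases "ip ?h ?h = 0") (auto simp: mult_le_cancel_right)
qed

section \<open>Almost orthogonality\<close>

lemma conv_left_commute:
  assumes "bint a" "bint b" "bint c"
  shows "conv a (conv b c) = conv b (conv a c)"
proof -
  have "conv a (conv b c) = conv (conv a b) c" by (rule conv_assoc[OF assms])
  also have "conv a b = conv b a" by (intro conv_commute bint_measurable assms)
  finally show ?thesis by (simp only: conv_assoc[OF assms(2,1,3)])
qed

lemma conv_sum_left:
  assumes "\<And>i. i \<in> I \<Longrightarrow> bint (k i)" "bint u"
  shows "conv (\<lambda>x. \<Sum>i\<in>I. k i x) u = (\<lambda>x. \<Sum>i\<in>I. conv (k i) u x)"
  using assms(1)
proof (induction I rule: infinite_finite_induct)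
  case (insert i I)
  have "bint (k i)" "bint (\<lambda>x. \<Sum>i\<in>I. k i x)" using insert.prems by (auto intro!: bint_sum)
  from conv_add_left[OF this assms(2)] show ?case using insert by simp
qed (auto simp: conv_def)

lemma conv_sum_right:
  assumes "\<And>i. i \<in> I \<Longrightarrow> bint (u i)" "bint k"
  shows "conv k (\<lambda>x. \<Sum>i\<in>I. u i x) = (\<lambda>x. \<Sum>i\<in>I. conv k (u i) x)"
proof -
  have "conv k (\<lambda>x. \<Sum>i\<in>I. u i x) = conv (\<lambda>x. \<Sum>i\<in>I. u i x) k"
    by (intro conv_commute bint_measurable assms bint_sum)
  also have "\<dots> = (\<lambda>x. \<Sum>i\<in>I. conv (u i) k x)" by (rule conv_sum_left[OF assms])
  also have "\<dots> = (\<lambda>x. \<Sum>i\<in>I. conv k (u i) x)"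
    using assms by (intro ext sum.cong refl fun_cong[OF conv_commute] bint_measurable)
  finally show ?thesis .
qed

text \<open>Almost orthogonality with only the indices from 0 to M - 1 active, so all sums are
  finite. The decay is written as an even power of \<open>\<rho>\<close>, so that
  \<open>\<rho>\<close> to the distance is its square root; half of the decay can then be spent and
  the other half kept.\<close>

definition cotlar_seq :: "real \<Rightarrow> int \<Rightarrow> (int \<Rightarrow> 'a::euclidean_space \<Rightarrow> real) \<Rightarrow> bool" where
  "cotlar_seq \<rho> M k \<longleftrightarrow> (\<forall>j. bint (k j)) \<and> (\<forall>j. j < 0 \<or> M \<le> j \<longrightarrow> k j = (\<lambda>x. 0)) \<and>
     (\<forall>j l. L2_bound (conv (reflect (k j)) (k l)) (\<rho> ^ (2 * nat \<bar>j - l\<bar>)))"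

text \<open>Write g_j for the adjoint of k_j times k_(j+d). Two bounds hold for the adjoint of g_j
  times g_l: each factor has norm at most \<open>\<rho>\<close> to the 2|d|, and, since convolutions
  commute, regrouping the four factors gives twice the decay in |j - l|. The smaller of both is
  below their geometric mean, which is the original decay times the factor removed by the
  normalisation.\<close>

lemma cotlar_seq_shift_product:
  fixes k :: "int \<Rightarrow> 'a::euclidean_space \<Rightarrow> real"
  assumes \<rho>: "0 < \<rho>" "\<rho> < 1" and k: "cotlar_seq \<rho> M k"
  shows "cotlar_seq \<rho> M (\<lambda>j x. (1 / \<rho> ^ nat \<bar>d\<bar>) * conv (reflect (k j)) (k (j + d)) x)"
proof -
  define g where "g j = conv (reflect (k j)) (k (j + d))" for j
  let ?s = "1 / \<rho> ^ nat \<bar>d\<bar>"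
  have b: "bint (k j)" for j using k by (simp add: cotlar_seq_def)
  have br: "bint (reflect (k j))" for j using bint_reflect b .
  have bg: "bint (g j)" for j unfolding g_def by (intro bint_conv b br)
  have nb: "L2_bound (conv (reflect (k j)) (k l)) (\<rho> ^ (2 * nat \<bar>j - l\<bar>))" for j l
    using k by (simp add: cotlar_seq_def)
  have z: "k j = (\<lambda>x. 0)" if "j < 0 \<or> M \<le> j" for j using k that unfolding cotlar_seq_def by blast
  have "L2_bound (conv (reflect (\<lambda>x. ?s * g j x)) (\<lambda>x. ?s * g l x)) (\<rho> ^ (2 * nat \<bar>j - l\<bar>))" for j l
  proof -
    let ?a = "k j" and ?b = "k (j + d)" and ?c = "k l" and ?e = "k (l + d)"
    have rg: "reflect (g j) = conv ?a (reflect ?b)"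
      by (simp add: g_def reflect_conv[OF bint_measurable[OF br] bint_measurable[OF b]] reflect_reflect)
    have d1: "L2_bound (g j) (\<rho> ^ (2 * nat \<bar>d\<bar>))" for j
      using nb[of j "j + d"] by (simp add: g_def)
    have 1: "L2_bound (conv (reflect (g j)) (g l)) (\<rho> ^ (2 * nat \<bar>d\<bar>) * \<rho> ^ (2 * nat \<bar>d\<bar>))"
      by (intro L2_bound_conv bint_reflect bg L2_bound_reflect d1)
    have "conv (reflect (g j)) (g l) = conv ?a (conv (reflect ?b) (conv (reflect ?c) ?e))"
      unfolding rg by (simp add: g_def conv_assoc[OF b br bint_conv[OF br b]])
    also have "\<dots> = conv ?a (conv (reflect ?c) (conv (reflect ?b) ?e))"
      by (simp only: conv_left_commute[OF br br b])
    also have "\<dots> = conv (conv (reflect ?c) ?a) (conv (reflect ?b) ?e)"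
      by (simp only: conv_left_commute[OF b br bint_conv[OF br b]] conv_assoc[OF br b bint_conv[OF br b]])
    finally have "L2_bound (conv (reflect (g j)) (g l)) (\<rho> ^ (2 * nat \<bar>l - j\<bar>) * \<rho> ^ (2 * nat \<bar>(j + d) - (l + d)\<bar>))"
      by (simp only:) (intro L2_bound_conv bint_conv br b nb)
    then have 2: "L2_bound (conv (reflect (g j)) (g l)) (\<rho> ^ (2 * nat \<bar>j - l\<bar>) * \<rho> ^ (2 * nat \<bar>j - l\<bar>))"
      by (simp add: abs_minus_commute)
    have le: "\<rho> ^ m \<le> \<rho> ^ n" if "n \<le> m" for m n using that \<rho> by (intro power_decreasing) auto
    have 3: "L2_bound (conv (reflect (g j)) (g l)) (\<rho> ^ (2 * nat \<bar>d\<bar>) * \<rho> ^ (2 * nat \<bar>j - l\<bar>))"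
    proof (cases "nat \<bar>d\<bar> \<le> nat \<bar>j - l\<bar>")
      case True
      show ?thesis by (rule L2_bound_mono[OF 2]) (use True \<rho> in \<open>intro mult_right_mono le, auto\<close>)
    next
      case False
      show ?thesis by (rule L2_bound_mono[OF 1]) (use False \<rho> in \<open>intro mult_left_mono le, auto\<close>)
    qed
    have "conv (reflect (\<lambda>x. ?s * g j x)) (\<lambda>x. ?s * g l x) = (\<lambda>x. ?s\<^sup>2 * conv (reflect (g j)) (g l) x)"
    proof -
      have "reflect (\<lambda>x. ?s * g j x) = (\<lambda>x. ?s * reflect (g j) x)" by (auto simp: reflect_def)
      then show ?thesis by (simp only: conv_cmult_left conv_cmult_right) (simp add: power2_eq_square)
    qed
    moreover have "\<bar>?s\<^sup>2\<bar> * (\<rho> ^ (2 * nat \<bar>d\<bar>) * \<rho> ^ (2 * nat \<bar>j - l\<bar>)) = \<rho> ^ (2 * nat \<bar>j - l\<bar>)"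
      using \<rho> by (simp add: power_divide power_mult[symmetric] mult.commute)
    ultimately show ?thesis using L2_bound_cmult[OF 3, of "?s\<^sup>2"] by metis
  qed
  moreover have "(\<lambda>x. ?s * g j x) = (\<lambda>x. 0)" if "j < 0 \<or> M \<le> j" for j
    by (auto simp: g_def z[OF that] conv_def reflect_def)
  moreover have "bint (\<lambda>x. ?s * g j x)" for j by (rule bint_cmult[OF bg])
  ultimately show ?thesis unfolding cotlar_seq_def g_def[symmetric] by blast
qed

lemma sum_geometric_int_le:
  fixes \<rho> :: real
  assumes "0 < \<rho>" "\<rho> < 1"
  shows "(\<Sum>d\<in>{-M<..<M}. \<rho> ^ nat \<bar>d\<bar>) \<le> 2 / (1 - \<rho>)"
proof -
  have g: "(\<Sum>i<n. \<rho> ^ i) \<le> 1 / (1 - \<rho>)" for n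
    using sum_le_suminf[of "\<lambda>i. \<rho> ^ i" "{..<n}"] assms by (simp add: suminf_geometric summable_geometric)
  have "(\<Sum>d\<in>{-M<..<M}. \<rho> ^ nat \<bar>d\<bar>) \<le> (\<Sum>d\<in>{0..<M} \<union> {-M<..0}. \<rho> ^ nat \<bar>d\<bar>)"
    using assms by (intro sum_mono2) auto
  also have "\<dots> \<le> (\<Sum>d\<in>{0..<M}. \<rho> ^ nat \<bar>d\<bar>) + (\<Sum>d\<in>{-M<..0}. \<rho> ^ nat \<bar>d\<bar>)"
    using assms by (subst sum_Un) (auto simp: sum_nonneg)
  also have "(\<Sum>d\<in>{0..<M}. \<rho> ^ nat \<bar>d\<bar>) = (\<Sum>i<nat M. \<rho> ^ i)"
    by (rule sum.reindex_bij_witness[of _ int nat]) auto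
  also have "(\<Sum>d\<in>{-M<..0}. \<rho> ^ nat \<bar>d\<bar>) = (\<Sum>i<nat M. \<rho> ^ i)"
    by (rule sum.reindex_bij_witness[of _ "\<lambda>i. - int i" "\<lambda>d. nat (- d)"]) auto
  finally show ?thesis using g[of "nat M"] by simp
qed

text \<open>Bootstrapping: if \<open>B\<close> bounds all sums of such sequences, then so does \<open>sqrt (L * B)\<close>, because
  the diagonals of \<open>T\<^sup>* T\<close> are, up to the factor \<open>\<rho>\<^bsup>|d|\<^esup>\<close>, again such sums. So the least such \<open>B\<close>
  is at most \<open>L\<close>.\<close>
lemma cotlar_seq_sum_bound:
  fixes k :: "int \<Rightarrow> 'a::euclidean_space \<Rightarrow> real"
  assumes \<rho>: "0 < \<rho>" "\<rho> < 1" and k: "cotlar_seq \<rho> M k"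
  shows "L2_bound (\<lambda>x. \<Sum>j\<in>{0..<M}. k j x) (4 / (1 - \<rho>))"
proof -
  define L where "L = 2 / (1 - \<rho>)"
  have L0: "L > 0" using \<rho> by (simp add: L_def)
  define good where "good = {B. B \<ge> 0 \<and> (\<forall>k::int \<Rightarrow> 'a \<Rightarrow> real. cotlar_seq \<rho> M k \<longrightarrow>
     L2_bound (\<lambda>x. \<Sum>j\<in>{0..<M}. k j x) B)}"
  \<comment> \<open>The triangle inequality gives a crude bound that grows with M. Its only purpose
    is to make \<open>good\<close> nonempty, so that its infimum exists.\<close>
  have ini: "real (card {0..<M}) \<in> good"
    unfolding good_def
  proof (intro CollectI conjI allI impI)
    fix k :: "int \<Rightarrow> 'a \<Rightarrow> real" assume k: "cotlar_seq \<rho> M k"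
    have b: "bint (k j)" for j using k by (simp add: cotlar_seq_def)
    have "L2_bound (conv (reflect (k j)) (k j)) (\<rho> ^ (2 * nat \<bar>j - j\<bar>))" for j
      using k unfolding cotlar_seq_def by blast
    then have "L2_bound (k j) 1" for j using L2_bound_sqrt[OF b, of j 1] by simp
    from L2_bound_sum[of "{0..<M}" k "\<lambda>_. 1", OF b this]
    show "L2_bound (\<lambda>x. \<Sum>j\<in>{0..<M}. k j x) (real (card {0..<M}))" by simp
  qed simp
  have step: "sqrt (L * B) \<in> good" if B: "B \<in> good" for B
    unfolding good_def
  proof (intro CollectI conjI allI impI)
    show "sqrt (L * B) \<ge> 0" using B L0 by (auto simp: good_def)
    fix k :: "int \<Rightarrow> 'a \<Rightarrow> real" assume k: "cotlar_seq \<rho> M k"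
    have b: "bint (k j)" for j using k by (simp add: cotlar_seq_def)
    have br: "bint (reflect (k j))" for j using bint_reflect b .
    have z: "k j = (\<lambda>x. 0)" if "j < 0 \<or> M \<le> j" for j using k that unfolding cotlar_seq_def by blast
    let ?S = "\<lambda>x. \<Sum>j\<in>{0..<M}. k j x"
    have bS: "bint ?S" by (intro bint_sum b)
    define g where "g d j = conv (reflect (k j)) (k (j + d))" for d j
    have bg: "bint (g d j)" for d j unfolding g_def by (intro bint_conv b br)
    have rS: "reflect ?S = (\<lambda>x. \<Sum>j\<in>{0..<M}. reflect (k j) x)" by (auto simp: reflect_def)
    have "conv (reflect ?S) ?S = (\<lambda>x. \<Sum>j\<in>{0..<M}. \<Sum>l\<in>{0..<M}. conv (reflect (k j)) (k l) x)"
      unfolding rS by (subst conv_sum_left[OF br bS], subst conv_sum_right[OF b br]) simp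
    also have "\<dots> = (\<lambda>x. \<Sum>j\<in>{0..<M}. \<Sum>d\<in>{-M<..<M}. g d j x)"
    proof (rule ext, rule sum.cong[OF refl])
      fix x j assume j: "j \<in> {0..<M}"
      have "(\<Sum>d\<in>{-M<..<M}. g d j x) = (\<Sum>d\<in>{-j..<M-j}. g d j x)"
      proof (rule sum.mono_neutral_right)
        show "\<forall>d\<in>{-M<..<M} - {-j..<M-j}. g d j x = 0"
        proof
          fix d assume "d \<in> {-M<..<M} - {-j..<M-j}"
          then have "k (j + d) = (\<lambda>x. 0)" by (intro z) auto
          then show "g d j x = 0" by (simp add: g_def conv_def)
        qed
      qed (use j in auto)
      also have "\<dots> = (\<Sum>l\<in>{0..<M}. conv (reflect (k j)) (k l) x)"
        by (rule sum.reindex_bij_witness[of _ "\<lambda>l. l - j" "\<lambda>d. j + d"]) (auto simp: g_def)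
      finally show "(\<Sum>l\<in>{0..<M}. conv (reflect (k j)) (k l) x) = (\<Sum>d\<in>{-M<..<M}. g d j x)" ..
    qed
    also have "\<dots> = (\<lambda>x. \<Sum>d\<in>{-M<..<M}. \<Sum>j\<in>{0..<M}. g d j x)"
      by (rule ext) (rule sum.swap)
    finally have eq: "conv (reflect ?S) ?S = (\<lambda>x. \<Sum>d\<in>{-M<..<M}. \<Sum>j\<in>{0..<M}. g d j x)" .
    have "L2_bound (\<lambda>x. \<Sum>j\<in>{0..<M}. g d j x) (\<rho> ^ nat \<bar>d\<bar> * B)" for d
    proof -
      have "L2_bound (\<lambda>x. \<Sum>j\<in>{0..<M}. (1 / \<rho> ^ nat \<bar>d\<bar>) * g d j x) B"
        using cotlar_seq_shift_product[OF \<rho> k, of d] B unfolding g_def good_def by blast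
      from L2_bound_cmult[OF this, of "\<rho> ^ nat \<bar>d\<bar>"] show ?thesis
        using \<rho> by (simp add: sum_distrib_left)
    qed
    then have "L2_bound (conv (reflect ?S) ?S) (\<Sum>d\<in>{-M<..<M}. \<rho> ^ nat \<bar>d\<bar> * B)"
      unfolding eq by (intro L2_bound_sum bint_sum bg)
    then have "L2_bound (conv (reflect ?S) ?S) (L * B)"
    proof (rule L2_bound_mono)
      show "(\<Sum>d\<in>{-M<..<M}. \<rho> ^ nat \<bar>d\<bar> * B) \<le> L * B"
        unfolding sum_distrib_right[symmetric] L_def
        using sum_geometric_int_le[OF \<rho>, of M] B by (intro mult_right_mono) (auto simp: good_def)
    qed
    then show "L2_bound ?S (sqrt (L * B))" by (rule L2_bound_sqrt[OF bS])
  qed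
  have bdd: "bdd_below good" by (auto simp: good_def bdd_below_def)
  have ne: "good \<noteq> {}" using ini by blast
  have I0: "Inf good \<ge> 0" by (rule cInf_greatest[OF ne]) (auto simp: good_def)
  have "(Inf good)\<^sup>2 / L \<le> Inf good"
  proof (rule cInf_greatest)
    fix B assume B: "B \<in> good"
    have "Inf good \<le> sqrt (L * B)" using cInf_lower[OF step[OF B] bdd] .
    then have "(Inf good)\<^sup>2 \<le> (sqrt (L * B))\<^sup>2" using I0 by (rule power_mono)
    then show "(Inf good)\<^sup>2 / L \<le> B" using L0 B by (simp add: good_def field_simps)
  qed (rule ne)
  then have "Inf good * Inf good \<le> L * Inf good" using L0 by (simp add: field_simps power2_eq_square)
  then have "Inf good \<le> L" using I0 L0 by (cases "Inf good = 0") (auto simp: mult_le_cancel_right)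
  \<comment> \<open>Going from L to 2 * L produces an element of \<open>good\<close> below the bound
    whether or not the infimum is attained.\<close>
  then have "Inf good < 2 * L" using L0 by simp
  then obtain B where "B \<in> good" "B < 2 * L" using cInf_lessD[OF ne] by blast
  then show ?thesis using k L2_bound_mono[of _ B "2 * L"] by (auto simp: good_def L_def)
qed

text \<open>Division by \<open>sqrt C\<close> normalises the decay and a shift moves the index range
  to start at 0; Young's inequality turns L^1 norms of the products into operator bounds.\<close>

lemma cotlar_L2_bound:
  fixes k :: "int \<Rightarrow> 'a::euclidean_space \<Rightarrow> real"
  assumes \<rho>: "0 < \<rho>" "\<rho> < 1" and C: "C > 0" and b: "\<And>j. bint (k j)"
    and orth: "\<And>j l. (\<integral>x. \<bar>conv (reflect (k j)) (k l) x\<bar> \<partial>lborel) \<le> C * \<rho> ^ (2 * nat \<bar>j - l\<bar>)"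
  shows "L2_bound (\<lambda>x. \<Sum>j\<in>{a..<b}. k j x) (sqrt C * (4 / (1 - \<rho>)))"
proof -
  let ?s = "1 / sqrt C"
  define k' where "k' j = (if 0 \<le> j \<and> j < b - a then (\<lambda>x. ?s * k (a + j) x) else (\<lambda>x. 0))" for j
  have "cotlar_seq \<rho> (b - a) k'"
    unfolding cotlar_seq_def
  proof (intro conjI allI impI)
    show "bint (k' j)" for j using bint_cmult[OF b, of ?s] by (auto simp: k'_def intro: bint_zero)
    show "k' j = (\<lambda>x. 0)" if "j < 0 \<or> b - a \<le> j" for j using that by (auto simp: k'_def)
    fix j l
    show "L2_bound (conv (reflect (k' j)) (k' l)) (\<rho> ^ (2 * nat \<bar>j - l\<bar>))"
    proof (cases "0 \<le> j \<and> j < b - a \<and> 0 \<le> l \<and> l < b - a")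
      case True
      let ?h = "conv (reflect (k (a + j))) (k (a + l))"
      have "conv (reflect (k' j)) (k' l) = conv (\<lambda>x. ?s * reflect (k (a + j)) x) (\<lambda>x. ?s * k (a + l) x)"
        using True by (simp add: k'_def reflect_def[abs_def])
      also have "\<dots> = (\<lambda>x. ?s\<^sup>2 * ?h x)"
        by (simp only: conv_cmult_left conv_cmult_right) (simp add: power2_eq_square)
      finally have eq: "conv (reflect (k' j)) (k' l) = (\<lambda>x. ?s\<^sup>2 * ?h x)" .
      have bh: "bint ?h" by (intro bint_conv bint_reflect b)
      have "L2_bound ?h (C * \<rho> ^ (2 * nat \<bar>j - l\<bar>))"
        using L2_bound_mono[OF L2_bound_L1[OF bh] orth] by simp
      from L2_bound_cmult[OF this, of "?s\<^sup>2"] show ?thesis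
        unfolding eq using C by (simp add: power_divide)
    next
      case False
      then have "conv (reflect (k' j)) (k' l) = (\<lambda>x. 0)"
        by (auto simp: k'_def conv_def reflect_def)
      then show ?thesis using L2_bound_mono[OF L2_bound_zero, of "\<rho> ^ (2 * nat \<bar>j - l\<bar>)"] \<rho> by simp
    qed
  qed
  from L2_bound_cmult[OF cotlar_seq_sum_bound[OF \<rho> this], of "sqrt C"]
  have "L2_bound (\<lambda>x. sqrt C * (\<Sum>j\<in>{0..<b - a}. k' j x)) (sqrt C * (4 / (1 - \<rho>)))"
    using C by simp
  also have "(\<lambda>x. sqrt C * (\<Sum>j\<in>{0..<b - a}. k' j x)) = (\<lambda>x. \<Sum>j\<in>{a..<b}. k j x)"
  proof
    fix x
    have "sqrt C * (\<Sum>j\<in>{0..<b - a}. k' j x) = (\<Sum>j\<in>{0..<b - a}. k (a + j) x)"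
      using C by (simp add: sum_distrib_left k'_def)
    also have "\<dots> = (\<Sum>j\<in>{a..<b}. k j x)"
      by (rule sum.reindex_bij_witness[of _ "\<lambda>j. j - a" "\<lambda>j. a + j"]) auto
    finally show "sqrt C * (\<Sum>j\<in>{0..<b - a}. k' j x) = (\<Sum>j\<in>{a..<b}. k j x)" .
  qed
  finally show ?thesis .
qed

section \<open>Dyadic cubes\<close>

text \<open>Levels grow towards fine scales: large cubes have negative level.\<close>

definition side :: "int \<Rightarrow> real" where "side k = 2 powi (- k)"

definition dyidx :: "int \<Rightarrow> 'a::euclidean_space \<Rightarrow> 'a \<Rightarrow> int" where
  "dyidx k x i = \<lfloor>2 powi k * (x \<bullet> i)\<rfloor>"

text \<open>Cubes are named by a level and any point in them. They are half open, so each level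
  partitions the space; \<open>m = 0\<close> is the dyadic cube of \<open>x\<close>, and
  \<open>m = 1\<close> adds its neighbours, which gives the concentric triple.\<close>

definition dblock :: "int \<Rightarrow> int \<Rightarrow> 'a::euclidean_space \<Rightarrow> 'a set" where
  "dblock m k x = {y. \<forall>i\<in>Basis. \<bar>dyidx k y i - dyidx k x i\<bar> \<le> m}"

abbreviation dcube :: "int \<Rightarrow> 'a::euclidean_space \<Rightarrow> 'a set" where "dcube \<equiv> dblock 0"
abbreviation dcube3 :: "int \<Rightarrow> 'a::euclidean_space \<Rightarrow> 'a set" where "dcube3 \<equiv> dblock 1"

lemma side_pos: "side k > 0" by (simp add: side_def)

lemma side_mult: "2 powi k * side k = 1"
  by (simp add: side_def power_int_minus)

lemma side_le: "j \<le> k \<Longrightarrow> side k \<le> side j"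
  by (simp add: side_def power_int_increasing)

lemma side_add: "side (k + m) = side k * side m"
  by (simp add: side_def power_int_add[symmetric])

lemma side_Suc: "side k = 2 * side (k + 1)" "side (k - 1) = 2 * side k"
proof -
  have "side 1 = 1 / 2" by (simp add: side_def power_int_minus)
  then show "side k = 2 * side (k + 1)" "side (k - 1) = 2 * side k"
    using side_add[of k 1] side_add[of "k - 1" 1] by simp_all
qed

lemma dyidx_le: "dyidx k x i \<le> n \<longleftrightarrow> x \<bullet> i < (of_int n + 1) * side k"
  using side_pos[of k] side_mult[of k]
  by (simp add: dyidx_def floor_le_iff side_def power_int_minus field_simps)

lemma dyidx_ge: "n \<le> dyidx k x i \<longleftrightarrow> of_int n * side k \<le> x \<bullet> i"
  using side_pos[of k] side_mult[of k]
  by (simp add: dyidx_def le_floor_iff side_def power_int_minus field_simps)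

text \<open>Passing to a coarser level is integer division of the index. All nesting properties of
  cubes and of their triples become integer arithmetic through this.\<close>

lemma dyidx_coarsen:
  assumes "j \<le> k" shows "dyidx j x i = dyidx k x i div 2 ^ nat (k - j)"
proof -
  have "2 powi k = (2::real) powi j * 2 ^ nat (k - j)"
    using assms by (simp add: power_int_add[symmetric] flip: power_int_of_nat)
  then have "2 powi j * (x \<bullet> i) = (2 powi k * (x \<bullet> i)) / real_of_int (2 ^ nat (k - j))"
    by simp
  then show ?thesis unfolding dyidx_def using floor_divide_real_eq_div[of "2 ^ nat (k - j)"] by simp
qed

lemma dblock_eq: "dblock m k x = {y. \<forall>i\<in>Basis. dyidx k x i - m \<le> dyidx k y i \<and> dyidx k y i \<le> dyidx k x i + m}"
  unfolding dblock_def by (intro Collect_cong ball_cong refl) linarith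

definition dcorner :: "int \<Rightarrow> int \<Rightarrow> 'a::euclidean_space \<Rightarrow> 'a" where
  "dcorner m k x = (\<Sum>i\<in>Basis. (of_int (dyidx k x i - m) * side k) *\<^sub>R i)"

lemma dblock_box:
  fixes x :: "'a::euclidean_space"
  shows "box (dcorner m k x) (dcorner m k x + ((2 * of_int m + 1) * side k) *\<^sub>R One) \<subseteq> dblock m k x"
    and "dblock m k x \<subseteq> cbox (dcorner m k x) (dcorner m k x + ((2 * of_int m + 1) * side k) *\<^sub>R One)"
proof -
  have a: "dcorner m k x \<bullet> i = of_int (dyidx k x i - m) * side k" if "i \<in> Basis" for i
    using that by (simp add: dcorner_def inner_sum_left_Basis)
  have b: "(dcorner m k x + ((2 * of_int m + 1) * side k) *\<^sub>R One) \<bullet> i = (of_int (dyidx k x i + m) + 1) * side k"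
    if "i \<in> Basis" for i using that by (simp add: a inner_add_left algebra_simps)
  show "box (dcorner m k x) (dcorner m k x + ((2 * of_int m + 1) * side k) *\<^sub>R One) \<subseteq> dblock m k x"
    by (auto simp: box_def dblock_eq dyidx_le dyidx_ge a b simp del: inner_add_left of_int_add of_int_diff)
  show "dblock m k x \<subseteq> cbox (dcorner m k x) (dcorner m k x + ((2 * of_int m + 1) * side k) *\<^sub>R One)"
    by (auto simp: cbox_def dblock_eq dyidx_le dyidx_ge a b less_imp_le simp del: inner_add_left of_int_add of_int_diff)
qed

lemma dblock_measurable[measurable]: "dblock m k x \<in> sets borel"
proof -
  have "dblock m k x = {y. \<forall>i\<in>Basis. of_int (dyidx k x i - m) * side k \<le> y \<bullet> i \<and>
     y \<bullet> i < (of_int (dyidx k x i + m) + 1) * side k}"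
    by (auto simp: dblock_eq dyidx_le dyidx_ge simp del: of_int_add of_int_diff)
  also have "\<dots> \<in> sets borel" by measurable
  finally show ?thesis .
qed

lemma emeasure_dblock:
  fixes x :: "'a::euclidean_space"
  assumes "m \<ge> 0"
  shows "emeasure lborel (dblock m k x) = ennreal (((2 * of_int m + 1) * side k) ^ DIM('a))"
proof -
  let ?a = "dcorner m k x" and ?s = "(2 * of_int m + 1) * side k"
  have s: "?s \<ge> 0" using assms side_pos[of k] by simp
  have b: "emeasure lborel (box ?a (?a + ?s *\<^sub>R One)) = ennreal (?s ^ DIM('a))"
    "emeasure lborel (cbox ?a (?a + ?s *\<^sub>R One)) = ennreal (?s ^ DIM('a))"
    using s by (simp_all add: emeasure_lborel_box_eq emeasure_lborel_cbox_eq inner_add_left algebra_simps)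
  show ?thesis
  proof (rule antisym)
    show "emeasure lborel (dblock m k x) \<le> ennreal (?s ^ DIM('a))"
      unfolding b(2)[symmetric] by (intro emeasure_mono dblock_box) auto
    show "ennreal (?s ^ DIM('a)) \<le> emeasure lborel (dblock m k x)"
      unfolding b(1)[symmetric] by (intro emeasure_mono dblock_box) auto
  qed
qed

lemma emeasure_dcube: "emeasure lborel (dcube k x) = ennreal (side k ^ DIM('a))" for x :: "'a::euclidean_space"
  using emeasure_dblock[of 0 k x] by simp

lemma emeasure_dcube3: "emeasure lborel (dcube3 k x) = ennreal (3 ^ DIM('a) * side k ^ DIM('a))" for x :: "'a::euclidean_space"
  using emeasure_dblock[of 1 k x] by (simp add: power_mult_distrib)

lemma bounded_dblock: "bounded (dblock m k x)"
  by (rule bounded_subset[OF bounded_cbox dblock_box(2)])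

lemma dblock_self: "m \<ge> 0 \<Longrightarrow> x \<in> dblock m k x" by (simp add: dblock_def)

lemma dblock_cong: "y \<in> dcube k x \<Longrightarrow> dblock m k y = dblock m k x"
  unfolding dblock_def by auto

lemma dcube_subset_dcube3: "dcube k x \<subseteq> dcube3 k x"
  unfolding dblock_def by auto

lemma dcube_mono: "j \<le> k \<Longrightarrow> dcube k x \<subseteq> dcube j x"
  by (auto simp: dblock_def dyidx_coarsen)

text \<open>Indices that differ by at most 1 still differ by at most 1 after division by a power of
  2.\<close>

lemma dcube3_mono:
  assumes "j \<le> k" shows "dcube3 k x \<subseteq> dcube3 j x"
proof
  fix y assume y: "y \<in> dcube3 k x"
  let ?c = "2 ^ nat (k - j) :: int"
  have d: "a div ?c \<le> b div ?c + 1" if "a \<le> b + 1" for a b :: int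
  proof -
    have "?c \<ge> 1" by simp
    then have "a \<le> b + ?c" using that by linarith
    then have "a div ?c \<le> (b + ?c) div ?c" by (rule zdiv_mono1) simp
    then show ?thesis by simp
  qed
  show "y \<in> dcube3 j x" unfolding dblock_def mem_Collect_eq
  proof
    fix i :: 'a assume "i \<in> Basis"
    then have "\<bar>dyidx k y i - dyidx k x i\<bar> \<le> 1" using y by (auto simp: dblock_def)
    then show "\<bar>dyidx j y i - dyidx j x i\<bar> \<le> 1"
      using d[of "dyidx k y i" "dyidx k x i"] d[of "dyidx k x i" "dyidx k y i"]
      unfolding dyidx_coarsen[OF assms] by linarith
  qed
qed

lemma dcube3_near:
  assumes "norm (x - y) \<le> side k" shows "y \<in> dcube3 k x"
  unfolding dblock_def mem_Collect_eq
proof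
  fix i :: 'a assume i: "i \<in> Basis"
  have "\<bar>x \<bullet> i - y \<bullet> i\<bar> \<le> side k"
    using Basis_le_norm[OF i, of "x - y"] assms by (simp add: inner_diff_left)
  moreover have "2 powi k * (x \<bullet> i) - 2 powi k * (y \<bullet> i) = 2 powi k * (x \<bullet> i - y \<bullet> i)"
    by (simp add: algebra_simps)
  ultimately have "\<bar>2 powi k * (x \<bullet> i) - 2 powi k * (y \<bullet> i)\<bar> \<le> 1"
    using side_mult[of k] mult_left_mono[of "\<bar>x \<bullet> i - y \<bullet> i\<bar>" "side k" "2 powi k"] by (simp add: abs_mult)
  then show "\<bar>dyidx k y i - dyidx k x i\<bar> \<le> 1" unfolding dyidx_def by linarith
qed

lemma dblock_dist:
  fixes x :: "'a::euclidean_space"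
  assumes "y \<in> dblock m k x"
  shows "norm (x - y) \<le> (of_int m + 1) * DIM('a) * side k"
proof -
  have "\<bar>(x - y) \<bullet> i\<bar> \<le> (of_int m + 1) * side k" if i: "i \<in> Basis" for i
  proof -
    have h: "\<bar>dyidx k y i - dyidx k x i\<bar> \<le> m" using assms i by (auto simp: dblock_def)
    have "x \<bullet> i \<le> (of_int (dyidx k x i) + 1) * side k" "of_int (dyidx k x i) * side k \<le> x \<bullet> i"
      "y \<bullet> i \<le> (of_int (dyidx k y i) + 1) * side k" "of_int (dyidx k y i) * side k \<le> y \<bullet> i"
      using dyidx_le[of k x i "dyidx k x i"] dyidx_ge[of "dyidx k x i" k x i]
        dyidx_le[of k y i "dyidx k y i"] dyidx_ge[of "dyidx k y i" k y i] by auto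
    moreover have "of_int (dyidx k y i) * side k \<le> of_int (dyidx k x i + m) * side k"
      "of_int (dyidx k x i) * side k \<le> of_int (dyidx k y i + m) * side k"
      using h side_pos[of k] by (auto intro!: mult_right_mono simp del: of_int_add)
    ultimately show ?thesis by (simp add: inner_diff_left algebra_simps abs_le_iff)
  qed
  then have "(\<Sum>i\<in>Basis. \<bar>(x - y) \<bullet> i\<bar>) \<le> (\<Sum>i\<in>(Basis::'a set). (of_int m + 1) * side k)"
    by (intro sum_mono) auto
  then show ?thesis using norm_le_l1[of "x - y"] by (simp add: mult_ac)
qed

lemma dcubes_finite_card:
  fixes S :: "'a::euclidean_space set"
  assumes "\<And>x i. x \<in> S \<Longrightarrow> i \<in> Basis \<Longrightarrow> lo \<le> dyidx k x i \<and> dyidx k x i \<le> hi"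
  shows "finite (dblock m k ` S)" "card (dblock m k ` S) \<le> nat (hi - lo + 1) ^ DIM('a)"
proof -
  let ?P = "PiE (Basis::'a set) (\<lambda>_. {lo..hi})"
  let ?F = "\<lambda>g. {y. \<forall>i\<in>Basis. \<bar>dyidx k y i - g i\<bar> \<le> m}"
  have s: "dblock m k ` S \<subseteq> ?F ` ?P"
  proof
    fix A assume "A \<in> dblock m k ` S"
    then obtain x where x: "x \<in> S" "A = dblock m k x" by auto
    have "A = ?F (restrict (dyidx k x) Basis)" by (auto simp: x dblock_def)
    moreover have "restrict (dyidx k x) Basis \<in> ?P" using assms[OF x(1)] by auto
    ultimately show "A \<in> ?F ` ?P" by blast
  qed
  have f: "finite ?P" by (intro finite_PiE) auto
  show "finite (dblock m k ` S)" by (rule finite_subset[OF s]) (simp add: f)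
  have "card (dblock m k ` S) \<le> card (?F ` ?P)" using s f by (intro card_mono) auto
  also have "\<dots> \<le> card ?P" by (rule card_image_le[OF f])
  also have "\<dots> = nat (hi - lo + 1) ^ DIM('a)" by (simp add: card_PiE)
  finally show "card (dblock m k ` S) \<le> nat (hi - lo + 1) ^ DIM('a)" .
qed

lemma dcubes_finite:
  fixes S :: "'a::euclidean_space set"
  assumes "bounded S" shows "finite (dblock m k ` S)"
proof -
  obtain B where B: "\<And>x. x \<in> S \<Longrightarrow> norm x \<le> B" using assms by (auto simp: bounded_iff)
  show ?thesis
  proof (rule dcubes_finite_card(1))
    fix x i :: 'a assume xi: "x \<in> S" "i \<in> Basis"
    have "\<bar>x \<bullet> i\<bar> \<le> B" using Basis_le_norm[OF xi(2), of x] B[OF xi(1)] by linarith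
    then have "2 powi k * (x \<bullet> i) \<le> 2 powi k * B" "2 powi k * (- B) \<le> 2 powi k * (x \<bullet> i)"
      by (intro mult_left_mono; simp add: abs_le_iff)+
    then show "\<lfloor>2 powi k * (- B)\<rfloor> \<le> dyidx k x i \<and> dyidx k x i \<le> \<lfloor>2 powi k * B\<rfloor>"
      unfolding dyidx_def by (auto intro: floor_mono)
  qed
qed

section \<open>Laminar families and the classes of tripled cubes\<close>

definition laminar :: "'a set set \<Rightarrow> bool" where
  "laminar \<P> \<longleftrightarrow> (\<forall>A\<in>\<P>. \<forall>B\<in>\<P>. A \<inter> B = {} \<or> A \<subseteq> B \<or> B \<subseteq> A)"

lemma laminar_subset: "laminar \<P> \<Longrightarrow> \<Q> \<subseteq> \<P> \<Longrightarrow> laminar \<Q>"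
  unfolding laminar_def by blast

lemma laminar_disjoint_cover:
  assumes "finite \<P>" "laminar \<P>"
  obtains \<Q> where "\<Q> \<subseteq> \<P>" "disjoint \<Q>" "\<Union>\<Q> = \<Union>\<P>"
proof -
  define \<Q> where "\<Q> = {A\<in>\<P>. \<forall>B\<in>\<P>. A \<subseteq> B \<longrightarrow> A = B}"
  have "\<exists>B\<in>\<Q>. A \<subseteq> B" if "A \<in> \<P>" for A
  proof -
    from finite_has_maximal2[OF assms(1) that] show ?thesis unfolding \<Q>_def by blast
  qed
  then have un: "\<Union>\<Q> = \<Union>\<P>" unfolding \<Q>_def by blast
  have dj: "disjoint \<Q>"
  proof (rule disjointI)
    fix A B assume AB: "A \<in> \<Q>" "B \<in> \<Q>" "A \<noteq> B"
    have "A \<inter> B = {} \<or> A \<subseteq> B \<or> B \<subseteq> A"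
      using assms(2) AB(1,2) by (simp add: laminar_def \<Q>_def)
    then show "A \<inter> B = {}" using AB by (auto simp: \<Q>_def)
  qed
  have "\<Q> \<subseteq> \<P>" by (auto simp: \<Q>_def)
  then show ?thesis by (rule that[OF _ dj un])
qed

text \<open>The maximal members are disjoint and have the same union, so a comparison of two
  measures on each member passes to the union with the same constant. This is the covering argument
  behind every weak type estimate for averages below.\<close>

lemma laminar_emeasure_le:
  assumes "finite \<P>" "laminar \<P>" "\<P> \<subseteq> sets M" "sets N = sets M"
    "\<And>P. P \<in> \<P> \<Longrightarrow> emeasure M P \<le> C * emeasure N P"
  shows "emeasure M (\<Union>\<P>) \<le> C * emeasure N (\<Union>\<P>)"
proof -
  obtain \<Q> where Q: "\<Q> \<subseteq> \<P>" "disjoint \<Q>" "\<Union>\<Q> = \<Union>\<P>"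
    by (rule laminar_disjoint_cover[OF assms(1,2)])
  have f: "finite \<Q>" using Q(1) assms(1) finite_subset by blast
  have s: "emeasure L (\<Union>\<Q>) = (\<Sum>P\<in>\<Q>. emeasure L P)" if "sets L = sets M" for L
  proof -
    have "disjoint_family_on (\<lambda>P. P) \<Q>" using Q(2) by (simp add: disjoint_family_on_def disjoint_def)
    moreover have "(\<lambda>P. P) ` \<Q> \<subseteq> sets L" using Q(1) assms(3) that by auto
    ultimately show ?thesis using sum_emeasure[of "\<lambda>P. P" \<Q> L] f by simp
  qed
  have "emeasure M (\<Union>\<Q>) \<le> (\<Sum>P\<in>\<Q>. C * emeasure N P)"
    unfolding s[OF refl] using assms(5) Q(1) by (intro sum_mono) auto
  also have "\<dots> = C * emeasure N (\<Union>\<Q>)" unfolding s[OF assms(4)] by (simp add: sum_distrib_left)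
  finally show ?thesis unfolding Q(3) .
qed

lemma dcube_nested:
  assumes "j \<le> k" shows "dcube j x \<inter> dcube k y = {} \<or> dcube k y \<subseteq> dcube j x"
proof (cases "dcube j x \<inter> dcube k y = {}")
  case False
  then obtain z where z: "z \<in> dcube j x" "z \<in> dcube k y" by blast
  show ?thesis
    using dcube_mono[OF assms, of z] dblock_cong[OF z(1), of 0] dblock_cong[OF z(2), of 0] by simp
qed auto

lemma laminar_dcubes: "laminar {dcube k x |k x. True}"
  unfolding laminar_def
proof (intro ballI, elim CollectE exE conjE)
  fix A B k j and x y :: 'a assume "A = dcube k x" "B = dcube j y"
  then show "A \<inter> B = {} \<or> A \<subseteq> B \<or> B \<subseteq> A"
    using dcube_nested[of k j x y] dcube_nested[of j k y x] by (cases "k \<le> j") (auto simp: Int_commute)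
qed

text \<open>The cubes \<open>dcube3\<close> split into \<open>3\<^sup>n\<close> laminar classes: since \<open>2 = -1\<close> modulo 3, the lower corners
  of a class are the multiples of \<open>3\<close>, shifted by \<open>r\<close> at even and by \<open>-r\<close> at odd levels.\<close>
definition dclass :: "int \<Rightarrow> 'a::euclidean_space \<Rightarrow> 'a \<Rightarrow> int" where
  "dclass k x = (\<lambda>i\<in>Basis. (if even k then dyidx k x i - 1 else - (dyidx k x i - 1)) mod 3)"

lemma dclass_range: "dclass k x \<in> PiE Basis (\<lambda>_. {0..2})"
proof -
  have "a mod 3 \<in> {0..2}" for a :: int
    using pos_mod_bound[of 3 a] pos_mod_sign[of 3 a] by (auto simp del: pos_mod_bound pos_mod_sign)
  then show ?thesis by (auto simp: dclass_def)
qed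

lemma three_dvd_two_power: "3 dvd (2 ^ d - (if even d then 1 else -1) :: int)"
proof (induction d)
  case (Suc d)
  then obtain q where "2 ^ d - (if even d then 1 else -1) = 3 * (q::int)" by (auto elim: dvdE)
  then have "2 ^ Suc d - (if even (Suc d) then 1 else -1) = (if even d then 3 * (2 * q + 1) else 3 * (2 * q - 1))"
    by (auto split: if_splits)
  then show ?case by (auto split: if_splits)
qed simp

lemma le_div_iff_mult_le_int:
  fixes a c n :: int
  assumes "c > 0" shows "a \<le> n div c \<longleftrightarrow> a * c \<le> n"
proof
  assume "a \<le> n div c"
  then have "a * c \<le> n div c * c" using assms by (intro mult_right_mono) auto
  also have "\<dots> \<le> n" using div_mult_mod_eq[of n c] pos_mod_sign[OF assms, of n] by linarith
  finally show "a * c \<le> n" .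
next
  assume "a * c \<le> n"
  then have "(a * c) div c \<le> n div c" using assms by (intro zdiv_mono1) auto
  then show "a \<le> n div c" using assms by simp
qed

text \<open>In each coordinate, counted in indices of the fine level, the coarse block is an
  interval of 3 * c indices starting at a * c, with c = 2^(l - k), and the fine block is three
  indices starting at b. Equal classes mean b = a * c modulo 3, so the fine block belongs to the
  partition of the line into triples that is aligned with the coarse block.\<close>

lemma dclass_nested:
  assumes kl: "k \<le> l" and c: "dclass k x = dclass l y"
  shows "dcube3 k x \<inter> dcube3 l y = {} \<or> dcube3 l y \<subseteq> dcube3 k x"
proof (cases "dcube3 k x \<inter> dcube3 l y = {}")
  case False
  then obtain z where z: "z \<in> dcube3 k x" "z \<in> dcube3 l y" by blast
  define c where "c = (2::int) ^ nat (l - k)"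
  have c0: "c > 0" by (simp add: c_def)
  have "dcube3 l y \<subseteq> dcube3 k x"
  proof
    fix u assume u: "u \<in> dcube3 l y"
    show "u \<in> dcube3 k x" unfolding dblock_eq mem_Collect_eq
    proof
      fix i :: 'a assume i: "i \<in> Basis"
      define a where "a = dyidx k x i - 1"
      define b where "b = dyidx l y i - 1"
      have e: "even k = (even l = even (nat (l - k)))" using kl by (simp add: even_nat_iff) blast
      have m: "(if even k then a else - a) mod 3 = (if even l then b else - b) mod 3"
        using fun_cong[OF c, of i] i unfolding dclass_def a_def b_def by (simp only: restrict_apply')
      define t where "t = (if even (nat (l - k)) then 1 else -1 :: int)"
      have r: "3 dvd (if even k then a else - a) - (if even l then b else - b)"
        using m by (simp only: mod_eq_dvd_iff)
      have "3 dvd b - t * a"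
      proof (cases "even k"; cases "even l")
        assume "even k" "even l" then show ?thesis using r e by (simp add: t_def dvd_diff_commute)
      next
        assume "even k" "odd l" then show ?thesis using r e by (simp add: t_def add.commute)
      next
        assume "odd k" "even l"
        then show ?thesis using r e dvd_minus_iff[of 3 "- a - b"] by (simp add: t_def add.commute)
      next
        assume "odd k" "odd l" then show ?thesis using r e by (simp add: t_def)
      qed
      moreover have "3 dvd a * (c - t)"
        using three_dvd_two_power[of "nat (l - k)"] unfolding c_def t_def by (rule dvd_mult)
      ultimately have "3 dvd (b - t * a) - a * (c - t)" by (rule dvd_diff)
      then have "3 dvd b - a * c" by (simp add: algebra_simps)
      then obtain q where "b - a * c = 3 * q" by (rule dvdE)
      then have q: "b = a * c + 3 * q" by simp
      have dk: "dyidx k w i = dyidx l w i div c" for w by (simp add: c_def dyidx_coarsen[OF kl])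
      have mem: "a \<le> n div c \<and> n div c \<le> a + 2 \<longleftrightarrow> a * c \<le> n \<and> n < (a + 3) * c" for n
        using le_div_iff_mult_le_int[OF c0, of a n] le_div_iff_mult_le_int[OF c0, of "a + 3" n] by linarith
      have "a \<le> dyidx k z i \<and> dyidx k z i \<le> a + 2" using z(1) i by (auto simp: dblock_eq a_def)
      then have z1: "a * c \<le> dyidx l z i" "dyidx l z i < (a + 3) * c" using mem dk by auto
      have z2: "b \<le> dyidx l z i" "dyidx l z i \<le> b + 2" using z(2) i by (auto simp: dblock_eq b_def)
      have u2: "b \<le> dyidx l u i" "dyidx l u i \<le> b + 2" using u i by (auto simp: dblock_eq b_def)
      \<comment> \<open>Both blocks contain the index of \<open>z\<close>, hence the number q of the
        triple lies between 0 and c - 1, and the entire triple is inside the coarse block.\<close>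
      have "q \<ge> 0" using q z1(1) z2(2) by linarith
      have "3 * q < 3 * c" using q z1(2) z2(1) by (simp add: algebra_simps)
      then have "q + 1 \<le> c" by simp
      then have "b + 3 \<le> (a + 3) * c" using q by (simp add: algebra_simps)
      then have "a * c \<le> dyidx l u i \<and> dyidx l u i < (a + 3) * c" using u2 q \<open>q \<ge> 0\<close> by linarith
      then have "a \<le> dyidx k u i \<and> dyidx k u i \<le> a + 2" using mem dk by auto
      then show "dyidx k x i - 1 \<le> dyidx k u i \<and> dyidx k u i \<le> dyidx k x i + 1" by (simp add: a_def)
    qed
  qed
  then show ?thesis ..
qed auto

lemma laminar_dclass: "laminar {dcube3 k x |k x. dclass k x = r}"
  unfolding laminar_def
proof (intro ballI, elim CollectE exE conjE)
  fix A B k j and x y :: 'a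
  assume "A = dcube3 k x" "B = dcube3 j y" "dclass k x = r" "dclass j y = r"
  then show "A \<inter> B = {} \<or> A \<subseteq> B \<or> B \<subseteq> A"
    using dclass_nested[of k j x y] dclass_nested[of j k y x] by (cases "k \<le> j") (auto simp: Int_commute)
qed

section \<open>The truncated kernels\<close>

lemma power_diff_le:
  fixes x y :: real
  assumes "0 \<le> y" "y \<le> x"
  shows "x ^ n - y ^ n \<le> real n * x ^ (n - 1) * (x - y)"
proof (induction n)
  case (Suc n)
  have "x ^ Suc n - y ^ Suc n = x * (x ^ n - y ^ n) + y ^ n * (x - y)" by (simp add: algebra_simps)
  also have "\<dots> \<le> x * (real n * x ^ (n - 1) * (x - y)) + x ^ n * (x - y)"
    using assms Suc by (intro add_mono mult_left_mono mult_right_mono power_mono) auto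
  also have "\<dots> = real (Suc n) * x ^ n * (x - y)"
    by (cases n) (simp_all add: algebra_simps)
  finally show ?case by simp
qed simp

lemma integrable_bounded_support:
  fixes f :: "'a::euclidean_space \<Rightarrow> real"
  assumes [measurable]: "f \<in> borel_measurable borel" and B: "\<And>x. \<bar>f x\<bar> \<le> B"
    and R: "\<And>x. f x \<noteq> 0 \<Longrightarrow> norm x \<le> R"
  shows "integrable lborel f"
proof (rule Bochner_Integration.integrable_bound)
  show "integrable lborel (\<lambda>x. B * indicator (cball (0::'a) R) x :: real)"
    using emeasure_lborel_cball_finite[of "0::'a" R] by (intro integrable_mult_right integrable_real_indicator) (auto simp: less_top)
  have "norm (f x) \<le> norm (B * indicator (cball (0::'a) R) x)" for x
  proof (cases "f x = 0")
    case False
    then show ?thesis using R[OF False] order_trans[OF B[of x] abs_ge_self[of B]] by simp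
  qed simp
  then show "AE x in lborel. norm (f x) \<le> norm (B * indicator (cball (0::'a) R) x)" by simp
qed auto

lemma measure_shell_le:
  fixes R t :: real
  assumes "0 \<le> t" "t \<le> R"
  shows "measure lborel (cball (0::'a::euclidean_space) (R + t) - ball 0 (R - t))
    \<le> unit_ball_vol DIM('a) * (2 * t * DIM('a) * (2 * R) ^ (DIM('a) - 1))"
proof -
  have "measure lborel (cball (0::'a) (R + t) - ball 0 (R - t))
     = measure lborel (cball (0::'a) (R + t)) - measure lborel (ball (0::'a) (R - t))"
    using assms emeasure_lborel_cball_finite[of "0::'a" "R + t"] by (intro measure_Diff) (auto simp: subset_iff less_top)
  also have "\<dots> = unit_ball_vol DIM('a) * ((R + t) ^ DIM('a) - (R - t) ^ DIM('a))"
    using assms content_cball[of "R + t" "0::'a"] content_ball[of "R - t" "0::'a"] by (simp add: algebra_simps)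
  also have "(R + t) ^ DIM('a) - (R - t) ^ DIM('a) \<le> DIM('a) * (R + t) ^ (DIM('a) - 1) * (2 * t)"
    using power_diff_le[of "R - t" "R + t" "DIM('a)"] assms by simp
  also have "\<dots> \<le> DIM('a) * (2 * R) ^ (DIM('a) - 1) * (2 * t)"
    using assms by (intro mult_right_mono mult_left_mono power_mono) auto
  finally show ?thesis by (simp add: mult_left_mono mult_ac)
qed

text \<open>As \<open>m\<close> has integral 0, the value k(x - z) may be subtracted from k(x - y)
  under the integral; Fubini does the rest. It is used with S = UNIV, z = 0 for almost
  orthogonality, and with S the outside of a ball, z a point of the cell, for the bad part of the
  decomposition.\<close>

lemma conv_L1_mean_zero:
  fixes k m :: "'a::euclidean_space \<Rightarrow> real"
  assumes k: "integrable lborel k" and m: "integrable lborel m" and m0: "(\<integral>y. m y \<partial>lborel) = 0"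
    and kb: "\<And>x. \<bar>k x\<bar> \<le> Bk" and S[measurable]: "S \<in> sets borel"
    and A: "\<And>y. m y \<noteq> 0 \<Longrightarrow> (\<integral>x. indicator S x * \<bar>k (x - y) - k (x - z)\<bar> \<partial>lborel) \<le> A"
  shows "(\<integral>x. indicator S x * \<bar>conv k m x\<bar> \<partial>lborel) \<le> A * (\<integral>y. \<bar>m y\<bar> \<partial>lborel)"
proof -
  have [measurable]: "k \<in> borel_measurable borel" "m \<in> borel_measurable borel" using k m by auto
  let ?g = "\<lambda>x y. k (x - y) * m y - k (x - z) * m y"
  have kz: "integrable lborel (\<lambda>x. k (x - z))" using lborel_integrable_translate[OF k] .
  have i1: "integrable (lborel \<Otimes>\<^sub>M lborel) (\<lambda>(x, y). k (x - z) * m y)"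
    using lborel_pair.integrable_fst' kz m
    by (intro lborel_pair.Fubini_integrable) (auto simp: abs_mult)
  have "integrable (lborel \<Otimes>\<^sub>M lborel) (\<lambda>p. (case p of (x, y) \<Rightarrow> k (x - y) * m y) - (case p of (x, y) \<Rightarrow> k (x - z) * m y))"
    by (rule Bochner_Integration.integrable_diff[OF conv_pair_integrable[OF k m] i1])
  then have i2: "integrable (lborel \<Otimes>\<^sub>M lborel) (\<lambda>(x, y). \<bar>?g x y\<bar>)"
    using integrable_abs by (simp add: split_beta')
  have i3: "integrable (lborel \<Otimes>\<^sub>M lborel) (\<lambda>(x, y). indicator S x * \<bar>?g x y\<bar>)"
    using integrable_mult_bounded[OF i2, of "\<lambda>(x, y). indicator S x" 1] by (simp add: split_beta' indicator_def)
  have pt: "\<bar>conv k m x\<bar> \<le> (\<integral>y. \<bar>?g x y\<bar> \<partial>lborel)" for x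
  proof -
    have j: "integrable lborel (\<lambda>y. k (x - y) * m y)" by (rule conv_bound(2)[OF _ kb m]) simp
    have "conv k m x = (\<integral>y. ?g x y \<partial>lborel)"
      using j m m0 by (simp add: conv_def)
    also have "\<bar>\<dots>\<bar> \<le> (\<integral>y. \<bar>?g x y\<bar> \<partial>lborel)" by (rule integral_abs_bound)
    finally show ?thesis .
  qed
  have "(\<integral>x. indicator S x * \<bar>conv k m x\<bar> \<partial>lborel) \<le> (\<integral>x. (\<integral>y. indicator S x * \<bar>?g x y\<bar> \<partial>lborel) \<partial>lborel)"
  proof (rule integral_mono)
    show "integrable lborel (\<lambda>x. indicator S x * \<bar>conv k m x\<bar>)"
      using conv_integrable[OF k m] by (intro integrable_mult_bounded[of _ _ _ 1]) (auto simp: indicator_def)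
    show "integrable lborel (\<lambda>x. \<integral>y. indicator S x * \<bar>?g x y\<bar> \<partial>lborel)"
      using lborel_pair.integrable_fst[OF i3] by simp
    show "indicator S x * \<bar>conv k m x\<bar> \<le> (\<integral>y. indicator S x * \<bar>?g x y\<bar> \<partial>lborel)" for x
      using pt[of x] by (simp add: indicator_def)
  qed
  also have "\<dots> = (\<integral>y. (\<integral>x. indicator S x * \<bar>?g x y\<bar> \<partial>lborel) \<partial>lborel)"
    using lborel_pair.Fubini_integral[OF i3] by simp
  also have "\<dots> \<le> (\<integral>y. A * \<bar>m y\<bar> \<partial>lborel)"
  proof (rule integral_mono)
    show "integrable lborel (\<lambda>y. \<integral>x. indicator S x * \<bar>?g x y\<bar> \<partial>lborel)"
      using lborel_pair.integrable_snd[OF i3] by simp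
    show "integrable lborel (\<lambda>y. A * \<bar>m y\<bar>)" using m by auto
    show "(\<integral>x. indicator S x * \<bar>?g x y\<bar> \<partial>lborel) \<le> A * \<bar>m y\<bar>" for y
    proof (cases "m y = 0")
      case False
      have "(\<lambda>x. indicator S x * \<bar>?g x y\<bar>) = (\<lambda>x. (indicator S x * \<bar>k (x - y) - k (x - z)\<bar>) * \<bar>m y\<bar>)"
        by (auto simp: abs_mult[symmetric] left_diff_distrib)
      then have "(\<integral>x. indicator S x * \<bar>?g x y\<bar> \<partial>lborel) = (\<integral>x. indicator S x * \<bar>k (x - y) - k (x - z)\<bar> \<partial>lborel) * \<bar>m y\<bar>"
        by simp
      also have "\<dots> \<le> A * \<bar>m y\<bar>" using A[OF False] by (intro mult_right_mono) auto
      finally show ?thesis .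
    qed simp
  qed
  finally show ?thesis by simp
qed

text \<open>The kernel conditions say nothing about the value at 0. Fixing it as 0 makes K a Borel
  function; truncated kernels do not see the change.\<close>

locale cz =
  fixes K :: "'a::euclidean_space \<Rightarrow> real" and c \<epsilon> :: real
  assumes CZ: "CZ_kernel K c \<epsilon>" and K0: "K 0 = 0"
begin

lemma c_pos: "c > 0" and eps_pos: "\<epsilon> > 0"
  using CZ by (auto simp: CZ_kernel_def)

lemma K_le:
  assumes "r > 0" "r \<le> norm x" shows "\<bar>K x\<bar> \<le> c / r ^ DIM('a)"
proof -
  have x: "x \<noteq> 0" using assms by auto
  have "\<bar>K x\<bar> \<le> c * norm x powr (- real DIM('a))" using CZ x by (auto simp: CZ_kernel_def)
  also have "norm x powr (- real DIM('a)) = 1 / norm x ^ DIM('a)"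
    using x by (simp add: powr_minus powr_realpow divide_inverse)
  also have "\<dots> \<le> 1 / r ^ DIM('a)"
    using assms by (intro divide_left_mono power_mono mult_pos_pos zero_less_power) auto
  finally show ?thesis using c_pos by (simp add: mult_left_mono)
qed

lemma K_smooth:
  assumes "r > 0" "r \<le> norm x" "norm y \<le> norm x / 2"
  shows "\<bar>K x - K (x - y)\<bar> \<le> c / r ^ DIM('a) * (norm y / r) powr \<epsilon>"
proof -
  have x: "x \<noteq> 0" using assms by auto
  have "\<bar>K x - K (x - y)\<bar> \<le> c * norm y powr \<epsilon> / norm x powr (real DIM('a) + \<epsilon>)"
    using CZ x assms by (auto simp: CZ_kernel_def)
  also have "\<dots> \<le> c * norm y powr \<epsilon> / r powr (real DIM('a) + \<epsilon>)"
    using assms c_pos eps_pos x by (intro divide_left_mono powr_mono2 mult_pos_pos) auto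
  also have "\<dots> = c / r ^ DIM('a) * (norm y / r) powr \<epsilon>"
    using assms by (simp add: powr_add powr_realpow powr_divide)
  finally show ?thesis .
qed

text \<open>The smoothness condition with y tending to 0. Continuity off the origin upgrades K from
  Lebesgue to Borel measurable, and later keeps K away from 0 near a point where it does not
  vanish.\<close>

lemma K_isCont:
  assumes "x \<noteq> 0" shows "isCont K x"
proof -
  have "((\<lambda>z. K z - K x) \<longlongrightarrow> 0) (at x)"
  proof (rule Lim_null_comparison)
    show "\<forall>\<^sub>F z in at x. norm (K z - K x) \<le> c / norm x ^ DIM('a) * (norm (x - z) / norm x) powr \<epsilon>"
      unfolding eventually_at
    proof (intro exI[of _ "norm x / 2"] conjI ballI impI)
      fix z assume "z \<noteq> x \<and> dist z x < norm x / 2"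
      then show "norm (K z - K x) \<le> c / norm x ^ DIM('a) * (norm (x - z) / norm x) powr \<epsilon>"
        using K_smooth[of "norm x" x "x - z"] assms by (simp add: dist_norm norm_minus_commute abs_minus_commute)
    qed (use assms in auto)
    have "((\<lambda>z. (norm (x - z) / norm x) powr \<epsilon>) \<longlongrightarrow> 0) (at x)"
    proof (rule tendsto_zero_powrI)
      have "((\<lambda>z. norm (x - z) / norm x) \<longlongrightarrow> norm (x - x) / norm x) (at x)"
        using assms by (intro tendsto_intros) auto
      then show "((\<lambda>z. norm (x - z) / norm x) \<longlongrightarrow> 0) (at x)" by simp
    qed (use eps_pos in auto)
    then show "((\<lambda>z. c / norm x ^ DIM('a) * (norm (x - z) / norm x) powr \<epsilon>) \<longlongrightarrow> 0) (at x)"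
      by (rule tendsto_mult_right_zero)
  qed
  then show ?thesis by (simp add: isCont_def LIM_zero_iff)
qed

lemma K_borel[measurable]: "K \<in> borel_measurable borel"
proof -
  have "(\<lambda>x. indicator (- {0}) x *\<^sub>R K x) \<in> borel_measurable borel"
    by (rule borel_measurable_continuous_on_indicator)
       (auto intro!: continuous_at_imp_continuous_on K_isCont)
  also have "(\<lambda>x. indicator (- {0}) x *\<^sub>R K x) = K"
    by (rule ext) (auto simp: indicator_def K0)
  finally show ?thesis .
qed

text \<open>The annuli are half open, so consecutive pieces add up exactly to
  \<open>kern a b\<close>; the spheres, on which this differs from the open annuli of the
  cancellation condition, are null sets.\<close>

definition piece :: "int \<Rightarrow> 'a \<Rightarrow> real" where
  "piece j x = (if 2 powi j < norm x \<and> norm x \<le> 2 powi (j + 1) then K x else 0)"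

definition kern :: "int \<Rightarrow> int \<Rightarrow> 'a \<Rightarrow> real" where
  "kern a b x = (if 2 powi a < norm x \<and> norm x \<le> 2 powi b then K x else 0)"

text \<open>The exponent is capped at 1 because cutting K off at the two spheres of an annulus
  creates jumps, whose contribution to the L^1 modulus of continuity is of first order in the
  shift.\<close>

definition \<theta> :: real where "\<theta> = min \<epsilon> 1"

lemma theta: "0 < \<theta>" "\<theta> \<le> 1" "\<theta> \<le> \<epsilon>" using eps_pos by (auto simp: \<theta>_def)

lemma kern_sum: "a \<le> b \<Longrightarrow> kern a b = (\<lambda>x. \<Sum>j\<in>{a..<b}. piece j x)"
proof (induction b rule: int_ge_induct)
  case base
  show ?case by (auto simp: kern_def)
next
  case (step b)
  have "{a..<b + 1} = insert b {a..<b}" using step.hyps by auto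
  then have "(\<lambda>x. \<Sum>j\<in>{a..<b + 1}. piece j x) = (\<lambda>x. piece b x + kern a b x)"
    by (simp add: step.IH)
  also have "\<dots> = kern a (b + 1)"
  proof
    fix x
    have "(2::real) powi a \<le> 2 powi b" "(2::real) powi b \<le> 2 powi (b + 1)"
      using step.hyps by (auto intro: power_int_increasing)
    then show "piece b x + kern a b x = kern a (b + 1) x" by (auto simp: kern_def piece_def)
  qed
  finally show ?case by simp
qed

lemma piece_borel[measurable]: "piece j \<in> borel_measurable borel"
  unfolding piece_def by measurable

lemma kern_borel[measurable]: "kern a b \<in> borel_measurable borel"
  unfolding kern_def by measurable

lemma piece_le: "\<bar>piece j x\<bar> \<le> c / (2 powi j) ^ DIM('a)"
  using K_le[of "2 powi j" x] c_pos by (auto simp: piece_def)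

lemma kern_le: "\<bar>kern a b x\<bar> \<le> c / (2 powi a) ^ DIM('a)"
  using K_le[of "2 powi a" x] c_pos by (auto simp: kern_def)

lemma bint_piece: "bint (piece j)"
proof -
  have "integrable lborel (piece j)"
    by (rule integrable_bounded_support[OF piece_borel piece_le, of j "2 powi (j + 1)"])
       (simp add: piece_def split: if_splits)
  then show ?thesis unfolding bint_def using piece_le by blast
qed

lemma bint_kern: "bint (kern a b)"
proof -
  have "integrable lborel (kern a b)"
    by (rule integrable_bounded_support[OF kern_borel kern_le, of a b "2 powi b"])
       (simp add: kern_def split: if_splits)
  then show ?thesis unfolding bint_def using kern_le by blast
qed

definition C1 :: real where "C1 = c * 2 ^ DIM('a) * unit_ball_vol DIM('a)"

lemma C1_pos: "C1 > 0" using c_pos by (simp add: C1_def)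

lemma piece_L1: "(\<integral>x. \<bar>piece j x\<bar> \<partial>lborel) \<le> C1"
proof -
  let ?r = "2 powi j :: real"
  have "(\<integral>x. \<bar>piece j x\<bar> \<partial>lborel) \<le> (\<integral>x. c / ?r ^ DIM('a) * indicator (cball (0::'a) (2 * ?r)) x \<partial>lborel)"
  proof (rule integral_mono)
    show "integrable lborel (\<lambda>x. \<bar>piece j x\<bar>)" using bint_piece by (auto simp: bint_def)
    show "integrable lborel (\<lambda>x. c / ?r ^ DIM('a) * indicator (cball (0::'a) (2 * ?r)) x)"
      using emeasure_lborel_cball_finite[of "0::'a" "2 * ?r"] by (intro integrable_mult_right integrable_real_indicator) (auto simp: less_top)
    show "\<bar>piece j x\<bar> \<le> c / ?r ^ DIM('a) * indicator (cball (0::'a) (2 * ?r)) x" for x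
      using piece_le[of j x] by (auto simp: piece_def indicator_def power_int_add split: if_splits)
  qed
  also have "\<dots> = c / ?r ^ DIM('a) * (unit_ball_vol DIM('a) * (2 * ?r) ^ DIM('a))"
    using content_cball[of "2 * ?r" "0::'a"] by simp
  also have "\<dots> = C1" by (simp add: C1_def power_mult_distrib)
  finally show ?thesis .
qed

lemma annulus_mean_zero:
  assumes "0 < r" "r < R"
  shows "(\<integral>x. (if r < norm x \<and> norm x \<le> R then K x else 0) \<partial>lborel) = 0"
proof -
  let ?f = "\<lambda>x. if r < norm x \<and> norm x \<le> R then K x else 0" and ?A = "{x::'a. r < norm x \<and> norm x < R}"
  have m: "?f \<in> borel_measurable borel" by measurable
  have "sphere 0 R \<in> null_sets (lebesgue :: 'a measure)"
    using negligible_sphere negligible_iff_null_sets by blast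
  then have "AE x in lebesgue. ?f x = indicator ?A x *\<^sub>R K x"
    by (rule AE_I') (auto simp: indicator_def split: if_splits)
  then have "(\<integral>x. ?f x \<partial>lebesgue) = (\<integral>x. indicator ?A x *\<^sub>R K x \<partial>lebesgue)"
    using m by (intro integral_cong_AE) (auto intro!: measurable_completion)
  also have "\<dots> = 0" using CZ assms by (simp add: CZ_kernel_def set_lebesgue_integral_def)
  finally show ?thesis using m by (simp add: integral_completion)
qed

lemma piece_mean_zero: "(\<integral>x. piece j x \<partial>lborel) = 0"
proof -
  have "(2::real) powi j < 2 powi (j + 1)" by (simp add: power_int_add)
  then have "(\<integral>x. (if 2 powi j < norm x \<and> norm x \<le> 2 powi (j + 1) then K x else 0) \<partial>lborel) = 0"
    by (intro annulus_mean_zero) simp_all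
  then show ?thesis by (simp only: piece_def)
qed

lemma piece_integrable: "integrable lborel (piece j)" "integrable lborel (\<lambda>x. piece j (x - y))"
  using lborel_integrable_translate[OF bint_integrable[OF bint_piece]] bint_integrable[OF bint_piece] by auto

lemma kern_integrable: "integrable lborel (kern a b)" "integrable lborel (\<lambda>x. kern a b (x - y))"
  using lborel_integrable_translate[OF bint_integrable[OF bint_kern]] bint_integrable[OF bint_kern] by auto

text \<open>The first summand serves shifts up to half the inner radius: 2^n comes from the
  smoothness of K inside the annulus, the other term from the two shells around its boundary. The
  summand 4 * C1 serves larger shifts.\<close>

definition C2 :: real where
  "C2 = c * unit_ball_vol DIM('a) * (2 ^ DIM('a) + 4 * DIM('a) * 4 ^ DIM('a)) + 4 * C1"

lemma C2_pos: "C2 > 0"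
  using c_pos C1_pos unfolding C2_def by (intro add_nonneg_pos mult_nonneg_nonneg) auto

text \<open>If x and x - y both lie in the annulus, the smoothness of K applies. If exactly one
  does, then x is within |y| of one of the two bounding spheres, and the size bound is charged to
  the shell around that sphere.\<close>

lemma piece_diff_le:
  assumes y: "norm y \<le> 2 powi j / 2"
  defines "r \<equiv> 2 powi j :: real"
  shows "\<bar>piece j (x - y) - piece j x\<bar> \<le> c / r ^ DIM('a) * ((norm y / r) powr \<epsilon> * indicator (cball 0 (2 * r)) x
     + (indicator (cball 0 (r + norm y) - ball 0 (r - norm y)) x
     + indicator (cball 0 (2 * r + norm y) - ball 0 (2 * r - norm y)) x))" (is "_ \<le> ?D * (?a + (?b1 + ?b2))")
proof -
  have r: "r > 0" by (simp add: r_def)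
  have D0: "?D \<ge> 0" using c_pos r by simp
  have tri: "norm x \<le> norm (x - y) + norm y" "norm (x - y) \<le> norm x + norm y"
    using norm_triangle_ineq[of "x - y" y] norm_triangle_ineq4[of x y] by auto
  have p: "piece j z = (if r < norm z \<and> norm z \<le> 2 * r then K z else 0)" for z
    by (auto simp: piece_def r_def power_int_add)
  have ple: "\<bar>piece j z\<bar> \<le> ?D" for z using piece_le by (simp add: r_def)
  consider "r < norm x \<and> norm x \<le> 2 * r" "r < norm (x - y) \<and> norm (x - y) \<le> 2 * r"
    | "r < norm x \<and> norm x \<le> 2 * r" "\<not> (r < norm (x - y) \<and> norm (x - y) \<le> 2 * r)"
    | "\<not> (r < norm x \<and> norm x \<le> 2 * r)" "r < norm (x - y) \<and> norm (x - y) \<le> 2 * r"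
    | "\<not> (r < norm x \<and> norm x \<le> 2 * r)" "\<not> (r < norm (x - y) \<and> norm (x - y) \<le> 2 * r)" by blast
  then show ?thesis
  proof cases
    case 1
    have "\<bar>K x - K (x - y)\<bar> \<le> ?D * (norm y / r) powr \<epsilon>"
      using y 1 r by (intro K_smooth) (auto simp: r_def)
    moreover have "?D * (norm y / r) powr \<epsilon> \<le> ?D * (?a + (?b1 + ?b2))"
      using 1 D0 by (intro mult_left_mono) auto
    ultimately show ?thesis using 1 by (simp add: p abs_minus_commute)
  next
    case 2
    then have "?b1 = (1::real) \<or> ?b2 = (1::real)" using tri by (auto simp: indicator_def)
    then have "1 \<le> ?a + (?b1 + ?b2)" by (auto simp: indicator_def)
    then have "?D * 1 \<le> ?D * (?a + (?b1 + ?b2))" using D0 by (intro mult_left_mono) auto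
    moreover have "piece j (x - y) = 0" using 2(2) by (auto simp: p)
    ultimately show ?thesis using ple[of x] by simp
  next
    case 3
    then have "?b1 = (1::real) \<or> ?b2 = (1::real)" using tri by (auto simp: indicator_def)
    then have "1 \<le> ?a + (?b1 + ?b2)" by (auto simp: indicator_def)
    then have "?D * 1 \<le> ?D * (?a + (?b1 + ?b2))" using D0 by (intro mult_left_mono) auto
    moreover have "piece j x = 0" using 3(1) by (auto simp: p)
    ultimately show ?thesis using ple[of "x - y"] by simp
  next
    case 4
    then have "piece j (x - y) = 0" "piece j x = 0" using p by auto
    moreover have "0 \<le> ?D * (?a + (?b1 + ?b2))" using D0 by (intro mult_nonneg_nonneg add_nonneg_nonneg) auto
    ultimately show ?thesis by simp
  qed
qed

lemma powr_theta_le: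
  assumes "0 \<le> s" "s \<le> 1" shows "s powr \<epsilon> \<le> s powr \<theta>" "s \<le> s powr \<theta>"
  using assms theta powr_mono'[of \<theta> \<epsilon> s] powr_mono'[of \<theta> 1 s] by (cases "s = 0"; simp)+

lemma piece_modulus_small:
  assumes y: "norm y \<le> 2 powi j / 2"
  shows "(\<integral>x. \<bar>piece j (x - y) - piece j x\<bar> \<partial>lborel) \<le> C2 * (norm y / 2 powi j) powr \<theta>"
proof -
  let ?n = "DIM('a)"
  define r where "r = (2 powi j :: real)"
  define s where "s = norm y / r"
  let ?v = "unit_ball_vol ?n"
  have r: "r > 0" by (simp add: r_def)
  have yr: "norm y \<le> r / 2" using y by (simp add: r_def)
  have s: "0 \<le> s" "s \<le> 1" using yr r by (auto simp: s_def field_simps)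
  let ?A = "cball (0::'a) (2 * r)"
  let ?B = "\<lambda>R. cball (0::'a) (R + norm y) - ball 0 (R - norm y)"
  let ?D = "c / r ^ ?n"
  have D0: "?D \<ge> 0" using c_pos r by simp
  have fin: "emeasure lborel (cball (0::'a) R) < \<infinity>" for R
    using emeasure_lborel_cball_finite[of "0::'a" R] by (simp add: less_top)
  have iA: "integrable lborel (\<lambda>x. indicator ?A x :: real)"
    using fin by (intro integrable_real_indicator) auto
  have iB: "integrable lborel (\<lambda>x. indicator (?B R) x :: real)" for R
    using le_less_trans[OF emeasure_mono[of "?B R" "cball 0 (R + norm y)" lborel] fin]
    by (intro integrable_real_indicator) auto
  have mB: "measure lborel (?B R) \<le> ?v * (2 * norm y * ?n * (2 * R) ^ (?n - 1))" if "norm y \<le> R" for R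
    using measure_shell_le[of "norm y" R] that by simp
  have ip: "integrable lborel (\<lambda>x. \<bar>piece j (x - y) - piece j x\<bar>)"
    using piece_integrable by auto
  have h1: "2 * norm y * ?n * (2 * r) ^ (?n - 1) \<le> s powr \<theta> * (2 * ?n * 4 ^ ?n * r ^ ?n)"
  proof -
    have "r * r ^ (?n - 1) = r ^ ?n" using power_eq_if[of r ?n] by simp
    moreover have "2 * norm y * ?n * (2 * r) ^ (?n - 1) = s * (2 * ?n * 2 ^ (?n - 1) * (r * r ^ (?n - 1)))"
      using r by (simp add: s_def power_mult_distrib)
    moreover have "(2::real) ^ (?n - 1) \<le> 4 ^ ?n"
      using power_increasing[of "?n - 1" ?n "4::real"] power_mono[of "2::real" 4 "?n - 1"] by linarith
    ultimately have eq: "2 * norm y * ?n * (2 * r) ^ (?n - 1) = s * (2 * ?n * 2 ^ (?n - 1) * r ^ ?n)"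
      and le: "(2::real) ^ (?n - 1) \<le> 4 ^ ?n" by (simp_all only:)
    have "2 * ?n * 2 ^ (?n - 1) * r ^ ?n \<le> 2 * ?n * 4 ^ ?n * r ^ ?n"
      using le r by (intro mult_right_mono mult_left_mono) auto
    then show ?thesis unfolding eq using powr_theta_le(2)[OF s] r s by (intro mult_mono) auto
  qed
  have h2: "2 * norm y * ?n * (2 * (2 * r)) ^ (?n - 1) \<le> s powr \<theta> * (2 * ?n * 4 ^ ?n * r ^ ?n)"
  proof -
    have "r * r ^ (?n - 1) = r ^ ?n" using power_eq_if[of r ?n] by simp
    moreover have "2 * norm y * ?n * (2 * (2 * r)) ^ (?n - 1) = s * (2 * ?n * 4 ^ (?n - 1) * (r * r ^ (?n - 1)))"
      using r by (simp add: s_def power_mult_distrib)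
    moreover have "(4::real) ^ (?n - 1) \<le> 4 ^ ?n" by (intro power_increasing) auto
    ultimately have eq: "2 * norm y * ?n * (2 * (2 * r)) ^ (?n - 1) = s * (2 * ?n * 4 ^ (?n - 1) * r ^ ?n)"
      and le: "(4::real) ^ (?n - 1) \<le> 4 ^ ?n" by (simp_all only:)
    have "2 * ?n * 4 ^ (?n - 1) * r ^ ?n \<le> 2 * ?n * 4 ^ ?n * r ^ ?n"
      using le r by (intro mult_right_mono mult_left_mono) auto
    then show ?thesis unfolding eq using powr_theta_le(2)[OF s] r s by (intro mult_mono) auto
  qed
  have "(\<integral>x. \<bar>piece j (x - y) - piece j x\<bar> \<partial>lborel)
    \<le> (\<integral>x. ?D * (s powr \<epsilon> * indicator ?A x + (indicator (?B r) x + indicator (?B (2 * r)) x)) \<partial>lborel)"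
    using iA iB[of r] iB[of "2 * r"] ip piece_diff_le[OF y, folded r_def s_def]
    by (intro integral_mono integrable_mult_right Bochner_Integration.integrable_add) auto
  also have "\<dots> = ?D * (s powr \<epsilon> * measure lborel ?A + (measure lborel (?B r) + measure lborel (?B (2 * r))))"
    using iA iB[of r] iB[of "2 * r"] by simp
  also have "\<dots> \<le> ?D * (s powr \<theta> * (?v * (2 * r) ^ ?n) +
      (?v * (2 * norm y * ?n * (2 * r) ^ (?n - 1)) + ?v * (2 * norm y * ?n * (2 * (2 * r)) ^ (?n - 1))))"
    using mB[of r] mB[of "2 * r"] yr r powr_theta_le[OF s] content_cball[of "2 * r" "0::'a"] D0
    by (intro mult_left_mono add_mono) (auto intro: mult_right_mono)
  also have "\<dots> \<le> ?D * (s powr \<theta> * (?v * (2 * r) ^ ?n) + (?v * (s powr \<theta> * (2 * ?n * 4 ^ ?n * r ^ ?n)) + ?v * (s powr \<theta> * (2 * ?n * 4 ^ ?n * r ^ ?n))))"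
    by (intro mult_left_mono[OF _ D0] add_mono order_refl mult_left_mono h1 h2) auto
  also have "\<dots> = c * ?v * (2 ^ ?n + 4 * ?n * 4 ^ ?n) * s powr \<theta>"
    using r by (simp add: power_mult_distrib field_simps)
  also have "\<dots> \<le> C2 * s powr \<theta>"
    using C1_pos by (intro mult_right_mono) (auto simp: C2_def)
  finally show ?thesis by (simp add: s_def r_def)
qed

lemma piece_modulus:
  "(\<integral>x. \<bar>piece j (x - y) - piece j x\<bar> \<partial>lborel) \<le> C2 * (norm y / 2 powi j) powr \<theta>"
proof (cases "norm y \<le> 2 powi j / 2")
  case False
  let ?s = "norm y / 2 powi j"
  have i: "integrable lborel (\<lambda>x. \<bar>piece j x\<bar>)" "integrable lborel (\<lambda>x. \<bar>piece j (x - y)\<bar>)"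
    using piece_integrable by auto
  have "(\<integral>x. \<bar>piece j (x - y) - piece j x\<bar> \<partial>lborel) \<le> (\<integral>x. \<bar>piece j (x - y)\<bar> + \<bar>piece j x\<bar> \<partial>lborel)"
    using i by (intro integral_mono_AE') (auto simp: abs_triangle_ineq4)
  also have "\<dots> = (\<integral>x. \<bar>piece j x\<bar> \<partial>lborel) + (\<integral>x. \<bar>piece j x\<bar> \<partial>lborel)"
    using i lborel_integral_translate[of "\<lambda>x. \<bar>piece j x\<bar>" y] by simp
  also have "\<dots> \<le> 2 * C1" using piece_L1[of j] by simp
  \<comment> \<open>A large shift has relative size at least 1/2, and (1/2)^\<theta> \<ge> 1/2 as
    \<theta> \<le> 1; this doubles the trivial bound 2 * C1.\<close>
  also have "\<dots> \<le> 4 * C1 * ?s powr \<theta>"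
  proof -
    have "1/2 \<le> ?s" using False by (simp add: field_simps)
    then have "(1/2) powr \<theta> \<le> ?s powr \<theta>" using theta by (intro powr_mono2) auto
    moreover have "(1/2) powr 1 \<le> (1/2::real) powr \<theta>" using theta by (intro powr_mono') auto
    ultimately have "1/2 \<le> ?s powr \<theta>" by simp
    then show ?thesis using C1_pos mult_left_mono[of "1/2" "?s powr \<theta>" "4 * C1"] by simp
  qed
  also have "\<dots> \<le> C2 * ?s powr \<theta>"
    using c_pos by (intro mult_right_mono) (auto simp: C2_def)
  finally show ?thesis .
qed (rule piece_modulus_small)

text \<open>The piece of the smaller scale has mean zero and is tested against the modulus of
  continuity of the piece of the larger scale; the ratio of the scales yields the decay.\<close>

lemma piece_orthogonal:
  "(\<integral>x. \<bar>conv (reflect (piece j)) (piece l) x\<bar> \<partial>lborel)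
     \<le> (2 * C1 * C2) * (2 powr (- \<theta> / 2)) ^ (2 * nat \<bar>j - l\<bar>)"
proof -
  have pw: "(2 powr (- \<theta> / 2)) ^ (2 * nat \<bar>j - l\<bar>) = (2 powi \<bar>j - l\<bar>) powr (- \<theta>)"
  proof -
    have "(2 powr (- \<theta> / 2)) ^ (2 * nat \<bar>j - l\<bar>) = 2 powr (- \<theta> * real_of_int \<bar>j - l\<bar>)"
      by (simp add: powr_power[symmetric] powr_realpow[symmetric] powr_powr)
    then show ?thesis by (simp add: powr_real_of_int[symmetric] powr_powr powr_of_int mult.commute flip: powr_real_of_int')
  qed
  have th: "(2::real) powr \<theta> \<le> 2" using theta powr_mono[of \<theta> 1 "2::real"] by simp
  \<comment> \<open>Common end of both cases, with i the smaller and m the larger index. The support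
    of the small piece has radius 2^(i+1), so an extra factor 2^\<theta> \<le> 2 appears, the origin
    of the 2 in \<open>2 * C1 * C2\<close>.\<close>
  have key: "A \<le> (2 * C1 * C2) * (2 powi \<bar>j - l\<bar>) powr (- \<theta>)"
    if "A \<le> C2 * ((2 powi (i + 1)) / 2 powi m) powr \<theta> * B" "0 \<le> B" "B \<le> C1" "m - i = \<bar>j - l\<bar>" for A B i m
  proof -
    have "(2 powi (i + 1)) / 2 powi m = 2 * (1 / 2 powi \<bar>j - l\<bar> :: real)"
      unfolding that(4)[symmetric] by (simp add: power_int_add power_int_diff)
    then have "((2 powi (i + 1)) / 2 powi m) powr \<theta> = 2 powr \<theta> * (2 powi \<bar>j - l\<bar>) powr (- \<theta>)"
      by (simp add: powr_mult powr_divide powr_minus_divide)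
    also have "\<dots> \<le> 2 * (2 powi \<bar>j - l\<bar>) powr (- \<theta>)" using th by (intro mult_right_mono) auto
    finally have "C2 * ((2 powi (i + 1)) / 2 powi m) powr \<theta> * B \<le> C2 * (2 * (2 powi \<bar>j - l\<bar>) powr (- \<theta>)) * C1"
      using that C2_pos C1_pos by (intro mult_mono) auto
    then show ?thesis using that(1) by (simp add: mult_ac)
  qed
  have scale: "C2 * (norm y / 2 powi m) powr \<theta> \<le> C2 * ((2 powi (i + 1)) / 2 powi m) powr \<theta>"
    if "norm y \<le> 2 powi (i + 1)" for y :: 'a and i m
    using that C2_pos theta by (intro mult_left_mono powr_mono2 divide_right_mono) auto
  have ir: "integrable lborel (reflect (piece j))" and il: "integrable lborel (piece l)"
    using bint_piece bint_reflect bint_integrable by blast+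
  note mr = bint_measurable[OF bint_reflect[OF bint_piece], of j]
  have rL: "(\<integral>y. \<bar>reflect (piece j) y\<bar> \<partial>lborel) = (\<integral>y. \<bar>piece j y\<bar> \<partial>lborel)"
    using lborel_integral_reflect[of "\<lambda>y. \<bar>piece j y\<bar>" 0] by (simp add: reflect_def)
  show ?thesis
  proof (cases "j \<le> l")
    case True
    have "conv (reflect (piece j)) (piece l) = conv (piece l) (reflect (piece j))"
      by (rule conv_commute) (auto intro: mr)
    moreover have "(\<integral>x. indicator UNIV x * \<bar>conv (piece l) (reflect (piece j)) x\<bar> \<partial>lborel)
      \<le> C2 * ((2 powi (j + 1)) / 2 powi l) powr \<theta> * (\<integral>y. \<bar>reflect (piece j) y\<bar> \<partial>lborel)"
    proof (rule conv_L1_mean_zero[OF il ir _ piece_le, of UNIV 0])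
      show "(\<integral>y. reflect (piece j) y \<partial>lborel) = 0"
        using lborel_integral_reflect[of "piece j" 0] piece_mean_zero by (simp add: reflect_def)
      fix y assume "reflect (piece j) y \<noteq> 0"
      then have "norm y \<le> 2 powi (j + 1)" by (auto simp: reflect_def piece_def split: if_splits)
      from order_trans[OF piece_modulus scale[OF this]]
      show "(\<integral>x. indicator UNIV x * \<bar>piece l (x - y) - piece l (x - 0)\<bar> \<partial>lborel) \<le> C2 * ((2 powi (j + 1)) / 2 powi l) powr \<theta>"
        by simp
    qed auto
    ultimately show ?thesis unfolding pw using piece_L1[of j] True rL
      by (intro key[of _ j l "\<integral>y. \<bar>piece j y\<bar> \<partial>lborel"]) auto
  next
    case False
    have "(\<integral>x. indicator UNIV x * \<bar>conv (reflect (piece j)) (piece l) x\<bar> \<partial>lborel)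
      \<le> C2 * ((2 powi (l + 1)) / 2 powi j) powr \<theta> * (\<integral>y. \<bar>piece l y\<bar> \<partial>lborel)"
    proof (rule conv_L1_mean_zero[OF ir il piece_mean_zero, where z=0 and S=UNIV])
      show "\<bar>reflect (piece j) x\<bar> \<le> c / (2 powi j) ^ DIM('a)" for x
        using piece_le by (simp add: reflect_def)
      fix y assume "piece l y \<noteq> 0"
      then have y: "norm (- y) \<le> 2 powi (l + 1)" by (auto simp: piece_def split: if_splits)
      have "(\<integral>x. \<bar>piece j (- (x - y)) - piece j (- x)\<bar> \<partial>lborel) = (\<integral>x. \<bar>piece j (x - (- y)) - piece j x\<bar> \<partial>lborel)"
        using lborel_integral_reflect[of "\<lambda>x. \<bar>piece j (x - (- y)) - piece j x\<bar>" 0] by (simp add: add.commute)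
      with order_trans[OF piece_modulus scale[OF y]]
      show "(\<integral>x. indicator UNIV x * \<bar>reflect (piece j) (x - y) - reflect (piece j) (x - 0)\<bar> \<partial>lborel) \<le> C2 * ((2 powi (l + 1)) / 2 powi j) powr \<theta>"
        by (simp add: reflect_def)
    qed auto
    then show ?thesis unfolding pw using piece_L1[of l] False
      by (intro key[of _ l j "\<integral>y. \<bar>piece l y\<bar> \<partial>lborel"]) auto
  qed
qed

definition BL :: real where "BL = sqrt (2 * C1 * C2) * (4 / (1 - 2 powr (- \<theta> / 2)))"

lemma two_powr_theta: "0 < 2 powr (- \<theta> / 2)" "2 powr (- \<theta> / 2) < (1::real)"
  using theta powr_less_mono[of "- \<theta> / 2" 0 "2::real"] by auto

theorem kern_L2_bound: "a \<le> b \<Longrightarrow> L2_bound (kern a b) BL"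
  unfolding kern_sum BL_def
  using two_powr_theta C1_pos C2_pos bint_piece piece_orthogonal by (intro cotlar_L2_bound) auto

definition CH :: real where "CH = C2 / (1 - 2 powr (- \<theta>))"

lemma two_powr_theta': "0 < 2 powr (- \<theta>)" "2 powr (- \<theta>) < (1::real)"
  using theta powr_less_mono[of "- \<theta>" 0 "2::real"] by auto

lemma CH_pos: "CH > 0"
  using C2_pos two_powr_theta' unfolding CH_def by (intro divide_pos_pos) auto

lemma sum_scales_le:
  fixes t :: real
  assumes "t > 0"
  shows "(\<Sum>j\<in>{j\<in>{a..<b}. t \<le> 2 powi j}. (t / 2 powi j) powr \<theta>) \<le> 1 / (1 - 2 powr (- \<theta>))"
proof -
  define j0 where "j0 = \<lceil>log 2 t\<rceil>"
  have iff: "t \<le> 2 powi j \<longleftrightarrow> j0 \<le> j" for j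
  proof -
    have "t \<le> 2 powi j \<longleftrightarrow> t \<le> 2 powr (of_int j)" by (simp add: powr_real_of_int')
    also have "\<dots> \<longleftrightarrow> log 2 t \<le> of_int j" using assms by (simp add: log_le_iff)
    finally show ?thesis by (simp add: j0_def ceiling_le_iff)
  qed
  let ?q = "2 powr (- \<theta>)" and ?J = "{j\<in>{a..<b}. t \<le> 2 powi j}"
  have fin: "finite ?J" by (rule finite_subset[of _ "{a..<b}"]) auto
  have "(\<Sum>j\<in>?J. (t / 2 powi j) powr \<theta>) \<le> (\<Sum>j\<in>?J. ?q ^ nat (j - j0))"
  proof (rule sum_mono)
    fix j assume "j \<in> ?J"
    then have j: "j0 \<le> j" using iff by auto
    have "t / 2 powi j \<le> 2 powi j0 / 2 powi j" using iff[of j0] by (intro divide_right_mono) auto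
    also have "\<dots> = 2 powr (- of_int (j - j0))"
      by (simp add: powr_real_of_int'[symmetric] powr_diff[symmetric])
    finally have "(t / 2 powi j) powr \<theta> \<le> (2 powr (- of_int (j - j0))) powr \<theta>"
      using assms theta by (intro powr_mono2) auto
    also have "\<dots> = ?q powr (real (nat (j - j0)))" using j by (simp add: powr_powr algebra_simps)
    also have "\<dots> = ?q ^ nat (j - j0)" by (rule powr_realpow) simp
    finally show "(t / 2 powi j) powr \<theta> \<le> ?q ^ nat (j - j0)" .
  qed
  also have "\<dots> = (\<Sum>i\<in>(\<lambda>j. nat (j - j0)) ` ?J. ?q ^ i)"
    using iff by (subst sum.reindex) (auto simp: inj_on_def eq_nat_nat_iff)
  also have "\<dots> \<le> (\<Sum>i. ?q ^ i)"
    using two_powr_theta' fin by (intro sum_le_suminf finite_imageI) (auto simp: summable_geometric)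
  also have "\<dots> = 1 / (1 - ?q)" using two_powr_theta' by (subst suminf_geometric) auto
  finally show ?thesis .
qed

text \<open>A piece whose scale 2^j is below |y| has outer radius less than 2|y| and vanishes at x
  and at x - y, both of norm at least 3|y|. The moduli of the remaining pieces form a geometric
  series that starts at size about 1, so the bound is independent of a and b.\<close>

lemma kern_hoermander:
  "(\<integral>x. indicator {x. 4 * norm y \<le> norm x} x * \<bar>kern a b (x - y) - kern a b x\<bar> \<partial>lborel) \<le> CH"
proof (cases "a \<le> b \<and> y \<noteq> 0")
  case True
  then have ab: "a \<le> b" and y: "norm y > 0" by auto
  let ?J = "{j\<in>{a..<b}. norm y \<le> 2 powi j}" and ?S = "{x::'a. 4 * norm y \<le> norm x}"
  have i: "integrable lborel (\<lambda>x. \<bar>piece j (x - y) - piece j x\<bar>)" for j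
    using piece_integrable by auto
  have ik: "integrable lborel (\<lambda>x. \<bar>kern a b (x - y) - kern a b x\<bar>)"
    using kern_integrable by auto
  have z: "piece j (x - y) - piece j x = 0" if "4 * norm y \<le> norm x" "2 powi j < norm y" for x j
  proof -
    have "norm x \<le> norm (x - y) + norm y" using norm_triangle_ineq[of "x - y" y] by simp
    moreover have "2 powi (j + 1) = 2 * (2 powi j :: real)" by (simp add: power_int_add)
    ultimately have "\<not> norm (x - y) \<le> 2 powi (j + 1)" "\<not> norm x \<le> 2 powi (j + 1)"
      using that y by linarith+
    then show ?thesis by (simp add: piece_def)
  qed
  have "(\<integral>x. indicator ?S x * \<bar>kern a b (x - y) - kern a b x\<bar> \<partial>lborel) \<le> (\<integral>x. (\<Sum>j\<in>?J. \<bar>piece j (x - y) - piece j x\<bar>) \<partial>lborel)"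
  proof (rule integral_mono)
    show "integrable lborel (\<lambda>x. indicator ?S x * \<bar>kern a b (x - y) - kern a b x\<bar>)"
      by (rule integrable_mult_bounded[OF ik, of _ 1]) (auto simp: indicator_def)
    show "integrable lborel (\<lambda>x. \<Sum>j\<in>?J. \<bar>piece j (x - y) - piece j x\<bar>)" using i by auto
    fix x
    show "indicator ?S x * \<bar>kern a b (x - y) - kern a b x\<bar> \<le> (\<Sum>j\<in>?J. \<bar>piece j (x - y) - piece j x\<bar>)"
    proof (cases "x \<in> ?S")
      case True
      have "kern a b (x - y) - kern a b x = (\<Sum>j\<in>{a..<b}. piece j (x - y) - piece j x)"
        by (simp add: kern_sum[OF ab] sum_subtractf)
      also have "\<dots> = (\<Sum>j\<in>?J. piece j (x - y) - piece j x)"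
        using True by (intro sum.mono_neutral_right ballI z) auto
      finally show ?thesis using True by simp
    qed (simp add: sum_nonneg)
  qed
  also have "\<dots> = (\<Sum>j\<in>?J. \<integral>x. \<bar>piece j (x - y) - piece j x\<bar> \<partial>lborel)" using i by simp
  also have "\<dots> \<le> (\<Sum>j\<in>?J. C2 * (norm y / 2 powi j) powr \<theta>)" by (intro sum_mono piece_modulus)
  also have "\<dots> \<le> C2 * (1 / (1 - 2 powr (- \<theta>)))"
    unfolding sum_distrib_left[symmetric] using sum_scales_le[OF y, of a b] C2_pos by (intro mult_left_mono) auto
  finally show ?thesis by (simp add: CH_def)
next
  case False
  have "kern a b x = 0" if "\<not> a \<le> b" for x
  proof -
    have "(2::real) powi b \<le> 2 powi a" using that by (intro power_int_increasing) auto
    then show ?thesis by (auto simp: kern_def)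
  qed
  then have "kern a b (x - y) - kern a b x = 0" for x using False by auto
  then show ?thesis using CH_pos by simp
qed

end

section \<open>Stopping cubes and the weak type estimate\<close>

definition dint :: "'a::euclidean_space set \<Rightarrow> ('a \<Rightarrow> real) \<Rightarrow> real" where
  "dint A f = (\<integral>y. indicator A y * f y \<partial>lborel)"

lemma integrable_indicator_mult:
  fixes f :: "'a \<Rightarrow> real"
  assumes "integrable M f" "A \<in> sets M"
  shows "integrable M (\<lambda>y. indicator A y * f y)"
  using integrable_mult_bounded[OF assms(1), of "indicator A" 1] assms(2)
  by (simp add: indicator_def)

lemma dint_mono:
  assumes "integrable lborel f" "A \<subseteq> B" "A \<in> sets borel" "B \<in> sets borel"
  shows "dint A (\<lambda>y. \<bar>f y\<bar>) \<le> dint B (\<lambda>y. \<bar>f y\<bar>)"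
  unfolding dint_def
proof (rule integral_mono)
  have "integrable lborel (\<lambda>y. \<bar>f y\<bar>)" using assms(1) by auto
  then show "integrable lborel (\<lambda>y. indicator A y * \<bar>f y\<bar>)" "integrable lborel (\<lambda>y. indicator B y * \<bar>f y\<bar>)"
    using assms(3,4) by (auto intro: integrable_indicator_mult)
qed (use assms(2) in \<open>auto simp: indicator_def\<close>)

lemma dint_le: "integrable lborel f \<Longrightarrow> A \<in> sets borel \<Longrightarrow> dint A (\<lambda>y. \<bar>f y\<bar>) \<le> (\<integral>y. \<bar>f y\<bar> \<partial>lborel)"
  using dint_mono[of f A UNIV] by (simp add: dint_def)

lemma dint_nonneg: "dint A (\<lambda>y. \<bar>f y\<bar>) \<ge> 0"
  by (simp add: dint_def)

lemma dint_abs_le: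
  assumes "integrable lborel f" "A \<in> sets borel"
  shows "\<bar>dint A f\<bar> \<le> dint A (\<lambda>y. \<bar>f y\<bar>)"
  using integral_abs_bound[of lborel "\<lambda>y. indicator A y * f y"] by (simp add: dint_def abs_mult)

lemma sum_dint_disjoint_le:
  assumes f: "integrable lborel f" and \<P>: "finite \<P>" "disjoint \<P>" "\<P> \<subseteq> sets borel"
  shows "(\<Sum>P\<in>\<P>. dint P (\<lambda>y. \<bar>f y\<bar>)) \<le> (\<integral>y. \<bar>f y\<bar> \<partial>lborel)"
proof -
  have i: "integrable lborel (\<lambda>y. indicator P y * \<bar>f y\<bar>)" if "P \<in> \<P>" for P
    using that f \<P>(3) by (intro integrable_indicator_mult) auto
  have "(\<Sum>P\<in>\<P>. dint P (\<lambda>y. \<bar>f y\<bar>)) = (\<integral>y. (\<Sum>P\<in>\<P>. indicator P y * \<bar>f y\<bar>) \<partial>lborel)"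
    unfolding dint_def using i by (simp add: Bochner_Integration.integral_sum)
  also have "\<dots> \<le> (\<integral>y. \<bar>f y\<bar> \<partial>lborel)"
  proof (rule integral_mono)
    show "integrable lborel (\<lambda>y. \<Sum>P\<in>\<P>. indicator P y * \<bar>f y\<bar>)" using i by auto
    show "integrable lborel (\<lambda>y. \<bar>f y\<bar>)" using f by auto
    fix y
    show "(\<Sum>P\<in>\<P>. indicator P y * \<bar>f y\<bar>) \<le> \<bar>f y\<bar>"
    proof (cases "\<exists>P\<in>\<P>. y \<in> P")
      case True
      then obtain P where P: "P \<in> \<P>" "y \<in> P" by blast
      have "y \<notin> P'" if "P' \<in> \<P> - {P}" for P' using \<P>(2) P that unfolding disjoint_def by blast
      then have "(\<Sum>P\<in>\<P> - {P}. indicator P y * \<bar>f y\<bar>) = 0" by (intro sum.neutral) auto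
      then show ?thesis using sum.remove[OF \<P>(1) P(1), of "\<lambda>P. indicator P y * \<bar>f y\<bar>"] P(2) by simp
    next
      case False
      then have "(\<Sum>P\<in>\<P>. indicator P y * \<bar>f y\<bar>) = 0" by (intro sum.neutral) auto
      then show ?thesis by simp
    qed
  qed
  finally show ?thesis .
qed

lemma measure_dcube: "measure lborel (dcube k x) = side k ^ DIM('a)" for x :: "'a::euclidean_space"
  using side_pos[of k] by (simp add: measure_def emeasure_dcube)

text \<open>Badness is a property of the cube, although it is stated for a point of it.\<close>

definition dyadic_pred :: "(int \<Rightarrow> 'a::euclidean_space \<Rightarrow> bool) \<Rightarrow> bool" where
  "dyadic_pred bad \<longleftrightarrow> (\<forall>k x y. y \<in> dcube k x \<longrightarrow> bad k y = bad k x)"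

text \<open>The first bad level from k0 on, or N if none occurs before. The cap makes the level
  exist for every point, so the stopping cubes partition the whole space; in return a stopping cube
  of level N need not be bad, and each application has to dispose of such cubes.\<close>

definition stop_level :: "(int \<Rightarrow> 'a \<Rightarrow> bool) \<Rightarrow> int \<Rightarrow> int \<Rightarrow> 'a \<Rightarrow> int" where
  "stop_level bad k0 N x = k0 + int (LEAST m. bad (k0 + int m) x \<or> N \<le> k0 + int m)"

definition stop_cube :: "(int \<Rightarrow> 'a \<Rightarrow> bool) \<Rightarrow> int \<Rightarrow> int \<Rightarrow> 'a::euclidean_space \<Rightarrow> 'a set" where
  "stop_cube bad k0 N x = dcube (stop_level bad k0 N x) x"

lemma stop_level:
  assumes "k0 \<le> N"
  shows "k0 \<le> stop_level bad k0 N x" "stop_level bad k0 N x \<le> N"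
    "bad (stop_level bad k0 N x) x \<or> stop_level bad k0 N x = N"
    "k0 \<le> k \<Longrightarrow> k < stop_level bad k0 N x \<Longrightarrow> \<not> bad k x"
proof -
  let ?P = "\<lambda>m. bad (k0 + int m) x \<or> N \<le> k0 + int m"
  have N: "?P (nat (N - k0))" using assms by auto
  show "k0 \<le> stop_level bad k0 N x" by (simp add: stop_level_def)
  show le: "stop_level bad k0 N x \<le> N"
    using Least_le[of ?P, OF N] assms by (simp add: stop_level_def)
  show "bad (stop_level bad k0 N x) x \<or> stop_level bad k0 N x = N"
    using LeastI[of ?P, OF N] le by (auto simp: stop_level_def)
  show "\<not> bad k x" if "k0 \<le> k" "k < stop_level bad k0 N x"
    using not_less_Least[of "nat (k - k0)" ?P] that by (auto simp: stop_level_def nat_less_iff)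
qed

text \<open>Two points of one stopping cube share all their cubes down to that level, so the search
  for the first bad level runs identically for both.\<close>

lemma stop_level_cong:
  assumes bad: "dyadic_pred bad"
    and le: "k0 \<le> N" and y: "y \<in> stop_cube bad k0 N x"
  shows "stop_level bad k0 N y = stop_level bad k0 N x"
proof -
  let ?P = "\<lambda>x m. bad (k0 + int m) x \<or> N \<le> k0 + int m"
  let ?a = "LEAST m. ?P x m"
  have N: "?P x (nat (N - k0))" using le by auto
  have eq: "?P y m = ?P x m" if "m \<le> ?a" for m
  proof -
    have "k0 + int m \<le> stop_level bad k0 N x" using that by (simp add: stop_level_def)
    then have "y \<in> dcube (k0 + int m) x" using y dcube_mono unfolding stop_cube_def by blast
    then have "bad (k0 + int m) y = bad (k0 + int m) x" using bad unfolding dyadic_pred_def by blast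
    then show ?thesis by simp
  qed
  have "(LEAST m. ?P y m) = ?a"
  proof (rule Least_equality)
    show "?P y ?a" using eq[of ?a] LeastI[of "?P x", OF N] by simp
    fix m assume m: "?P y m"
    show "?a \<le> m"
    proof (rule ccontr)
      assume "\<not> ?a \<le> m"
      then show False using eq[of m] m not_less_Least[of m "?P x"] by simp
    qed
  qed
  then show ?thesis by (simp add: stop_level_def)
qed

lemma stop_cube_self: "x \<in> stop_cube bad k0 N x"
  by (simp add: stop_cube_def dblock_self)

lemma stop_cube_cong:
  assumes bad: "dyadic_pred bad"
    and le: "k0 \<le> N" and y: "y \<in> stop_cube bad k0 N x"
  shows "stop_cube bad k0 N y = stop_cube bad k0 N x"
  using stop_level_cong[OF bad le y] y dblock_cong[of y _ x 0] by (simp add: stop_cube_def)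

lemma stop_cube_iff:
  assumes "dyadic_pred bad" "k0 \<le> N"
  shows "y \<in> stop_cube bad k0 N x \<longleftrightarrow> stop_cube bad k0 N y = stop_cube bad k0 N x"
  using stop_cube_cong[OF assms, of y x] stop_cube_self[of y bad k0 N] by auto

lemma stop_cubes_disjoint:
  assumes "dyadic_pred bad" "k0 \<le> N"
  shows "disjoint (stop_cube bad k0 N ` S)"
proof (rule disjointI)
  fix A B assume "A \<in> stop_cube bad k0 N ` S" "B \<in> stop_cube bad k0 N ` S" "A \<noteq> B"
  then obtain x y where xy: "A = stop_cube bad k0 N x" "B = stop_cube bad k0 N y" "A \<noteq> B" by blast
  have "z \<notin> B" if "z \<in> A" for z
    using that xy stop_cube_cong[OF assms, of z x] stop_cube_cong[OF assms, of z y] by auto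
  then show "A \<inter> B = {}" by blast
qed

lemma stop_cubes_finite:
  fixes S :: "'a::euclidean_space set"
  assumes "k0 \<le> N" "bounded S"
  shows "finite (stop_cube bad k0 N ` S)"
proof (rule finite_subset)
  show "stop_cube bad k0 N ` S \<subseteq> (\<Union>k\<in>{k0..N}. dcube k ` S)"
    using stop_level(1,2)[OF assms(1)] by (fastforce simp: stop_cube_def)
  show "finite (\<Union>k\<in>{k0..N}. dcube k ` S)" using dcubes_finite[OF assms(2)] by auto
qed

lemma stop_cube_sets: "stop_cube bad k0 N x \<in> sets borel"
  by (simp add: stop_cube_def)

lemma exists_large_side:
  shows "\<exists>k\<le>N. M \<le> side k ^ DIM('a::euclidean_space)"
proof -
  obtain m :: nat where m: "M \<le> 2 ^ m" using real_arch_pow[of 2 M] by (auto intro: less_imp_le)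
  define k where "k = min N (- int m)"
  have "2 ^ m \<le> side k" using side_le[of k "- int m"] by (simp add: k_def side_def)
  then have "side k \<ge> 1" "M \<le> side k" using m one_le_power[of "2::real" m] by linarith+
  moreover have "side k \<le> side k ^ DIM('a)" using \<open>side k \<ge> 1\<close> by (intro self_le_power) auto
  ultimately show ?thesis by (intro exI[of _ k]) (auto simp: k_def)
qed

lemma exists_small_side:
  assumes "\<delta> > 0" shows "\<exists>k\<ge>N. C * side k < \<delta>"
proof -
  obtain m :: nat where m: "\<bar>C\<bar> * (1/2) ^ m < \<delta>"
  proof (cases "C = 0")
    case False
    obtain m where "(1/2::real) ^ m < \<delta> / \<bar>C\<bar>"
      using real_arch_pow_inv[of "\<delta> / \<bar>C\<bar>" "1/2"] assms False by auto
    then show ?thesis using that[of m] False by (simp add: field_simps)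
  qed (use assms that[of 0] in simp)
  define k where "k = max N (int m)"
  have "side k \<le> (1/2) ^ m"
  proof -
    have "side (int m) = (1/2) ^ m" by (simp add: side_def power_int_minus power_one_over inverse_eq_divide)
    then show ?thesis using side_le[of "int m" k] by (simp add: k_def)
  qed
  then have "\<bar>C\<bar> * side k < \<delta>" using mult_left_mono[of "side k" "(1/2) ^ m" "\<bar>C\<bar>"] m by simp
  moreover have "C * side k \<le> \<bar>C\<bar> * side k" using side_pos[of k] by (intro mult_right_mono) auto
  ultimately have "C * side k < \<delta>" by linarith
  then show ?thesis by (intro exI[of _ k]) (auto simp: k_def)
qed

lemma Markov_abs:
  fixes g :: "'a::euclidean_space \<Rightarrow> real"
  assumes "integrable lborel g" "t > 0" "(\<integral>x. \<bar>g x\<bar> \<partial>lborel) \<le> A"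
  shows "emeasure lborel {x. t \<le> \<bar>g x\<bar>} \<le> ennreal (A / t)"
proof -
  have "emeasure lborel {x \<in> space lborel. t \<le> \<bar>g x\<bar>} \<le> (1 / t) * (\<integral>x. \<bar>g x\<bar> \<partial>lborel)"
    using assms by (intro integral_Markov_inequality) auto
  also have "\<dots> \<le> ennreal (A / t)" using assms by (intro ennreal_leI) (simp add: divide_right_mono)
  finally show ?thesis by simp
qed

lemma conv_add_right:
  assumes k: "k \<in> borel_measurable borel" "\<And>x. \<bar>k x\<bar> \<le> B" and u: "integrable lborel u" "integrable lborel v"
  shows "conv k (\<lambda>y. u y + v y) x = conv k u x + conv k v x"
  using conv_bound(2)[OF k u(1), of x] conv_bound(2)[OF k u(2), of x]
  by (simp add: conv_def distrib_left)

lemma conv_sum_right_integrable: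
  assumes k: "k \<in> borel_measurable borel" "\<And>x. \<bar>k x\<bar> \<le> B" and u: "\<And>i. i \<in> I \<Longrightarrow> integrable lborel (u i)"
  shows "conv k (\<lambda>y. \<Sum>i\<in>I. u i y) x = (\<Sum>i\<in>I. conv k (u i) x)"
  using conv_bound(2)[OF k u, of _ x]
  by (simp add: conv_def sum_distrib_left Bochner_Integration.integral_sum)

context cz begin

text \<open>The three summands come from the good part (Chebyshev in L^2 at height l / 2), from the
  exceptional balls around the bad cells, and from the bad part outside these balls.\<close>

definition CW :: real where
  "CW = 4 * BL\<^sup>2 * 2 ^ DIM('a) + unit_ball_vol DIM('a) * (4 * DIM('a)) ^ DIM('a) + 4 * CH"

lemma CW_pos: "CW > 0"
  using CH_pos unfolding CW_def by (intro add_nonneg_pos add_nonneg_nonneg mult_nonneg_nonneg) auto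

text \<open>Averages and mean zero parts are taken on all stopping cells, but only bad cells enter
  the exceptional set. The other cells have the finest level N, so small in comparison with the
  inner radius 2^a of the kernel that near such a cell its mean zero part does not contribute to the
  convolution.\<close>

theorem kern_weak_type:
  fixes f :: "'a \<Rightarrow> real"
  assumes f: "integrable lborel f" and supp: "\<And>y. f y \<noteq> 0 \<Longrightarrow> norm y \<le> R"
    and l: "l > 0" and ab: "a \<le> b"
  shows "emeasure lborel {x. l \<le> \<bar>conv (kern a b) f x\<bar>} \<le> ennreal (CW / l * (\<integral>y. \<bar>f y\<bar> \<partial>lborel))"
proof -
  let ?n = "DIM('a)" and ?T = "conv (kern a b)" and ?af = "\<lambda>y. \<bar>f y\<bar>"
  define F where "F = (\<integral>y. \<bar>f y\<bar> \<partial>lborel)"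
  have F0: "F \<ge> 0" by (simp add: F_def)
  have [measurable]: "f \<in> borel_measurable borel" using f by auto
  \<comment> \<open>Points within 4 n side N of the reference point of a cell are within 5 n side N
    of every point of it, hence inside the hole of the kernel.\<close>
  obtain N where N: "5 * ?n * side N < 2 powi a" using exists_small_side[of "2 powi a" 0 "5 * ?n"] by auto
  \<comment> \<open>The starting cubes are so large that the total mass of f already has average at
    most l on them.\<close>
  obtain k0 where k0: "k0 \<le> N" "F / l \<le> side k0 ^ ?n"
    using exists_large_side[where M="F / l" and N=N and 'a='a] by auto
  define bad where "bad k x \<longleftrightarrow> l * side k ^ ?n < dint (dcube k x) ?af" for k and x :: 'a
  have bc: "dyadic_pred bad"
    unfolding dyadic_pred_def
  proof (intro allI impI)
    fix k x y assume "y \<in> dcube k (x::'a)"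
    then show "bad k y = bad k x" using dblock_cong[of y k x 0] by (simp add: bad_def)
  qed
  let ?lev = "stop_level bad k0 N" and ?cell = "stop_cube bad k0 N"
  define \<P> where "\<P> = ?cell ` cball 0 R"
  have finP: "finite \<P>" unfolding \<P>_def by (intro stop_cubes_finite k0) auto
  have disP: "disjoint \<P>" unfolding \<P>_def by (rule stop_cubes_disjoint[OF bc k0(1)])
  have setP: "\<P> \<subseteq> sets borel" unfolding \<P>_def using stop_cube_sets by auto
  have memP: "y \<in> P \<longleftrightarrow> P = ?cell y" if "P \<in> \<P>" for P y
    using that stop_cube_iff[OF bc k0(1), where y=y] unfolding \<P>_def by auto
  have sumP: "(\<Sum>P\<in>\<P>. indicator P y * G P) = (if ?cell y \<in> \<P> then G (?cell y) else 0)"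
    for y and G :: "'a set \<Rightarrow> real"
  proof -
    have "(\<Sum>P\<in>\<P>. indicator P y * G P) = (\<Sum>P\<in>\<P>. if P = ?cell y then G P else 0)"
      using memP by (intro sum.cong) (auto simp: indicator_def)
    then show ?thesis using finP by (simp add: sum.delta')
  qed
  have mP: "measure lborel (?cell x) = side (?lev x) ^ ?n" for x by (simp add: stop_cube_def measure_dcube)
  \<comment> \<open>The parent of a cell was not stopped, so its average is at most l, and the
    passage to the cell costs 2^n; at the top level the choice of k0 gives the bound
    directly.\<close>
  have avg: "dint (?cell x) ?af \<le> l * 2 ^ ?n * side (?lev x) ^ ?n" for x
  proof (cases "?lev x = k0")
    case True
    have "dint (?cell x) ?af \<le> F" unfolding F_def by (rule dint_le[OF f stop_cube_sets])
    also have "\<dots> \<le> l * side k0 ^ ?n" using k0(2) l by (simp add: field_simps)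
    also have "\<dots> \<le> l * 2 ^ ?n * side (?lev x) ^ ?n"
      using l side_pos[of k0] True one_le_power[of "2::real" ?n] by (simp add: mult_left_mono)
    finally show ?thesis .
  next
    case False
    then have "k0 \<le> ?lev x - 1" using stop_level(1)[OF k0(1), of bad x] by linarith
    then have nb: "\<not> bad (?lev x - 1) x" by (intro stop_level(4)[OF k0(1)]) auto
    have "dint (?cell x) ?af \<le> dint (dcube (?lev x - 1) x) ?af"
      unfolding stop_cube_def by (intro dint_mono f dcube_mono) auto
    also have "\<dots> \<le> l * side (?lev x - 1) ^ ?n" using nb by (simp add: bad_def)
    finally show ?thesis by (simp add: side_Suc(2) power_mult_distrib)
  qed
  define A where "A P = dint P f / measure lborel P" for P
  have Ale: "\<bar>A P\<bar> * measure lborel P \<le> dint P ?af" "\<bar>A P\<bar> \<le> 2 ^ ?n * l" if P: "P \<in> \<P>" for P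
  proof -
    obtain x where x: "P = ?cell x" using P by (auto simp: \<P>_def)
    have p: "measure lborel P > 0" using side_pos by (simp add: x mP)
    have "\<bar>A P\<bar> = \<bar>dint P f\<bar> / measure lborel P" by (simp add: A_def)
    also have "\<dots> \<le> dint P ?af / measure lborel P"
      using dint_abs_le[OF f, of P] p x stop_cube_sets by (intro divide_right_mono) auto
    finally have le: "\<bar>A P\<bar> \<le> dint P ?af / measure lborel P" .
    then show "\<bar>A P\<bar> * measure lborel P \<le> dint P ?af" using p by (simp add: field_simps)
    have "dint P ?af / measure lborel P \<le> 2 ^ ?n * l"
      using avg[of x] p by (simp add: x mP field_simps)
    then show "\<bar>A P\<bar> \<le> 2 ^ ?n * l" using le by linarith
  qed
  define g where "g y = (\<Sum>P\<in>\<P>. indicator P y * A P)" for y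
  define b' where "b' P y = indicator P y * (f y - A P)" for P y
  have iP: "integrable lborel (indicator P :: 'a \<Rightarrow> real)" if P: "P \<in> \<P>" for P
  proof -
    obtain x where x: "P = ?cell x" using P by (auto simp: \<P>_def)
    show ?thesis using stop_cube_sets by (intro integrable_real_indicator) (auto simp: x stop_cube_def emeasure_dcube)
  qed
  have iAP: "integrable lborel (\<lambda>y. indicator P y * A P)" if "P \<in> \<P>" for P using iP[OF that] by auto
  have iPf: "integrable lborel (\<lambda>y. indicator P y * f y)" if "P \<in> \<P>" for P
    using that setP by (intro integrable_indicator_mult f) auto
  have ib: "integrable lborel (b' P)" if "P \<in> \<P>" for P
    unfolding b'_def[abs_def] using iPf[OF that] iAP[OF that] by (simp add: right_diff_distrib)
  have gle: "\<bar>g y\<bar> \<le> 2 ^ ?n * l" for y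
    unfolding g_def sumP using Ale(2) l by auto
  have ig: "integrable lborel g" unfolding g_def[abs_def] using iAP by auto
  have bg: "bint g" unfolding bint_def using ig gle by blast
  have fdec: "f y = g y + (\<Sum>P\<in>\<P>. b' P y)" for y
  proof -
    have "g y + (\<Sum>P\<in>\<P>. b' P y) = (\<Sum>P\<in>\<P>. indicator P y * f y)"
      unfolding g_def b'_def sum.distrib[symmetric] by (intro sum.cong) (auto simp: algebra_simps)
    also have "\<dots> = (if ?cell y \<in> \<P> then f y else 0)" by (rule sumP)
    also have "\<dots> = f y" using supp[of y] by (auto simp: \<P>_def)
    finally show ?thesis by simp
  qed
  have g1: "(\<integral>y. \<bar>g y\<bar> \<partial>lborel) \<le> F"
  proof -
    have "(\<integral>y. \<bar>g y\<bar> \<partial>lborel) \<le> (\<integral>y. (\<Sum>P\<in>\<P>. indicator P y * \<bar>A P\<bar>) \<partial>lborel)"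
      using ig iP unfolding g_def[abs_def]
      by (intro integral_mono) (auto intro!: order_trans[OF sum_abs] sum_mono simp: abs_mult)
    also have "\<dots> = (\<Sum>P\<in>\<P>. \<bar>A P\<bar> * measure lborel P)"
      using iP setP by (subst Bochner_Integration.integral_sum) (auto simp: mult.commute)
    also have "\<dots> \<le> (\<Sum>P\<in>\<P>. dint P ?af)" using Ale(1) by (intro sum_mono)
    also have "\<dots> \<le> F" unfolding F_def by (rule sum_dint_disjoint_le[OF f finP disP setP])
    finally show ?thesis .
  qed
  have good: "emeasure lborel {x. l / 2 \<le> \<bar>?T g x\<bar>} \<le> ennreal (4 * BL\<^sup>2 * 2 ^ ?n / l * F)"
  proof -
    have "ip g g \<le> (\<integral>y. 2 ^ ?n * l * \<bar>g y\<bar> \<partial>lborel)"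
      unfolding ip_def
    proof (rule integral_mono)
      show "integrable lborel (\<lambda>x. g x * g x)" using bint_integrable[OF bint_mult[OF bg bg]] .
      show "integrable lborel (\<lambda>y. 2 ^ ?n * l * \<bar>g y\<bar>)" using ig by auto
      show "g y * g y \<le> 2 ^ ?n * l * \<bar>g y\<bar>" for y
        using mult_right_mono[OF gle[of y], of "\<bar>g y\<bar>"] by (simp add: abs_mult[symmetric])
    qed
    also have "\<dots> \<le> 2 ^ ?n * l * F" using g1 l by (simp add: mult_left_mono)
    finally have gg: "ip g g \<le> 2 ^ ?n * l * F" .
    have bT: "bint (?T g)" by (intro bint_conv bint_kern bg)
    have "ip (?T g) (?T g) \<le> BL\<^sup>2 * ip g g" by (rule L2_boundD[OF kern_L2_bound[OF ab] bg])
    also have "\<dots> \<le> BL\<^sup>2 * (2 ^ ?n * l * F)" using gg by (intro mult_left_mono) auto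
    finally have "(\<integral>x. \<bar>?T g x * ?T g x\<bar> \<partial>lborel) \<le> BL\<^sup>2 * (2 ^ ?n * l * F)" by (simp add: ip_def abs_mult_self_eq)
    from Markov_abs[OF bint_integrable[OF bint_mult[OF bT bT]] _ this, of "(l / 2)\<^sup>2"] l
    have "emeasure lborel {x. (l / 2)\<^sup>2 \<le> \<bar>?T g x * ?T g x\<bar>} \<le> ennreal (BL\<^sup>2 * (2 ^ ?n * l * F) / (l / 2)\<^sup>2)" by simp
    moreover have "(l / 2)\<^sup>2 \<le> \<bar>?T g x * ?T g x\<bar> \<longleftrightarrow> l / 2 \<le> \<bar>?T g x\<bar>" for x
      using l abs_le_square_iff[of "l / 2" "?T g x"] by (simp add: power2_eq_square)
    moreover have "BL\<^sup>2 * (2 ^ ?n * l * F) / (l / 2)\<^sup>2 = 4 * BL\<^sup>2 * 2 ^ ?n / l * F"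
      using l by (simp add: power2_eq_square)
    ultimately show ?thesis by simp
  qed
  have "\<exists>z. P = ?cell z" if "P \<in> \<P>" for P using that by (auto simp: \<P>_def)
  then obtain z where z: "\<And>P. P \<in> \<P> \<Longrightarrow> P = ?cell (z P)" by metis
  define r where "r P = side (?lev (z P))" for P
  have rpos: "r P > 0" for P by (simp add: r_def side_pos)
  define S where "S P = {x. 4 * (?n * r P) \<le> norm (x - z P)}" for P
  have S[measurable]: "S P \<in> sets borel" for P unfolding S_def by measurable
  define \<Omega> where "\<Omega> = (\<Union>P\<in>{P\<in>\<P>. bad (?lev (z P)) (z P)}. ball (z P) (4 * (?n * r P)))"
  have dist: "norm (y - z P) \<le> ?n * r P" if "P \<in> \<P>" "y \<in> P" for P y
    using dblock_dist[of y 0 "?lev (z P)" "z P"] that z[OF that(1)]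
    by (simp add: stop_cube_def r_def norm_minus_commute)
  have bbad: "(\<integral>x. indicator (S P) x * \<bar>?T (b' P) x\<bar> \<partial>lborel) \<le> CH * (2 * dint P ?af)" if P: "P \<in> \<P>" for P
  proof -
    have "(\<integral>x. indicator (S P) x * \<bar>?T (b' P) x\<bar> \<partial>lborel) \<le> CH * (\<integral>y. \<bar>b' P y\<bar> \<partial>lborel)"
    proof (rule conv_L1_mean_zero[OF kern_integrable(1) ib[OF P] _ kern_le S, where z="z P"])
      have "measure lborel P \<noteq> 0" using z[OF P] mP[of "z P"] side_pos[of "?lev (z P)"] by simp
      moreover have "(\<integral>y. b' P y \<partial>lborel) = dint P f - A P * measure lborel P"
        unfolding b'_def right_diff_distrib using iPf[OF P] iAP[OF P] iP[OF P] P setP by (auto simp: dint_def)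
      ultimately show "(\<integral>y. b' P y \<partial>lborel) = 0" by (simp add: A_def)
      fix y assume "b' P y \<noteq> 0"
      then have y: "norm (y - z P) \<le> ?n * r P" using dist[OF P] by (auto simp: b'_def indicator_def split: if_splits)
      let ?h = "\<lambda>x. indicator {x. 4 * (?n * r P) \<le> norm x} x * \<bar>kern a b (x - (y - z P)) - kern a b x\<bar>"
      have m: "?h \<in> borel_measurable borel" by measurable
      have "(\<integral>x. indicator (S P) x * \<bar>kern a b (x - y) - kern a b (x - z P)\<bar> \<partial>lborel) = (\<integral>x. ?h (x - z P) \<partial>lborel)"
        by (intro Bochner_Integration.integral_cong) (auto simp: S_def indicator_def)
      also have "\<dots> = (\<integral>x. ?h x \<partial>lborel)" by (rule lborel_integral_translate[OF m])
      also have "\<dots> \<le> (\<integral>x. indicator {x. 4 * norm (y - z P) \<le> norm x} x * \<bar>kern a b (x - (y - z P)) - kern a b x\<bar> \<partial>lborel)"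
        using kern_integrable y
        by (intro integral_mono integrable_indicator_mult) (auto simp: indicator_def)
      also have "\<dots> \<le> CH" by (rule kern_hoermander)
      finally show "(\<integral>x. indicator (S P) x * \<bar>kern a b (x - y) - kern a b (x - z P)\<bar> \<partial>lborel) \<le> CH" .
    qed
    also have "(\<integral>y. \<bar>b' P y\<bar> \<partial>lborel) \<le> (\<integral>y. indicator P y * \<bar>f y\<bar> + indicator P y * \<bar>A P\<bar> \<partial>lborel)"
    proof (rule integral_mono)
      show "integrable lborel (\<lambda>y. \<bar>b' P y\<bar>)" using ib[OF P] by auto
      show "integrable lborel (\<lambda>y. indicator P y * \<bar>f y\<bar> + indicator P y * \<bar>A P\<bar>)"
        using integrable_abs[OF iPf[OF P]] iP[OF P] by (auto simp: abs_mult)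
    qed (auto simp: b'_def indicator_def)
    also have "\<dots> = dint P ?af + \<bar>A P\<bar> * measure lborel P"
      using integrable_abs[OF iPf[OF P]] iP[OF P] P setP by (auto simp: abs_mult dint_def)
    also have "\<dots> \<le> 2 * dint P ?af" using Ale(1)[OF P] by simp
    finally show ?thesis using CH_pos by (simp add: mult_left_mono)
  qed
  define H where "H x = (\<Sum>P\<in>\<P>. indicator (S P) x * \<bar>?T (b' P) x\<bar>)" for x
  have iT: "integrable lborel (\<lambda>x. indicator (S P) x * \<bar>?T (b' P) x\<bar>)" if "P \<in> \<P>" for P
    using conv_integrable[OF kern_integrable(1) ib[OF that]] by (intro integrable_indicator_mult) auto
  have iH: "integrable lborel H" unfolding H_def[abs_def] using iT by auto
  have H0: "H x \<ge> 0" for x unfolding H_def by (intro sum_nonneg) auto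
  have "(\<integral>x. \<bar>H x\<bar> \<partial>lborel) = (\<Sum>P\<in>\<P>. \<integral>x. indicator (S P) x * \<bar>?T (b' P) x\<bar> \<partial>lborel)"
    using H0 iT by (simp add: H_def[symmetric] Bochner_Integration.integral_sum[symmetric])
  also have "\<dots> \<le> (\<Sum>P\<in>\<P>. CH * (2 * dint P ?af))" using bbad by (intro sum_mono)
  also have "\<dots> = 2 * CH * (\<Sum>P\<in>\<P>. dint P ?af)" by (simp add: sum_distrib_left mult_ac)
  also have "\<dots> \<le> 2 * CH * F"
    unfolding F_def using sum_dint_disjoint_le[OF f finP disP setP] CH_pos by (intro mult_left_mono) auto
  finally have "(\<integral>x. \<bar>H x\<bar> \<partial>lborel) \<le> 2 * CH * F" .
  from Markov_abs[OF iH _ this, of "l / 2"] l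
  have HH: "emeasure lborel {x. l / 2 \<le> \<bar>H x\<bar>} \<le> ennreal (4 * CH / l * F)" by (simp add: field_simps)
  have Om: "emeasure lborel \<Omega> \<le> ennreal (unit_ball_vol ?n * (4 * ?n) ^ ?n / l * F)"
  proof -
    let ?Q = "{P\<in>\<P>. bad (?lev (z P)) (z P)}" and ?c = "unit_ball_vol ?n * (4 * ?n) ^ ?n / l"
    have "emeasure lborel \<Omega> \<le> (\<Sum>P\<in>?Q. emeasure lborel (ball (z P) (4 * (?n * r P))))"
      unfolding \<Omega>_def using finP by (intro emeasure_subadditive_finite) auto
    also have "\<dots> \<le> (\<Sum>P\<in>?Q. ennreal (?c * dint P ?af))"
    proof (rule sum_mono)
      fix P assume P: "P \<in> ?Q"
      have "l * r P ^ ?n \<le> dint P ?af" using P z[of P] by (auto simp: bad_def r_def stop_cube_def)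
      then have le: "r P ^ ?n \<le> dint P ?af / l" using l by (simp add: field_simps)
      have "emeasure lborel (ball (z P) (4 * (?n * r P))) = ennreal (unit_ball_vol ?n * (4 * (?n * r P)) ^ ?n)"
        using rpos[of P] by (intro emeasure_ball) auto
      also have "unit_ball_vol ?n * (4 * (?n * r P)) ^ ?n = (unit_ball_vol ?n * (4 * ?n) ^ ?n) * r P ^ ?n"
        by (simp add: power_mult_distrib)
      also have "\<dots> \<le> (unit_ball_vol ?n * (4 * ?n) ^ ?n) * (dint P ?af / l)" using le by (intro mult_left_mono) auto
      also have "\<dots> = ?c * dint P ?af" by simp
      finally show "emeasure lborel (ball (z P) (4 * (?n * r P))) \<le> ennreal (?c * dint P ?af)"
        by (simp add: ennreal_leI)
    qed
    also have "\<dots> = ennreal (\<Sum>P\<in>?Q. ?c * dint P ?af)" using l by (intro sum_ennreal mult_nonneg_nonneg divide_nonneg_nonneg dint_nonneg) auto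
    also have "\<dots> \<le> ennreal (?c * F)"
    proof (rule ennreal_leI)
      have "(\<Sum>P\<in>?Q. dint P ?af) \<le> F" unfolding F_def
        using disP setP finP by (intro sum_dint_disjoint_le[OF f]) (auto simp: disjoint_def)
      then show "(\<Sum>P\<in>?Q. ?c * dint P ?af) \<le> ?c * F"
        unfolding sum_distrib_left[symmetric] using l by (intro mult_left_mono) auto
    qed
    finally show ?thesis .
  qed
  have Tf: "?T f x = ?T g x + (\<Sum>P\<in>\<P>. ?T (b' P) x)" for x
  proof -
    have "?T f x = ?T (\<lambda>y. g y + (\<Sum>P\<in>\<P>. b' P y)) x" by (simp add: fdec[symmetric])
    also have "\<dots> = ?T g x + ?T (\<lambda>y. \<Sum>P\<in>\<P>. b' P y) x"
      using ib by (intro conv_add_right[OF kern_borel kern_le] ig) auto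
    also have "?T (\<lambda>y. \<Sum>P\<in>\<P>. b' P y) x = (\<Sum>P\<in>\<P>. ?T (b' P) x)"
      using ib by (intro conv_sum_right_integrable[OF kern_borel kern_le])
    finally show ?thesis .
  qed
  have "{x. l \<le> \<bar>?T f x\<bar>} \<subseteq> ({x. l / 2 \<le> \<bar>?T g x\<bar>} \<union> \<Omega>) \<union> {x. l / 2 \<le> \<bar>H x\<bar>}"
  proof
    fix x assume x: "x \<in> {x. l \<le> \<bar>?T f x\<bar>}"
    show "x \<in> ({x. l / 2 \<le> \<bar>?T g x\<bar>} \<union> \<Omega>) \<union> {x. l / 2 \<le> \<bar>H x\<bar>}"
    proof (cases "x \<in> \<Omega>")
      case False
      \<comment> \<open>Outside the exceptional set every term may be localised to
        \<open>S P\<close> for free: a bad cell is far away by the definition of the set, and for a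
        cell of level N that is near x the convolution vanishes.\<close>
      have eqS: "\<bar>?T (b' P) x\<bar> = indicator (S P) x * \<bar>?T (b' P) x\<bar>" if P: "P \<in> \<P>" for P
      proof (cases "x \<in> S P")
        case xS: False
        then have lt: "norm (x - z P) < 4 * (?n * r P)" by (simp add: S_def)
        have "\<not> bad (?lev (z P)) (z P)"
        proof
          assume "bad (?lev (z P)) (z P)"
          then have "x \<in> \<Omega>" unfolding \<Omega>_def using P lt by (auto simp: dist_norm norm_minus_commute)
          then show False using False by simp
        qed
        then have "?lev (z P) = N" using stop_level(3)[OF k0(1), of bad "z P"] by simp
        then have rN: "r P = side N" by (simp add: r_def)
        have "kern a b (x - y) * b' P y = 0" for y
        proof (cases "y \<in> P")
          case True
          have "norm (x - y) \<le> norm (x - z P) + norm (y - z P)"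
            using norm_triangle_ineq4[of "x - z P" "y - z P"] by simp
          also have "\<dots> \<le> 2 powi a" using lt dist[OF P True] N unfolding rN by linarith
          finally show ?thesis by (simp add: kern_def)
        qed (simp add: b'_def)
        then have "?T (b' P) x = 0" unfolding conv_def by (intro integral_eq_zero_AE AE_I2)
        then show ?thesis by simp
      qed simp
      have "\<bar>\<Sum>P\<in>\<P>. ?T (b' P) x\<bar> \<le> (\<Sum>P\<in>\<P>. \<bar>?T (b' P) x\<bar>)" by (rule sum_abs)
      also have "\<dots> = H x" unfolding H_def by (rule sum.cong[OF refl eqS])
      finally have "\<bar>\<Sum>P\<in>\<P>. ?T (b' P) x\<bar> \<le> H x" .
      then have "l \<le> \<bar>?T g x\<bar> + H x" using x Tf[of x] by simp
      then have "l / 2 \<le> \<bar>?T g x\<bar> \<or> l / 2 \<le> H x" by linarith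
      then show ?thesis using H0[of x] by auto
    qed simp
  qed
  moreover have [measurable]: "?T g \<in> borel_measurable borel" "H \<in> borel_measurable borel" "\<Omega> \<in> sets borel"
    using conv_integrable[OF kern_integrable(1) ig] iH finP by (auto simp: \<Omega>_def)
  moreover have sets: "{x. l / 2 \<le> \<bar>?T g x\<bar>} \<in> sets borel" "{x. l / 2 \<le> \<bar>H x\<bar>} \<in> sets borel" by measurable
  ultimately have "emeasure lborel {x. l \<le> \<bar>?T f x\<bar>}
     \<le> emeasure lborel (({x. l / 2 \<le> \<bar>?T g x\<bar>} \<union> \<Omega>) \<union> {x. l / 2 \<le> \<bar>H x\<bar>})"
    using ig conv_integrable[OF kern_integrable(1) ig] iH finP
    by (intro emeasure_mono) (auto simp: \<Omega>_def)
  also have "\<dots> \<le> (emeasure lborel {x. l / 2 \<le> \<bar>?T g x\<bar>} + emeasure lborel \<Omega>) + emeasure lborel {x. l / 2 \<le> \<bar>H x\<bar>}"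
    using sets \<open>\<Omega> \<in> sets borel\<close>
    by (intro order_trans[OF emeasure_subadditive] add_right_mono emeasure_subadditive) auto
  also have "\<dots> \<le> (ennreal (4 * BL\<^sup>2 * 2 ^ ?n / l * F) + ennreal (unit_ball_vol ?n * (4 * ?n) ^ ?n / l * F)) + ennreal (4 * CH / l * F)"
    by (intro add_mono good Om HH)
  also have "\<dots> = ennreal (CW / l * F)"
  proof -
    have "0 \<le> 4 * BL\<^sup>2 * 2 ^ ?n / l * F" "0 \<le> unit_ball_vol ?n * (4 * ?n) ^ ?n / l * F" "0 \<le> 4 * CH / l * F"
      using l F0 CH_pos by (intro mult_nonneg_nonneg divide_nonneg_nonneg; simp)+
    moreover from this have "0 \<le> 4 * BL\<^sup>2 * 2 ^ ?n / l * F + unit_ball_vol ?n * (4 * ?n) ^ ?n / l * F" by linarith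
    ultimately show ?thesis by (simp only: ennreal_plus[symmetric]) (simp add: CW_def algebra_simps add_divide_distrib)
  qed
  finally show ?thesis by (simp add: F_def)
qed

end

section \<open>The grand maximal truncated operator\<close>

lemma emeasure_density_abs:
  assumes "integrable lborel f" "A \<in> sets borel"
  shows "emeasure (density lborel (\<lambda>y. ennreal \<bar>f y\<bar>)) A = ennreal (dint A (\<lambda>y. \<bar>f y\<bar>))"
proof -
  have i: "integrable lborel (\<lambda>y. indicator A y * \<bar>f y\<bar>)"
    using assms by (intro integrable_indicator_mult) auto
  have "emeasure (density lborel (\<lambda>y. ennreal \<bar>f y\<bar>)) A = (\<integral>\<^sup>+y. ennreal (indicator A y * \<bar>f y\<bar>) \<partial>lborel)"
  proof (subst emeasure_density)
    show "(\<lambda>y. ennreal \<bar>f y\<bar>) \<in> borel_measurable lborel" using assms(1) by auto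
    show "(\<integral>\<^sup>+y. ennreal \<bar>f y\<bar> * indicator A y \<partial>lborel) = (\<integral>\<^sup>+y. ennreal (indicator A y * \<bar>f y\<bar>) \<partial>lborel)"
      by (intro nn_integral_cong) (auto simp: indicator_def)
  qed (use assms(2) in simp)
  also have "\<dots> = ennreal (dint A (\<lambda>y. \<bar>f y\<bar>))"
    unfolding dint_def by (rule nn_integral_eq_integral[OF i]) auto
  finally show ?thesis .
qed

lemma card_dclass_range: "card (PiE (Basis::'a::euclidean_space set) (\<lambda>_. {0..2::int})) = 3 ^ DIM('a)"
  by (simp add: card_PiE)

lemma finite_dclass_range: "finite (PiE (Basis::'a::euclidean_space set) (\<lambda>_. {0..2::int}))"
  by (intro finite_PiE) auto

text \<open>One factor 3^n is the number of laminar classes; the other arises because the average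
  over the triple is normalised by the volume of the cube itself.\<close>

lemma dyadic_maximal_weak_type:
  fixes f :: "'a::euclidean_space \<Rightarrow> real" and S :: "'a set" and k0 N :: int
  assumes f: "integrable lborel f" and S: "bounded S" and t: "t > 0"
  defines "\<P> \<equiv> {dcube3 k x |k x. k \<in> {k0..N} \<and> x \<in> S \<and> t * side k ^ DIM('a) < dint (dcube3 k x) (\<lambda>y. \<bar>f y\<bar>)}"
  shows "\<Union>\<P> \<in> sets borel" "emeasure lborel (\<Union>\<P>) \<le> ennreal (9 ^ DIM('a) / t * (\<integral>y. \<bar>f y\<bar> \<partial>lborel))"
proof -
  let ?n = "DIM('a)" and ?af = "\<lambda>y. \<bar>f y\<bar>" and ?R = "PiE (Basis::'a set) (\<lambda>_. {0..2::int})"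
  define F where "F = (\<integral>y. \<bar>f y\<bar> \<partial>lborel)"
  have [measurable]: "f \<in> borel_measurable borel" using f by auto
  define \<Q> where "\<Q> r = {dcube3 k x |k x. k \<in> {k0..N} \<and> x \<in> S \<and> t * side k ^ ?n < dint (dcube3 k x) ?af \<and> dclass k x = r}" for r
  have "\<P> \<subseteq> (\<Union>k\<in>{k0..N}. dcube3 k ` S)" by (auto simp: \<P>_def)
  then have finP: "finite \<P>" by (rule finite_subset) (use dcubes_finite[OF S] in auto)
  have setP: "\<P> \<subseteq> sets borel" by (auto simp: \<P>_def)
  show "\<Union>\<P> \<in> sets borel" using finP setP by (intro sets.finite_Union) auto
  have QP: "\<Q> r \<subseteq> \<P>" for r by (auto simp: \<Q>_def \<P>_def)
  have un: "\<Union>\<P> = (\<Union>r\<in>?R. \<Union>(\<Q> r))"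
  proof
    show "\<Union>\<P> \<subseteq> (\<Union>r\<in>?R. \<Union>(\<Q> r))"
    proof
      fix y assume "y \<in> \<Union>\<P>"
      then obtain k x where kx: "k \<in> {k0..N}" "x \<in> S" "t * side k ^ ?n < dint (dcube3 k x) ?af" "y \<in> dcube3 k x"
        by (auto simp: \<P>_def)
      then have "dcube3 k x \<in> \<Q> (dclass k x)" unfolding \<Q>_def by blast
      then show "y \<in> (\<Union>r\<in>?R. \<Union>(\<Q> r))" using kx(4) dclass_range[of k x] by blast
    qed
  qed (use QP in blast)
  have Q: "emeasure lborel (\<Union>(\<Q> r)) \<le> ennreal (3 ^ ?n / t * F)" for r
  proof -
    let ?\<nu> = "density lborel (\<lambda>y. ennreal \<bar>f y\<bar>)"
    have "emeasure lborel (\<Union>(\<Q> r)) \<le> ennreal (3 ^ ?n / t) * emeasure ?\<nu> (\<Union>(\<Q> r))"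
    proof (rule laminar_emeasure_le)
      show "finite (\<Q> r)" using QP finP finite_subset by blast
      show "laminar (\<Q> r)" by (rule laminar_subset[OF laminar_dclass[of r]]) (auto simp: \<Q>_def)
      show "\<Q> r \<subseteq> sets lborel" using QP setP by auto
      fix P assume "P \<in> \<Q> r"
      then obtain k x where kx: "P = dcube3 k x" "t * side k ^ ?n < dint P ?af" by (auto simp: \<Q>_def)
      have "emeasure lborel P = ennreal (3 ^ ?n / t * (t * side k ^ ?n))" using t by (simp add: kx(1) emeasure_dcube3)
      also have "\<dots> \<le> ennreal (3 ^ ?n / t * dint P ?af)"
        using kx(2) t by (intro ennreal_leI mult_left_mono) auto
      also have "\<dots> = ennreal (3 ^ ?n / t) * ennreal (dint P ?af)"
        using t by (intro ennreal_mult dint_nonneg) auto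
      also have "ennreal (dint P ?af) = emeasure ?\<nu> P"
        by (simp add: kx(1) emeasure_density_abs[OF f])
      finally show "emeasure lborel P \<le> ennreal (3 ^ ?n / t) * emeasure ?\<nu> P" .
    qed simp
    also have "\<dots> \<le> ennreal (3 ^ ?n / t) * ennreal F"
    proof (rule mult_left_mono)
      have "emeasure ?\<nu> (\<Union>(\<Q> r)) \<le> emeasure ?\<nu> UNIV" by (rule emeasure_mono) auto
      then show "emeasure ?\<nu> (\<Union>(\<Q> r)) \<le> ennreal F"
        using emeasure_density_abs[OF f, of UNIV] by (simp add: dint_def F_def)
    qed simp
    also have "\<dots> = ennreal (3 ^ ?n / t * F)" using t by (intro ennreal_mult[symmetric]) (auto simp: F_def)
    finally show ?thesis .
  qed
  have "emeasure lborel (\<Union>\<P>) \<le> (\<Sum>r\<in>?R. emeasure lborel (\<Union>(\<Q> r)))"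
    unfolding un
  proof (intro emeasure_subadditive_finite finite_dclass_range image_subsetI)
    fix r show "\<Union>(\<Q> r) \<in> sets lborel"
      using QP[of r] setP finite_subset[OF QP finP, of r] by (simp, intro sets.finite_Union) auto
  qed
  also have "\<dots> \<le> (\<Sum>r\<in>?R. ennreal (3 ^ ?n / t * F))" by (intro sum_mono Q)
  also have "\<dots> = of_nat (3 ^ ?n) * ennreal (3 ^ ?n / t * F)"
    by (simp only: sum_constant card_dclass_range)
  also have "\<dots> = ennreal (real (3 ^ ?n) * (3 ^ ?n / t * F))"
    unfolding ennreal_of_nat_eq_real_of_nat using t by (intro ennreal_mult[symmetric]) (auto simp: F_def)
  also have "real (3 ^ ?n) * (3 ^ ?n / t * F) = 9 ^ ?n / t * F"
    by (simp add: power_mult_distrib[symmetric])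
  finally show "emeasure lborel (\<Union>\<P>) \<le> ennreal (9 ^ ?n / t * (\<integral>y. \<bar>f y\<bar> \<partial>lborel))" by (simp add: F_def)
qed

text \<open>The laminar comparison of Lebesgue measure with its restriction to G: the dyadic weak
  type inequality for the maximal function of an indicator.\<close>

lemma dense_dcubes_cover:
  fixes \<Q> :: "'a::euclidean_space set set"
  assumes Q: "finite \<Q>" "\<Q> \<subseteq> {dcube k x |k x. True}" and G: "G \<in> sets borel"
    and d: "\<And>P. P \<in> \<Q> \<Longrightarrow> emeasure lborel P \<le> C * emeasure lborel (P \<inter> G)"
  shows "emeasure lborel (\<Union>\<Q>) \<le> C * emeasure lborel G"
proof -
  let ?\<nu> = "density lborel (indicator G)"
  have nu: "emeasure ?\<nu> A = emeasure lborel (A \<inter> G)" if "A \<in> sets borel" for A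
  proof -
    have "emeasure ?\<nu> A = (\<integral>\<^sup>+y. indicator G y * indicator A y \<partial>lborel)"
      using that G by (subst emeasure_density) auto
    also have "\<dots> = (\<integral>\<^sup>+y. indicator (A \<inter> G) y \<partial>lborel)"
      by (intro nn_integral_cong) (auto simp: indicator_def)
    finally show ?thesis using that G by simp
  qed
  have sQ: "\<Q> \<subseteq> sets borel" using Q(2) by auto
  have "emeasure lborel (\<Union>\<Q>) \<le> C * emeasure ?\<nu> (\<Union>\<Q>)"
    using Q sQ d by (intro laminar_emeasure_le laminar_subset[OF laminar_dcubes Q(2)]) (auto simp: nu subset_iff)
  also have "emeasure ?\<nu> (\<Union>\<Q>) = emeasure lborel (\<Union>\<Q> \<inter> G)"
    using Q(1) sQ by (intro nu sets.finite_Union) auto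
  also have "C * emeasure lborel (\<Union>\<Q> \<inter> G) \<le> C * emeasure lborel G"
    using G by (intro mult_left_mono emeasure_mono) auto
  finally show ?thesis .
qed

lemma dcube3_far:
  assumes "y \<notin> dcube3 k x" "z \<in> dcube k x" shows "side k < norm (z - y)"
  using dcube3_near[of z y k] dblock_cong[OF assms(2), of 1] assms(1) by fastforce

context cz begin

abbreviation tk :: "real \<Rightarrow> 'a \<Rightarrow> real" where "tk \<equiv> trunc_kernel K"

lemma tk_borel[measurable]: "tk \<delta> \<in> borel_measurable borel"
  unfolding trunc_kernel_def[abs_def] by measurable

lemma tk_le: "\<delta> > 0 \<Longrightarrow> \<bar>tk \<delta> x\<bar> \<le> c / \<delta> ^ DIM('a)"
  using K_le[of \<delta> x] c_pos by (auto simp: trunc_kernel_def)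

text \<open>A superlevel set of the grand maximal operator at one scale. Quantifying over all points
  of the cube makes the condition depend on the cube only, so stopping arguments apply; the lower
  bound \<open>\<eta>\<close> on truncations lets the search end at a finite level.\<close>

definition gbad :: "real \<Rightarrow> ('a \<Rightarrow> real) \<Rightarrow> real \<Rightarrow> int \<Rightarrow> 'a \<Rightarrow> bool" where
  "gbad \<eta> f t k x \<longleftrightarrow> (\<exists>\<xi>\<in>dcube k x. \<exists>\<delta>\<ge>\<eta>. t < \<bar>conv (tk \<delta>) (\<lambda>y. indicator (- dcube3 k x) y * f y) \<xi>\<bar>)"

lemma gbad_cong: "y \<in> dcube k x \<Longrightarrow> gbad \<eta> f t k y = gbad \<eta> f t k x"
  using dblock_cong[of y k x] by (simp add: gbad_def)

definition C3 :: real where "C3 = 2 * c * 2 ^ DIM('a) * (4 * DIM('a)) powr \<theta>"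

lemma C3_pos: "C3 > 0" using c_pos by (simp add: C3_def)

text \<open>If the two points are close in comparison with their distance to y, the smoothness of K
  applies. Otherwise the ratio of the two sides is bounded below, the power of \<open>4 * n\<close>
  in \<open>C3\<close> lifts the right hand side above the sum of the two size bounds, and the
  triangle inequality suffices.\<close>

lemma K_ring_diff:
  assumes jk: "j < k" and \<xi>: "\<xi> \<in> dcube k x" and z: "z \<in> dcube k x" and y: "y \<notin> dcube3 (j + 1) x"
  shows "\<bar>K (\<xi> - y) - K (z - y)\<bar> \<le> C3 / side j ^ DIM('a) * (side k / side j) powr \<theta>"
proof -
  let ?n = "DIM('a)" and ?r = "side (j + 1)"
  have r: "side j = 2 * ?r" "?r > 0" by (auto simp: side_Suc(1)[of j] side_pos)
  have "\<xi> \<in> dcube (j + 1) x" "z \<in> dcube (j + 1) x"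
    using \<xi> z dcube_mono[of "j + 1" k x] jk by auto
  then have far: "?r < norm (\<xi> - y)" "?r < norm (z - y)" using dcube3_far[OF y] by auto
  have d: "norm (\<xi> - z) \<le> ?n * side k"
    using dblock_dist[of z 0 k \<xi>] z dblock_cong[OF \<xi>, of 0] by simp
  let ?q = "side k / side j"
  have q: "0 < ?q" "?q \<le> 1" using side_pos[of k] side_pos[of j] side_le[of j k] jk by (auto simp: field_simps)
  have E: "c / ?r ^ ?n = c * 2 ^ ?n / side j ^ ?n" by (simp add: r(1) power_mult_distrib)
  have pm: "(4 * ?n * ?q) powr \<theta> = (4 * ?n) powr \<theta> * ?q powr \<theta>" by (rule powr_mult)
  show ?thesis
  proof (cases "?n * side k \<le> ?r / 2")
    case True
    have "\<bar>K (\<xi> - y) - K ((\<xi> - y) - (\<xi> - z))\<bar> \<le> c / ?r ^ ?n * (norm (\<xi> - z) / ?r) powr \<epsilon>"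
      using far d True r by (intro K_smooth) auto
    also have "\<dots> \<le> c / ?r ^ ?n * ((norm (\<xi> - z) / ?r) powr \<theta>)"
      using d True r c_pos by (intro mult_left_mono powr_theta_le(1)) (auto simp: field_simps)
    also have "\<dots> \<le> c / ?r ^ ?n * ((4 * ?n * ?q) powr \<theta>)"
    proof (intro mult_left_mono powr_mono2)
      have "norm (\<xi> - z) / ?r \<le> ?n * side k / ?r" using d r by (intro divide_right_mono) auto
      also have "\<dots> = 2 * ?n * ?q" using r by simp
      also have "\<dots> \<le> 4 * ?n * ?q" using q by (intro mult_right_mono) auto
      finally show "norm (\<xi> - z) / ?r \<le> 4 * ?n * ?q" .
    qed (use theta c_pos r in auto)
    also have "\<dots> \<le> 2 * (c / ?r ^ ?n * ((4 * ?n * ?q) powr \<theta>))"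
    proof -
      have le2: "x \<le> 2 * x" if "0 \<le> x" for x :: real using that by simp
      show ?thesis using c_pos r by (intro le2 mult_nonneg_nonneg) auto
    qed
    also have "\<dots> = C3 / side j ^ ?n * ?q powr \<theta>"
      unfolding E pm by (simp add: C3_def)
    finally show ?thesis by (simp add: algebra_simps)
  next
    case False
    then have "1 \<le> 4 * ?n * ?q" using r side_pos[of j] by (simp add: field_simps)
    then have one: "1 \<le> (4 * ?n * ?q) powr \<theta>" using theta by (simp add: ge_one_powr_ge_zero)
    have "\<bar>K (\<xi> - y)\<bar> \<le> c / ?r ^ ?n" "\<bar>K (z - y)\<bar> \<le> c / ?r ^ ?n" using far r by (auto intro!: K_le)
    then have "\<bar>K (\<xi> - y) - K (z - y)\<bar> \<le> 2 * (c / ?r ^ ?n) * 1" by simp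
    also have "\<dots> \<le> 2 * (c / ?r ^ ?n) * (4 * ?n * ?q) powr \<theta>"
      using one c_pos r by (intro mult_left_mono) auto
    also have "\<dots> = C3 / side j ^ ?n * ?q powr \<theta>"
      unfolding E pm by (simp add: C3_def)
    finally show ?thesis .
  qed
qed

definition CT :: real where "CT = 1 / (1 - 2 powr (- \<theta>))"

lemma CT_pos: "CT > 0" using two_powr_theta' by (simp add: CT_def)

lemma sum_sides_le: "(\<Sum>j\<in>{k0..<k}. (side k / side j) powr \<theta>) \<le> CT"
proof -
  have "(\<Sum>j\<in>{k0..<k}. (side k / side j) powr \<theta>) = (\<Sum>i\<in>{- k + 1..<- k0 + 1}. (side k / 2 powi i) powr \<theta>)"
    by (rule sum.reindex_bij_witness[of _ uminus uminus]) (auto simp: side_def)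
  also have "{- k + 1..<- k0 + 1} = {i\<in>{- k + 1..<- k0 + 1}. side k \<le> 2 powi i}"
    by (auto simp: side_def intro!: power_int_increasing)
  also have "(\<Sum>i\<in>\<dots>. (side k / 2 powi i) powr \<theta>) \<le> CT"
    unfolding CT_def by (rule sum_scales_le[OF side_pos])
  finally show ?thesis .
qed

text \<open>Smallness of the averages of f relative to t that meets three demands: moving the
  truncation and then the point changes the integral by at most t / 2, the local part exceeds t / 4
  on at most half of a cube, and truncations beyond the top cube stay below t / 2.\<close>

definition \<gamma> :: real where "\<gamma> = 1 / (2 * (c * 2 ^ DIM('a) + C3 * CT) + 8 * CW + 1)"

lemma gam: "\<gamma> > 0" "\<gamma> * (c * 2 ^ DIM('a) + C3 * CT) \<le> 1 / 2" "\<gamma> * CW \<le> 1 / 8" "\<gamma> * c \<le> 1 / 2"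
proof -
  define A where "A = c * 2 ^ DIM('a) + C3 * CT"
  have A: "A > 0" using c_pos C3_pos CT_pos unfolding A_def by (intro add_pos_pos mult_pos_pos) auto
  have g: "\<gamma> = 1 / (2 * A + 8 * CW + 1)" by (simp add: \<gamma>_def A_def)
  have D: "2 * A + 8 * CW + 1 > 0" using A CW_pos by linarith
  show g0: "\<gamma> > 0" using D by (simp add: g)
  have gA: "\<gamma> * A \<le> 1 / 2" using D A CW_pos unfolding g by (simp add: field_simps)
  then show "\<gamma> * (c * 2 ^ DIM('a) + C3 * CT) \<le> 1 / 2" by (simp add: A_def)
  show "\<gamma> * CW \<le> 1 / 8" using D A CW_pos unfolding g by (simp add: field_simps)
  have "c * 1 \<le> c * 2 ^ DIM('a)" using c_pos by (intro mult_left_mono) auto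
  moreover have "C3 * CT > 0" using C3_pos CT_pos by simp
  ultimately have "c \<le> A" unfolding A_def by linarith
  then have "\<gamma> * c \<le> \<gamma> * A" using g0 by (intro mult_left_mono) auto
  then show "\<gamma> * c \<le> 1 / 2" using gA by linarith
qed

text \<open>A large truncation at scale \<open>\<delta>\<close> near \<open>x\<close> forces the singular integral itself to be large on half of
  the dyadic cube around \<open>x\<close> of side comparable to \<open>\<delta>\<close> (or of the given cube, if that is larger).\<close>
lemma gbad_dense:
  fixes f :: "'a \<Rightarrow> real"
  assumes f: "integrable lborel f" and supp: "\<And>y. f y \<noteq> 0 \<Longrightarrow> y \<in> dcube3 k0 x0"
    and x: "x \<in> dcube k0 x0" and k: "k0 \<le> k" "k \<le> N" and t: "t > 0" and \<eta>: "\<eta> > 0"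
    and small: "\<And>j. k0 \<le> j \<Longrightarrow> j \<le> N \<Longrightarrow> dint (dcube3 j x) (\<lambda>y. \<bar>f y\<bar>) \<le> \<gamma> * t * side j ^ DIM('a)"
    and bad: "gbad \<eta> f t k x"
    and ab: "a \<le> b" "2 powi a < side N" "2 * DIM('a) * side k0 \<le> 2 powi b"
  shows "\<exists>j\<in>{k0..k}. emeasure lborel (dcube j x) \<le>
     2 * emeasure lborel (dcube j x \<inter> {z. t / 4 \<le> \<bar>conv (kern a b) f z\<bar>})"
proof -
  let ?n = "DIM('a)" and ?af = "\<lambda>y. \<bar>f y\<bar>" and ?T = "conv (kern a b)"
  define F where "F = (\<integral>y. \<bar>f y\<bar> \<partial>lborel)"
  have [measurable]: "f \<in> borel_measurable borel" using f by auto
  obtain \<xi> \<delta> where \<xi>: "\<xi> \<in> dcube k x" and \<delta>: "\<delta> \<ge> \<eta>"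
    and big: "t < \<bar>conv (tk \<delta>) (\<lambda>y. indicator (- dcube3 k x) y * f y) \<xi>\<bar>"
    using bad by (auto simp: gbad_def)
  have d0: "\<delta> > 0" using \<delta> \<eta> by simp
  have x3: "dcube3 k0 x = dcube3 k0 x0" using dblock_cong[OF x] .
  have FF: "F \<le> \<gamma> * t * side k0 ^ ?n"
  proof -
    have "dint (dcube3 k0 x) ?af = F" unfolding dint_def F_def
      using supp by (intro Bochner_Integration.integral_cong) (auto simp: indicator_def x3)
    then show ?thesis using small[of k0] k by simp
  qed
  have g0: "\<gamma> * t > 0" using gam(1) t by simp
  \<comment> \<open>The bound is extended to levels coarser than k0, where the integral is all of F,
    because level j - 1 occurs below and j may equal k0.\<close>
  have D: "dint (dcube3 j x) ?af \<le> \<gamma> * t * side j ^ ?n" if "j \<le> N" for j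
  proof (cases "k0 \<le> j")
    case False
    have "dint (dcube3 j x) ?af \<le> F" unfolding F_def by (intro dint_le f) auto
    also have "\<dots> \<le> \<gamma> * t * side k0 ^ ?n" by (rule FF)
    also have "\<dots> \<le> \<gamma> * t * side j ^ ?n"
      using g0 side_le[of j k0] side_pos[of k0] False by (intro mult_left_mono power_mono) auto
    finally show ?thesis .
  qed (use small that in auto)
  have ifA: "integrable lborel (\<lambda>y. indicator A y * f y)" if "A \<in> sets borel" for A
    using that by (intro integrable_indicator_mult f) auto
  \<comment> \<open>A truncation at or above twice the top side would see only values of K of size
    at most c / side^n; with the small total mass of f it could not exceed t.\<close>
  have dlt: "\<delta> < side (k0 - 1)"
  proof (rule ccontr)
    assume "\<not> \<delta> < side (k0 - 1)"
    then have "side k0 \<le> \<delta>" using side_Suc(2)[of k0] side_pos[of k0] by linarith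
    have "\<bar>conv (tk \<delta>) (\<lambda>y. indicator (- dcube3 k x) y * f y) \<xi>\<bar>
        \<le> c / \<delta> ^ ?n * (\<integral>y. \<bar>indicator (- dcube3 k x) y * f y\<bar> \<partial>lborel)"
      by (rule conv_bound(1)[OF tk_borel tk_le[OF d0] ifA]) auto
    also have "\<dots> \<le> c / \<delta> ^ ?n * F"
      using dint_le[OF f, of "- dcube3 k x"] c_pos d0
      by (intro mult_left_mono) (auto simp: dint_def F_def abs_mult)
    also have "\<dots> \<le> c / side k0 ^ ?n * F"
      using \<open>side k0 \<le> \<delta>\<close> side_pos[of k0] c_pos
      by (intro mult_right_mono divide_left_mono power_mono mult_pos_pos zero_less_power) (auto simp: F_def d0)
    also have "\<dots> \<le> c / side k0 ^ ?n * (\<gamma> * t * side k0 ^ ?n)"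
      using FF c_pos side_pos[of k0] by (intro mult_left_mono) auto
    also have "\<dots> = (\<gamma> * c) * t" using side_pos[of k0] by simp
    also have "\<dots> \<le> 1 / 2 * t" using gam(4) t by (intro mult_right_mono) auto
    finally show False using big t by simp
  qed
  \<comment> \<open>The finest level between k0 and k with \<delta> < 2 side j. Unless j = k, also
    side j \<le> \<delta>, so the cube at level j is comparable with the truncation.\<close>
  define j where "j = Max {j \<in> {k0..k}. \<delta> < side (j - 1)}"
  have fin: "finite {j \<in> {k0..k}. \<delta> < side (j - 1)}" by (rule finite_subset[of _ "{k0..k}"]) auto
  have jin: "j \<in> {j \<in> {k0..k}. \<delta> < side (j - 1)}"
    unfolding j_def using dlt k by (intro Max_in fin) auto
  then have j: "k0 \<le> j" "j \<le> k" "\<delta> < side (j - 1)" by auto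
  have jk: "j = k \<or> side j \<le> \<delta>"
  proof (rule ccontr)
    assume "\<not> (j = k \<or> side j \<le> \<delta>)"
    then have "j + 1 \<in> {j \<in> {k0..k}. \<delta> < side (j - 1)}" using j by auto
    then have "j + 1 \<le> j" unfolding j_def by (rule Max_ge[OF fin])
    then show False by simp
  qed
  have \<xi>j: "\<xi> \<in> dcube j x" using \<xi> dcube_mono[OF j(2)] by blast
  define g where "g y = indicator (- dcube3 j x) y * f y" for y
  have ig: "integrable lborel g" unfolding g_def[abs_def] by (rule ifA) auto
  \<comment> \<open>Seen from the cube, the support of g lies beyond the inner and within the outer
    radius of \<open>kern a b\<close>, so this doubly truncated kernel acts like K itself.\<close>
  have kernK: "kern a b (z - y) * g y = K (z - y) * g y" if z: "z \<in> dcube j x" for z y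
  proof (cases "g y = 0")
    case False
    then have y: "y \<notin> dcube3 j x" "y \<in> dcube3 k0 x" using supp[of y] by (auto simp: g_def x3 split: if_splits)
    have "side N \<le> side j" using j k by (intro side_le) auto
    then have "2 powi a < norm (z - y)" using dcube3_far[OF y(1) z] ab by linarith
    moreover have "z \<in> dcube k0 x" using z dcube_mono[OF j(1)] by blast
    then have "y \<in> dcube3 k0 z" using dblock_cong[of z k0 x 1] y(2) by simp
    then have "norm (z - y) \<le> 2 powi b" using dblock_dist[of y 1 k0 z] ab(3) by simp
    ultimately show ?thesis by (simp add: kern_def)
  qed simp
  \<comment> \<open>Truncating at \<delta> and removing the triple at level j differ only at points
    of the triple at level j - 1 that are at distance at least side j from \<xi>; there the size
    bound of K meets the small average.\<close>
  have step1: "\<bar>conv (tk \<delta>) (\<lambda>y. indicator (- dcube3 k x) y * f y) \<xi> - ?T g \<xi>\<bar> \<le> (\<gamma> * (c * 2 ^ ?n)) * t"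
  proof -
    let ?h = "\<lambda>y. tk \<delta> (\<xi> - y) * (indicator (- dcube3 k x) y * f y)"
    have i1: "integrable lborel ?h" by (rule conv_bound(2)[OF tk_borel tk_le[OF d0] ifA]) auto
    have i2: "integrable lborel (\<lambda>y. kern a b (\<xi> - y) * g y)" by (rule conv_bound(2)[OF kern_borel kern_le ig])
    have s: "side j > 0" by (rule side_pos)
    have pt: "\<bar>?h y - kern a b (\<xi> - y) * g y\<bar> \<le> c / side j ^ ?n * (indicator (dcube3 (j - 1) x) y * \<bar>f y\<bar>)" for y
    proof (cases "?h y = kern a b (\<xi> - y) * g y")
      case True
      show ?thesis unfolding True using c_pos s by (simp add: mult_nonneg_nonneg)
    next
      case False
      have far3: "y \<notin> dcube3 j x \<Longrightarrow> side j < norm (\<xi> - y)" using dcube3_far \<xi>j by blast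
      have sub: "dcube3 k x \<subseteq> dcube3 j x" by (rule dcube3_mono[OF j(2)])
      have K1: "\<bar>K (\<xi> - y) * f y\<bar> \<le> c / side j ^ ?n * \<bar>f y\<bar>" if "side j \<le> norm (\<xi> - y)"
        unfolding abs_mult by (intro mult_right_mono K_le[OF s that]) simp
      have \<xi>3: "dcube3 (j - 1) \<xi> = dcube3 (j - 1) x"
        using \<xi>j dcube_mono[of "j - 1" j x] by (intro dblock_cong) auto
      show ?thesis
      proof (cases "y \<in> dcube3 j x")
        case True
        then have g: "kern a b (\<xi> - y) * g y = 0" by (simp add: g_def)
        then have nz: "?h y \<noteq> 0" using False by (simp only: simp_thms)
        then have "y \<notin> dcube3 k x" "\<delta> < norm (\<xi> - y)"
          by (auto simp: trunc_kernel_def split: if_splits)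
        moreover have "j \<noteq> k" using True calculation by auto
        ultimately have le: "side j \<le> norm (\<xi> - y)" using jk by linarith
        have h: "?h y = K (\<xi> - y) * f y" using nz by (auto simp: trunc_kernel_def indicator_def split: if_splits)
        have "y \<in> dcube3 (j - 1) x" using True dcube3_mono[of "j - 1" j x] by auto
        then show ?thesis unfolding h g using K1[OF le] by simp
      next
        case yF: False
        then have yk: "y \<notin> dcube3 k x" using sub by blast
        have le: "side j \<le> norm (\<xi> - y)" using far3[OF yF] by simp
        have gy: "kern a b (\<xi> - y) * g y = K (\<xi> - y) * f y" using kernK[OF \<xi>j, of y] yF by (simp add: g_def)
        then have nh: "?h y \<noteq> K (\<xi> - y) * f y" using False by (simp only: simp_thms)
        have "\<not> \<delta> < norm (\<xi> - y)"
        proof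
          assume "\<delta> < norm (\<xi> - y)"
          then have "?h y = K (\<xi> - y) * f y" using yk by (simp add: trunc_kernel_def)
          then show False using nh by (simp only: simp_thms)
        qed
        then have z: "?h y = 0" "norm (\<xi> - y) \<le> side (j - 1)" using j(3) by (auto simp: trunc_kernel_def)
        then have "y \<in> dcube3 (j - 1) x" using dcube3_near[of \<xi> y "j - 1"] \<xi>3 by simp
        then show ?thesis unfolding z(1) gy using K1[OF le] by simp
      qed
    qed
    have "\<bar>conv (tk \<delta>) (\<lambda>y. indicator (- dcube3 k x) y * f y) \<xi> - ?T g \<xi>\<bar>
      = \<bar>\<integral>y. ?h y - kern a b (\<xi> - y) * g y \<partial>lborel\<bar>" using i1 i2 by (simp add: conv_def)
    also have "\<dots> \<le> (\<integral>y. \<bar>?h y - kern a b (\<xi> - y) * g y\<bar> \<partial>lborel)" by (rule integral_abs_bound)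
    also have "\<dots> \<le> (\<integral>y. c / side j ^ ?n * (indicator (dcube3 (j - 1) x) y * \<bar>f y\<bar>) \<partial>lborel)"
    proof (rule integral_mono[OF _ _ pt])
      show "integrable lborel (\<lambda>y. \<bar>?h y - kern a b (\<xi> - y) * g y\<bar>)" using i1 i2 by auto
      show "integrable lborel (\<lambda>y. c / side j ^ ?n * (indicator (dcube3 (j - 1) x) y * \<bar>f y\<bar>))"
        using f by (intro integrable_mult_right integrable_indicator_mult) auto
    qed
    also have "\<dots> = c / side j ^ ?n * dint (dcube3 (j - 1) x) ?af" by (simp add: dint_def)
    also have "\<dots> \<le> c / side j ^ ?n * (\<gamma> * t * side (j - 1) ^ ?n)"
      using D[of "j - 1"] j k c_pos s by (intro mult_left_mono) auto
    also have "\<dots> = (\<gamma> * (c * 2 ^ ?n)) * t" using s by (simp add: side_Suc(2) power_mult_distrib)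
    finally show ?thesis .
  qed
  \<comment> \<open>Moving from \<xi> to z: the outside of the triple splits into rings between
    consecutive triples. Smallness of the average on each ring is uniform, and the factors (side j /
    side i)^\<theta> sum to at most \<open>CT\<close>.\<close>
  have step2: "\<bar>?T g \<xi> - ?T g z\<bar> \<le> (\<gamma> * (C3 * CT)) * t" if z: "z \<in> dcube j x" for z
  proof -
    define w where "w i = C3 / side i ^ ?n * (side j / side i) powr \<theta>" for i
    have i1: "integrable lborel (\<lambda>y. kern a b (\<xi> - y) * g y)" "integrable lborel (\<lambda>y. kern a b (z - y) * g y)"
      by (rule conv_bound(2)[OF kern_borel kern_le ig])+
    have w0: "w i \<ge> 0" for i using C3_pos side_pos[of i] by (simp add: w_def)
    have pt: "\<bar>kern a b (\<xi> - y) * g y - kern a b (z - y) * g y\<bar> \<le> (\<Sum>i\<in>{k0..<j}. w i * (indicator (dcube3 i x) y * \<bar>f y\<bar>))" for y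
    proof (cases "g y = 0")
      case False
      then have y: "y \<notin> dcube3 j x" "y \<in> dcube3 k0 x" "g y = f y" using supp[of y] by (auto simp: g_def x3 indicator_def split: if_splits)
      define i where "i = Max {i\<in>{k0..j}. y \<in> dcube3 i x}"
      have fin: "finite {i\<in>{k0..j}. y \<in> dcube3 i x}" by (rule finite_subset[of _ "{k0..j}"]) auto
      have "i \<in> {i\<in>{k0..j}. y \<in> dcube3 i x}" unfolding i_def using y(2) j(1) by (intro Max_in fin) auto
      then have i: "k0 \<le> i" "i \<le> j" "y \<in> dcube3 i x" by auto
      have ij: "i < j" using i y(1) by (cases "i = j") auto
      have "y \<notin> dcube3 (i + 1) x"
      proof
        assume "y \<in> dcube3 (i + 1) x"
        then have "i + 1 \<in> {i\<in>{k0..j}. y \<in> dcube3 i x}" using i ij by auto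
        then have "i + 1 \<le> i" unfolding i_def by (rule Max_ge[OF fin])
        then show False by simp
      qed
      then have "\<bar>K (\<xi> - y) - K (z - y)\<bar> * \<bar>f y\<bar> \<le> w i * \<bar>f y\<bar>"
        unfolding w_def by (intro mult_right_mono K_ring_diff[OF ij \<xi>j z]) auto
      also have "\<dots> = w i * (indicator (dcube3 i x) y * \<bar>f y\<bar>)" using i(3) by simp
      also have "\<dots> \<le> (\<Sum>i\<in>{k0..<j}. w i * (indicator (dcube3 i x) y * \<bar>f y\<bar>))"
        using i ij w0 by (intro member_le_sum[where f="\<lambda>i. w i * (indicator (dcube3 i x) y * \<bar>f y\<bar>)"]) auto
      finally have le: "\<bar>K (\<xi> - y) - K (z - y)\<bar> * \<bar>f y\<bar> \<le> (\<Sum>i\<in>{k0..<j}. w i * (indicator (dcube3 i x) y * \<bar>f y\<bar>))" .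
      have "kern a b (\<xi> - y) * g y - kern a b (z - y) * g y = (K (\<xi> - y) - K (z - y)) * f y"
        unfolding kernK[OF \<xi>j, of y] kernK[OF z, of y] by (simp only: y(3) left_diff_distrib)
      then show ?thesis using le by (simp only: abs_mult)
    qed (auto intro!: sum_nonneg mult_nonneg_nonneg w0)
    have iw: "integrable lborel (\<lambda>y. w i * (indicator (dcube3 i x) y * \<bar>f y\<bar>))" for i
      using f by (intro integrable_mult_right integrable_indicator_mult) auto
    have "\<bar>?T g \<xi> - ?T g z\<bar> = \<bar>\<integral>y. kern a b (\<xi> - y) * g y - kern a b (z - y) * g y \<partial>lborel\<bar>"
      using i1 by (simp add: conv_def)
    also have "\<dots> \<le> (\<integral>y. \<bar>kern a b (\<xi> - y) * g y - kern a b (z - y) * g y\<bar> \<partial>lborel)" by (rule integral_abs_bound)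
    also have "\<dots> \<le> (\<integral>y. (\<Sum>i\<in>{k0..<j}. w i * (indicator (dcube3 i x) y * \<bar>f y\<bar>)) \<partial>lborel)"
      by (rule integral_mono[OF _ _ pt]) (use i1 iw in auto)
    also have "\<dots> = (\<Sum>i\<in>{k0..<j}. w i * dint (dcube3 i x) ?af)"
      using iw by (simp add: Bochner_Integration.integral_sum dint_def)
    also have "\<dots> \<le> (\<Sum>i\<in>{k0..<j}. w i * (\<gamma> * t * side i ^ ?n))"
      using D j k by (intro sum_mono mult_left_mono w0) auto
    also have "\<dots> = C3 * (\<gamma> * t) * (\<Sum>i\<in>{k0..<j}. (side j / side i) powr \<theta>)"
      unfolding sum_distrib_left w_def using less_imp_neq[OF side_pos] by (intro sum.cong refl) (simp add: field_simps)
    also have "\<dots> \<le> C3 * (\<gamma> * t) * CT"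
      using sum_sides_le C3_pos g0 by (intro mult_left_mono) auto
    finally show ?thesis by (simp add: mult_ac)
  qed
  have large: "t / 2 \<le> \<bar>?T g z\<bar>" if "z \<in> dcube j x" for z
  proof -
    have "(\<gamma> * (c * 2 ^ ?n)) * t + (\<gamma> * (C3 * CT)) * t = (\<gamma> * (c * 2 ^ ?n + C3 * CT)) * t" by (simp add: algebra_simps)
    also have "\<dots> \<le> 1 / 2 * t" using gam(2) t by (intro mult_right_mono) auto
    finally show ?thesis using step1 step2[OF that] big by linarith
  qed
  let ?P = "dcube j x" and ?G = "{z. t / 4 \<le> \<bar>?T f z\<bar>}"
  define h where "h y = indicator (dcube3 j x) y * f y" for y
  have ih: "integrable lborel h" unfolding h_def[abs_def] by (rule ifA) auto
  let ?H = "{z. t / 4 \<le> \<bar>?T h z\<bar>}"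
  have Tf: "?T f z = ?T g z + ?T h z" for z
  proof -
    have fgh: "f = (\<lambda>y. g y + h y)" by (auto simp: g_def h_def indicator_def)
    show ?thesis by (subst fgh) (rule conv_add_right[OF kern_borel kern_le ig ih])
  qed
  have [measurable]: "?T f \<in> borel_measurable borel" "?T h \<in> borel_measurable borel"
    using conv_integrable[OF kern_integrable(1) f] conv_integrable[OF kern_integrable(1) ih] by auto
  have sets: "?G \<in> sets borel" "?H \<in> sets borel" by measurable
  \<comment> \<open>The outer part is at least t / 2 throughout the cube, so where the full integral
    stays below t / 4 the local part h must reach t / 4. The weak type bound limits this to half of
    the cube.\<close>
  have cov: "?P \<subseteq> (?P \<inter> ?G) \<union> ?H"
  proof
    fix z assume z: "z \<in> ?P"
    have "t / 4 \<le> \<bar>?T f z\<bar> \<or> t / 4 \<le> \<bar>?T h z\<bar>" using large[OF z] Tf[of z] by linarith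
    then show "z \<in> (?P \<inter> ?G) \<union> ?H" using z by auto
  qed
  obtain R where R: "\<forall>y\<in>dcube3 j x. norm y \<le> R" using bounded_dblock[of 1 j x] by (auto simp: bounded_iff)
  have "norm y \<le> R" if "h y \<noteq> 0" for y using that R by (auto simp: h_def indicator_def split: if_splits)
  then have "emeasure lborel ?H \<le> ennreal (CW / (t / 4) * (\<integral>y. \<bar>h y\<bar> \<partial>lborel))"
    using t ab(1) by (intro kern_weak_type[OF ih]) auto
  also have "(\<integral>y. \<bar>h y\<bar> \<partial>lborel) = dint (dcube3 j x) ?af" by (simp add: h_def dint_def abs_mult)
  also have "CW / (t / 4) * dint (dcube3 j x) ?af \<le> CW / (t / 4) * (\<gamma> * t * side j ^ ?n)"
    using D[of j] j k CW_pos t by (intro mult_left_mono) auto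
  also have "\<dots> = 4 * (\<gamma> * CW) * side j ^ ?n" using t by simp
  also have "\<dots> \<le> 4 * (1 / 8) * side j ^ ?n"
    using gam(3) side_pos[of j] by (intro mult_right_mono mult_left_mono) auto
  finally have H: "emeasure lborel ?H \<le> ennreal (side j ^ ?n / 2)"
    using CW_pos t D[of j] j k dint_nonneg by (simp add: ennreal_leI mult_left_mono)
  have "ennreal (side j ^ ?n) \<le> emeasure lborel (?P \<inter> ?G) + ennreal (side j ^ ?n / 2)"
  proof -
    have "emeasure lborel ?P \<le> emeasure lborel ((?P \<inter> ?G) \<union> ?H)" using sets by (intro emeasure_mono cov) auto
    also have "\<dots> \<le> emeasure lborel (?P \<inter> ?G) + emeasure lborel ?H" using sets by (intro emeasure_subadditive) auto
    also have "\<dots> \<le> emeasure lborel (?P \<inter> ?G) + ennreal (side j ^ ?n / 2)" using H by (intro add_left_mono)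
    finally show ?thesis by (simp add: emeasure_dcube)
  qed
  moreover have "emeasure lborel (?P \<inter> ?G) \<noteq> \<infinity>"
  proof -
    have "emeasure lborel (?P \<inter> ?G) \<le> emeasure lborel ?P" by (intro emeasure_mono) auto
    then show ?thesis by (auto simp: emeasure_dcube top_unique)
  qed
  then obtain m where m: "emeasure lborel (?P \<inter> ?G) = ennreal m" "m \<ge> 0"
    by (cases "emeasure lborel (?P \<inter> ?G)") auto
  ultimately have "ennreal (side j ^ ?n) \<le> ennreal (m + side j ^ ?n / 2)"
    using side_pos[of j] by (simp add: ennreal_plus)
  then have "side j ^ ?n \<le> 2 * m" using m(2) side_pos[of j] by (subst (asm) ennreal_le_iff) auto
  then have "emeasure lborel ?P \<le> ennreal (2 * m)" by (simp add: emeasure_dcube ennreal_leI)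
  also have "\<dots> = 2 * ennreal m" using m(2) by (simp add: ennreal_mult')
  finally show ?thesis using m(1) j by (intro bexI[of _ j]) auto
qed

text \<open>The first term is the maximal function at height \<gamma> t; in the second, 8 = 2 * 4
  combines the density 1/2 with the height t / 4.\<close>

definition CG :: real where "CG = 9 ^ DIM('a) / \<gamma> + 8 * CW"

lemma CG_pos: "CG > 0"
  using gam(1) CW_pos unfolding CG_def by (intro add_pos_pos divide_pos_pos) auto

text \<open>A cube of the family either lies in the set where averages over triples exceed \<gamma>
  t, or contains a point x1 all of whose averages are small. In the second case
  \<open>gbad_dense\<close> applies at x1 and puts the cube inside a dyadic cube that is half filled
  by a level set of the singular integral, whose weak type bound is known.\<close>

theorem grand_maximal_weak_type:
  fixes f :: "'a \<Rightarrow> real" and N :: int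
  assumes f: "integrable lborel f" and supp: "\<And>y. f y \<noteq> 0 \<Longrightarrow> y \<in> dcube3 k0 x0"
    and t: "t > 0" and \<eta>: "\<eta> > 0"
  defines "\<E> \<equiv> {dcube k x |k x. k \<in> {k0..N} \<and> x \<in> dcube k0 x0 \<and> gbad \<eta> f t k x}"
  shows "\<Union>\<E> \<in> sets borel" "emeasure lborel (\<Union>\<E>) \<le> ennreal (CG / t * (\<integral>y. \<bar>f y\<bar> \<partial>lborel))"
proof -
  let ?n = "DIM('a)" and ?af = "\<lambda>y. \<bar>f y\<bar>"
  define F where "F = (\<integral>y. \<bar>f y\<bar> \<partial>lborel)"
  have gt: "\<gamma> * t > 0" using gam(1) t by simp
  have "\<E> \<subseteq> (\<Union>k\<in>{k0..N}. dcube k ` dcube k0 x0)" by (auto simp: \<E>_def)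
  then have finE: "finite \<E>" by (rule finite_subset) (use dcubes_finite[OF bounded_dblock] in auto)
  show sE: "\<Union>\<E> \<in> sets borel" using finE by (intro sets.finite_Union) (auto simp: \<E>_def)
  \<comment> \<open>The inner radius is below the finest side and the outer radius 2^b above the
    diameter of the top triple; only a \<le> b matters for the constants.\<close>
  define a where "a = - N - 1"
  have a: "2 powi a < side N" by (simp add: a_def side_def power_int_diff)
  obtain m :: nat where m: "2 * ?n * side k0 \<le> 2 ^ m" using real_arch_pow[of 2 "2 * ?n * side k0"] by (auto intro: less_imp_le)
  define b where "b = max a (int m)"
  have "(2::real) ^ m \<le> 2 powi b" using power_int_increasing[of "int m" b "2::real"] by (simp add: b_def)
  then have b: "a \<le> b" "2 * ?n * side k0 \<le> 2 powi b" using m by (auto simp: b_def)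
  let ?T = "conv (kern a b)"
  let ?G = "{z. t / 4 \<le> \<bar>?T f z\<bar>}"
  have [measurable]: "?T f \<in> borel_measurable borel" using conv_integrable[OF kern_integrable(1) f] by auto
  have G: "?G \<in> sets borel" by measurable
  define \<M> where "\<M> = {dcube3 k x |k x. k \<in> {k0..N} \<and> x \<in> dcube k0 x0 \<and> (\<gamma> * t) * side k ^ ?n < dint (dcube3 k x) ?af}"
  have sM: "\<Union>\<M> \<in> sets borel" unfolding \<M>_def by (rule dyadic_maximal_weak_type(1)[OF f bounded_dblock gt])
  define \<Q> where "\<Q> = {P \<in> (\<Union>k\<in>{k0..N}. dcube k ` dcube k0 x0). emeasure lborel P \<le> 2 * emeasure lborel (P \<inter> ?G)}"
  have finQ: "finite \<Q>"
    by (rule finite_subset[of _ "\<Union>k\<in>{k0..N}. dcube k ` dcube k0 x0"])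
       (use dcubes_finite[OF bounded_dblock] in \<open>auto simp: \<Q>_def\<close>)
  have sQ: "\<Q> \<subseteq> sets borel" by (auto simp: \<Q>_def)
  have sUQ: "\<Union>\<Q> \<in> sets borel" using finQ sQ by (intro sets.finite_Union) auto
  have "\<Union>\<E> \<subseteq> \<Union>\<M> \<union> \<Union>\<Q>"
  proof (rule Union_least)
    fix P assume "P \<in> \<E>"
    then obtain k x where P: "P = dcube k x" "k \<in> {k0..N}" "x \<in> dcube k0 x0" "gbad \<eta> f t k x" by (auto simp: \<E>_def)
    show "P \<subseteq> \<Union>\<M> \<union> \<Union>\<Q>"
    proof (cases "P \<subseteq> \<Union>\<M>")
      case False
      then obtain x1 where x1: "x1 \<in> dcube k x" "x1 \<notin> \<Union>\<M>" using P(1) by blast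
      have P1: "P = dcube k x1" using P(1) dblock_cong[OF x1(1), of 0] by simp
      have x10: "x1 \<in> dcube k0 x0" using x1(1) dcube_mono[of k0 k x] dblock_cong[OF P(3), of 0] P(2) by auto
      have small: "dint (dcube3 j x1) ?af \<le> \<gamma> * t * side j ^ ?n" if "k0 \<le> j" "j \<le> N" for j
      proof (rule ccontr)
        assume "\<not> dint (dcube3 j x1) ?af \<le> \<gamma> * t * side j ^ ?n"
        then have M: "dcube3 j x1 \<in> \<M>" using that x10 unfolding \<M>_def by (auto simp: not_le)
        have "x1 \<in> dcube3 j x1" by (simp add: dblock_self)
        then have "x1 \<in> \<Union>\<M>" by (rule UnionI[OF M])
        then show False using x1(2) by simp
      qed
      have g1: "gbad \<eta> f t k x1" using P(4) gbad_cong[OF x1(1)] by simp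
      obtain j where j: "j \<in> {k0..k}" "emeasure lborel (dcube j x1) \<le> 2 * emeasure lborel (dcube j x1 \<inter> ?G)"
        using gbad_dense[OF f supp x10 _ _ t \<eta> small g1 b(1) a b(2)] P(2) by auto
      then have "dcube j x1 \<in> \<Q>" using x10 P(2) unfolding \<Q>_def by auto
      moreover have "P \<subseteq> dcube j x1" unfolding P1 using j(1) by (intro dcube_mono) auto
      ultimately show ?thesis by blast
    qed auto
  qed
  then have "emeasure lborel (\<Union>\<E>) \<le> emeasure lborel (\<Union>\<M> \<union> \<Union>\<Q>)"
    using sM sUQ by (intro emeasure_mono) auto
  also have "\<dots> \<le> emeasure lborel (\<Union>\<M>) + emeasure lborel (\<Union>\<Q>)"
    using sM sUQ by (intro emeasure_subadditive) auto
  also have "emeasure lborel (\<Union>\<M>) \<le> ennreal (9 ^ ?n / (\<gamma> * t) * F)"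
    unfolding \<M>_def F_def by (rule dyadic_maximal_weak_type(2)[OF f bounded_dblock gt])
  also have "emeasure lborel (\<Union>\<Q>) \<le> ennreal (8 * CW / t * F)"
  proof -
    have "emeasure lborel (\<Union>\<Q>) \<le> 2 * emeasure lborel ?G"
      by (rule dense_dcubes_cover[OF finQ _ G]) (auto simp: \<Q>_def)
    also have "\<dots> \<le> 2 * ennreal (CW / (t / 4) * F)"
    proof -
      obtain R where R: "\<forall>y\<in>dcube3 k0 x0. norm y \<le> R" using bounded_dblock[of 1 k0 x0] by (auto simp: bounded_iff)
      have "norm y \<le> R" if "f y \<noteq> 0" for y using R supp[OF that] by blast
      then show ?thesis unfolding F_def using t b(1) by (intro mult_left_mono kern_weak_type[OF f]) auto
    qed
    also have "\<dots> = ennreal (8 * CW / t * F)"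
      using ennreal_mult[of 2 "CW / (t / 4) * F"] CW_pos t by (simp add: F_def field_simps)
    finally show ?thesis .
  qed
  also have "ennreal (9 ^ ?n / (\<gamma> * t) * F) + ennreal (8 * CW / t * F) = ennreal (CG / t * F)"
  proof -
    have "0 \<le> 9 ^ ?n / (\<gamma> * t) * F" "0 \<le> 8 * CW / t * F"
      using gt CW_pos t by (auto simp: F_def)
    then show ?thesis by (simp only: ennreal_plus[symmetric]) (simp add: CG_def algebra_simps add_divide_distrib)
  qed
  finally show "emeasure lborel (\<Union>\<E>) \<le> ennreal (CG / t * (\<integral>y. \<bar>f y\<bar> \<partial>lborel))"
    by (simp add: F_def add_mono)
qed

end

section \<open>Sparse domination\<close>

text \<open>The integral over the triple is divided by the volume of the single cube, which makes
  this 3^n times the average over the triple; the factor is restored in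
  \<open>cube_majorant\<close>.\<close>

definition cavg :: "('a::euclidean_space \<Rightarrow> real) \<Rightarrow> int \<times> 'a \<Rightarrow> 'a \<Rightarrow> real" where
  "cavg f p \<xi> = dint (dcube3 (fst p) (snd p)) (\<lambda>y. \<bar>f y\<bar>) / side (fst p) ^ DIM('a) * indicator (dcube (fst p) (snd p)) \<xi>"

lemma cavg_nonneg: "0 \<le> cavg f p \<xi>"
  unfolding cavg_def using side_pos[of "fst p"] dint_nonneg
  by (intro mult_nonneg_nonneg divide_nonneg_nonneg) auto

text \<open>Members are pairs of a level and a point instead of sets, so that the cube, its triple
  and its class can all be read off. \<open>E\<close> selects disjoint parts that carry at least
  half of each cube.\<close>

definition sparse_family :: "int \<Rightarrow> 'a::euclidean_space \<Rightarrow> (int \<times> 'a) set \<Rightarrow> (int \<times> 'a \<Rightarrow> 'a set) \<Rightarrow> bool" where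
  "sparse_family k0 x0 I E \<longleftrightarrow> finite I \<and> disjoint_family_on E I \<and>
     (\<forall>p\<in>I. k0 \<le> fst p \<and> snd p \<in> dcube k0 x0 \<and> E p \<in> sets borel \<and> E p \<subseteq> dcube (fst p) (snd p) \<and>
        side (fst p) ^ DIM('a) \<le> 2 * measure lborel (E p))"

lemma sparse_familyD:
  fixes x0 :: "'a::euclidean_space"
  assumes "sparse_family k0 x0 I E"
  shows "finite I" "disjoint_family_on E I"
    "p \<in> I \<Longrightarrow> k0 \<le> fst p" "p \<in> I \<Longrightarrow> snd p \<in> dcube k0 x0" "p \<in> I \<Longrightarrow> E p \<in> sets borel"
    "p \<in> I \<Longrightarrow> E p \<subseteq> dcube (fst p) (snd p)"
    "p \<in> I \<Longrightarrow> side (fst p) ^ DIM('a) \<le> 2 * measure lborel (E p)"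
  using assms unfolding sparse_family_def by blast+

lemma sparse_family_empty: "sparse_family k0 x0 {} E"
  by (simp add: sparse_family_def disjoint_family_on_def)

context cz begin

text \<open>At height \<open>AS\<close> times the normalised integral over the top triple, the weak
  type bound for the grand maximal operator leaves a set of measure at most 2^(-n-2) times that of
  the cube.\<close>

definition AS :: real where "AS = CG * 2 ^ (DIM('a) + 2)"

lemma AS_pos: "AS > 0" using CG_pos by (simp add: AS_def)

text \<open>The constant is the same at every level: each stopping step adds one cube to the sum and
  leaves the constant alone, so the depth of the recursion does not matter.\<close>

definition dominated :: "real \<Rightarrow> ('a \<Rightarrow> real) \<Rightarrow> int \<Rightarrow> 'a \<Rightarrow> (int \<times> 'a) set \<Rightarrow> bool" where
  "dominated \<eta> f k0 x0 I \<longleftrightarrow> (\<forall>\<xi>\<in>dcube k0 x0. \<forall>\<delta>\<ge>\<eta>.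
     \<bar>conv (tk \<delta>) (\<lambda>y. indicator (dcube3 k0 x0) y * f y) \<xi>\<bar> \<le> AS * (\<Sum>p\<in>I. cavg f p \<xi>))"

text \<open>End of the recursion: the triple at level N has diameter at most \<open>\<eta>\<close>,
  so it lies entirely inside the truncated part of the kernel.\<close>

lemma local_trunc_zero:
  assumes "2 * DIM('a) * side N \<le> \<eta>" "\<eta> \<le> \<delta>" "\<xi> \<in> dcube N x"
  shows "conv (tk \<delta>) (\<lambda>y. indicator (dcube3 N x) y * f y) \<xi> = 0"
proof -
  have "tk \<delta> (\<xi> - y) * (indicator (dcube3 N x) y * f y) = 0" for y
  proof (cases "y \<in> dcube3 N x")
    case True
    then have "y \<in> dcube3 N \<xi>" using dblock_cong[OF assms(3), of 1] by simp
    then have "norm (\<xi> - y) \<le> \<delta>" using dblock_dist[of y 1 N \<xi>] assms(1,2) by simp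
    then show ?thesis by (simp add: trunc_kernel_def)
  qed simp
  then show ?thesis unfolding conv_def by (intro integral_eq_zero_AE AE_I2)
qed

text \<open>Stopping is governed by the density of the union of the \<open>gbad\<close> cubes, with
  threshold 2^(-n-1). A stopping cube is then not \<open>gbad\<close> itself, so outside its triple
  the truncations are at most t; and the bad stopping cubes together fill at most half of the top
  cube, so the rest can serve as its private part. Inside the triples of the bad stopping cubes the
  induction hypothesis takes over.\<close>

lemma sparse_domination_step:
  fixes f :: "'a \<Rightarrow> real"
  assumes f: "integrable lborel f" and \<eta>: "\<eta> > 0" and N: "2 * DIM('a) * side N \<le> \<eta>" and kN: "k0 < N"
    and IH: "\<And>k x. k0 < k \<Longrightarrow> k \<le> N \<Longrightarrow> \<exists>I E. sparse_family k x I E \<and> dominated \<eta> f k x I"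
  shows "\<exists>I E. sparse_family k0 x0 I E \<and> dominated \<eta> f k0 x0 I"
proof -
  let ?n = "DIM('a)" and ?Q = "dcube k0 x0"
  define g where "g y = indicator (dcube3 k0 x0) y * f y" for y
  have ifA: "integrable lborel (\<lambda>y. indicator A y * f y)" if "A \<in> sets borel" for A
    using that by (intro integrable_indicator_mult f) auto
  have ig: "integrable lborel g" unfolding g_def[abs_def] by (rule ifA) auto
  define F where "F = dint (dcube3 k0 x0) (\<lambda>y. \<bar>f y\<bar>)"
  have gF: "(\<integral>y. \<bar>g y\<bar> \<partial>lborel) = F" by (simp add: g_def F_def dint_def abs_mult)
  have F0: "F \<ge> 0" by (simp add: F_def dint_nonneg)
  show ?thesis
  proof (cases "F = 0")
    case True
    have "dominated \<eta> f k0 x0 {}"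
      unfolding dominated_def g_def[symmetric]
    proof (intro ballI allI impI)
      fix \<xi> \<delta> assume "\<eta> \<le> \<delta>"
      then have "\<bar>conv (tk \<delta>) g \<xi>\<bar> \<le> c / \<delta> ^ ?n * (\<integral>y. \<bar>g y\<bar> \<partial>lborel)"
        using \<eta> by (intro conv_bound(1) tk_borel tk_le ig) auto
      then show "\<bar>conv (tk \<delta>) g \<xi>\<bar> \<le> AS * (\<Sum>p\<in>{}. cavg f p \<xi>)" using True gF by simp
    qed
    then show ?thesis using sparse_family_empty by blast
  next
    case False
    then have Fp: "F > 0" using F0 by simp
    have s0: "side k0 ^ ?n > 0" using side_pos by simp
    define t where "t = AS * F / side k0 ^ ?n"
    have t: "t > 0" using Fp AS_pos s0 by (simp add: t_def)
    have suppg: "g y \<noteq> 0 \<Longrightarrow> y \<in> dcube3 k0 x0" for y by (auto simp: g_def indicator_def split: if_splits)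
    define \<E> where "\<E> = {dcube k x |k x. k \<in> {k0..N} \<and> x \<in> ?Q \<and> gbad \<eta> g t k x}"
    have sE: "\<Union>\<E> \<in> sets borel" unfolding \<E>_def by (rule grand_maximal_weak_type(1)[OF ig suppg t \<eta>])
    have "emeasure lborel (\<Union>\<E>) \<le> ennreal (CG / t * (\<integral>y. \<bar>g y\<bar> \<partial>lborel))"
      unfolding \<E>_def by (rule grand_maximal_weak_type(2)[OF ig suppg t \<eta>])
    also have "CG / t * (\<integral>y. \<bar>g y\<bar> \<partial>lborel) = side k0 ^ ?n / 2 ^ (?n + 2)"
      unfolding gF t_def AS_def using Fp CG_pos by (simp add: field_simps)
    finally have eE: "emeasure lborel (\<Union>\<E>) \<le> ennreal (side k0 ^ ?n / 2 ^ (?n + 2))" .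
    have finE: "emeasure lborel (A \<inter> \<Union>\<E>) < \<infinity>" if "A \<in> sets borel" for A
      using le_less_trans[OF order_trans[OF emeasure_mono[of "A \<inter> \<Union>\<E>" "\<Union>\<E>" lborel] eE]] sE by simp
    have mE: "measure lborel (\<Union>\<E>) \<le> side k0 ^ ?n / 2 ^ (?n + 2)"
      unfolding measure_def using eE s0 by (intro enn2real_leI) auto
    \<comment> \<open>The threshold lies between two needs: small enough that a cube filled by the
      union has a bad parent, and large enough, against the measure bound 2^(-n-2), that the bad
      cubes cover at most half of the top cube.\<close>
    define bad where "bad k x \<longleftrightarrow> side k ^ ?n < 2 ^ (?n + 1) * measure lborel (dcube k x \<inter> \<Union>\<E>)" for k x
    have bc: "dyadic_pred bad"
      unfolding dyadic_pred_def
    proof (intro allI impI)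
      fix k x y assume "y \<in> dcube k (x::'a)"
      then show "bad k y = bad k x" using dblock_cong[of y k x 0] by (simp add: bad_def)
    qed
    have le: "k0 \<le> N" using kN by simp
    let ?lev = "stop_level bad k0 N" and ?cell = "stop_cube bad k0 N"
    have nb0: "\<not> bad k0 x" for x
    proof -
      have "measure lborel (dcube k0 x \<inter> \<Union>\<E>) \<le> measure lborel (\<Union>\<E>)"
        using sE finE[of UNIV] by (intro measure_mono_fmeasurable fmeasurableI) auto
      then have "2 ^ (?n + 1) * measure lborel (dcube k0 x \<inter> \<Union>\<E>) \<le> 2 ^ (?n + 1) * (side k0 ^ ?n / 2 ^ (?n + 2))"
        using mE by (intro mult_left_mono) auto
      also have "\<dots> = side k0 ^ ?n / 2" by simp
      finally show ?thesis using s0 by (simp add: bad_def)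
    qed
    have lev: "k0 < ?lev x" "?lev x \<le> N" for x
    proof -
      have "?lev x \<noteq> k0" using stop_level(3)[OF le, of bad x] nb0[of x] kN by auto
      then show "k0 < ?lev x" using stop_level(1)[OF le, of bad x] by linarith
      show "?lev x \<le> N" by (rule stop_level(2)[OF le])
    qed
    have cellQ: "?cell x \<subseteq> ?Q" if "x \<in> ?Q" for x
      using dcube_mono[of k0 "?lev x" x] lev(1)[of x] dblock_cong[OF that, of 0] by (simp add: stop_cube_def)
    \<comment> \<open>A \<open>gbad\<close> stopping cube would be contained in the union and fill
      the fraction 2^(-n) of its parent, so stopping would have occurred one level earlier.\<close>
    have notg: "\<not> gbad \<eta> g t (?lev x) x" if x: "x \<in> ?Q" for x
    proof
      assume gb: "gbad \<eta> g t (?lev x) x"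
      have "dcube (?lev x) x \<in> \<E>" unfolding \<E>_def using gb x lev[of x] by force
      then have "dcube (?lev x) x \<inter> \<Union>\<E> = dcube (?lev x) x" by blast
      moreover have "measure lborel (dcube (?lev x) x \<inter> \<Union>\<E>) \<le> measure lborel (dcube (?lev x - 1) x \<inter> \<Union>\<E>)"
        using sE finE[of "dcube (?lev x - 1) x"] dcube_mono[of "?lev x - 1" "?lev x" x]
        by (intro measure_mono_fmeasurable fmeasurableI) auto
      ultimately have "side (?lev x) ^ ?n \<le> measure lborel (dcube (?lev x - 1) x \<inter> \<Union>\<E>)"
        by (simp add: measure_dcube)
      moreover have "\<not> bad (?lev x - 1) x"
        using lev(1)[of x] by (intro stop_level(4)[OF le]) auto
      then have "2 ^ (?n + 1) * measure lborel (dcube (?lev x - 1) x \<inter> \<Union>\<E>) \<le> 2 ^ ?n * side (?lev x) ^ ?n"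
        by (simp add: bad_def side_Suc(2) power_mult_distrib)
      then have "2 * measure lborel (dcube (?lev x - 1) x \<inter> \<Union>\<E>) \<le> side (?lev x) ^ ?n" by simp
      moreover have "side (?lev x) ^ ?n > 0" using side_pos by simp
      ultimately show False by linarith
    qed
    define S where "S = {x \<in> ?Q. bad (?lev x) x}"
    define \<P> where "\<P> = ?cell ` S"
    have bdS: "bounded S" using bounded_dblock[of 0 k0 x0] by (rule bounded_subset) (auto simp: S_def)
    have finP: "finite \<P>" unfolding \<P>_def by (rule stop_cubes_finite[OF le bdS])
    have disP: "disjoint \<P>" unfolding \<P>_def by (rule stop_cubes_disjoint[OF bc le])
    have memP: "y \<in> P \<longleftrightarrow> P = ?cell y" if P: "P \<in> \<P>" for P y
    proof -
      obtain x where "P = ?cell x" using P by (auto simp: \<P>_def)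
      then show ?thesis using stop_cube_iff[OF bc le, where y=y and x=x] by auto
    qed
    have setsP: "\<Union>\<P> \<in> sets borel"
      using finP stop_cube_sets by (intro sets.finite_Union) (auto simp: \<P>_def)
    have PQ: "\<Union>\<P> \<subseteq> ?Q" using cellQ by (fastforce simp: \<P>_def S_def)
    have "emeasure lborel (\<Union>\<P>) \<le> ennreal (2 ^ (?n + 1)) * emeasure lborel (\<Union>\<E>)"
    proof (rule dense_dcubes_cover[OF finP _ sE])
      show "\<P> \<subseteq> {dcube k x |k x. True}" by (auto simp: \<P>_def stop_cube_def)
      fix P assume "P \<in> \<P>"
      then obtain x where x: "P = ?cell x" "bad (?lev x) x" by (auto simp: \<P>_def S_def)
      have "emeasure lborel P = ennreal (side (?lev x) ^ ?n)" by (simp add: x stop_cube_def emeasure_dcube)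
      also have "\<dots> \<le> ennreal (2 ^ (?n + 1) * measure lborel (P \<inter> \<Union>\<E>))"
        using x(2) unfolding x(1) stop_cube_def bad_def by (intro ennreal_leI) simp
      also have "\<dots> = ennreal (2 ^ (?n + 1)) * emeasure lborel (P \<inter> \<Union>\<E>)"
        using finE[of P] by (subst ennreal_mult) (auto simp: emeasure_eq_ennreal_measure x(1) stop_cube_def)
      finally show "emeasure lborel P \<le> ennreal (2 ^ (?n + 1)) * emeasure lborel (P \<inter> \<Union>\<E>)" .
    qed
    also have "\<dots> \<le> ennreal (2 ^ (?n + 1)) * ennreal (side k0 ^ ?n / 2 ^ (?n + 2))"
      using eE by (intro mult_left_mono) auto
    also have "\<dots> = ennreal (2 ^ (?n + 1) * (side k0 ^ ?n / 2 ^ (?n + 2)))"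
      using s0 by (intro ennreal_mult[symmetric]) auto
    also have "2 ^ (?n + 1) * (side k0 ^ ?n / 2 ^ (?n + 2)) = side k0 ^ ?n / 2" by simp
    finally have mP: "measure lborel (\<Union>\<P>) \<le> side k0 ^ ?n / 2"
      unfolding measure_def using s0 by (intro enn2real_leI) auto
    have "\<forall>P\<in>\<P>. \<exists>z. z \<in> S \<and> P = ?cell z" by (auto simp: \<P>_def)
    then obtain z where z: "\<forall>P\<in>\<P>. z P \<in> S \<and> P = ?cell (z P)" by metis
    have "\<forall>P. \<exists>I E. sparse_family (?lev (z P)) (z P) I E \<and> dominated \<eta> f (?lev (z P)) (z P) I"
      using IH lev by blast
    then obtain I' E' where IE: "\<forall>P. sparse_family (?lev (z P)) (z P) (I' P) (E' P) \<and> dominated \<eta> f (?lev (z P)) (z P) (I' P)"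
      by metis
    have sfam: "sparse_family (?lev (z P)) (z P) (I' P) (E' P)" and dom: "dominated \<eta> f (?lev (z P)) (z P) (I' P)" for P
      using IE by auto
    have PC: "P = dcube (?lev (z P)) (z P)" if "P \<in> \<P>" for P using z that by (simp add: stop_cube_def)
    define I where "I = insert (k0, x0) (\<Union>P\<in>\<P>. I' P)"
    \<comment> \<open>The subfamily to which p belongs is recovered from the stopping cell that
      contains its point.\<close>
    define E where "E p = (if p = (k0, x0) then ?Q - \<Union>\<P> else E' (?cell (snd p)) p)" for p
    have sub: "k0 < fst p" "snd p \<in> P" "?cell (snd p) = P" "E p = E' P p" "E p \<subseteq> P" "p \<noteq> (k0, x0)"
      if P: "P \<in> \<P>" and p: "p \<in> I' P" for P p
    proof -
      show k: "k0 < fst p" using sparse_familyD(3)[OF sfam p] lev(1)[of "z P"] by linarith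
      show s: "snd p \<in> P" using sparse_familyD(4)[OF sfam p] PC[OF P] by simp
      show ce: "?cell (snd p) = P" using memP[OF P, of "snd p"] s by simp
      show ne: "p \<noteq> (k0, x0)" using k by auto
      show e: "E p = E' P p" using ne ce by (simp add: E_def)
      have "dcube (fst p) (snd p) \<subseteq> dcube (?lev (z P)) (snd p)"
        by (rule dcube_mono[OF sparse_familyD(3)[OF sfam p]])
      also have "\<dots> = P" using dblock_cong[OF sparse_familyD(4)[OF sfam p], of 0] PC[OF P] by simp
      finally show "E p \<subseteq> P" using sparse_familyD(6)[OF sfam p] e by simp
    qed
    have finI: "finite I" unfolding I_def using finP sparse_familyD(1)[OF sfam] by auto
    have x0Q: "x0 \<in> ?Q" by (simp add: dblock_self)
    have "sparse_family k0 x0 I E"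
      unfolding sparse_family_def
    proof (intro conjI ballI finI)
      show "disjoint_family_on E I"
        unfolding disjoint_family_on_def
      proof (intro ballI impI)
        fix p q assume pq: "p \<in> I" "q \<in> I" "p \<noteq> q"
        show "E p \<inter> E q = {}"
        proof (cases "p = (k0, x0) \<or> q = (k0, x0)")
          case True
          then show ?thesis
          proof
            assume p: "p = (k0, x0)"
            then obtain P where "P \<in> \<P>" "q \<in> I' P" using pq by (auto simp: I_def)
            then have "E q \<subseteq> \<Union>\<P>" using sub(5) by blast
            then show ?thesis using p by (auto simp: E_def)
          next
            assume q: "q = (k0, x0)"
            then obtain P where "P \<in> \<P>" "p \<in> I' P" using pq by (auto simp: I_def)
            then have "E p \<subseteq> \<Union>\<P>" using sub(5) by blast
            then show ?thesis using q by (auto simp: E_def)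
          qed
        next
          case False
          then obtain P R where PR: "P \<in> \<P>" "p \<in> I' P" "R \<in> \<P>" "q \<in> I' R" using pq by (auto simp: I_def)
          show ?thesis
          proof (cases "P = R")
            case True
            then show ?thesis using sparse_familyD(2)[OF sfam[of P]] PR pq(3) sub(4)[OF PR(1,2)] sub(4)[OF PR(3,4)]
              by (simp add: disjoint_family_on_def)
          next
            case False
            then have "P \<inter> R = {}" using disP PR by (simp add: disjoint_def)
            then show ?thesis using sub(5)[OF PR(1,2)] sub(5)[OF PR(3,4)] by blast
          qed
        qed
      qed
      fix p assume p: "p \<in> I"
      consider (top) "p = (k0, x0)" | (below) P where "P \<in> \<P>" "p \<in> I' P" using p by (auto simp: I_def)
      then have "k0 \<le> fst p \<and> snd p \<in> ?Q \<and> E p \<in> sets borel \<and> E p \<subseteq> dcube (fst p) (snd p)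
          \<and> side (fst p) ^ ?n \<le> 2 * measure lborel (E p)"
      proof cases
        case top
        have "measure lborel (?Q - \<Union>\<P>) = measure lborel ?Q - measure lborel (\<Union>\<P>)"
          using setsP PQ by (intro measure_Diff) (auto simp: emeasure_dcube)
        then have "side k0 ^ ?n \<le> 2 * measure lborel (?Q - \<Union>\<P>)" using mP by (simp add: measure_dcube)
        then show ?thesis using top x0Q setsP by (auto simp: E_def)
      next
        case below
        then have "snd p \<in> ?Q" using sub(2) PQ by blast
        then show ?thesis
          using below sparse_familyD(5-7)[OF sfam below(2)] sub(1,4)[OF below] by simp
      qed
      then show "k0 \<le> fst p" "snd p \<in> ?Q" "E p \<in> sets borel" "E p \<subseteq> dcube (fst p) (snd p)"
        "side (fst p) ^ ?n \<le> 2 * measure lborel (E p)" by blast+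
    qed
    moreover have "dominated \<eta> f k0 x0 I"
      unfolding dominated_def g_def[symmetric]
    proof (intro ballI allI impI)
      fix \<xi> \<delta> assume \<xi>: "\<xi> \<in> ?Q" and \<delta>: "\<eta> \<le> \<delta>"
      let ?k = "?lev \<xi>"
      have d0: "\<delta> > 0" using \<delta> \<eta> by simp
      have s3: "dcube3 ?k \<xi> \<subseteq> dcube3 k0 x0"
        using dcube3_mono[of k0 ?k \<xi>] lev(1)[of \<xi>] dblock_cong[OF \<xi>, of 1] by simp
      have "g = (\<lambda>y. indicator (- dcube3 ?k \<xi>) y * g y + indicator (dcube3 ?k \<xi>) y * f y)"
        using s3 by (auto simp: g_def indicator_def fun_eq_iff)
      then have "conv (tk \<delta>) g \<xi> = conv (tk \<delta>) (\<lambda>y. indicator (- dcube3 ?k \<xi>) y * g y + indicator (dcube3 ?k \<xi>) y * f y) \<xi>"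
        by (rule arg_cong)
      also have "\<dots> = conv (tk \<delta>) (\<lambda>y. indicator (- dcube3 ?k \<xi>) y * g y) \<xi> + conv (tk \<delta>) (\<lambda>y. indicator (dcube3 ?k \<xi>) y * f y) \<xi>"
        by (rule conv_add_right[OF tk_borel tk_le[OF d0] integrable_indicator_mult[OF ig] ifA]) auto
      finally have "\<bar>conv (tk \<delta>) g \<xi>\<bar> \<le> \<bar>conv (tk \<delta>) (\<lambda>y. indicator (- dcube3 ?k \<xi>) y * g y) \<xi>\<bar>
          + \<bar>conv (tk \<delta>) (\<lambda>y. indicator (dcube3 ?k \<xi>) y * f y) \<xi>\<bar>" by simp
      moreover have "\<bar>conv (tk \<delta>) (\<lambda>y. indicator (- dcube3 ?k \<xi>) y * g y) \<xi>\<bar> \<le> t"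
      proof (rule ccontr)
        assume "\<not> ?thesis"
        then have "gbad \<eta> g t ?k \<xi>" unfolding gbad_def using \<delta> by (intro bexI[of _ \<xi>] exI[of _ \<delta>]) (auto simp: dblock_self)
        then show False using notg[OF \<xi>] by simp
      qed
      moreover have "t = AS * cavg f (k0, x0) \<xi>" using \<xi> by (simp add: t_def cavg_def F_def)
      ultimately have main: "\<bar>conv (tk \<delta>) g \<xi>\<bar> \<le> AS * cavg f (k0, x0) \<xi> + \<bar>conv (tk \<delta>) (\<lambda>y. indicator (dcube3 ?k \<xi>) y * f y) \<xi>\<bar>"
        by linarith
      show "\<bar>conv (tk \<delta>) g \<xi>\<bar> \<le> AS * (\<Sum>p\<in>I. cavg f p \<xi>)"
      proof (cases "bad ?k \<xi>")
        case False
        \<comment> \<open>Only the cap can stop at a cube that is not bad; at level N the inner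
          contribution vanishes and the top term alone suffices.\<close>
        then have "?k = N" using stop_level(3)[OF le, of bad \<xi>] by simp
        then have "conv (tk \<delta>) (\<lambda>y. indicator (dcube3 ?k \<xi>) y * f y) \<xi> = 0"
          using local_trunc_zero[OF N \<delta>, of \<xi> \<xi> f] by (simp add: dblock_self)
        moreover have "cavg f (k0, x0) \<xi> \<le> (\<Sum>p\<in>I. cavg f p \<xi>)"
          using finI cavg_nonneg by (intro member_le_sum) (auto simp: I_def)
        then have "AS * cavg f (k0, x0) \<xi> \<le> AS * (\<Sum>p\<in>I. cavg f p \<xi>)" using AS_pos by (intro mult_left_mono) auto
        ultimately show ?thesis using main by simp
      next
        case True
        let ?P = "?cell \<xi>"
        have P: "?P \<in> \<P>" using True \<xi> by (auto simp: \<P>_def S_def)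
        have zz: "\<xi> \<in> ?cell (z ?P)" using z P stop_cube_self[of \<xi> bad k0 N] by auto
        have lz: "?lev (z ?P) = ?k" using stop_level_cong[OF bc le zz] by simp
        have \<xi>z: "\<xi> \<in> dcube (?lev (z ?P)) (z ?P)" using zz by (simp add: stop_cube_def)
        have "dcube3 ?k \<xi> = dcube3 (?lev (z ?P)) (z ?P)" using dblock_cong[OF \<xi>z, of 1] lz by simp
        then have "\<bar>conv (tk \<delta>) (\<lambda>y. indicator (dcube3 ?k \<xi>) y * f y) \<xi>\<bar> \<le> AS * (\<Sum>p\<in>I' ?P. cavg f p \<xi>)"
          using dom[of ?P] \<xi>z \<delta> by (simp add: dominated_def)
        then have "\<bar>conv (tk \<delta>) g \<xi>\<bar> \<le> AS * (cavg f (k0, x0) \<xi> + (\<Sum>p\<in>I' ?P. cavg f p \<xi>))"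
          using main by (simp add: distrib_left)
        also have "cavg f (k0, x0) \<xi> + (\<Sum>p\<in>I' ?P. cavg f p \<xi>) = (\<Sum>p\<in>insert (k0, x0) (I' ?P). cavg f p \<xi>)"
          using sparse_familyD(1)[OF sfam[of ?P]] sub(6)[OF P] by (subst sum.insert) auto
        also have "\<dots> \<le> (\<Sum>p\<in>I. cavg f p \<xi>)"
          using finI P cavg_nonneg by (intro sum_mono2) (auto simp: I_def)
        finally show ?thesis using AS_pos by (simp add: mult_left_mono)
      qed
    qed
    ultimately show ?thesis by blast
  qed
qed

text \<open>Recursion on the distance of the level to N, with N so fine that the empty family works
  there.\<close>

theorem sparse_domination:
  fixes f :: "'a \<Rightarrow> real"
  assumes f: "integrable lborel f" and \<eta>: "\<eta> > 0"
  shows "\<exists>I E. sparse_family k0 x0 I E \<and> dominated \<eta> f k0 x0 I"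
proof -
  obtain N where N: "N \<ge> k0" "2 * DIM('a) * side N < \<eta>"
    using exists_small_side[OF \<eta>, of k0 "2 * DIM('a)"] by auto
  have "k \<le> N \<Longrightarrow> \<exists>I E. sparse_family k x I E \<and> dominated \<eta> f k x I" for k x
  proof (induction "nat (N - k)" arbitrary: k x rule: less_induct)
    case less
    show ?case
    proof (cases "k = N")
      case True
      have "dominated \<eta> f k x {}" unfolding dominated_def True
        using local_trunc_zero[of N \<eta>] N(2) by simp
      then show ?thesis using sparse_family_empty by blast
    next
      case False
      show ?thesis
      proof (rule sparse_domination_step[OF f \<eta>, of N])
        fix k' x' assume "k < k'" "k' \<le> N"
        then show "\<exists>I E. sparse_family k' x' I E \<and> dominated \<eta> f k' x' I" by (intro less.hyps) auto
      qed (use N less.prems False in auto)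
    qed
  qed
  then show ?thesis using N(1) by blast
qed

end

section \<open>Weighted estimates for sparse operators\<close>

lemma sum_powr_int_le:
  fixes s :: real
  assumes "finite K" "\<And>k. k \<in> K \<Longrightarrow> k \<le> m" "s > 0"
  shows "(\<Sum>k\<in>K. 2 powr (s * of_int k)) \<le> 2 powr (s * of_int m) / (1 - 2 powr (- s))"
proof -
  let ?q = "2 powr (- s)"
  have q: "0 < ?q" "?q < 1" using assms(3) powr_less_mono[of "- s" 0 "2::real"] by auto
  have "(\<Sum>k\<in>K. 2 powr (s * of_int k)) = (\<Sum>k\<in>K. 2 powr (s * of_int m) * ?q ^ nat (m - k))"
  proof (rule sum.cong[OF refl])
    fix k assume "k \<in> K"
    then have k: "k \<le> m" using assms(2) by simp
    have "?q ^ nat (m - k) = ?q powr (real (nat (m - k)))" by (rule powr_realpow[symmetric]) simp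
    also have "\<dots> = 2 powr (- s * (of_int m - of_int k))" using k by (simp add: powr_powr)
    finally show "2 powr (s * of_int k) = 2 powr (s * of_int m) * ?q ^ nat (m - k)"
      by (simp add: powr_add[symmetric] algebra_simps)
  qed
  also have "\<dots> = 2 powr (s * of_int m) * (\<Sum>i\<in>(\<lambda>k. nat (m - k)) ` K. ?q ^ i)"
    using assms(2) by (subst sum.reindex) (auto simp: inj_on_def eq_nat_nat_iff sum_distrib_left)
  also have "\<dots> \<le> 2 powr (s * of_int m) * (1 / (1 - ?q))"
  proof (rule mult_left_mono)
    have "(\<Sum>i\<in>(\<lambda>k. nat (m - k)) ` K. ?q ^ i) \<le> (\<Sum>i. ?q ^ i)"
      using assms(1) q by (intro sum_le_suminf finite_imageI) (auto simp: summable_geometric)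
    then show "(\<Sum>i\<in>(\<lambda>k. nat (m - k)) ` K. ?q ^ i) \<le> 1 / (1 - ?q)"
      using q by (subst (asm) suminf_geometric) auto
  qed simp
  finally show ?thesis by simp
qed

text \<open>Compare y with 2 C x: whichever is larger carries the product. The coefficient 1/2 in
  front of y^p is what allows this term to be absorbed.\<close>

lemma absorb_powr:
  fixes x y C p :: real
  assumes "0 \<le> x" "0 \<le> y" "C > 0" "p > 1"
  shows "C * x * y powr (p - 1) \<le> (2 * C) powr p / 2 * x powr p + y powr p / 2"
proof -
  have pw: "z * z powr (p - 1) = z powr p" if "z \<ge> 0" for z :: real
    using that assms(4) by (cases "z = 0") (simp_all add: powr_mult_base)
  have "(2 * C * x) * y powr (p - 1) \<le> (2 * C * x) powr p + y powr p"
  proof (cases "y \<le> 2 * C * x")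
    case True
    then have "(2 * C * x) * y powr (p - 1) \<le> (2 * C * x) * (2 * C * x) powr (p - 1)"
      using assms by (intro mult_left_mono powr_mono2) auto
    also have "\<dots> = (2 * C * x) powr p" using assms by (intro pw) auto
    finally show ?thesis using powr_ge_zero[of y p] by linarith
  next
    case False
    then have "(2 * C * x) * y powr (p - 1) \<le> y * y powr (p - 1)" by (intro mult_right_mono) auto
    also have "\<dots> = y powr p" using assms by (intro pw) auto
    finally show ?thesis using powr_ge_zero[of "2 * C * x" p] by linarith
  qed
  moreover have "(2 * C * x) powr p = (2 * C) powr p * x powr p" using assms by (simp add: powr_mult)
  ultimately show ?thesis by simp
qed

text \<open>The factor 2^p pays for rounding the coefficients to powers of two; the second factor is
  (2 C)^p from the absorption, with C the sum of a geometric series of ratio 2^(-(p-1)).\<close>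

definition carleson_const :: "real \<Rightarrow> real" where
  "carleson_const p = 2 powr p * (2 * (1 / (1 - 2 powr (- (p - 1))))) powr p"

lemma carleson_const_pos: "p > 1 \<Longrightarrow> carleson_const p > 0"
  using powr_less_mono[of "- (p - 1)" 0 "2::real"] unfolding carleson_const_def
  by (intro mult_pos_pos) auto

text \<open>Dyadic layer cake instead of an integral: only finitely many levels \<open>2\<^sup>k\<close> occur, and \<open>\<Phi>\<close>
  stands for the \<open>p\<close>-th power of the maximal function.\<close>
theorem carleson_embedding:
  fixes g :: "'a \<Rightarrow> real" and a :: "'i \<Rightarrow> real"
  assumes p: "p > 1" and I: "finite I" and P: "\<And>i. i \<in> I \<Longrightarrow> P i \<in> sets \<nu>"
    and E: "\<And>i. i \<in> I \<Longrightarrow> E i \<in> sets \<nu>" "\<And>i. i \<in> I \<Longrightarrow> E i \<subseteq> P i" "disjoint_family_on E I"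
    and lam: "laminar (P ` I)" and fin: "\<And>i. i \<in> I \<Longrightarrow> emeasure \<nu> (P i) < \<infinity>"
    and g[measurable]: "g \<in> borel_measurable \<nu>" and g0: "\<And>x. 0 \<le> g x"
    and a0: "\<And>i. i \<in> I \<Longrightarrow> 0 \<le> a i"
    and a: "\<And>i. i \<in> I \<Longrightarrow> ennreal (a i) * emeasure \<nu> (P i) \<le> (\<integral>\<^sup>+x. ennreal (g x) * indicator (P i) x \<partial>\<nu>)"
  shows "(\<Sum>i\<in>I. ennreal (a i powr p) * emeasure \<nu> (E i)) \<le> ennreal (carleson_const p) * (\<integral>\<^sup>+x. ennreal (g x powr p) \<partial>\<nu>)"
proof -
  \<comment> \<open>The largest integer with 2^(lv i) strictly below a_i. Strictness places the cube
    of i in the superlevel set of its own level.\<close>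
  define lv where "lv i = \<lceil>log 2 (a i)\<rceil> - 1" for i
  have lv: "2 powr (of_int (lv i)) < a i" "a i \<le> 2 powr (of_int (lv i) + 1)" if "a i > 0" for i
  proof -
    have "of_int (lv i) < log 2 (a i)" "log 2 (a i) \<le> of_int (lv i) + 1" unfolding lv_def by linarith+
    then show "2 powr (of_int (lv i)) < a i" "a i \<le> 2 powr (of_int (lv i) + 1)"
      using that by (auto simp: less_log_iff log_le_iff)
  qed
  define K where "K = lv ` {i\<in>I. a i > 0}"
  have finK: "finite K" using I by (simp add: K_def)
  define \<Omega> where "\<Omega> k = \<Union>(P ` {i\<in>I. 2 powr (of_int k) < a i})" for k :: int
  have [measurable]: "\<Omega> k \<in> sets \<nu>" for k unfolding \<Omega>_def using I P by auto
  \<comment> \<open>Doob's maximal inequality in its integral form: by laminarity the constant is 1,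
    and the integral extends over the superlevel set only.\<close>
  have weak: "ennreal (2 powr of_int k) * emeasure \<nu> (\<Omega> k) \<le> (\<integral>\<^sup>+x. ennreal (g x) * indicator (\<Omega> k) x \<partial>\<nu>)" for k
  proof -
    let ?N = "density \<nu> (\<lambda>x. ennreal (g x))" and ?c = "2 powr (of_int k) :: real"
    have "emeasure \<nu> (\<Omega> k) \<le> ennreal (1 / ?c) * emeasure ?N (\<Omega> k)"
      unfolding \<Omega>_def
    proof (rule laminar_emeasure_le)
      show "finite (P ` {i\<in>I. ?c < a i})" using I by auto
      show "laminar (P ` {i\<in>I. ?c < a i})" by (rule laminar_subset[OF lam]) auto
      show "P ` {i\<in>I. ?c < a i} \<subseteq> sets \<nu>" using P by auto
      fix A assume "A \<in> P ` {i\<in>I. ?c < a i}"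
      then obtain i where i: "i \<in> I" "?c < a i" "A = P i" by auto
      have "emeasure \<nu> A = ennreal (1 / ?c) * (ennreal ?c * emeasure \<nu> A)"
        by (simp add: mult.assoc[symmetric] ennreal_mult[symmetric])
      also have "\<dots> \<le> ennreal (1 / ?c) * (ennreal (a i) * emeasure \<nu> A)"
        using i by (intro mult_left_mono mult_right_mono ennreal_leI) auto
      also have "\<dots> \<le> ennreal (1 / ?c) * (\<integral>\<^sup>+x. ennreal (g x) * indicator (P i) x \<partial>\<nu>)"
        using a[OF i(1)] i by (intro mult_left_mono) auto
      also have "\<dots> = ennreal (1 / ?c) * emeasure ?N A" using P i by (simp add: emeasure_density)
      finally show "emeasure \<nu> A \<le> ennreal (1 / ?c) * emeasure ?N A" .
    qed simp
    then have "ennreal ?c * emeasure \<nu> (\<Omega> k) \<le> ennreal ?c * (ennreal (1 / ?c) * emeasure ?N (\<Omega> k))"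
      by (intro mult_left_mono) auto
    also have "\<dots> = emeasure ?N (\<Omega> k)" by (simp add: mult.assoc[symmetric] ennreal_mult[symmetric])
    finally show ?thesis by (simp add: emeasure_density)
  qed
  \<comment> \<open>Finiteness of the measures makes the integral of \<Phi> finite, which the
    absorption below requires.\<close>
  have finO: "emeasure \<nu> (\<Omega> k) < \<infinity>" for k
  proof -
    have "emeasure \<nu> (\<Omega> k) \<le> (\<Sum>i\<in>{i\<in>I. 2 powr (of_int k) < a i}. emeasure \<nu> (P i))"
      unfolding \<Omega>_def using I P by (intro emeasure_subadditive_finite) auto
    also have "\<dots> < \<infinity>" using I fin by auto
    finally show ?thesis .
  qed
  \<comment> \<open>With M the maximal function of the averages, \<Phi> stands for M^p and \<Psi>
    for M^(p-1); both are finite sums over the levels that occur.\<close>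
  define \<Phi> where "\<Phi> x = (\<Sum>k\<in>K. 2 powr (p * of_int k) * indicator (\<Omega> k) x :: real)" for x
  define \<Psi> where "\<Psi> x = (\<Sum>k\<in>K. 2 powr ((p - 1) * of_int k) * indicator (\<Omega> k) x :: real)" for x
  have [measurable]: "\<Phi> \<in> borel_measurable \<nu>" "\<Psi> \<in> borel_measurable \<nu>"
    unfolding \<Phi>_def[abs_def] \<Psi>_def[abs_def] by measurable
  have \<Phi>0: "\<Phi> x \<ge> 0" for x unfolding \<Phi>_def by (intro sum_nonneg) auto
  have \<Psi>0: "\<Psi> x \<ge> 0" for x unfolding \<Psi>_def by (intro sum_nonneg) auto
  have member: "2 powr (p * of_int k) \<le> \<Phi> x" if k: "k \<in> K" and x: "x \<in> \<Omega> k" for k x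
  proof -
    have "2 powr (p * of_int k) * indicator (\<Omega> k) x \<le> \<Phi> x"
      unfolding \<Phi>_def using k finK by (intro member_le_sum[where f="\<lambda>k. 2 powr (p * of_int k) * indicator (\<Omega> k) x"]) auto
    then show ?thesis using x by simp
  qed
  have 1: "(\<Sum>i\<in>I. ennreal (a i powr p) * emeasure \<nu> (E i)) \<le> ennreal (2 powr p) * (\<integral>\<^sup>+x. ennreal (\<Phi> x) \<partial>\<nu>)"
  proof -
    have "(\<Sum>i\<in>I. ennreal (a i powr p) * emeasure \<nu> (E i)) = (\<Sum>i\<in>I. \<integral>\<^sup>+x. ennreal (a i powr p) * indicator (E i) x \<partial>\<nu>)"
      using E(1) by (intro sum.cong refl) (simp add: nn_integral_cmult)
    also have "\<dots> = (\<integral>\<^sup>+x. (\<Sum>i\<in>I. ennreal (a i powr p) * indicator (E i) x) \<partial>\<nu>)"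
      using E(1) by (intro nn_integral_sum[symmetric]) auto
    also have "\<dots> \<le> (\<integral>\<^sup>+x. ennreal (2 powr p) * ennreal (\<Phi> x) \<partial>\<nu>)"
    proof (rule nn_integral_mono)
      fix x
      show "(\<Sum>i\<in>I. ennreal (a i powr p) * indicator (E i) x) \<le> ennreal (2 powr p) * ennreal (\<Phi> x)"
      proof (cases "\<exists>i\<in>I. x \<in> E i \<and> a i > 0")
        case True
        then obtain i where i: "i \<in> I" "x \<in> E i" "a i > 0" by blast
        have "(\<Sum>j\<in>I. ennreal (a j powr p) * indicator (E j) x) = ennreal (a i powr p) * indicator (E i) x"
        proof -
          have "ennreal (a j powr p) * indicator (E j) x = 0" if "j \<in> I - {i}" for j
            using E(3) i that by (auto simp: disjoint_family_on_def indicator_def)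
          then have "(\<Sum>j\<in>I - {i}. ennreal (a j powr p) * indicator (E j) x) = 0" by (intro sum.neutral) blast
          then show ?thesis using sum.remove[OF I i(1), of "\<lambda>j. ennreal (a j powr p) * indicator (E j) x"] by simp
        qed
        also have "\<dots> = ennreal (a i powr p)" using i by simp
        also have "\<dots> \<le> ennreal (2 powr p * \<Phi> x)"
        proof (rule ennreal_leI)
          have "x \<in> \<Omega> (lv i)" unfolding \<Omega>_def using i lv(1)[OF i(3)] E(2) by auto
          then have m: "2 powr (p * of_int (lv i)) \<le> \<Phi> x" using i by (intro member) (auto simp: K_def)
          have "a i powr p \<le> (2 powr (of_int (lv i) + 1)) powr p" using lv(2)[OF i(3)] i p by (intro powr_mono2) auto
          also have "\<dots> = 2 powr p * 2 powr (p * of_int (lv i))" by (simp add: powr_powr powr_add[symmetric] algebra_simps)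
          also have "\<dots> \<le> 2 powr p * \<Phi> x" using m by (intro mult_left_mono) auto
          finally show "a i powr p \<le> 2 powr p * \<Phi> x" .
        qed
        also have "\<dots> = ennreal (2 powr p) * ennreal (\<Phi> x)" using \<Phi>0 by (intro ennreal_mult) auto
        finally show ?thesis .
      next
        case False
        then have "ennreal (a i powr p) * indicator (E i) x = 0" if "i \<in> I" for i
          using a0[OF that] that by (cases "x \<in> E i") auto
        then have "(\<Sum>i\<in>I. ennreal (a i powr p) * indicator (E i) x) = 0" by (intro sum.neutral) blast
        then show ?thesis by simp
      qed
    qed
    also have "\<dots> = ennreal (2 powr p) * (\<integral>\<^sup>+x. ennreal (\<Phi> x) \<partial>\<nu>)" by (rule nn_integral_cmult) measurable
    finally show ?thesis .
  qed
  have intPhi: "(\<integral>\<^sup>+x. ennreal (\<Phi> x) \<partial>\<nu>) = (\<Sum>k\<in>K. ennreal (2 powr (p * of_int k)) * emeasure \<nu> (\<Omega> k))"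
  proof -
    have "(\<integral>\<^sup>+x. ennreal (\<Phi> x) \<partial>\<nu>) = (\<integral>\<^sup>+x. (\<Sum>k\<in>K. ennreal (2 powr (p * of_int k)) * indicator (\<Omega> k) x) \<partial>\<nu>)"
      unfolding \<Phi>_def by (intro nn_integral_cong) (subst sum_ennreal[symmetric], auto simp: ennreal_mult ennreal_indicator)
    also have "\<dots> = (\<Sum>k\<in>K. \<integral>\<^sup>+x. ennreal (2 powr (p * of_int k)) * indicator (\<Omega> k) x \<partial>\<nu>)"
      by (intro nn_integral_sum) measurable
    also have "\<dots> = (\<Sum>k\<in>K. ennreal (2 powr (p * of_int k)) * emeasure \<nu> (\<Omega> k))"
      by (intro sum.cong refl nn_integral_cmult_indicator) measurable
    finally show ?thesis .
  qed
  have finPhi: "(\<integral>\<^sup>+x. ennreal (\<Phi> x) \<partial>\<nu>) < \<infinity>"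
    unfolding intPhi using finK finO by (auto simp: ennreal_mult_less_top)
  define C where "C = 1 / (1 - 2 powr (- (p - 1)))"
  have C: "C > 0" using p powr_less_mono[of "- (p - 1)" 0 "2::real"] by (simp add: C_def)
  \<comment> \<open>Splitting 2^(pk) into 2^((p-1)k) and 2^k, the weak type inequality is applied to
    the second factor at each level and then summed.\<close>
  have 2: "(\<integral>\<^sup>+x. ennreal (\<Phi> x) \<partial>\<nu>) \<le> (\<integral>\<^sup>+x. ennreal (g x * \<Psi> x) \<partial>\<nu>)"
  proof -
    have "(\<integral>\<^sup>+x. ennreal (\<Phi> x) \<partial>\<nu>) = (\<Sum>k\<in>K. ennreal (2 powr ((p - 1) * of_int k)) * (ennreal (2 powr of_int k) * emeasure \<nu> (\<Omega> k)))"
      unfolding intPhi mult.assoc[symmetric]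
      by (intro sum.cong refl) (simp add: ennreal_mult[symmetric] powr_add[symmetric] algebra_simps)
    also have "\<dots> \<le> (\<Sum>k\<in>K. ennreal (2 powr ((p - 1) * of_int k)) * (\<integral>\<^sup>+x. ennreal (g x) * indicator (\<Omega> k) x \<partial>\<nu>))"
      by (intro sum_mono mult_left_mono weak) auto
    also have "\<dots> = (\<Sum>k\<in>K. \<integral>\<^sup>+x. ennreal (2 powr ((p - 1) * of_int k)) * (ennreal (g x) * indicator (\<Omega> k) x) \<partial>\<nu>)"
      by (intro sum.cong refl nn_integral_cmult[symmetric]) measurable
    also have "\<dots> = (\<integral>\<^sup>+x. (\<Sum>k\<in>K. ennreal (2 powr ((p - 1) * of_int k)) * (ennreal (g x) * indicator (\<Omega> k) x)) \<partial>\<nu>)"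
      by (intro nn_integral_sum[symmetric]) measurable
    also have "\<dots> = (\<integral>\<^sup>+x. ennreal (g x * \<Psi> x) \<partial>\<nu>)"
    proof (intro nn_integral_cong)
      fix x
      have "(\<Sum>k\<in>K. ennreal (2 powr ((p - 1) * of_int k)) * (ennreal (g x) * indicator (\<Omega> k) x))
        = (\<Sum>k\<in>K. ennreal (g x * (2 powr ((p - 1) * of_int k) * indicator (\<Omega> k) x)))"
        using g0 by (intro sum.cong refl) (auto simp: ennreal_mult[symmetric] indicator_def mult.commute)
      also have "\<dots> = ennreal (g x * \<Psi> x)"
        using g0 unfolding \<Psi>_def sum_distrib_left by (intro sum_ennreal) auto
      finally show "(\<Sum>k\<in>K. ennreal (2 powr ((p - 1) * of_int k)) * (ennreal (g x) * indicator (\<Omega> k) x)) = ennreal (g x * \<Psi> x)" .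
    qed
    finally show ?thesis .
  qed
  \<comment> \<open>At a given point \<Psi> is a geometric sum dominated by its top level, and that
    level alone is bounded by a power of \<Phi>; \<open>absorb_powr\<close> separates g from
    \<Phi>.\<close>
  have 3: "g x * \<Psi> x \<le> (2 * C) powr p / 2 * g x powr p + \<Phi> x / 2" for x
  proof -
    have "\<Psi> x \<le> C * (\<Phi> x powr (1 / p)) powr (p - 1)"
    proof (cases "{k\<in>K. x \<in> \<Omega> k} = {}")
      case True
      then have "\<Psi> x = 0" unfolding \<Psi>_def by (intro sum.neutral) auto
      then show ?thesis using C by simp
    next
      case False
      let ?K = "{k\<in>K. x \<in> \<Omega> k}" and ?m = "Max {k\<in>K. x \<in> \<Omega> k}"
      have fK: "finite ?K" using finK by simp
      have m: "?m \<in> ?K" by (rule Max_in[OF fK False])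
      have "\<Psi> x = (\<Sum>k\<in>?K. 2 powr ((p - 1) * of_int k))"
        unfolding \<Psi>_def using finK by (intro sum.mono_neutral_cong_right) (auto simp: indicator_def)
      also have "\<dots> \<le> 2 powr ((p - 1) * of_int ?m) / (1 - 2 powr (- (p - 1)))"
        using fK p by (intro sum_powr_int_le) auto
      also have "\<dots> = C * (2 powr (p * of_int ?m)) powr ((p - 1) / p)"
        using p by (simp add: C_def powr_powr mult.commute)
      also have "\<dots> \<le> C * \<Phi> x powr ((p - 1) / p)"
        using member[of ?m x] m C p by (intro mult_left_mono powr_mono2) auto
      also have "\<dots> = C * (\<Phi> x powr (1 / p)) powr (p - 1)" by (simp add: powr_powr)
      finally show ?thesis .
    qed
    then have "g x * \<Psi> x \<le> C * g x * (\<Phi> x powr (1 / p)) powr (p - 1)"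
      using g0[of x] mult_left_mono[of "\<Psi> x" "C * (\<Phi> x powr (1 / p)) powr (p - 1)" "g x"] by (simp add: mult_ac)
    also have "\<dots> \<le> (2 * C) powr p / 2 * g x powr p + (\<Phi> x powr (1 / p)) powr p / 2"
      using g0 C p by (intro absorb_powr) auto
    also have "(\<Phi> x powr (1 / p)) powr p = \<Phi> x" using p \<Phi>0 by (simp add: powr_powr)
    finally show ?thesis .
  qed
  let ?G = "\<integral>\<^sup>+x. ennreal (g x powr p) \<partial>\<nu>" and ?D = "(2 * C) powr p"
  \<comment> \<open>Half of the integral of \<Phi> on the right is moved to the left.\<close>
  have 4: "(\<integral>\<^sup>+x. ennreal (\<Phi> x) \<partial>\<nu>) \<le> ennreal ?D * ?G"
  proof -
    have "(\<integral>\<^sup>+x. ennreal (\<Phi> x) \<partial>\<nu>) \<le> (\<integral>\<^sup>+x. ennreal (?D / 2) * ennreal (g x powr p) + ennreal (1 / 2) * ennreal (\<Phi> x) \<partial>\<nu>)"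
    proof (rule order_trans[OF 2 nn_integral_mono])
      fix x
      have "ennreal (g x * \<Psi> x) \<le> ennreal (?D / 2 * g x powr p + 1 / 2 * \<Phi> x)"
        using 3[of x] by (intro ennreal_leI) simp
      also have "\<dots> = ennreal (?D / 2 * g x powr p) + ennreal (1 / 2 * \<Phi> x)"
        using \<Phi>0[of x] by (intro ennreal_plus) auto
      also have "ennreal (?D / 2 * g x powr p) = ennreal (?D / 2) * ennreal (g x powr p)" by (intro ennreal_mult) auto
      also have "ennreal (1 / 2 * \<Phi> x) = ennreal (1 / 2) * ennreal (\<Phi> x)" using \<Phi>0[of x] by (intro ennreal_mult) auto
      finally show "ennreal (g x * \<Psi> x) \<le> ennreal (?D / 2) * ennreal (g x powr p) + ennreal (1 / 2) * ennreal (\<Phi> x)" .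
    qed
    also have "\<dots> = ennreal (?D / 2) * ?G + ennreal (1 / 2) * (\<integral>\<^sup>+x. ennreal (\<Phi> x) \<partial>\<nu>)"
      by (subst nn_integral_add) (auto simp: nn_integral_cmult)
    finally have le: "(\<integral>\<^sup>+x. ennreal (\<Phi> x) \<partial>\<nu>) \<le> ennreal (?D / 2) * ?G + ennreal (1 / 2) * (\<integral>\<^sup>+x. ennreal (\<Phi> x) \<partial>\<nu>)" .
    obtain X where X: "(\<integral>\<^sup>+x. ennreal (\<Phi> x) \<partial>\<nu>) = ennreal X" "X \<ge> 0"
      using finPhi by (cases "\<integral>\<^sup>+x. ennreal (\<Phi> x) \<partial>\<nu>") auto
    show ?thesis
    proof (cases ?G)
      case (real Y)
      have "ennreal (?D / 2 * Y + 1 / 2 * X) = ennreal (?D / 2) * ennreal Y + ennreal (1 / 2) * ennreal X"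

      proof -
        have "ennreal (?D / 2 * Y) = ennreal (?D / 2) * ennreal Y" "ennreal (1 / 2 * X) = ennreal (1 / 2) * ennreal X"
          using X(2) real(1) by (intro ennreal_mult; simp)+
        moreover have "ennreal (?D / 2 * Y + 1 / 2 * X) = ennreal (?D / 2 * Y) + ennreal (1 / 2 * X)"
          using X(2) real(1) by (intro ennreal_plus) auto
        ultimately show ?thesis by (simp only:)
      qed
      then have "ennreal X \<le> ennreal (?D / 2 * Y + 1 / 2 * X)"
        using le unfolding X(1) real(2) by (simp only:)
      then have "X \<le> ?D / 2 * Y + 1 / 2 * X" using X(2) real(1) by (subst (asm) ennreal_le_iff) auto
      then have "X \<le> ?D * Y" by simp
      then show ?thesis unfolding X(1) real(2) using real(1) by (simp add: ennreal_mult[symmetric] ennreal_leI)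
    next
      case top
      then show ?thesis using C by (simp add: ennreal_mult_top)
    qed
  qed
  have "ennreal (2 powr p) * (\<integral>\<^sup>+x. ennreal (\<Phi> x) \<partial>\<nu>) \<le> ennreal (2 powr p) * (ennreal ?D * ?G)"
    using 4 by (intro mult_left_mono) auto
  also have "\<dots> = ennreal (carleson_const p) * ?G"
    by (simp add: carleson_const_def C_def mult.assoc[symmetric] ennreal_mult[symmetric])
  finally show ?thesis using 1 by (rule order_trans[rotated])
qed

section \<open>Power counting and bilinear sparse forms\<close>

lemma mult_le_powr_add:
  fixes x y p q :: real
  assumes "x \<ge> 0" "y \<ge> 0" "p > 1" "q = p / (p - 1)"
  shows "x * y \<le> x powr p + y powr q"
proof -
  have q: "q > 1" "1 / p + 1 / q = 1" using assms(3) by (simp_all add: assms(4) less_divide_eq diff_divide_distrib)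
  have "x * y \<le> x powr p / p + y powr q / q" using Youngs_inequality[of p q x y] assms q by auto
  also have "\<dots> \<le> x powr p / 1 + y powr q / 1"
    using assms q by (intro add_mono divide_left_mono) auto
  finally show ?thesis by simp
qed

text \<open>The power counting behind the linear dependence on the \<open>A\<^sub>p\<close> constant for \<open>p \<ge> 2\<close>.\<close>
lemma sparse_term_le:
  fixes p q S W SE WE m e \<kappa> A f g :: real
  assumes p: "p \<ge> 2" "q = p / (p - 1)" and pos: "SE > 0" "SE \<le> S" "WE > 0" "W > 0" "m > 0" "e > 0" "\<kappa> > 0" "A > 0"
    and me: "m \<le> \<kappa> * e" and eE: "e \<le> 2 * WE powr (1 / p) * SE powr (1 / q)"
    and Ap: "W * S powr (p - 1) \<le> A * m powr p" and fg: "f \<ge> 0" "g \<ge> 0"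
  shows "f * g / m \<le> A * (2 * \<kappa>) powr (p - 1) * ((f / S) powr p * SE + (g / W) powr q * WE)"
proof -
  have S: "S > 0" using pos by simp
  have q: "q > 1" using p(1) by (simp add: p(2) less_divide_eq)
  have "S * W / m \<le> A * m powr (p - 1) * S powr (2 - p)"
  proof -
    have "S powr (p - 1) * S powr (2 - p) = S" using S by (simp add: powr_add[symmetric])
    then have "S * W = (W * S powr (p - 1)) * S powr (2 - p)" by (simp add: mult_ac)
    also have "\<dots> \<le> (A * m powr p) * S powr (2 - p)" using Ap by (intro mult_right_mono) auto
    finally have "S * W / m \<le> (A * m powr p) * S powr (2 - p) / m" using pos by (intro divide_right_mono) auto
    also have "m powr p = m powr (p - 1) * m" using pos powr_add[of m "p - 1" 1] by simp
    finally show ?thesis using pos by (simp add: mult_ac)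
  qed
  also have "\<dots> \<le> A * ((2 * \<kappa>) powr (p - 1) * WE powr (1 / q) * SE powr ((p - 1) / q)) * SE powr (2 - p)"
  proof (intro mult_mono mult_left_mono)
    have "m powr (p - 1) \<le> (\<kappa> * (2 * WE powr (1 / p) * SE powr (1 / q))) powr (p - 1)"
      using p pos order_trans[OF me mult_left_mono[OF eE, of \<kappa>]] by (intro powr_mono2) auto
    also have "\<dots> = (2 * \<kappa>) powr (p - 1) * (WE powr (1 / p)) powr (p - 1) * (SE powr (1 / q)) powr (p - 1)"
      using pos by (simp add: powr_mult mult_ac)
    also have "(WE powr (1 / p)) powr (p - 1) = WE powr (1 / q)" using p by (simp add: powr_powr)
    also have "(SE powr (1 / q)) powr (p - 1) = SE powr ((p - 1) / q)" by (simp add: powr_powr)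
    finally show "m powr (p - 1) \<le> (2 * \<kappa>) powr (p - 1) * WE powr (1 / q) * SE powr ((p - 1) / q)" .
    \<comment> \<open>The exponent 2 - p is at most 0 precisely for p \<ge> 2, so replacing S by the
      smaller SE increases the power.\<close>
    show "S powr (2 - p) \<le> SE powr (2 - p)" using p pos by (intro powr_mono2') auto
  qed (use pos in auto)
  also have "\<dots> = A * (2 * \<kappa>) powr (p - 1) * (SE powr (1 / p) * WE powr (1 / q))"
  proof -
    have "(p - 1) / q + (2 - p) = 1 / p" unfolding p(2) using p(1) by (simp add: field_simps)
    then have "SE powr ((p - 1) / q) * SE powr (2 - p) = SE powr (1 / p)" by (simp add: powr_add[symmetric])
    then show ?thesis by (simp add: mult_ac)
  qed
  finally have SW: "S * W / m \<le> A * (2 * \<kappa>) powr (p - 1) * (SE powr (1 / p) * WE powr (1 / q))" .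
  let ?x = "f / S * SE powr (1 / p)" and ?y = "g / W * WE powr (1 / q)"
  have "f * g / m = (f / S) * (g / W) * (S * W / m)" using S pos by simp
  also have "\<dots> \<le> (f / S) * (g / W) * (A * (2 * \<kappa>) powr (p - 1) * (SE powr (1 / p) * WE powr (1 / q)))"
    using SW fg S pos by (intro mult_left_mono) auto
  also have "\<dots> = A * (2 * \<kappa>) powr (p - 1) * (?x * ?y)" by (simp add: mult_ac)
  also have "\<dots> \<le> A * (2 * \<kappa>) powr (p - 1) * (?x powr p + ?y powr q)"
    using p fg S pos by (intro mult_left_mono mult_le_powr_add) auto
  also have "?x powr p = (f / S) powr p * (SE powr (1 / p)) powr p" by (rule powr_mult)
  also have "(SE powr (1 / p)) powr p = SE" using p(1) pos by (simp add: powr_powr)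
  also have "?y powr q = (g / W) powr q * (WE powr (1 / q)) powr q" by (rule powr_mult)
  also have "(WE powr (1 / q)) powr q = WE" using q pos by (simp add: powr_powr)
  finally show ?thesis .
qed

text \<open>\<open>P\<close> are the tripled cubes with volume \<open>m\<close>, \<open>Q\<close>
  the cubes on which the operator lives, \<open>E\<close> the disjoint private parts carrying at
  least m / \<kappa>. Triples are laminar only within a class \<open>cl\<close>, and each class
  costs one application of the embedding.\<close>

locale sparse_data =
  fixes M :: "'a measure" and I :: "'i set" and P Q E :: "'i \<Rightarrow> 'a set" and m :: "'i \<Rightarrow> real"
    and \<kappa> :: real and R :: "'c set" and cl :: "'i \<Rightarrow> 'c"
  assumes finI: "finite I" and finR: "finite R" and cl: "\<And>i. i \<in> I \<Longrightarrow> cl i \<in> R"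
    and lam: "\<And>r. laminar (P ` {i\<in>I. cl i = r})"
    and disj: "disjoint_family_on E I"
    and PE: "\<And>i. i \<in> I \<Longrightarrow> P i \<in> sets M" "\<And>i. i \<in> I \<Longrightarrow> E i \<in> sets M" "\<And>i. i \<in> I \<Longrightarrow> E i \<subseteq> P i"
      "\<And>i. i \<in> I \<Longrightarrow> emeasure M (P i) < \<infinity>"
    and Q: "\<And>i. i \<in> I \<Longrightarrow> Q i \<in> sets M" "\<And>i. i \<in> I \<Longrightarrow> Q i \<subseteq> P i"
    and m: "\<And>i. i \<in> I \<Longrightarrow> 0 < m i" "\<And>i. i \<in> I \<Longrightarrow> m i \<le> \<kappa> * measure M (E i)"
    and \<kappa>: "\<kappa> > 0"
begin

abbreviation wm :: "('a \<Rightarrow> real) \<Rightarrow> 'a measure" where "wm w \<equiv> density M (\<lambda>x. ennreal (w x))"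

lemma E_measure_pos: assumes "i \<in> I" shows "measure M (E i) > 0"
proof (rule ccontr)
  assume "\<not> measure M (E i) > 0"
  then have "\<kappa> * measure M (E i) \<le> 0" using \<kappa> by (simp add: mult_nonneg_nonpos not_less)
  then show False using m[OF assms] by linarith
qed

lemma weight_E:
  fixes w :: "'a \<Rightarrow> real"
  assumes i: "i \<in> I" and [measurable]: "w \<in> borel_measurable M" and w: "\<And>x. w x > 0"
    and W: "emeasure (wm w) (P i) = ennreal W" "W \<ge> 0"
  obtains WE where "emeasure (wm w) (E i) = ennreal WE" "WE > 0" "WE \<le> W"
proof -
  have le: "emeasure (wm w) (E i) \<le> ennreal W"
    unfolding W(1)[symmetric] using PE[OF i] by (intro emeasure_mono) auto
  then obtain WE where WE: "emeasure (wm w) (E i) = ennreal WE" "WE \<ge> 0"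
    by (cases "emeasure (wm w) (E i)") (auto simp: top_unique)
  have "WE \<noteq> 0"
  proof
    assume "WE = 0"
    then have "E i \<in> null_sets (wm w)" using WE PE(2)[OF i] by (auto simp: null_sets_def)
    then have "AE x in M. x \<in> E i \<longrightarrow> ennreal (w x) = 0" by (subst (asm) null_sets_density_iff) auto
    then have "AE x in M. x \<notin> E i"
    proof (rule eventually_mono)
      fix x assume "x \<in> E i \<longrightarrow> ennreal (w x) = 0"
      then show "x \<notin> E i" using w[of x] by (auto simp: ennreal_eq_0_iff)
    qed
    then have "E i \<in> null_sets M" using AE_iff_null_sets[OF PE(2)[OF i]] by simp
    then show False using E_measure_pos[OF i] by (simp add: null_sets_def measure_def)
  qed
  then show ?thesis using that[OF WE(1)] WE le W(2) by (simp add: ennreal_le_iff)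
qed

text \<open>Hoelder's inequality for 1 = w^(1/p) \<sigma>^(1/q), derived from the pointwise Young
  inequality after rescaling the weights; Young without its coefficients gives the factor 2.\<close>

lemma measure_E_le:
  fixes w \<sigma> :: "'a \<Rightarrow> real" and p q :: real
  assumes i: "i \<in> I" and p: "p > 1" "q = p / (p - 1)"
    and [measurable]: "w \<in> borel_measurable M" "\<sigma> \<in> borel_measurable M"
    and w: "\<And>x. w x > 0" "\<And>x. \<sigma> x > 0" "\<And>x. w x * \<sigma> x powr (p - 1) = 1"
    and WE: "emeasure (wm w) (E i) = ennreal WE" "WE > 0"
    and SE: "emeasure (wm \<sigma>) (E i) = ennreal SE" "SE > 0"
  shows "measure M (E i) \<le> 2 * WE powr (1 / p) * SE powr (1 / q)"
proof -
  have q: "1 / q = 1 - 1 / p" "1 / p = 1 - 1 / q" "q > 1" "q / p = 1 / (p - 1)" "1 / q = (p - 1) / p"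
    using p(1) by (simp_all add: p(2) diff_divide_distrib less_divide_eq)
  \<comment> \<open>The scalings leave the product w^(1/p) \<sigma>^(1/q) unchanged and balance the
    two integrals: both become WE^(1/p) SE^(1/q).\<close>
  define s where "s = (SE / WE) powr (1 / q)"
  define s' where "s' = (SE / WE) powr (- 1 / p)"
  have s: "s > 0" "s' > 0" using WE SE by (auto simp: s_def s'_def)
  have ss: "s powr (1 / p) * s' powr (1 / q) = 1"
    using WE SE by (simp add: s_def s'_def powr_powr powr_add[symmetric] mult.commute)
  have pt: "1 \<le> s * w x + s' * \<sigma> x" for x
  proof -
    have "w x powr (1 / p) * \<sigma> x powr (1 / q) = (w x * \<sigma> x powr (p - 1)) powr (1 / p)"
      using w(1,2)[of x] p by (simp add: powr_mult powr_powr q(5))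
    then have "1 = (s powr (1 / p) * s' powr (1 / q)) * (w x powr (1 / p) * \<sigma> x powr (1 / q))" using ss w(3) by simp
    also have "\<dots> = (s * w x) powr (1 / p) * (s' * \<sigma> x) powr (1 / q)" by (simp add: powr_mult mult_ac)
    also have "\<dots> \<le> ((s * w x) powr (1 / p)) powr p + ((s' * \<sigma> x) powr (1 / q)) powr q"
      using p by (intro mult_le_powr_add) auto
    also have "\<dots> = s * w x + s' * \<sigma> x" using p(1) q(3) s w(1,2)[of x] by (simp add: powr_powr)
    finally show ?thesis .
  qed
  have "emeasure M (E i) = (\<integral>\<^sup>+x. indicator (E i) x \<partial>M)" using PE(2)[OF i] by simp
  also have "\<dots> \<le> (\<integral>\<^sup>+x. ennreal s * (ennreal (w x) * indicator (E i) x) + ennreal s' * (ennreal (\<sigma> x) * indicator (E i) x) \<partial>M)"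
  proof (rule nn_integral_mono)
    fix x
    have "ennreal 1 \<le> ennreal (s * w x + s' * \<sigma> x)" using pt by (rule ennreal_leI)
    also have "\<dots> = ennreal s * ennreal (w x) + ennreal s' * ennreal (\<sigma> x)"
      using s w(1,2)[of x] by (simp add: ennreal_mult ennreal_plus less_imp_le)
    finally show "indicator (E i) x \<le> ennreal s * (ennreal (w x) * indicator (E i) x) + ennreal s' * (ennreal (\<sigma> x) * indicator (E i) x)"
      by (auto simp: indicator_def)
  qed
  also have "\<dots> = ennreal s * emeasure (wm w) (E i) + ennreal s' * emeasure (wm \<sigma>) (E i)"
    using PE(2)[OF i] by (subst nn_integral_add) (auto simp: nn_integral_cmult emeasure_density)
  also have "\<dots> = ennreal (s * WE + s' * SE)"
    using s WE SE by (simp add: ennreal_mult ennreal_plus less_imp_le)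
  finally have "measure M (E i) \<le> s * WE + s' * SE"
    unfolding measure_def using s WE SE by (intro enn2real_leI) auto
  also have "s * WE = WE powr (1 / p) * SE powr (1 / q)"
  proof -
    have "WE powr (1 / p) * WE powr (1 / q) = WE" using WE(2) q(1) by (simp add: powr_add[symmetric])
    then show ?thesis using WE(2) SE(2) unfolding s_def by (simp add: powr_divide field_simps)
  qed
  also have "s' * SE = WE powr (1 / p) * SE powr (1 / q)"
  proof -
    have "SE powr (1 / p) * SE powr (1 / q) = SE" using SE(2) q(1) by (simp add: powr_add[symmetric])
    then show ?thesis using WE(2) SE(2) unfolding s'_def by (simp add: powr_divide powr_minus field_simps)
  qed
  finally show ?thesis by (simp add: mult_ac)
qed

text \<open>The quotient f / S is at most the \<sigma>-average of F over \<open>P\<close>, so the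
  embedding applies on each laminar class; summing over the classes gives the factor
  \<open>card R\<close>.\<close>

lemma carleson_classes:
  fixes \<sigma> F :: "'a \<Rightarrow> real" and f S :: "'i \<Rightarrow> real"
  assumes p: "p > 1" and [measurable]: "\<sigma> \<in> borel_measurable M" "F \<in> borel_measurable M"
    and F: "\<And>x. F x \<ge> 0" and f: "\<And>i. i \<in> I \<Longrightarrow> f i \<ge> 0"
    and S: "\<And>i. i \<in> I \<Longrightarrow> emeasure (wm \<sigma>) (P i) = ennreal (S i)" "\<And>i. i \<in> I \<Longrightarrow> S i > 0"
    and fF: "\<And>i. i \<in> I \<Longrightarrow> ennreal (f i) \<le> (\<integral>\<^sup>+x. ennreal (F x) * indicator (P i) x \<partial>wm \<sigma>)"
  shows "(\<Sum>i\<in>I. ennreal ((f i / S i) powr p) * emeasure (wm \<sigma>) (E i))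
     \<le> ennreal (card R * carleson_const p) * (\<integral>\<^sup>+x. ennreal (F x powr p) \<partial>wm \<sigma>)"
proof -
  let ?t = "\<lambda>i. ennreal ((f i / S i) powr p) * emeasure (wm \<sigma>) (E i)"
  have "(\<Sum>i\<in>I. ?t i) = (\<Sum>r\<in>R. \<Sum>i\<in>{i\<in>I. cl i = r}. ?t i)"
    using cl by (intro sum.group[symmetric] finI finR) auto
  also have "\<dots> \<le> (\<Sum>r\<in>R. ennreal (carleson_const p) * (\<integral>\<^sup>+x. ennreal (F x powr p) \<partial>wm \<sigma>))"
  proof (intro sum_mono carleson_embedding[OF p])
    fix r
    show "finite {i\<in>I. cl i = r}" using finI by simp
    show "disjoint_family_on E {i\<in>I. cl i = r}" using disj by (auto simp: disjoint_family_on_def)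
    show "laminar (P ` {i\<in>I. cl i = r})" by (rule lam)
    fix i assume "i \<in> {i\<in>I. cl i = r}"
    then have i: "i \<in> I" by simp
    show "P i \<in> sets (wm \<sigma>)" "E i \<in> sets (wm \<sigma>)" "E i \<subseteq> P i" using PE[OF i] by auto
    show "emeasure (wm \<sigma>) (P i) < \<infinity>" using S(1)[OF i] by simp
    show "0 \<le> f i / S i" using f[OF i] S(2)[OF i] by simp
    have "ennreal (f i / S i) * emeasure (wm \<sigma>) (P i) = ennreal (f i)"
      unfolding S(1)[OF i] using f[OF i] S(2)[OF i] by (simp add: ennreal_mult[symmetric])
    then show "ennreal (f i / S i) * emeasure (wm \<sigma>) (P i) \<le> (\<integral>\<^sup>+x. ennreal (F x) * indicator (P i) x \<partial>wm \<sigma>)"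
      using fF[OF i] by simp
  qed (use F in auto)
  also have "\<dots> = ennreal (card R * carleson_const p) * (\<integral>\<^sup>+x. ennreal (F x powr p) \<partial>wm \<sigma>)"
    using carleson_const_pos[OF p] by (simp add: ennreal_mult ennreal_of_nat_eq_real_of_nat mult.assoc)
  finally show ?thesis .
qed

text \<open>Each term of the form is split by \<open>sparse_term_le\<close> into \<sigma>-averages
  of F and w-averages of G, weighted by the masses of the disjoint parts \<open>E\<close>; these are
  exactly the sums in the Carleson embedding for \<sigma> with exponent p and for w with exponent
  q.\<close>

lemma bilinear_sparse_ge2:
  fixes w \<sigma> F G :: "'a \<Rightarrow> real" and f g W S :: "'i \<Rightarrow> real" and p q A :: real
  assumes p: "p \<ge> 2" "q = p / (p - 1)" and A: "A > 0"
    and [measurable]: "w \<in> borel_measurable M" "\<sigma> \<in> borel_measurable M" "F \<in> borel_measurable M" "G \<in> borel_measurable M"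
    and w: "\<And>x. w x > 0" "\<And>x. \<sigma> x > 0" "\<And>x. w x * \<sigma> x powr (p - 1) = 1"
    and FG: "\<And>x. F x \<ge> 0" "\<And>x. G x \<ge> 0"
    and fg: "\<And>i. i \<in> I \<Longrightarrow> f i \<ge> 0" "\<And>i. i \<in> I \<Longrightarrow> g i \<ge> 0"
    and W: "\<And>i. i \<in> I \<Longrightarrow> emeasure (wm w) (P i) = ennreal (W i)" "\<And>i. i \<in> I \<Longrightarrow> W i \<ge> 0"
    and S: "\<And>i. i \<in> I \<Longrightarrow> emeasure (wm \<sigma>) (P i) = ennreal (S i)" "\<And>i. i \<in> I \<Longrightarrow> S i \<ge> 0"
    and Ap: "\<And>i. i \<in> I \<Longrightarrow> W i * S i powr (p - 1) \<le> A * m i powr p"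
    and fF: "\<And>i. i \<in> I \<Longrightarrow> ennreal (f i) \<le> (\<integral>\<^sup>+x. ennreal (F x) * indicator (P i) x \<partial>wm \<sigma>)"
    and gG: "\<And>i. i \<in> I \<Longrightarrow> ennreal (g i) \<le> (\<integral>\<^sup>+x. ennreal (G x) * indicator (P i) x \<partial>wm w)"
  shows "(\<Sum>i\<in>I. ennreal (f i * g i / m i)) \<le> ennreal (A * ((2 * \<kappa>) powr (p - 1) * (card R * (carleson_const p + carleson_const q)))) *
    ((\<integral>\<^sup>+x. ennreal (F x powr p) \<partial>wm \<sigma>) + (\<integral>\<^sup>+x. ennreal (G x powr q) \<partial>wm w))"
proof -
  have q: "q > 1" using p(1) by (simp add: p(2) less_divide_eq)
  have p1: "p > 1" using p by simp
  let ?T = "A * (2 * \<kappa>) powr (p - 1)"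
  have T: "?T \<ge> 0" using A by simp
  have SW: "S i > 0" "W i > 0" if i: "i \<in> I" for i
  proof -
    obtain SE where "SE > 0" "SE \<le> S i" by (rule weight_E[OF i _ w(2) S(1)[OF i] S(2)[OF i]]) auto
    then show "S i > 0" by simp
    obtain WE where "WE > 0" "WE \<le> W i" by (rule weight_E[OF i _ w(1) W(1)[OF i] W(2)[OF i]]) auto
    then show "W i > 0" by simp
  qed
  have tm: "ennreal (f i * g i / m i) \<le> ennreal ?T * (ennreal ((f i / S i) powr p) * emeasure (wm \<sigma>) (E i)
       + ennreal ((g i / W i) powr q) * emeasure (wm w) (E i))" if i: "i \<in> I" for i
  proof -
    obtain SE where SE: "emeasure (wm \<sigma>) (E i) = ennreal SE" "SE > 0" "SE \<le> S i"
      by (rule weight_E[OF i _ w(2) S(1)[OF i] S(2)[OF i]]) auto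
    obtain WE where WE: "emeasure (wm w) (E i) = ennreal WE" "WE > 0" "WE \<le> W i"
      by (rule weight_E[OF i _ w(1) W(1)[OF i] W(2)[OF i]]) auto
    have "measure M (E i) \<le> 2 * WE powr (1 / p) * SE powr (1 / q)"
      by (rule measure_E_le[OF i p1 p(2) _ _ w WE(1,2) SE(1,2)]) auto
    then have "f i * g i / m i \<le> ?T * ((f i / S i) powr p * SE + (g i / W i) powr q * WE)"
      using E_measure_pos[OF i] m[OF i] SW[OF i] Ap[OF i] fg i \<kappa> A SE(2,3) WE(2)
      by (intro sparse_term_le[OF p]) auto
    then have "ennreal (f i * g i / m i) \<le> ennreal (?T * ((f i / S i) powr p * SE + (g i / W i) powr q * WE))"
      by (rule ennreal_leI)
    also have "\<dots> = ennreal ?T * (ennreal ((f i / S i) powr p) * ennreal SE + ennreal ((g i / W i) powr q) * ennreal WE)"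
      using T SE(2) WE(2) by (simp add: ennreal_mult ennreal_plus less_imp_le)
    finally show ?thesis by (simp only: SE(1) WE(1))
  qed
  let ?NF = "\<integral>\<^sup>+x. ennreal (F x powr p) \<partial>wm \<sigma>" and ?NG = "\<integral>\<^sup>+x. ennreal (G x powr q) \<partial>wm w"
  let ?c = "carleson_const p" and ?d = "carleson_const q"
  have cd: "?c > 0" "?d > 0" using carleson_const_pos p1 q by auto
  have "(\<Sum>i\<in>I. ennreal (f i * g i / m i)) \<le> ennreal ?T * ((\<Sum>i\<in>I. ennreal ((f i / S i) powr p) * emeasure (wm \<sigma>) (E i))
       + (\<Sum>i\<in>I. ennreal ((g i / W i) powr q) * emeasure (wm w) (E i)))"
    unfolding sum.distrib[symmetric] sum_distrib_left by (intro sum_mono tm)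
  also have "\<dots> \<le> ennreal ?T * (ennreal (card R * ?c) * ?NF + ennreal (card R * ?d) * ?NG)"
    using SW FG fg by (intro mult_left_mono add_mono carleson_classes p1 q S(1) W(1) fF gG) auto
  also have "\<dots> \<le> ennreal ?T * (ennreal (card R * (?c + ?d)) * ?NF + ennreal (card R * (?c + ?d)) * ?NG)"
    using cd by (intro mult_left_mono add_mono mult_right_mono ennreal_leI) auto
  also have "\<dots> = ennreal (?T * (card R * (?c + ?d))) * (?NF + ?NG)"
  proof -
    have "ennreal (?T * (card R * (?c + ?d))) = ennreal ?T * ennreal (card R * (?c + ?d))"
      using T cd by (intro ennreal_mult) auto
    then show ?thesis by (simp only: distrib_left mult.assoc)
  qed
  finally show ?thesis by (simp add: mult.assoc)
qed

text \<open>The two powers belong to the cases p \<ge> 2 and p < 2, since q - 1 = 1 / (p - 1); their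
  sum covers both.\<close>

definition sparse_const :: "real \<Rightarrow> real" where
  "sparse_const p = ((2 * \<kappa>) powr (p - 1) + (2 * \<kappa>) powr (1 / (p - 1))) *
     (card R * (carleson_const p + carleson_const (p / (p - 1))))"

text \<open>The bilinear form is symmetric, so \<open>p < 2\<close> reduces to the dual exponent with \<open>w\<close> and \<open>\<sigma>\<close> exchanged.\<close>
lemma bilinear_sparse:
  fixes w \<sigma> F G :: "'a \<Rightarrow> real" and f g W S :: "'i \<Rightarrow> real" and p q A :: real
  assumes p: "p > 1" "q = p / (p - 1)" and A: "A > 0"
    and [measurable]: "w \<in> borel_measurable M" "\<sigma> \<in> borel_measurable M" "F \<in> borel_measurable M" "G \<in> borel_measurable M"
    and w: "\<And>x. w x > 0" "\<And>x. \<sigma> x > 0" "\<And>x. w x * \<sigma> x powr (p - 1) = 1"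
    and FG: "\<And>x. F x \<ge> 0" "\<And>x. G x \<ge> 0"
    and fg: "\<And>i. i \<in> I \<Longrightarrow> f i \<ge> 0" "\<And>i. i \<in> I \<Longrightarrow> g i \<ge> 0"
    and W: "\<And>i. i \<in> I \<Longrightarrow> emeasure (wm w) (P i) = ennreal (W i)" "\<And>i. i \<in> I \<Longrightarrow> W i \<ge> 0"
    and S: "\<And>i. i \<in> I \<Longrightarrow> emeasure (wm \<sigma>) (P i) = ennreal (S i)" "\<And>i. i \<in> I \<Longrightarrow> S i \<ge> 0"
    and Ap: "\<And>i. i \<in> I \<Longrightarrow> W i * S i powr (p - 1) \<le> A * m i powr p"
    and fF: "\<And>i. i \<in> I \<Longrightarrow> ennreal (f i) \<le> (\<integral>\<^sup>+x. ennreal (F x) * indicator (P i) x \<partial>wm \<sigma>)"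
    and gG: "\<And>i. i \<in> I \<Longrightarrow> ennreal (g i) \<le> (\<integral>\<^sup>+x. ennreal (G x) * indicator (P i) x \<partial>wm w)"
  shows "(\<Sum>i\<in>I. ennreal (f i * g i / m i)) \<le> ennreal (sparse_const p * A powr max 1 (1 / (p - 1))) *
    ((\<integral>\<^sup>+x. ennreal (F x powr p) \<partial>wm \<sigma>) + (\<integral>\<^sup>+x. ennreal (G x powr q) \<partial>wm w))"
proof -
  let ?NF = "\<integral>\<^sup>+x. ennreal (F x powr p) \<partial>wm \<sigma>" and ?NG = "\<integral>\<^sup>+x. ennreal (G x powr q) \<partial>wm w"
  have q: "q > 1" "q - 1 = 1 / (p - 1)" "p = q / (q - 1)" using p(1) by (simp_all add: p(2) field_simps)
  let ?C = "card R * (carleson_const p + carleson_const q)"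
  have C: "?C \<ge> 0" using carleson_const_pos[OF p(1)] carleson_const_pos[OF q(1)] by simp
  have K: "(2 * \<kappa>) powr (p - 1) * ?C \<le> sparse_const p" "(2 * \<kappa>) powr (q - 1) * ?C \<le> sparse_const p"
    unfolding sparse_const_def p(2)[symmetric] q(2) using C by (intro mult_right_mono; simp)+
  show ?thesis
  proof (cases "p \<ge> 2")
    case True
    then have "max 1 (1 / (p - 1)) = 1" by (simp add: max_def)
    then have le: "A * ((2 * \<kappa>) powr (p - 1) * ?C) \<le> sparse_const p * A powr max 1 (1 / (p - 1))"
      using K(1) A by (simp add: mult.commute mult_left_mono)
    have "(\<Sum>i\<in>I. ennreal (f i * g i / m i)) \<le> ennreal (A * ((2 * \<kappa>) powr (p - 1) * ?C)) * (?NF + ?NG)"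
      by (rule bilinear_sparse_ge2[OF True p(2) A _ _ _ _ w FG fg W S Ap fF gG]) auto
    also have "\<dots> \<le> ennreal (sparse_const p * A powr max 1 (1 / (p - 1))) * (?NF + ?NG)"
      using le by (intro mult_right_mono ennreal_leI) auto
    finally show ?thesis .
  next
    case False
    have q2: "q \<ge> 2" using False p(1) by (simp add: p(2) le_divide_eq)
    have "max 1 (1 / (p - 1)) = q - 1" using q2 q(2) by (simp add: max_def)
    then have le: "A powr (q - 1) * ((2 * \<kappa>) powr (q - 1) * ?C) \<le> sparse_const p * A powr max 1 (1 / (p - 1))"
      using mult_left_mono[OF K(2), of "A powr (q - 1)"] by (simp add: mult.commute)
    have pq: "(p - 1) * (q - 1) = 1" "p * (q - 1) = q"
      unfolding q(2) using p(1) by (simp_all add: p(2))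
    have ws: "\<sigma> x * w x powr (q - 1) = 1" for x
    proof -
      have "1 = (w x * \<sigma> x powr (p - 1)) powr (q - 1)" using w(3) by simp
      also have "\<dots> = w x powr (q - 1) * \<sigma> x" using w(2)[of x] by (simp add: powr_mult powr_powr pq(1))
      finally show ?thesis by (simp add: mult.commute)
    qed
    have Ap': "S i * W i powr (q - 1) \<le> A powr (q - 1) * m i powr q" if i: "i \<in> I" for i
    proof -
      have "W i powr (q - 1) * S i = (W i * S i powr (p - 1)) powr (q - 1)"
        using S(2)[OF i] by (simp add: powr_mult powr_powr pq(1))
      also have "\<dots> \<le> (A * m i powr p) powr (q - 1)"
        using Ap[OF i] W(2)[OF i] q(1) by (intro powr_mono2) auto
      also have "\<dots> = A powr (q - 1) * m i powr q" by (simp add: powr_mult powr_powr pq(2))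
      finally show ?thesis by (simp add: mult.commute)
    qed
    have "(\<Sum>i\<in>I. ennreal (f i * g i / m i)) = (\<Sum>i\<in>I. ennreal (g i * f i / m i))" by (simp add: mult.commute)
    also have "\<dots> \<le> ennreal (A powr (q - 1) * ((2 * \<kappa>) powr (q - 1) * (card R * (carleson_const q + carleson_const p)))) * (?NG + ?NF)"
      by (rule bilinear_sparse_ge2[OF q2 q(3) _ _ _ _ _ w(2,1) ws FG(2,1) fg(2,1) S W Ap' gG fF]) (use A in auto)
    also have "\<dots> \<le> ennreal (sparse_const p * A powr max 1 (1 / (p - 1))) * (?NG + ?NF)"
      using le by (intro mult_right_mono ennreal_leI) (auto simp: add.commute)
    finally show ?thesis by (simp add: add.commute)
  qed
qed

text \<open>Duality by testing with a single function: h^p is h times h^(p-1), so the norm of h is a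
  value of the bilinear form at G proportional to h^(p-1). The additive form of
  \<open>bilinear_sparse\<close> returns a multiple of the same norm, which a suitable scaling of G
  makes absorbable.\<close>

theorem sparse_operator_bound:
  fixes w \<sigma> \<phi> :: "'a \<Rightarrow> real" and f W S :: "'i \<Rightarrow> real" and p A :: real
  assumes p: "p > 1" and A: "A > 0"
    and [measurable]: "w \<in> borel_measurable M" "\<sigma> \<in> borel_measurable M" "\<phi> \<in> borel_measurable M"
    and w: "\<And>x. w x > 0" "\<And>x. \<sigma> x > 0" "\<And>x. w x * \<sigma> x powr (p - 1) = 1"
    and f: "\<And>i. i \<in> I \<Longrightarrow> f i \<ge> 0"
    and W: "\<And>i. i \<in> I \<Longrightarrow> emeasure (wm w) (P i) = ennreal (W i)" "\<And>i. i \<in> I \<Longrightarrow> W i \<ge> 0"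
    and S: "\<And>i. i \<in> I \<Longrightarrow> emeasure (wm \<sigma>) (P i) = ennreal (S i)" "\<And>i. i \<in> I \<Longrightarrow> S i \<ge> 0"
    and Ap: "\<And>i. i \<in> I \<Longrightarrow> W i * S i powr (p - 1) \<le> A * m i powr p"
    and f\<phi>: "\<And>i. i \<in> I \<Longrightarrow> ennreal (f i) \<le> (\<integral>\<^sup>+x. ennreal \<bar>\<phi> x\<bar> * indicator (P i) x \<partial>M)"
  shows "(\<integral>\<^sup>+x. ennreal ((\<Sum>i\<in>I. f i / m i * indicator (Q i) x) powr p) \<partial>wm w)
     \<le> ennreal ((2 * (sparse_const p * A powr max 1 (1 / (p - 1)))) powr p) * (\<integral>\<^sup>+x. ennreal (\<bar>\<phi> x\<bar> powr p) \<partial>wm w)"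
proof -
  define q where "q = p / (p - 1)"
  have q: "q > 1" "(q - 1) * (p - 1) = 1" "(p - 1) * q = p" using p by (simp_all add: q_def field_simps)
  define K where "K = sparse_const p * A powr max 1 (1 / (p - 1))"
  define h where "h x = (\<Sum>i\<in>I. f i / m i * indicator (Q i) x)" for x
  have [measurable]: "h \<in> borel_measurable M" unfolding h_def[abs_def] using Q by measurable
  have h0: "h x \<ge> 0" for x unfolding h_def using f m(1) by (intro sum_nonneg mult_nonneg_nonneg divide_nonneg_nonneg) (auto simp: less_imp_le)
  define B where "B = (\<Sum>i\<in>I. f i / m i)"
  have hB: "h x \<le> B" for x
    unfolding h_def B_def
  proof (rule sum_mono)
    fix i assume i: "i \<in> I"
    have "0 \<le> f i / m i" using f[OF i] m(1)[OF i] by simp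
    then show "f i / m i * indicator (Q i) x \<le> f i / m i" by (simp add: indicator_def)
  qed
  let ?X = "\<integral>\<^sup>+x. ennreal (h x powr p) \<partial>wm w" and ?Y = "\<integral>\<^sup>+x. ennreal (\<bar>\<phi> x\<bar> powr p) \<partial>wm w"
  have QW: "emeasure (wm w) (Q i) \<le> ennreal (W i)" if i: "i \<in> I" for i
    unfolding W(1)[OF i, symmetric] using Q[OF i] PE(1)[OF i] by (intro emeasure_mono) auto
  \<comment> \<open>h is bounded and lives on finitely many cubes of finite weight; without
    finiteness the norm could not be absorbed.\<close>
  have finX: "?X < \<infinity>"
  proof -
    have "?X \<le> (\<integral>\<^sup>+x. (\<Sum>i\<in>I. ennreal (B powr p) * indicator (Q i) x) \<partial>wm w)"
    proof (rule nn_integral_mono)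
      fix x
      show "ennreal (h x powr p) \<le> (\<Sum>i\<in>I. ennreal (B powr p) * indicator (Q i) x)"
      proof (cases "\<exists>i\<in>I. x \<in> Q i")
        case True
        then obtain i where i: "i \<in> I" "x \<in> Q i" by blast
        have "ennreal (h x powr p) \<le> ennreal (B powr p) * indicator (Q i) x"
          using i hB[of x] h0[of x] p by (auto intro!: ennreal_leI powr_mono2)
        also have "\<dots> \<le> (\<Sum>i\<in>I. ennreal (B powr p) * indicator (Q i) x)"
          using i finI by (intro member_le_sum[where f="\<lambda>i. ennreal (B powr p) * indicator (Q i) x"]) auto
        finally show ?thesis .
      next
        case False
        then have "h x = 0" unfolding h_def by (intro sum.neutral) auto
        then show ?thesis by simp
      qed
    qed
    also have "\<dots> = (\<Sum>i\<in>I. ennreal (B powr p) * emeasure (wm w) (Q i))"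
      using Q(1) by (subst nn_integral_sum) (auto simp: nn_integral_cmult_indicator)
    also have "\<dots> \<le> (\<Sum>i\<in>I. ennreal (B powr p) * ennreal (W i))" using QW by (intro sum_mono mult_left_mono) auto
    also have "\<dots> < \<infinity>" using finI by (auto simp: ennreal_mult_less_top)
    finally show ?thesis .
  qed
  obtain X where X: "?X = ennreal X" "X \<ge> 0" using finX by (cases ?X) auto
  have goal: "ennreal X \<le> ennreal ((2 * K) powr p) * ?Y"
  proof (cases "I = {}")
    case True
    then have "?X = 0" by (simp add: h_def)
    then show ?thesis using X by simp
  next
    case False
    then have "card R > 0" using cl finR by (auto simp: card_gt_0_iff)
    then have K: "K > 0"
      unfolding K_def sparse_const_def
      using \<kappa> A carleson_const_pos[OF p] carleson_const_pos[OF q(1)] unfolding q_def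
      by (intro mult_pos_pos add_pos_pos) auto
    \<comment> \<open>Chosen so that K \<tau>^q = \<tau> / 2: exactly half of the left hand side is
      absorbed, and 2 K / \<tau> = (2 K)^p is the claimed constant.\<close>
    define \<tau> where "\<tau> = (2 * K) powr (- (p - 1))"
    have \<tau>: "\<tau> > 0" using K by (simp add: \<tau>_def)
    have K\<tau>: "K * \<tau> powr q = \<tau> / 2"
    proof -
      have "- (p - 1) * (q - 1) = - 1" using q(2) by algebra
      then have "\<tau> powr (q - 1) = (2 * K) powr (- 1)" by (simp only: \<tau>_def powr_powr)
      then have "\<tau> powr (q - 1) = 1 / (2 * K)" using K by (simp only: powr_minus_divide) simp
      then have "\<tau> powr q = \<tau> / (2 * K)" using \<tau> powr_add[of \<tau> "q - 1" 1] by simp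
      then show ?thesis using K by simp
    qed
    \<comment> \<open>This substitution turns integrals of \<phi> into integrals against \<sigma>,
      and the L^p(\<sigma>) norm of F is the L^p(w) norm of \<phi>.\<close>
    define F where "F x = \<bar>\<phi> x\<bar> / \<sigma> x" for x
    define G where "G x = \<tau> * h x powr (p - 1)" for x
    have [measurable]: "F \<in> borel_measurable M" "G \<in> borel_measurable M"
      unfolding F_def[abs_def] G_def[abs_def] by measurable
    have F0: "F x \<ge> 0" for x using w(2)[of x] by (simp add: F_def)
    have G0: "G x \<ge> 0" for x using \<tau> by (simp add: G_def)
    have G\<tau>: "G x \<le> \<tau> * B powr (p - 1)" for x
      unfolding G_def using \<tau> h0[of x] hB[of x] p by (intro mult_left_mono powr_mono2) auto
    let ?J = "\<lambda>i. \<integral>\<^sup>+x. ennreal (G x) * indicator (Q i) x \<partial>wm w"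
    define g where "g i = enn2real (?J i)" for i
    have g0: "g i \<ge> 0" for i by (simp add: g_def)
    have Jg: "?J i = ennreal (g i)" if i: "i \<in> I" for i
    proof -
      have "?J i \<le> (\<integral>\<^sup>+x. ennreal (\<tau> * B powr (p - 1)) * indicator (Q i) x \<partial>wm w)"
        by (intro nn_integral_mono mult_right_mono ennreal_leI G\<tau>) auto
      also have "\<dots> = ennreal (\<tau> * B powr (p - 1)) * emeasure (wm w) (Q i)"
        using Q(1)[OF i] by (intro nn_integral_cmult_indicator) auto
      also have "\<dots> \<le> ennreal (\<tau> * B powr (p - 1)) * ennreal (W i)" using QW[OF i] by (intro mult_left_mono) auto
      also have "\<dots> < \<infinity>" by (simp add: ennreal_mult_less_top)
      finally show ?thesis by (simp add: g_def)
    qed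
    have fF: "ennreal (f i) \<le> (\<integral>\<^sup>+x. ennreal (F x) * indicator (P i) x \<partial>wm \<sigma>)" if i: "i \<in> I" for i
    proof -
      have [measurable]: "P i \<in> sets M" by (rule PE(1)[OF i])
      have "(\<integral>\<^sup>+x. ennreal (F x) * indicator (P i) x \<partial>wm \<sigma>) = (\<integral>\<^sup>+x. ennreal (\<sigma> x) * (ennreal (F x) * indicator (P i) x) \<partial>M)"
        by (intro nn_integral_density) measurable
      also have "\<dots> = (\<integral>\<^sup>+x. ennreal \<bar>\<phi> x\<bar> * indicator (P i) x \<partial>M)"
      proof (rule nn_integral_cong)
        fix x
        have "ennreal (\<sigma> x) * ennreal (F x) = ennreal \<bar>\<phi> x\<bar>"
          using w(2)[of x] F0[of x] by (simp add: ennreal_mult[symmetric] F_def)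
        then show "ennreal (\<sigma> x) * (ennreal (F x) * indicator (P i) x) = ennreal \<bar>\<phi> x\<bar> * indicator (P i) x"
          by (simp add: mult.assoc[symmetric])
      qed
      finally show ?thesis using f\<phi>[OF i] by simp
    qed
    have gG: "ennreal (g i) \<le> (\<integral>\<^sup>+x. ennreal (G x) * indicator (P i) x \<partial>wm w)" if i: "i \<in> I" for i
      unfolding Jg[OF i, symmetric] using Q(2)[OF i] by (intro nn_integral_mono mult_left_mono) (auto simp: indicator_def)
    have NF: "(\<integral>\<^sup>+x. ennreal (F x powr p) \<partial>wm \<sigma>) = ?Y"
    proof -
      have "(\<integral>\<^sup>+x. ennreal (F x powr p) \<partial>wm \<sigma>) = (\<integral>\<^sup>+x. ennreal (\<sigma> x) * ennreal (F x powr p) \<partial>M)"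
        by (intro nn_integral_density) measurable
      also have "\<dots> = (\<integral>\<^sup>+x. ennreal (w x) * ennreal (\<bar>\<phi> x\<bar> powr p) \<partial>M)"
      proof (rule nn_integral_cong)
        fix x
        have s: "\<sigma> x > 0" by (rule w(2))
        have e: "\<sigma> x powr p = \<sigma> x powr (p - 1) * \<sigma> x" using s powr_add[of "\<sigma> x" "p - 1" 1] by simp
        have "w x = 1 / \<sigma> x powr (p - 1)" using w(3)[of x] s by (simp add: field_simps)
        then have "\<sigma> x * F x powr p = w x * \<bar>\<phi> x\<bar> powr p"
          using s by (simp add: F_def powr_divide e)
        then show "ennreal (\<sigma> x) * ennreal (F x powr p) = ennreal (w x) * ennreal (\<bar>\<phi> x\<bar> powr p)"
          using s w(1)[of x] by (simp add: ennreal_mult[symmetric] less_imp_le)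
      qed
      also have "\<dots> = ?Y" by (intro nn_integral_density[symmetric]) measurable
      finally show ?thesis .
    qed
    have NG: "(\<integral>\<^sup>+x. ennreal (G x powr q) \<partial>wm w) = ennreal (\<tau> powr q * X)"
    proof -
      have "(\<integral>\<^sup>+x. ennreal (G x powr q) \<partial>wm w) = (\<integral>\<^sup>+x. ennreal (\<tau> powr q) * ennreal (h x powr p) \<partial>wm w)"
        by (intro nn_integral_cong) (simp add: G_def powr_mult powr_powr q(3) ennreal_mult)
      also have "\<dots> = ennreal (\<tau> powr q) * ?X" by (rule nn_integral_cmult) measurable
      also have "\<dots> = ennreal (\<tau> powr q * X)" unfolding X(1) using X(2) by (simp add: ennreal_mult)
      finally show ?thesis .
    qed
    have "ennreal (\<tau> * X) = ennreal \<tau> * ?X" unfolding X(1) using X(2) \<tau> by (simp add: ennreal_mult)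
    also have "\<dots> = (\<integral>\<^sup>+x. ennreal \<tau> * ennreal (h x powr p) \<partial>wm w)" by (rule nn_integral_cmult[symmetric]) measurable
    also have "\<dots> = (\<integral>\<^sup>+x. (\<Sum>i\<in>I. ennreal (f i / m i) * (ennreal (G x) * indicator (Q i) x)) \<partial>wm w)"
    proof (rule nn_integral_cong)
      fix x
      have "h x powr p = h x * h x powr (p - 1)" using h0[of x] p by (cases "h x = 0") (simp_all add: powr_mult_base)
      then have "\<tau> * h x powr p = (\<Sum>i\<in>I. f i / m i * (G x * indicator (Q i) x))"
        unfolding h_def[of x] G_def by (simp add: sum_distrib_left sum_distrib_right mult_ac)
      then have "ennreal \<tau> * ennreal (h x powr p) = ennreal (\<Sum>i\<in>I. f i / m i * (G x * indicator (Q i) x))"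
        using \<tau> by (simp add: ennreal_mult[symmetric])
      also have "\<dots> = (\<Sum>i\<in>I. ennreal (f i / m i * (G x * indicator (Q i) x)))"
        using f m(1) G0[of x] by (intro sum_ennreal[symmetric] mult_nonneg_nonneg divide_nonneg_nonneg) (auto simp: less_imp_le)
      also have "\<dots> = (\<Sum>i\<in>I. ennreal (f i / m i) * (ennreal (G x) * indicator (Q i) x))"
      proof (rule sum.cong[OF refl])
        fix i assume i: "i \<in> I"
        have "ennreal (f i / m i * (G x * indicator (Q i) x)) = ennreal (f i / m i) * ennreal (G x * indicator (Q i) x)"
          using f[OF i] m(1)[OF i] G0[of x] by (intro ennreal_mult) auto
        also have "ennreal (G x * indicator (Q i) x) = ennreal (G x) * indicator (Q i) x" by (simp add: indicator_def)
        finally show "ennreal (f i / m i * (G x * indicator (Q i) x)) = ennreal (f i / m i) * (ennreal (G x) * indicator (Q i) x)" .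
      qed
      finally show "ennreal \<tau> * ennreal (h x powr p) = (\<Sum>i\<in>I. ennreal (f i / m i) * (ennreal (G x) * indicator (Q i) x))" .
    qed
    also have "\<dots> = (\<Sum>i\<in>I. ennreal (f i / m i) * ?J i)"
      using Q(1) by (subst nn_integral_sum) (auto simp: nn_integral_cmult)
    also have "\<dots> = (\<Sum>i\<in>I. ennreal (f i * g i / m i))"
    proof (rule sum.cong[OF refl])
      fix i assume i: "i \<in> I"
      have "ennreal (f i / m i) * ennreal (g i) = ennreal (f i / m i * g i)"
        using f[OF i] m(1)[OF i] g0[of i] by (intro ennreal_mult[symmetric]) auto
      then show "ennreal (f i / m i) * ?J i = ennreal (f i * g i / m i)" unfolding Jg[OF i] by simp
    qed
    also have "\<dots> \<le> ennreal K * (?Y + ennreal (\<tau> powr q * X))"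
      unfolding NF[symmetric] NG[symmetric] K_def
      by (rule bilinear_sparse[OF p q_def A _ _ _ _ w F0 G0 f g0 W S Ap fF gG]) auto
    finally have main: "ennreal (\<tau> * X) \<le> ennreal K * (?Y + ennreal (\<tau> powr q * X))" .
    show ?thesis
    proof (cases ?Y)
      case (real Y)
      have "ennreal (\<tau> * X) \<le> ennreal (K * (Y + \<tau> powr q * X))"
        using main unfolding real(2) using real(1) X(2) K
        by (simp add: ennreal_mult ennreal_plus)
      then have "\<tau> * X \<le> K * (Y + \<tau> powr q * X)" using real(1) X(2) K by (subst (asm) ennreal_le_iff) auto
      also have "\<dots> = K * Y + \<tau> / 2 * X" unfolding K\<tau>[symmetric] by (simp add: algebra_simps)
      finally have "\<tau> * X \<le> 2 * K * Y" by simp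
      then have "X \<le> 2 * K * Y / \<tau>" using \<tau> by (simp add: field_simps)
      also have "\<dots> = (2 * K) powr p * Y"
      proof -
        have "\<tau> = 1 / (2 * K) powr (p - 1)" unfolding \<tau>_def by (rule powr_minus_divide)
        then have "2 * K / \<tau> = (2 * K) * (2 * K) powr (p - 1)" by simp
        also have "\<dots> = (2 * K) powr p" using K powr_add[of "2 * K" 1 "p - 1"] by simp
        finally have "2 * K / \<tau> = (2 * K) powr p" .
        then show ?thesis by (simp only: times_divide_eq_left[symmetric])
      qed
      finally show ?thesis unfolding real(2) using real(1) by (simp add: ennreal_mult[symmetric] ennreal_leI)
    next
      case top
      then show ?thesis using K by (simp add: ennreal_mult_top)
    qed
  qed
  then show ?thesis unfolding X(1)[symmetric] K_def h_def by simp
qed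

end

text \<open>The A_p condition in the shape used by sparse families: strict positivity at every
  point, so that the dual weight is a real function, finite masses, and the A_p product on tripled
  dyadic cubes cleared of denominators.\<close>

definition good_weight :: "real \<Rightarrow> real \<Rightarrow> ('a::euclidean_space \<Rightarrow> real) \<Rightarrow> bool" where
  "good_weight p A w \<longleftrightarrow> w \<in> borel_measurable lebesgue \<and> (\<forall>x. w x > 0) \<and> A > 0 \<and>
     (\<forall>k x. \<exists>W\<ge>0. \<exists>S\<ge>0. emeasure (density lebesgue (\<lambda>x. ennreal (w x))) (dcube3 k x) = ennreal W \<and>
        emeasure (density lebesgue (\<lambda>x. ennreal (w x powr (- 1 / (p - 1))))) (dcube3 k x) = ennreal S \<and>
        W * S powr (p - 1) \<le> A * (3 ^ DIM('a) * side k ^ DIM('a)) powr p)"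

section \<open>Majorants of the truncations on dyadic cubes and on boxes\<close>

context cz begin

text \<open>\<open>AS\<close> from the sparse domination, 3^n from the normalisation of
  \<open>cavg\<close>, 2 from \<open>sparse_operator_bound\<close>; the sparseness parameter is 2 *
  3^n because a triple has 3^n times the volume of its cube and at least half of the cube is
  private.\<close>

definition maximal_const :: "real \<Rightarrow> real" where
  "maximal_const p = AS * 3 ^ DIM('a) * 2 * sparse_data.sparse_const (2 * 3 ^ DIM('a))
     (PiE (Basis::'a set) (\<lambda>_. {0..2::int})) p"

lemma maximal_const_pos:
  assumes "p > 1" shows "maximal_const p > 0"
proof -
  let ?R = "PiE (Basis::'a set) (\<lambda>_. {0..2::int})" and ?\<kappa> = "2 * 3 ^ DIM('a) :: real"
  \<comment> \<open>An instance with empty index set, made only to unfold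
    \<open>sparse_const\<close>, which depends on \<kappa> and on the set of classes.\<close>
  interpret sparse_data lebesgue "{} :: 'a set" "\<lambda>_. {}" "\<lambda>_. {}" "\<lambda>_. {}" "\<lambda>_. 1" ?\<kappa> ?R "\<lambda>_. undefined"
    by standard (auto simp: finite_dclass_range laminar_def disjoint_family_on_def)
  have "p / (p - 1) > 1" using assms by (simp add: less_divide_eq)
  then have "sparse_const p > 0"
    unfolding sparse_const_def card_dclass_range using carleson_const_pos assms
    by (intro mult_pos_pos add_pos_pos) auto
  then show ?thesis unfolding maximal_const_def using AS_pos by simp
qed

text \<open>The sparse sum itself serves as majorant: a finite combination of indicators of cubes,
  hence Borel, that dominates all truncations from \<eta> on at once.\<close>

lemma cube_majorant:
  fixes \<phi> w :: "'a \<Rightarrow> real"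
  assumes p: "p > 1" and gw: "good_weight p A w" and \<phi>: "integrable lborel \<phi>"
    and supp: "\<And>y. \<phi> y \<noteq> 0 \<Longrightarrow> y \<in> dcube3 k0 x0" and \<eta>: "\<eta> > 0"
  shows "\<exists>h\<in>borel_measurable borel. (\<forall>x. h x \<ge> 0) \<and> (\<forall>x\<in>dcube k0 x0. \<forall>\<delta>\<ge>\<eta>. \<bar>conv (tk \<delta>) \<phi> x\<bar> \<le> h x) \<and>
    (\<integral>\<^sup>+x. ennreal (h x powr p) \<partial>density lebesgue (\<lambda>x. ennreal (w x)))
     \<le> ennreal ((maximal_const p * A powr max 1 (1 / (p - 1))) powr p) *
        (\<integral>\<^sup>+x. ennreal (\<bar>\<phi> x\<bar> powr p) \<partial>density lebesgue (\<lambda>x. ennreal (w x)))"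
proof -
  let ?n = "DIM('a)" and ?R = "PiE (Basis::'a set) (\<lambda>_. {0..2::int})" and ?\<kappa> = "2 * 3 ^ DIM('a) :: real"
  let ?wm = "density lebesgue (\<lambda>x. ennreal (w x))"
  define \<sigma> where "\<sigma> x = w x powr (- 1 / (p - 1))" for x
  have w: "w \<in> borel_measurable lebesgue" "\<And>x. w x > 0" "A > 0" using gw by (auto simp: good_weight_def)
  have [measurable]: "w \<in> borel_measurable lebesgue" by (rule w)
  have sm: "\<sigma> \<in> borel_measurable lebesgue" unfolding \<sigma>_def[abs_def] by measurable
  have [measurable]: "\<phi> \<in> borel_measurable borel" using \<phi> by auto
  have \<phi>L: "\<phi> \<in> borel_measurable lebesgue" by (rule measurable_completion) simp
  obtain I E where sf: "sparse_family k0 x0 I E" and dom: "dominated \<eta> \<phi> k0 x0 I"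
    using sparse_domination[OF \<phi> \<eta>] by blast
  let ?P = "\<lambda>p::int \<times> 'a. dcube3 (fst p) (snd p)" and ?Q = "\<lambda>p::int \<times> 'a. dcube (fst p) (snd p)"
  let ?m = "\<lambda>p::int \<times> 'a. 3 ^ ?n * side (fst p) ^ ?n" and ?cl = "\<lambda>p::int \<times> 'a. dclass (fst p) (snd p)"
  interpret sparse_data lebesgue I ?P ?Q E ?m ?\<kappa> ?R ?cl
  proof
    show "finite I" "disjoint_family_on E I" by (rule sparse_familyD(1,2)[OF sf])+
    show "laminar (?P ` {i \<in> I. ?cl i = r})" for r
      by (rule laminar_subset[OF laminar_dclass[of r]]) auto
    fix i assume i: "i \<in> I"
    show "?cl i \<in> ?R" by (rule dclass_range)
    show "?P i \<in> sets lebesgue" "?Q i \<in> sets lebesgue" "E i \<in> sets lebesgue"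
      using sparse_familyD(5)[OF sf i] by auto
    show "E i \<subseteq> ?P i" using sparse_familyD(6)[OF sf i] dcube_subset_dcube3 by blast
    show "emeasure lebesgue (?P i) < \<infinity>" by (simp add: emeasure_dcube3)
    show "?Q i \<subseteq> ?P i" by (rule dcube_subset_dcube3)
    show "0 < ?m i" using side_pos by simp
    have "3 ^ ?n * side (fst i) ^ ?n \<le> 3 ^ ?n * (2 * measure lborel (E i))"
      by (intro mult_left_mono sparse_familyD(7)[OF sf i]) auto
    then show "?m i \<le> ?\<kappa> * measure lebesgue (E i)"
      using sparse_familyD(5)[OF sf i] by (simp add: measure_completion)
  qed (simp_all add: finite_dclass_range)
  have "\<forall>i. \<exists>W S. W \<ge> 0 \<and> S \<ge> 0 \<and> emeasure ?wm (?P i) = ennreal W \<and> emeasure (wm \<sigma>) (?P i) = ennreal S \<and>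
      W * S powr (p - 1) \<le> A * ?m i powr p"
    using gw unfolding good_weight_def \<sigma>_def by blast
  then obtain W S where WS: "\<forall>i. W i \<ge> 0 \<and> S i \<ge> 0 \<and> emeasure ?wm (?P i) = ennreal (W i) \<and> emeasure (wm \<sigma>) (?P i) = ennreal (S i) \<and>
      W i * S i powr (p - 1) \<le> A * ?m i powr p"
    by metis
  define f where "f i = dint (?P i) (\<lambda>y. \<bar>\<phi> y\<bar>)" for i :: "int \<times> 'a"
  define h0 where "h0 x = (\<Sum>i\<in>I. f i / ?m i * indicator (?Q i) x)" for x
  have h00: "h0 x \<ge> 0" for x unfolding h0_def
    using side_pos by (intro sum_nonneg mult_nonneg_nonneg divide_nonneg_nonneg) (auto simp: f_def dint_nonneg less_imp_le)
  have bound: "(\<integral>\<^sup>+x. ennreal (h0 x powr p) \<partial>?wm)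
     \<le> ennreal ((2 * (sparse_const p * A powr max 1 (1 / (p - 1)))) powr p) * (\<integral>\<^sup>+x. ennreal (\<bar>\<phi> x\<bar> powr p) \<partial>?wm)"
    unfolding h0_def
  proof (rule sparse_operator_bound[OF p w(3,1) sm \<phi>L w(2)])
    show "\<sigma> x > 0" for x using w(2)[of x] by (simp add: \<sigma>_def)
    have "- 1 / (p - 1) * (p - 1) = -1" using p by simp
    then have "\<sigma> x powr (p - 1) = w x powr -1" for x unfolding \<sigma>_def by (simp only: powr_powr)
    then show "w x * \<sigma> x powr (p - 1) = 1" for x using w(2)[of x] by (simp add: powr_minus)
    fix i assume "i \<in> I"
    show "f i \<ge> 0" by (simp add: f_def dint_nonneg)
    show "emeasure ?wm (?P i) = ennreal (W i)" "W i \<ge> 0" "emeasure (wm \<sigma>) (?P i) = ennreal (S i)" "S i \<ge> 0"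
      "W i * S i powr (p - 1) \<le> A * ?m i powr p" using spec[OF WS, of i] by blast+
    have "(\<integral>\<^sup>+x. ennreal \<bar>\<phi> x\<bar> * indicator (?P i) x \<partial>lebesgue) = (\<integral>\<^sup>+x. ennreal \<bar>\<phi> x\<bar> * indicator (?P i) x \<partial>lborel)"
      by (rule nn_integral_completion)
    also have "\<dots> = emeasure (density lborel (\<lambda>x. ennreal \<bar>\<phi> x\<bar>)) (?P i)" by (subst emeasure_density) auto
    also have "\<dots> = ennreal (f i)" unfolding f_def by (rule emeasure_density_abs[OF \<phi>]) simp
    finally show "ennreal (f i) \<le> (\<integral>\<^sup>+x. ennreal \<bar>\<phi> x\<bar> * indicator (?P i) x \<partial>lebesgue)" by simp
  qed
  let ?a = "AS * 3 ^ ?n"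
  have a0: "?a > 0" using AS_pos by simp
  define h where "h x = ?a * h0 x" for x
  have hb: "h \<in> borel_measurable borel" unfolding h_def[abs_def] h0_def by measurable
  have cav: "AS * (\<Sum>i\<in>I. cavg \<phi> i x) = h x" for x
  proof -
    have "cavg \<phi> i x = 3 ^ ?n * (f i / ?m i * indicator (?Q i) x)" for i by (simp add: cavg_def f_def)
    then show ?thesis by (simp add: h_def h0_def sum_distrib_left mult_ac)
  qed
  have \<phi>eq: "(\<lambda>y. indicator (dcube3 k0 x0) y * \<phi> y) = \<phi>"
  proof
    show "indicator (dcube3 k0 x0) y * \<phi> y = \<phi> y" for y using supp[of y] by (auto simp: indicator_def)
  qed
  have "(\<integral>\<^sup>+x. ennreal (h x powr p) \<partial>?wm) = (\<integral>\<^sup>+x. ennreal (?a powr p) * ennreal (h0 x powr p) \<partial>?wm)"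
    unfolding h_def by (intro nn_integral_cong) (simp only: powr_mult, rule ennreal_mult, auto)
  also have "\<dots> = ennreal (?a powr p) * (\<integral>\<^sup>+x. ennreal (h0 x powr p) \<partial>?wm)"
  proof (rule nn_integral_cmult)
    have "h0 \<in> borel_measurable borel" unfolding h0_def[abs_def] by measurable
    then have "h0 \<in> borel_measurable lebesgue" by (intro measurable_completion) simp
    then show "(\<lambda>x. ennreal (h0 x powr p)) \<in> borel_measurable ?wm" by measurable
  qed
  also have "\<dots> \<le> ennreal (?a powr p) * (ennreal ((2 * (sparse_const p * A powr max 1 (1 / (p - 1)))) powr p) * (\<integral>\<^sup>+x. ennreal (\<bar>\<phi> x\<bar> powr p) \<partial>?wm))"
    using bound by (intro mult_left_mono) auto
  also have "\<dots> = ennreal ((maximal_const p * A powr max 1 (1 / (p - 1))) powr p) * (\<integral>\<^sup>+x. ennreal (\<bar>\<phi> x\<bar> powr p) \<partial>?wm)"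
  proof -
    have "maximal_const p * A powr max 1 (1 / (p - 1)) = ?a * (2 * (sparse_const p * A powr max 1 (1 / (p - 1))))"
      by (simp add: maximal_const_def mult_ac)
    then have "(maximal_const p * A powr max 1 (1 / (p - 1))) powr p = ?a powr p * (2 * (sparse_const p * A powr max 1 (1 / (p - 1)))) powr p"
      by (simp only: powr_mult)
    then have "ennreal ((maximal_const p * A powr max 1 (1 / (p - 1))) powr p) = ennreal (?a powr p) * ennreal ((2 * (sparse_const p * A powr max 1 (1 / (p - 1)))) powr p)"
      by (simp only:) (rule ennreal_mult, auto)
    then show ?thesis by (simp only: mult.assoc)
  qed
  finally have fin: "(\<integral>\<^sup>+x. ennreal (h x powr p) \<partial>?wm) \<le> ennreal ((maximal_const p * A powr max 1 (1 / (p - 1))) powr p) * (\<integral>\<^sup>+x. ennreal (\<bar>\<phi> x\<bar> powr p) \<partial>?wm)" .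
  show ?thesis
  proof (intro bexI[OF _ hb] conjI allI ballI impI fin)
    show "h x \<ge> 0" for x using h00 a0 by (simp add: h_def)
    fix x \<delta> assume "x \<in> dcube k0 x0" "\<eta> \<le> \<delta>"
    then show "\<bar>conv (tk \<delta>) \<phi> x\<bar> \<le> h x" using dom unfolding dominated_def \<phi>eq cav by blast
  qed
qed

text \<open>Dyadic cubes never cross the coordinate hyperplanes, so no increasing sequence of them
  exhausts the space. This box around the origin meets 2^n dyadic cubes of level -m, and the triple
  of each of them contains the whole box.\<close>

definition dbox :: "nat \<Rightarrow> 'a set" where
  "dbox m = {x. \<forall>i\<in>Basis. - (2 ^ m) \<le> x \<bullet> i \<and> x \<bullet> i < 2 ^ m}"

lemma dbox_idx:
  assumes "x \<in> dbox m" "i \<in> Basis"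
  shows "-1 \<le> dyidx (- int m) x i \<and> dyidx (- int m) x i \<le> 0"
  using assms unfolding dyidx_le dyidx_ge by (auto simp: dbox_def side_def)

lemma dbox_borel[measurable]: "dbox m \<in> sets borel"
  unfolding dbox_def by measurable

lemma dbox_subset_dcube3: "x \<in> dbox m \<Longrightarrow> dbox m \<subseteq> dcube3 (- int m) x"
proof
  fix y assume x: "x \<in> dbox m" and y: "y \<in> dbox m"
  have "\<bar>dyidx (- int m) y i - dyidx (- int m) x i\<bar> \<le> 1" if "i \<in> Basis" for i
    using dbox_idx[OF x that] dbox_idx[OF y that] by linarith
  then show "y \<in> dcube3 (- int m) x" by (simp add: dblock_def)
qed

text \<open>The support of \<phi> fits into the triple of each of the at most 2^n dyadic cubes of
  the box, so \<open>cube_majorant\<close> applies to each with the same \<phi>. The majorants are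
  glued along the disjoint cubes, and their p-th powers add up.\<close>

lemma box_majorant:
  fixes \<phi> w :: "'a \<Rightarrow> real"
  assumes p: "p > 1" and gw: "good_weight p A w" and \<phi>: "integrable lborel \<phi>"
    and supp: "\<And>y. \<phi> y \<noteq> 0 \<Longrightarrow> y \<in> dbox m" and \<eta>: "\<eta> > 0"
  shows "\<exists>H\<in>borel_measurable borel. (\<forall>x. H x \<ge> 0) \<and> (\<forall>x\<in>dbox m. \<forall>\<delta>\<ge>\<eta>. \<bar>conv (tk \<delta>) \<phi> x\<bar> \<le> H x) \<and>
    (\<integral>\<^sup>+x. ennreal (H x powr p) \<partial>density lebesgue (\<lambda>x. ennreal (w x)))
     \<le> ennreal (2 ^ DIM('a) * (maximal_const p * A powr max 1 (1 / (p - 1))) powr p) *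
        (\<integral>\<^sup>+x. ennreal (\<bar>\<phi> x\<bar> powr p) \<partial>density lebesgue (\<lambda>x. ennreal (w x)))"
proof -
  let ?n = "DIM('a)" and ?wm = "density lebesgue (\<lambda>x. ennreal (w x))" and ?k = "- int m"
  let ?C = "(maximal_const p * A powr max 1 (1 / (p - 1))) powr p" and ?Y = "\<integral>\<^sup>+x. ennreal (\<bar>\<phi> x\<bar> powr p) \<partial>?wm"
  let ?\<D> = "dcube ?k ` dbox m"
  have finD: "finite ?\<D>" and cardD: "card ?\<D> \<le> 2 ^ ?n"
    using dcubes_finite_card[of "dbox m" "-1" ?k 0 0] dbox_idx by auto
  have "\<forall>D\<in>?\<D>. \<exists>h. h \<in> borel_measurable borel \<and> (\<forall>x. h x \<ge> 0) \<and> (\<forall>x\<in>D. \<forall>\<delta>\<ge>\<eta>. \<bar>conv (tk \<delta>) \<phi> x\<bar> \<le> h x) \<and>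
     (\<integral>\<^sup>+x. ennreal (h x powr p) \<partial>?wm) \<le> ennreal ?C * ?Y"
  proof
    fix D assume "D \<in> ?\<D>"
    then obtain x where x: "x \<in> dbox m" "D = dcube ?k x" by auto
    show "\<exists>h. h \<in> borel_measurable borel \<and> (\<forall>x. h x \<ge> 0) \<and> (\<forall>x\<in>D. \<forall>\<delta>\<ge>\<eta>. \<bar>conv (tk \<delta>) \<phi> x\<bar> \<le> h x) \<and>
     (\<integral>\<^sup>+x. ennreal (h x powr p) \<partial>?wm) \<le> ennreal ?C * ?Y"
      unfolding x(2) Bex_def[symmetric] using supp dbox_subset_dcube3[OF x(1)] by (intro cube_majorant[OF p gw \<phi> _ \<eta>]) auto
  qed
  from bchoice[OF this] obtain h where hh: "\<forall>D\<in>?\<D>. h D \<in> borel_measurable borel \<and> (\<forall>x. h D x \<ge> 0) \<and>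
     (\<forall>x\<in>D. \<forall>\<delta>\<ge>\<eta>. \<bar>conv (tk \<delta>) \<phi> x\<bar> \<le> h D x) \<and> (\<integral>\<^sup>+x. ennreal (h D x powr p) \<partial>?wm) \<le> ennreal ?C * ?Y"
    by (rule exE)
  have h: "h D \<in> borel_measurable borel" "h D x \<ge> 0" "x \<in> D \<Longrightarrow> \<eta> \<le> \<delta> \<Longrightarrow> \<bar>conv (tk \<delta>) \<phi> x\<bar> \<le> h D x"
    "(\<integral>\<^sup>+x. ennreal (h D x powr p) \<partial>?wm) \<le> ennreal ?C * ?Y" if "D \<in> ?\<D>" for D x \<delta>
    using bspec[OF hh that] by blast+
  define H where "H x = (\<Sum>D\<in>?\<D>. indicator D x * h D x)" for x
  have Dm: "D \<in> sets borel" if "D \<in> ?\<D>" for D using that by auto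
  have HD: "H x = (if dcube ?k x \<in> ?\<D> then h (dcube ?k x) x else 0)" for x
  proof -
    have "x \<in> D \<longleftrightarrow> D = dcube ?k x" if D: "D \<in> ?\<D>" for D
    proof -
      from D obtain z where z: "D = dcube ?k z" by (rule imageE)
      show ?thesis
      proof
        assume "x \<in> D"
        then have "dcube ?k x = dcube ?k z" unfolding z by (rule dblock_cong)
        then show "D = dcube ?k x" using z by (rule trans[OF _ sym, rotated])
      next
        assume "D = dcube ?k x"
        then show "x \<in> D" by (simp only: dblock_self le_refl)
      qed
    qed
    then have "H x = (\<Sum>D\<in>?\<D>. if D = dcube ?k x then h D x else 0)"
      unfolding H_def by (intro sum.cong refl) (simp add: indicator_def)
    also have "\<dots> = (if dcube ?k x \<in> ?\<D> then h (dcube ?k x) x else 0)" by (rule sum.delta[OF finD])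
    finally show ?thesis .
  qed
  have Hb: "H \<in> borel_measurable borel"
    unfolding H_def[abs_def] using h(1) Dm by (intro borel_measurable_sum borel_measurable_times borel_measurable_indicator) auto
  have "(\<integral>\<^sup>+x. ennreal (H x powr p) \<partial>?wm) \<le> (\<integral>\<^sup>+x. (\<Sum>D\<in>?\<D>. ennreal (h D x powr p)) \<partial>?wm)"
  proof (rule nn_integral_mono)
    fix x
    show "ennreal (H x powr p) \<le> (\<Sum>D\<in>?\<D>. ennreal (h D x powr p))"
    proof (cases "dcube ?k x \<in> ?\<D>")
      case True
      then have "ennreal (H x powr p) = ennreal (h (dcube ?k x) x powr p)" by (simp add: HD)
      also have "\<dots> \<le> (\<Sum>D\<in>?\<D>. ennreal (h D x powr p))"
        using True finD by (intro member_le_sum[where f="\<lambda>D. ennreal (h D x powr p)"]) auto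
      finally show ?thesis .
    qed (simp add: HD)
  qed
  also have "\<dots> = (\<Sum>D\<in>?\<D>. \<integral>\<^sup>+x. ennreal (h D x powr p) \<partial>?wm)"
  proof (rule nn_integral_sum)
    fix D assume "D \<in> ?\<D>"
    then have "h D \<in> borel_measurable lebesgue" using h(1) by (intro measurable_completion) simp
    then show "(\<lambda>x. ennreal (h D x powr p)) \<in> borel_measurable ?wm" by measurable
  qed
  also have "\<dots> \<le> (\<Sum>D\<in>?\<D>. ennreal ?C * ?Y)" by (intro sum_mono h(4))
  also have "\<dots> = of_nat (card ?\<D>) * (ennreal ?C * ?Y)" by simp
  also have "\<dots> \<le> of_nat (2 ^ ?n) * (ennreal ?C * ?Y)"
    using cardD by (intro mult_right_mono) (simp_all only: of_nat_le_iff zero_le)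
  also have "\<dots> = ennreal (2 ^ ?n * ?C) * ?Y"
  proof -
    have "ennreal (2 ^ ?n * ?C) = ennreal (real (2 ^ ?n)) * ennreal ?C" by (simp only: of_nat_power of_nat_numeral) (rule ennreal_mult, auto)
    then show ?thesis by (simp only: ennreal_of_nat_eq_real_of_nat mult.assoc)
  qed
  finally have fin: "(\<integral>\<^sup>+x. ennreal (H x powr p) \<partial>?wm) \<le> ennreal (2 ^ ?n * ?C) * ?Y" .
  show ?thesis
  proof (intro bexI[OF _ Hb] conjI allI ballI impI fin)
    show "H x \<ge> 0" for x using h(2) by (simp add: HD)
    fix x \<delta> assume "x \<in> dbox m" "\<eta> \<le> \<delta>"
    then show "\<bar>conv (tk \<delta>) \<phi> x\<bar> \<le> H x" using h(3)[of "dcube ?k x" x \<delta>] by (simp add: HD dblock_self)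
  qed
qed

end

section \<open>Almost everywhere convergence of the truncations\<close>

lemma at_right_Cauchy_limit:
  fixes g :: "real \<Rightarrow> real"
  assumes "\<And>t. t > 0 \<Longrightarrow> \<exists>d>0. \<forall>a b. 0 < a \<and> a < d \<and> 0 < b \<and> b < d \<longrightarrow> \<bar>g a - g b\<bar> < t"
  shows "\<exists>l. (g \<longlongrightarrow> l) (at_right 0)"
proof -
  define s where "s n = 1 / real (Suc n)" for n
  have s0: "s n > 0" for n by (simp add: s_def)
  have sl: "\<exists>n0. \<forall>n\<ge>n0. s n < d" if d: "d > 0" for d
  proof -
    obtain n0 where n0: "1 / real (Suc n0) < d" using reals_Archimedean[OF d] by (auto simp: inverse_eq_divide)
    have "s n < d" if "n \<ge> n0" for n
    proof -
      have "s n \<le> 1 / real (Suc n0)" unfolding s_def using that by (intro divide_left_mono) auto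
      then show ?thesis using n0 by linarith
    qed
    then show ?thesis by blast
  qed
  have "Cauchy (\<lambda>n. g (s n))"
  proof (rule CauchyI)
    fix t :: real assume "t > 0"
    then obtain d where d: "d > 0" "\<forall>a b. 0 < a \<and> a < d \<and> 0 < b \<and> b < d \<longrightarrow> \<bar>g a - g b\<bar> < t" using assms by blast
    obtain n0 where "\<forall>n\<ge>n0. s n < d" using sl[OF d(1)] by blast
    then show "\<exists>M. \<forall>m\<ge>M. \<forall>n\<ge>M. norm (g (s m) - g (s n)) < t" using d(2) s0 by (intro exI[of _ n0]) auto
  qed
  then obtain l where l: "(\<lambda>n. g (s n)) \<longlonglongrightarrow> l" using Cauchy_convergent convergent_def by blast
  have "(g \<longlongrightarrow> l) (at_right 0)"
  proof (rule tendstoI)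
    fix t :: real assume "t > 0"
    then obtain d where d: "d > 0" "\<forall>a b. 0 < a \<and> a < d \<and> 0 < b \<and> b < d \<longrightarrow> \<bar>g a - g b\<bar> < t / 2" using assms[of "t / 2"] by auto
    obtain n0 where n0: "\<forall>n\<ge>n0. s n < d" using sl[OF d(1)] by blast
    obtain n1 where n1: "\<forall>n\<ge>n1. \<bar>g (s n) - l\<bar> < t / 2"
      using LIMSEQ_D[OF l, of "t / 2"] \<open>t > 0\<close> by auto
    have "dist (g a) l < t" if "0 < a" "a < d" for a
    proof -
      let ?n = "max n0 n1"
      have "\<bar>g a - g (s ?n)\<bar> < t / 2" using d(2) that s0[of ?n] n0 by auto
      moreover have "\<bar>g (s ?n) - l\<bar> < t / 2" using n1 by auto
      ultimately show ?thesis unfolding dist_real_def by linarith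
    qed
    then show "\<forall>\<^sub>F x in at_right 0. dist (g x) l < t"
      unfolding eventually_at_right_field using d(1) by blast
  qed
  then show ?thesis by blast
qed

lemma tendsto_at_right_Cauchy:
  fixes g :: "real \<Rightarrow> real"
  assumes "(g \<longlongrightarrow> l) (at_right 0)" "t > 0"
  shows "\<exists>d>0. \<forall>a b. 0 < a \<and> a < d \<and> 0 < b \<and> b < d \<longrightarrow> \<bar>g a - g b\<bar> < t"
proof -
  have "\<forall>\<^sub>F x in at_right 0. dist (g x) l < t / 2" using tendstoD[OF assms(1), of "t / 2"] assms(2) by simp
  then obtain d where d: "d > 0" "\<forall>y>0. y < d \<longrightarrow> dist (g y) l < t / 2"
    unfolding eventually_at_right_field by blast
  have "\<bar>g a - g b\<bar> < t" if "0 < a" "a < d" "0 < b" "b < d" for a b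
  proof -
    have "\<bar>g a - l\<bar> < t / 2" "\<bar>g b - l\<bar> < t / 2" using d(2) that by (auto simp: dist_real_def)
    then show ?thesis by linarith
  qed
  then show ?thesis using d(1) by blast
qed

text \<open>B may fail to be measurable; the intersection of covers of measure at most 1 / (m + 1)
  is a measurable null set around it.\<close>

lemma null_set_by_small_covers:
  fixes B :: "'a::euclidean_space set"
  assumes "\<And>e. e > 0 \<Longrightarrow> \<exists>V\<in>sets lborel. B \<subseteq> V \<and> emeasure lborel V \<le> ennreal e"
  shows "\<exists>N\<in>null_sets lborel. B \<subseteq> N"
proof -
  have "\<forall>m. \<exists>V. V \<in> sets lborel \<and> B \<subseteq> V \<and> emeasure lborel V \<le> ennreal (1 / real (Suc m))"
  proof
    fix m :: nat
    show "\<exists>V. V \<in> sets lborel \<and> B \<subseteq> V \<and> emeasure lborel V \<le> ennreal (1 / real (Suc m))"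
      using assms[of "1 / real (Suc m)"] by auto
  qed
  from choice[OF this] obtain V where V: "\<forall>m. V m \<in> sets lborel \<and> B \<subseteq> V m \<and> emeasure lborel (V m) \<le> ennreal (1 / real (Suc m))" by blast
  define N where "N = (\<Inter>m. V m)"
  have N: "N \<in> sets lborel" "B \<subseteq> N" unfolding N_def using V by auto
  have "emeasure lborel N \<le> ennreal (1 / real (Suc m))" for m
  proof -
    have "emeasure lborel N \<le> emeasure lborel (V m)" using V by (intro emeasure_mono) (auto simp: N_def)
    then show ?thesis using V order_trans by blast
  qed
  then have "emeasure lborel N \<le> ennreal e" if "e > 0" for e
  proof -
    obtain m where "1 / real (Suc m) < e" using reals_Archimedean[OF \<open>e > 0\<close>] by (auto simp: inverse_eq_divide)
    then have "ennreal (1 / real (Suc m)) \<le> ennreal e" by (intro ennreal_leI) simp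
    then show ?thesis using \<open>\<And>m. emeasure lborel N \<le> ennreal (1 / real (Suc m))\<close>[of m] by (rule order_trans[rotated])
  qed
  then have "emeasure lborel N \<le> 0 + ennreal e" if "e > 0" for e using that by simp
  then have "emeasure lborel N \<le> 0" by (rule ennreal_le_epsilon)
  then show ?thesis using N by (intro bexI[of _ N]) (auto simp: null_sets_def)
qed

text \<open>Inside S take a compact C of positive measure and an open U around C that exceeds it by
  less than half of its measure. A small translate of C stays in U; if it avoided C, it would fit
  into U - C, which is too small.\<close>

lemma Steinhaus_differences:
  fixes S :: "'a::euclidean_space set"
  assumes S: "S \<in> sets borel" "emeasure lborel S > 0"
  shows "\<exists>r>0. \<forall>z. norm z < r \<longrightarrow> (\<exists>x\<in>S. x - z \<in> S)"
proof -
  obtain m :: nat where m: "emeasure lborel (S \<inter> cball 0 (real m)) > 0"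
  proof (rule ccontr)
    assume "\<not> thesis"
    then have "emeasure lborel (S \<inter> cball 0 (real m)) = 0" for m :: nat using that not_gr_zero by blast
    then have "(\<Union>m::nat. S \<inter> cball 0 (real m)) \<in> null_sets lborel"
      using S(1) by (intro null_sets_UN) (auto simp: null_sets_def)
    moreover have "(\<Union>m::nat. S \<inter> cball 0 (real m)) = S"
    proof -
      have "\<exists>m::nat. norm x \<le> real m" for x :: 'a by (rule real_arch_simple)
      then show ?thesis by auto
    qed
    ultimately show False using S(2) by (auto simp: null_sets_def)
  qed
  let ?S = "S \<inter> cball 0 (real m)"
  have Sb: "?S \<in> sets borel" using S(1) by auto
  have SL: "?S \<in> sets lebesgue" using Sb by simp
  have fin: "emeasure lborel ?S < \<infinity>"
    using le_less_trans[OF emeasure_mono[of ?S "cball 0 (real m)" lborel]] emeasure_lborel_cball_finite[of 0 "real m"] by auto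
  obtain \<mu> where \<mu>: "emeasure lborel ?S = ennreal \<mu>" "\<mu> > 0"
    using m fin by (cases "emeasure lborel ?S") (auto simp: ennreal_zero_less_top)
  have "\<mu> / 2 > 0" using \<mu>(2) by simp
  from sets_lebesgue_inner_closed[OF SL this] obtain C where C: "closed C" "C \<subseteq> ?S" "emeasure lebesgue (?S - C) < ennreal (\<mu> / 2)"
    by metis
  have cC: "compact C" using C(1,2) bounded_subset[OF bounded_cball[of 0 "real m"], of C] by (auto simp: compact_eq_bounded_closed)
  have Cb: "C \<in> sets borel" using C(1) by simp
  have "emeasure lborel C \<le> emeasure lborel ?S" using C(2) Sb by (intro emeasure_mono) auto
  then obtain \<nu> where \<nu>: "emeasure lborel C = ennreal \<nu>" "\<nu> \<ge> 0"
    using fin by (cases "emeasure lborel C") auto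
  have "\<nu> > 0"
  proof (rule ccontr)
    assume "\<not> \<nu> > 0"
    then have "emeasure lborel C = 0" using \<nu> by simp
    have "emeasure lborel ?S \<le> emeasure lborel (C \<union> (?S - C))" using Sb Cb by (intro emeasure_mono) auto
    also have "\<dots> \<le> emeasure lborel C + emeasure lborel (?S - C)" using Sb Cb by (intro emeasure_subadditive) auto
    also have "\<dots> \<le> ennreal (\<mu> / 2)" using C(3) \<open>emeasure lborel C = 0\<close> Sb Cb by simp
    finally show False using \<mu> by simp
  qed
  have "\<nu> / 2 > 0" "C \<in> sets lebesgue" using \<open>\<nu> > 0\<close> Cb by simp_all
  from sets_lebesgue_outer_open[OF this(2,1)] obtain U where U: "open U" "C \<subseteq> U" "emeasure lebesgue (U - C) < ennreal (\<nu> / 2)"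
    by metis
  obtain r where r: "r > 0" "(\<Union>x\<in>C. ball x r) \<subseteq> U"
    using compact_subset_open_imp_ball_epsilon_subset[OF cC U(1,2)] by auto
  have "\<exists>x\<in>S. x - z \<in> S" if z: "norm z < r" for z
  proof (rule ccontr)
    assume no: "\<not> (\<exists>x\<in>S. x - z \<in> S)"
    let ?T = "(\<lambda>x. z + x) ` C"
    have "compact ?T" using cC by (rule compact_translation)
    then have Tb: "?T \<in> sets borel" by (simp add: compact_imp_closed)
    have Tm: "emeasure lborel ?T = emeasure lborel C"
      using emeasure_lebesgue_affine[of 1 z C] Tb Cb by (simp add: add.commute)
    have "?T \<subseteq> U - C"
    proof
      fix y assume "y \<in> ?T"
      then obtain x where x: "x \<in> C" "y = z + x" by auto
      have "y \<in> ball x r" using z x by (simp add: dist_norm)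
      then have "y \<in> U" using r(2) x by blast
      moreover have "y \<notin> C"
      proof
        assume "y \<in> C"
        then have "y \<in> S" "y - z \<in> S" using x C(2) by auto
        then show False using no by blast
      qed
      ultimately show "y \<in> U - C" by blast
    qed
    then have "emeasure lborel ?T \<le> emeasure lborel (U - C)" using U(1) Cb by (intro emeasure_mono) auto
    also have "\<dots> < ennreal (\<nu> / 2)" using U(1,3) Cb by simp
    finally show False using Tm \<nu> by (simp add: ennreal_less_iff)
  qed
  then show ?thesis using r(1) by blast
qed

lemma convex_dcube3_frontier: "negligible (frontier (dcube3 k (x::'a::euclidean_space)))"
proof -
  have "convex (dcube3 k x)"
  proof -
    have "dcube3 k x = (\<Inter>i\<in>Basis. {y. of_int (dyidx k x i - 1) * side k \<le> i \<bullet> y} \<inter> {y. i \<bullet> y < (of_int (dyidx k x i + 1) + 1) * side k})"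
      by (auto simp: dblock_eq dyidx_le dyidx_ge inner_commute simp del: of_int_add of_int_diff)
    also have "convex \<dots>"
      by (intro convex_INT ballI convex_Int convex_halfspace_lt convex_halfspace_ge)
    finally show ?thesis .
  qed
  then show ?thesis by (rule negligible_convex_frontier)
qed

context cz begin

text \<open>For truncations from 1 / (m + 1) on, the grand maximal operator at a sufficiently fine
  level N dominates, because the inner part vanishes there. This gives one cover for each m, all of
  the same measure bound.\<close>

theorem max_trunc_weak_type:
  fixes h :: "'a \<Rightarrow> real"
  assumes h: "integrable lborel h" and supp: "\<And>y. h y \<noteq> 0 \<Longrightarrow> y \<in> dcube3 k0 x0" and t: "t > 0"
  shows "\<exists>V\<in>sets lborel. {x\<in>dcube k0 x0. \<exists>\<delta>>0. t < \<bar>conv (tk \<delta>) h x\<bar>} \<subseteq> V \<and>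
     emeasure lborel V \<le> ennreal (CG / t * (\<integral>y. \<bar>h y\<bar> \<partial>lborel))"
proof -
  let ?c = "ennreal (CG / t * (\<integral>y. \<bar>h y\<bar> \<partial>lborel))" and ?\<eta> = "\<lambda>m::nat. 1 / real (Suc m)"
  have ex: "\<exists>U. U \<in> sets lborel \<and> {x\<in>dcube k0 x0. \<exists>\<delta>\<ge>?\<eta> m. t < \<bar>conv (tk \<delta>) h x\<bar>} \<subseteq> U \<and> emeasure lborel U \<le> ?c" for m
  proof -
    have e0: "?\<eta> m > 0" by simp
    obtain N where N: "N \<ge> k0" "2 * DIM('a) * side N < ?\<eta> m"
      using exists_small_side[OF e0, of k0 "2 * DIM('a)"] by auto
    let ?U = "\<Union>{dcube k x |k x. k \<in> {k0..N} \<and> x \<in> dcube k0 x0 \<and> gbad (?\<eta> m) h t k x}"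
    have "{x\<in>dcube k0 x0. \<exists>\<delta>\<ge>?\<eta> m. t < \<bar>conv (tk \<delta>) h x\<bar>} \<subseteq> ?U"
    proof
      fix x assume "x \<in> {x\<in>dcube k0 x0. \<exists>\<delta>\<ge>?\<eta> m. t < \<bar>conv (tk \<delta>) h x\<bar>}"
      then obtain \<delta> where x: "x \<in> dcube k0 x0" "\<delta> \<ge> ?\<eta> m" "t < \<bar>conv (tk \<delta>) h x\<bar>" by auto
      have d0: "\<delta> > 0" using x(2) e0 by linarith
      have "h = (\<lambda>y. indicator (- dcube3 N x) y * h y + indicator (dcube3 N x) y * h y)"
        by (auto simp: indicator_def)
      then have "conv (tk \<delta>) h x = conv (tk \<delta>) (\<lambda>y. indicator (- dcube3 N x) y * h y + indicator (dcube3 N x) y * h y) x"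
        by (rule arg_cong)
      also have "\<dots> = conv (tk \<delta>) (\<lambda>y. indicator (- dcube3 N x) y * h y) x + conv (tk \<delta>) (\<lambda>y. indicator (dcube3 N x) y * h y) x"
        by (rule conv_add_right[OF tk_borel tk_le[OF d0] integrable_indicator_mult[OF h] integrable_indicator_mult[OF h]]) auto
      also have "conv (tk \<delta>) (\<lambda>y. indicator (dcube3 N x) y * h y) x = 0"
        using N(2) x(2) by (intro local_trunc_zero[of N "?\<eta> m"]) (auto simp: dblock_self)
      finally have "gbad (?\<eta> m) h t N x"
        unfolding gbad_def using x by (intro bexI[of _ x] exI[of _ \<delta>]) (auto simp: dblock_self)
      then have "dcube N x \<in> {dcube k x |k x. k \<in> {k0..N} \<and> x \<in> dcube k0 x0 \<and> gbad (?\<eta> m) h t k x}"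
        using x(1) N(1) by force
      moreover have "x \<in> dcube N x" by (simp add: dblock_self)
      ultimately show "x \<in> ?U" by (rule UnionI)
    qed
    moreover have "?U \<in> sets borel" by (rule grand_maximal_weak_type(1)[OF h supp t e0])
    moreover have "emeasure lborel ?U \<le> ?c" by (rule grand_maximal_weak_type(2)[OF h supp t e0])
    ultimately show ?thesis by (intro exI[of _ ?U]) simp
  qed
  have "\<forall>m. \<exists>U. U \<in> sets lborel \<and> {x\<in>dcube k0 x0. \<exists>\<delta>\<ge>?\<eta> m. t < \<bar>conv (tk \<delta>) h x\<bar>} \<subseteq> U \<and> emeasure lborel U \<le> ?c"
    by (rule allI, rule ex)
  from choice[OF this] obtain U where U: "\<forall>m. U m \<in> sets lborel \<and> {x\<in>dcube k0 x0. \<exists>\<delta>\<ge>?\<eta> m. t < \<bar>conv (tk \<delta>) h x\<bar>} \<subseteq> U m \<and> emeasure lborel (U m) \<le> ?c"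
    by blast
  define A where "A m = (\<Inter>j\<in>{m..}. U j)" for m
  have Am: "A m \<in> sets lborel" for m unfolding A_def using U by (intro sets.countable_INT'') auto
  have inc: "incseq A" unfolding incseq_def A_def by auto
  have "emeasure lborel (\<Union>m. A m) = (SUP m. emeasure lborel (A m))"
    using Am inc by (intro SUP_emeasure_incseq[symmetric]) auto
  also have "\<dots> \<le> ?c"
  proof (rule SUP_least)
    fix m
    have "emeasure lborel (A m) \<le> emeasure lborel (U m)" using U by (intro emeasure_mono) (auto simp: A_def)
    then show "emeasure lborel (A m) \<le> ?c" using U order_trans by blast
  qed
  finally have le: "emeasure lborel (\<Union>m. A m) \<le> ?c" .
  have "{x\<in>dcube k0 x0. \<exists>\<delta>>0. t < \<bar>conv (tk \<delta>) h x\<bar>} \<subseteq> (\<Union>m. A m)"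
  proof
    fix x assume "x \<in> {x\<in>dcube k0 x0. \<exists>\<delta>>0. t < \<bar>conv (tk \<delta>) h x\<bar>}"
    then obtain \<delta> where x: "x \<in> dcube k0 x0" "\<delta> > 0" "t < \<bar>conv (tk \<delta>) h x\<bar>" by auto
    obtain m where m: "?\<eta> m < \<delta>" using reals_Archimedean[OF x(2)] by (auto simp: inverse_eq_divide)
    have "x \<in> U j" if "j \<ge> m" for j
    proof -
      have "?\<eta> j \<le> ?\<eta> m" using that by (intro divide_left_mono) auto
      then have "?\<eta> j \<le> \<delta>" using m by linarith
      then have "x \<in> {x\<in>dcube k0 x0. \<exists>\<delta>\<ge>?\<eta> j. t < \<bar>conv (tk \<delta>) h x\<bar>}" using x by blast
      then show ?thesis using U by blast
    qed
    then show "x \<in> (\<Union>m. A m)" unfolding A_def by blast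
  qed
  then show ?thesis using le Am by (intro bexI[of _ "\<Union>m. A m"]) auto
qed

definition trunc_converges :: "('a \<Rightarrow> real) \<Rightarrow> 'a \<Rightarrow> bool" where
  "trunc_converges h x \<longleftrightarrow> (\<exists>l. ((\<lambda>\<delta>. conv (tk \<delta>) h x) \<longlongrightarrow> l) (at_right 0))"

lemma trunc_converges_eventually_const:
  assumes "d > 0" "\<And>\<delta>. 0 < \<delta> \<Longrightarrow> \<delta> < d \<Longrightarrow> conv (tk \<delta>) h x = a"
  shows "trunc_converges h x"
  unfolding trunc_converges_def
proof (intro exI)
  have "\<forall>\<^sub>F \<delta> in at_right 0. conv (tk \<delta>) h x = a"
    unfolding eventually_at_right_field using assms by blast
  then show "((\<lambda>\<delta>. conv (tk \<delta>) h x) \<longlongrightarrow> a) (at_right 0)" by (rule tendsto_eventually)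
qed

text \<open>Off the frontier the truncations are constant for small \<delta>: at an interior point
  the additional annuli lie in S and cancel, and at an exterior point S stays away from the
  singularity.\<close>

lemma trunc_converges_indicator:
  fixes S :: "'a set"
  assumes S[measurable]: "S \<in> sets borel" and bd: "bounded S" and x: "x \<notin> frontier S"
  shows "trunc_converges (indicator S) x"
proof -
  have iS: "integrable lborel (indicator S :: 'a \<Rightarrow> real)"
    using bd emeasure_bounded_finite[OF bd] by (intro integrable_real_indicator) auto
  consider "x \<in> interior S" | "x \<in> - closure S" using x by (auto simp: frontier_def)
  then show ?thesis
  proof cases
    case 1
    then obtain r where r: "r > 0" "ball x r \<subseteq> S" by (auto simp: mem_interior)
    show ?thesis
    proof (rule trunc_converges_eventually_const[of "r / 2"])
      fix \<delta> :: real assume d: "0 < \<delta>" "\<delta> < r / 2"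
      let ?a = "\<lambda>z. if \<delta> < norm z \<and> norm z \<le> r / 2 then K z else 0"
      have ma: "?a \<in> borel_measurable borel" by measurable
      have i1: "integrable lborel (\<lambda>y. tk (r / 2) (x - y) * indicator S y)"
        by (rule conv_bound(2)[OF tk_borel tk_le iS]) (use r in auto)
      have i2: "integrable lborel (\<lambda>y. ?a (x - y))"
      proof (rule lborel_integrable_reflect, rule integrable_bounded_support[OF ma])
        show "\<bar>?a z\<bar> \<le> c / \<delta> ^ DIM('a)" for z using K_le[OF d(1), of z] c_pos d by auto
        show "?a z \<noteq> 0 \<Longrightarrow> norm z \<le> r / 2" for z by (auto split: if_splits)
      qed
      have "tk \<delta> (x - y) * indicator S y = tk (r / 2) (x - y) * indicator S y + ?a (x - y)" for y
      proof (cases "\<delta> < norm (x - y) \<and> norm (x - y) \<le> r / 2")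
        case True
        then have "y \<in> S" using r by (auto simp: subset_iff dist_norm)
        then show ?thesis using True by (simp add: trunc_kernel_def)
      qed (use d in \<open>auto simp: trunc_kernel_def\<close>)
      then have "conv (tk \<delta>) (indicator S) x = conv (tk (r / 2)) (indicator S) x + (\<integral>y. ?a (x - y) \<partial>lborel)"
        unfolding conv_def using i1 i2 by simp
      also have "(\<integral>y. ?a (x - y) \<partial>lborel) = 0"
        using lborel_integral_reflect[OF ma, of x] annulus_mean_zero[of \<delta> "r / 2"] d by simp
      finally show "conv (tk \<delta>) (indicator S) x = conv (tk (r / 2)) (indicator S) x" by simp
    qed (use r in auto)
  next
    case 2
    have "open (- closure S)" by (rule open_Compl) (rule closed_closure)
    then obtain r where r: "r > 0" "ball x r \<subseteq> - closure S" using 2 openE by blast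
    show ?thesis
    proof (rule trunc_converges_eventually_const[OF r(1)])
      fix \<delta> :: real assume d: "0 < \<delta>" "\<delta> < r"
      \<comment> \<open>Since K 0 = 0, \<open>tk 0\<close> is K itself; it serves as the value
        independent of \<delta>.\<close>
      have "tk \<delta> (x - y) * indicator S y = tk 0 (x - y) * indicator S y" for y
      proof (cases "y \<in> S")
        case True
        then have "y \<notin> ball x r" using r(2) closure_subset by blast
        then have "\<delta> < norm (x - y)" using d by (simp add: dist_norm)
        then show ?thesis using d K0 by (simp add: trunc_kernel_def)
      qed simp
      then show "conv (tk \<delta>) (indicator S) x = conv (tk 0) (indicator S) x" unfolding conv_def by (simp only:)
    qed
  qed
qed

definition converges_ae :: "int \<Rightarrow> 'a \<Rightarrow> ('a \<Rightarrow> real) \<Rightarrow> bool" where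
  "converges_ae k0 x0 h \<longleftrightarrow> (AE x in lborel. x \<in> dcube k0 x0 \<longrightarrow> trunc_converges (\<lambda>y. indicator (dcube3 k0 x0) y * h y) x)"

text \<open>Banach's principle: by the weak type bound for the maximal truncation of h - g, the
  oscillation of the truncations of h exceeds 3 t only on a set of arbitrarily small
  measure.\<close>

lemma converges_ae_closed:
  fixes h :: "'a \<Rightarrow> real"
  assumes h: "integrable lborel h"
    and approx: "\<And>e. e > 0 \<Longrightarrow> \<exists>g. integrable lborel g \<and> converges_ae k0 x0 g \<and> (\<integral>x. \<bar>h x - g x\<bar> \<partial>lborel) \<le> e"
  shows "converges_ae k0 x0 h"
proof -
  let ?r = "\<lambda>h y. indicator (dcube3 k0 x0) y * h y :: real"
  \<comment> \<open>The three parts of 3 t are the oscillation for g and two values of the maximal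
    truncation of the difference.\<close>
  define B where "B t = {x\<in>dcube k0 x0. \<not> (\<exists>d>0. \<forall>a b. 0 < a \<and> a < d \<and> 0 < b \<and> b < d \<longrightarrow> \<bar>conv (tk a) (?r h) x - conv (tk b) (?r h) x\<bar> < 3 * t)}" for t
  have null: "\<exists>N\<in>null_sets lborel. B t \<subseteq> N" if t: "t > 0" for t
  proof (rule null_set_by_small_covers)
    fix e :: real assume e: "e > 0"
    \<comment> \<open>This accuracy makes the weak type bound at height t equal to e.\<close>
    define e' where "e' = t * e / CG"
    have e': "e' > 0" using t e CG_pos by (simp add: e'_def)
    obtain g where g: "integrable lborel g" "converges_ae k0 x0 g" "(\<integral>x. \<bar>h x - g x\<bar> \<partial>lborel) \<le> e'"
      using approx[OF e'] by blast
    obtain M where M: "M \<in> null_sets lborel" "{x. \<not> (x \<in> dcube k0 x0 \<longrightarrow> trunc_converges (?r g) x)} \<subseteq> M"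
      using g(2) unfolding converges_ae_def by (auto elim!: AE_E simp: null_sets_def)
    let ?u = "?r (\<lambda>y. h y - g y)"
    have ihg: "integrable lborel (\<lambda>y. h y - g y)" using h g(1) by simp
    have iu: "integrable lborel ?u" by (rule integrable_indicator_mult[OF ihg]) simp
    have u1: "(\<integral>y. \<bar>?u y\<bar> \<partial>lborel) \<le> e'"
    proof -
      have "(\<integral>y. \<bar>?u y\<bar> \<partial>lborel) \<le> (\<integral>x. \<bar>h x - g x\<bar> \<partial>lborel)"
        using dint_le[OF ihg, of "dcube3 k0 x0"] by (simp add: dint_def abs_mult)
      then show ?thesis using g(3) by linarith
    qed
    obtain V where V: "V \<in> sets lborel" "{x\<in>dcube k0 x0. \<exists>\<delta>>0. t < \<bar>conv (tk \<delta>) ?u x\<bar>} \<subseteq> V"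
      "emeasure lborel V \<le> ennreal (CG / t * (\<integral>y. \<bar>?u y\<bar> \<partial>lborel))"
      using max_trunc_weak_type[OF iu _ t, of k0 x0] by (auto simp: indicator_def split: if_splits)
    have "CG / t * (\<integral>y. \<bar>?u y\<bar> \<partial>lborel) \<le> CG / t * e'" using u1 CG_pos t by (intro mult_left_mono) auto
    also have "\<dots> = e" using CG_pos t by (simp add: e'_def)
    finally have Ve: "emeasure lborel V \<le> ennreal e" using V(3) by (meson ennreal_leI order_trans)
    have "B t \<subseteq> M \<union> V"
    proof
      fix x assume x: "x \<in> B t"
      then have xQ: "x \<in> dcube k0 x0" by (simp add: B_def)
      show "x \<in> M \<union> V"
      proof (rule ccontr)
        assume no: "x \<notin> M \<union> V"
        then have "trunc_converges (?r g) x" using M(2) xQ by blast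
        then obtain l where l: "((\<lambda>\<delta>. conv (tk \<delta>) (?r g) x) \<longlongrightarrow> l) (at_right 0)" by (auto simp: trunc_converges_def)
        obtain d where d: "d > 0" "\<forall>a b. 0 < a \<and> a < d \<and> 0 < b \<and> b < d \<longrightarrow> \<bar>conv (tk a) (?r g) x - conv (tk b) (?r g) x\<bar> < t"
          using tendsto_at_right_Cauchy[OF l t] by blast
        have us: "\<bar>conv (tk a) ?u x\<bar> \<le> t" if "a > 0" for a
        proof (rule ccontr)
          assume "\<not> \<bar>conv (tk a) ?u x\<bar> \<le> t"
          then have "t < \<bar>conv (tk a) ?u x\<bar>" by simp
          then have "x \<in> V" using V(2) xQ that by blast
          then show False using no by simp
        qed
        have split: "conv (tk a) (?r h) x = conv (tk a) (?r g) x + conv (tk a) ?u x" if "a > 0" for a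
        proof -
          have eq: "?r h = (\<lambda>y. ?r g y + ?u y)" by (auto simp: algebra_simps)
          show ?thesis unfolding eq
            by (rule conv_add_right[OF tk_borel tk_le[OF that] integrable_indicator_mult[OF g(1)] iu]) auto
        qed
        have "\<bar>conv (tk a) (?r h) x - conv (tk b) (?r h) x\<bar> < 3 * t" if ab: "0 < a" "a < d" "0 < b" "b < d" for a b
        proof -
          have "\<bar>conv (tk a) (?r g) x - conv (tk b) (?r g) x\<bar> < t" using d(2) ab by blast
          then show ?thesis using us[OF ab(1)] us[OF ab(3)] split[OF ab(1)] split[OF ab(3)] by linarith
        qed
        then show False using x d(1) by (auto simp: B_def)
      qed
    qed
    moreover have "emeasure lborel (M \<union> V) \<le> ennreal e"
    proof -
      have "emeasure lborel (M \<union> V) \<le> emeasure lborel M + emeasure lborel V" using M(1) V(1) by (intro emeasure_subadditive) auto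
      then show ?thesis using M(1) Ve by (simp add: null_sets_def)
    qed
    moreover have "M \<union> V \<in> sets lborel" using M(1) V(1) by (simp only: sets.Un null_setsD2)
    ultimately show "\<exists>V\<in>sets lborel. B t \<subseteq> V \<and> emeasure lborel V \<le> ennreal e" by blast
  qed
  have "\<forall>m::nat. \<exists>N. N \<in> null_sets lborel \<and> B (1 / real (Suc m)) \<subseteq> N"
  proof
    fix m :: nat
    show "\<exists>N. N \<in> null_sets lborel \<and> B (1 / real (Suc m)) \<subseteq> N" using null[of "1 / real (Suc m)"] by auto
  qed
  from choice[OF this] obtain N where N: "\<forall>m::nat. N m \<in> null_sets lborel \<and> B (1 / real (Suc m)) \<subseteq> N m" by blast
  have "(\<Union>m. N m) \<in> null_sets lborel" using N by (intro null_sets_UN) auto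
  then show ?thesis unfolding converges_ae_def
  proof (rule AE_I')
    show "{x \<in> space lborel. \<not> (x \<in> dcube k0 x0 \<longrightarrow> trunc_converges (?r h) x)} \<subseteq> (\<Union>m. N m)"
    proof
      fix x assume "x \<in> {x \<in> space lborel. \<not> (x \<in> dcube k0 x0 \<longrightarrow> trunc_converges (?r h) x)}"
      then have x: "x \<in> dcube k0 x0" "\<not> trunc_converges (?r h) x" by auto
      show "x \<in> (\<Union>m. N m)"
      proof (rule ccontr)
        assume no: "x \<notin> (\<Union>m. N m)"
        have "trunc_converges (?r h) x" unfolding trunc_converges_def
        proof (rule at_right_Cauchy_limit)
          fix t :: real assume t: "t > 0"
          obtain m where m: "1 / real (Suc m) < t / 3" using reals_Archimedean[of "t / 3"] t by (auto simp: inverse_eq_divide)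
          have "x \<notin> B (1 / real (Suc m))" using no N by blast
          then obtain d where d: "d > 0" "\<forall>a b. 0 < a \<and> a < d \<and> 0 < b \<and> b < d \<longrightarrow> \<bar>conv (tk a) (?r h) x - conv (tk b) (?r h) x\<bar> < 3 * (1 / real (Suc m))"
            using x(1) unfolding B_def by blast
          have "3 * (1 / real (Suc m)) < t" using m by simp
          then show "\<exists>d>0. \<forall>a b. 0 < a \<and> a < d \<and> 0 < b \<and> b < d \<longrightarrow> \<bar>conv (tk a) (?r h) x - conv (tk b) (?r h) x\<bar> < t"
            using d less_trans by blast
        qed
        then show False using x(2) by simp
      qed
    qed
  qed
qed

end

lemma negligible_frontier_Union:
  assumes "finite F" "\<And>A. A \<in> F \<Longrightarrow> negligible (frontier A)"
  shows "negligible (frontier (\<Union>F))"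
  using assms
proof (induction F rule: finite_induct)
  case (insert A F)
  have "negligible (frontier A \<union> frontier (\<Union>F))" using insert by (intro negligible_Un) auto
  then show ?case using frontier_Un_subset[of A "\<Union>F"] unfolding Union_insert by (rule negligible_subset)
qed simp

context cz begin

lemma conv_cmult_right: "conv k (\<lambda>y. u y * a) x = conv k u x * a"
  by (simp add: conv_def mult.assoc[symmetric])

lemma converges_ae_add:
  assumes "integrable lborel g" "converges_ae k0 x0 g" "integrable lborel h" "converges_ae k0 x0 h"
  shows "converges_ae k0 x0 (\<lambda>x. g x + h x)"
proof -
  let ?r = "\<lambda>h y. indicator (dcube3 k0 x0) y * h y :: real"
  have ig: "integrable lborel (?r g)" and ih: "integrable lborel (?r h)"
    by (rule integrable_indicator_mult, fact, simp)+
  have eq: "?r (\<lambda>x. g x + h x) = (\<lambda>y. ?r g y + ?r h y)" by (auto simp: algebra_simps)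
  have "trunc_converges (?r (\<lambda>x. g x + h x)) x" if gh: "trunc_converges (?r g) x" "trunc_converges (?r h) x" for x
  proof -
    obtain l m where "((\<lambda>\<delta>. conv (tk \<delta>) (?r g) x) \<longlongrightarrow> l) (at_right 0)" "((\<lambda>\<delta>. conv (tk \<delta>) (?r h) x) \<longlongrightarrow> m) (at_right 0)"
      using gh unfolding trunc_converges_def by blast
    then have lim: "((\<lambda>\<delta>. conv (tk \<delta>) (?r g) x + conv (tk \<delta>) (?r h) x) \<longlongrightarrow> l + m) (at_right 0)" by (rule tendsto_add)
    have "conv (tk \<delta>) (?r (\<lambda>x. g x + h x)) x = conv (tk \<delta>) (?r g) x + conv (tk \<delta>) (?r h) x" if "\<delta> > 0" for \<delta>
      unfolding eq by (rule conv_add_right[OF tk_borel tk_le[OF that] ig ih])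
    then have "\<forall>\<^sub>F \<delta> in at_right 0. conv (tk \<delta>) (?r g) x + conv (tk \<delta>) (?r h) x = conv (tk \<delta>) (?r (\<lambda>x. g x + h x)) x"
      unfolding eventually_at_right_field by (intro exI[of _ 1]) auto
    from Lim_transform_eventually[OF lim this] show ?thesis unfolding trunc_converges_def by (rule exI)
  qed
  then show ?thesis using assms(2,4) unfolding converges_ae_def by (auto elim: eventually_elim2)
qed

lemma converges_ae_cmult:
  assumes "converges_ae k0 x0 g"
  shows "converges_ae k0 x0 (\<lambda>x. g x * a)"
proof -
  let ?r = "\<lambda>h y. indicator (dcube3 k0 x0) y * h y :: real"
  have eq: "?r (\<lambda>x. g x * a) = (\<lambda>y. ?r g y * a)" by (auto simp: mult.assoc)
  have "trunc_converges (?r (\<lambda>x. g x * a)) x" if "trunc_converges (?r g) x" for x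
    using that unfolding trunc_converges_def eq conv_cmult_right by (elim exE) (rule exI, erule tendsto_mult_right)
  then show ?thesis using assms unfolding converges_ae_def by (auto elim: eventually_mono)
qed

lemma converges_ae_indicator_frontier:
  assumes [measurable]: "S \<in> sets borel" and fr: "negligible (frontier S)"
  shows "converges_ae k0 x0 (indicator S)"
proof -
  let ?T = "S \<inter> dcube3 k0 x0"
  have eq: "(\<lambda>y. indicator (dcube3 k0 x0) y * indicator S y) = (indicator ?T :: 'a \<Rightarrow> real)"
    by (auto simp: indicator_def)
  have "negligible (frontier S \<union> frontier (dcube3 k0 x0))" using fr convex_dcube3_frontier by (rule negligible_Un)
  then have "negligible (frontier ?T)" by (rule negligible_subset) (rule frontier_Int_subset)
  then have "frontier ?T \<in> null_sets lebesgue" by (simp add: negligible_iff_null_sets)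
  then have "frontier ?T \<in> null_sets lborel" by (simp add: null_sets_completion_iff)
  moreover have "bounded ?T" using bounded_dblock[of 1 k0 x0] by (rule bounded_subset) auto
  ultimately show ?thesis unfolding converges_ae_def eq
    using trunc_converges_indicator[of ?T] by (intro AE_I'[of "frontier ?T"]) auto
qed

text \<open>Between a compact C inside S and an open U around C, both within e / 2 in measure,
  compactness places a finite union of balls. Its frontier is negligible and its indicator is close
  to that of S in L^1.\<close>

lemma converges_ae_indicator_bounded:
  assumes S: "S \<in> sets borel" and bd: "bounded S"
  shows "converges_ae k0 x0 (indicator S)"
proof (rule converges_ae_closed)
  show iS: "integrable lborel (indicator S :: 'a \<Rightarrow> real)"
    using S emeasure_bounded_finite[OF bd] by (intro integrable_real_indicator) auto
  fix e :: real assume e: "e > 0"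
  have SL: "S \<in> sets lebesgue" and e2: "e / 2 > 0" using S e by simp_all
  from sets_lebesgue_inner_closed[OF SL e2] obtain C where C: "closed C" "C \<subseteq> S" "emeasure lebesgue (S - C) < ennreal (e / 2)"
    by metis
  have cC: "compact C" using C bd by (simp add: compact_eq_bounded_closed bounded_subset[OF bd])
  have Cb: "C \<in> sets borel" using C(1) by simp
  then have CL: "C \<in> sets lebesgue" by simp
  from sets_lebesgue_outer_open[OF CL e2] obtain U where U: "open U" "C \<subseteq> U" "emeasure lebesgue (U - C) < ennreal (e / 2)"
    by metis
  from compact_subset_open_imp_ball_epsilon_subset[OF cC U(1,2)] obtain r where r: "r > 0" "(\<Union>x\<in>C. ball x r) \<subseteq> U"
    by metis
  have "C \<subseteq> (\<Union>x\<in>C. ball x r)" using r(1) by auto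
  from compactE_image[OF cC _ this] obtain X where X: "X \<subseteq> C" "finite X" "C \<subseteq> (\<Union>x\<in>X. ball x r)" by auto
  let ?F = "\<Union>x\<in>X. ball x r"
  have Fb: "?F \<in> sets borel" by (intro borel_open open_UN) simp
  have Ub: "U \<in> sets borel" using U(1) by simp
  have FU: "?F \<subseteq> U" using X(1) r(2) by auto
  have "negligible (frontier ?F)"
    using X(2) by (intro negligible_frontier_Union) (auto intro!: negligible_convex_frontier)
  then have conv: "converges_ae k0 x0 (indicator ?F)" using Fb by (intro converges_ae_indicator_frontier) auto
  have bF: "bounded ?F" using X(2) by (auto intro!: bounded_UN)
  have iF: "integrable lborel (indicator ?F :: 'a \<Rightarrow> real)"
    using Fb emeasure_bounded_finite[OF bF] by (intro integrable_real_indicator) auto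
  have "ennreal (\<integral>x. \<bar>indicator S x - indicator ?F x :: real\<bar> \<partial>lborel) = (\<integral>\<^sup>+x. ennreal \<bar>indicator S x - indicator ?F x :: real\<bar> \<partial>lborel)"
    using iS iF by (intro nn_integral_eq_integral[symmetric]) auto
  also have "\<dots> \<le> (\<integral>\<^sup>+x. indicator (S - C) x + indicator (U - C) x \<partial>lborel)"
  proof (rule nn_integral_mono)
    have "ennreal \<bar>indicator S x - indicator F x :: real\<bar> \<le> indicator (S - C) x + indicator (U - C) x"
      if "C \<subseteq> F" "F \<subseteq> U" for F x
      using that C(2) by (auto simp: indicator_def)
    from this[OF X(3) FU] show "ennreal \<bar>indicator S x - indicator ?F x :: real\<bar> \<le> indicator (S - C) x + indicator (U - C) x" for x .
  qed
  also have "\<dots> = emeasure lborel (S - C) + emeasure lborel (U - C)"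
    using S Cb Ub by (subst nn_integral_add) auto
  also have "\<dots> \<le> ennreal (e / 2) + ennreal (e / 2)"
    using C(3) U(1,3) S Cb by (intro add_mono) (simp_all add: less_imp_le)
  also have "\<dots> = ennreal e" using e by (subst ennreal_plus[symmetric]) auto
  finally have "(\<integral>x. \<bar>indicator S x - indicator ?F x :: real\<bar> \<partial>lborel) \<le> e" using e by (simp add: ennreal_le_iff)
  then show "\<exists>g. integrable lborel g \<and> converges_ae k0 x0 g \<and> (\<integral>x. \<bar>indicator S x - g x\<bar> \<partial>lborel) \<le> e"
    using iF conv by blast
qed

lemma converges_ae_restrict:
  "converges_ae k0 x0 (\<lambda>y. indicator (dcube3 k0 x0) y * h y) \<Longrightarrow> converges_ae k0 x0 h"
  unfolding converges_ae_def by (simp add: mult.assoc[symmetric] indicator_inter_arith[symmetric])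

theorem converges_ae_integrable:
  fixes h :: "'a \<Rightarrow> real"
  assumes "integrable lborel h" shows "converges_ae k0 x0 h"
  using assms
proof (induction rule: integrable_induct)
  case (base A c)
  have "converges_ae k0 x0 (indicator (A \<inter> dcube3 k0 x0))"
    using base(1) bounded_subset[OF bounded_dblock[of 1 k0 x0]] by (intro converges_ae_indicator_bounded) auto
  also have "indicator (A \<inter> dcube3 k0 x0) = (\<lambda>y. indicator (dcube3 k0 x0) y * indicator A y :: real)"
    by (auto simp: indicator_def)
  finally have "converges_ae k0 x0 (indicator A)" by (rule converges_ae_restrict)
  then show ?case using converges_ae_cmult[of k0 x0 "indicator A" c] by simp
next
  case (add f g)
  then show ?case by (intro converges_ae_add)
next
  case (lim f s)
  note lim = lim.hyps(1) lim.IH lim.hyps(2-4)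
  show ?case
  proof (rule converges_ae_closed[OF lim(5)])
    fix e :: real assume e: "e > 0"
    have "(\<lambda>i. \<integral>x. \<bar>f x - s i x\<bar> \<partial>lborel) \<longlonglongrightarrow> (\<integral>x. 0 \<partial>(lborel :: 'a measure))"
    proof (rule integral_dominated_convergence[where w="\<lambda>x. 3 * \<bar>f x\<bar>"])
      show "integrable lborel (\<lambda>x. 3 * \<bar>f x\<bar>)" using lim(5) by simp
      show "(\<lambda>x. \<bar>f x - s i x\<bar>) \<in> borel_measurable lborel" for i
        using lim(1)[of i] lim(5) by (intro borel_measurable_abs borel_measurable_diff) auto
      have "(\<lambda>i. \<bar>f x - s i x\<bar>) \<longlonglongrightarrow> 0" for x
        using tendsto_rabs[OF tendsto_diff[OF tendsto_const lim(3)[of x]], of "f x"] by simp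
      then show "AE x in lborel. (\<lambda>i. \<bar>f x - s i x\<bar>) \<longlonglongrightarrow> 0" by simp
      have "\<bar>f x - s i x\<bar> \<le> 3 * \<bar>f x\<bar>" for i x using lim(4)[of x i] by simp
      then show "AE x in lborel. norm \<bar>f x - s i x\<bar> \<le> 3 * \<bar>f x\<bar>" for i by simp
    qed simp
    then have "(\<lambda>i. \<integral>x. \<bar>f x - s i x\<bar> \<partial>lborel) \<longlonglongrightarrow> 0" by simp
    from LIMSEQ_D[OF this e] obtain i where "norm ((\<integral>x. \<bar>f x - s i x\<bar> \<partial>lborel) - 0) < e" by blast
    then have "(\<integral>x. \<bar>f x - s i x\<bar> \<partial>lborel) \<le> e" by simp
    then show "\<exists>g. integrable lborel g \<and> converges_ae k0 x0 g \<and> (\<integral>x. \<bar>f x - g x\<bar> \<partial>lborel) \<le> e"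
      using lim(1,2) by blast
  qed
qed

section \<open>Functions that are not locally integrable\<close>

lemma trunc_integrable_mono:
  assumes [measurable]: "\<phi> \<in> borel_measurable borel" and "\<delta> \<le> d"
    and i: "integrable lborel (\<lambda>y. tk \<delta> (x - y) * \<phi> y)"
  shows "integrable lborel (\<lambda>y. tk d (x - y) * \<phi> y)"
  by (rule Bochner_Integration.integrable_bound[OF i]) (use assms(2) in \<open>auto simp: trunc_kernel_def\<close>)

text \<open>Points outside the triple are at distance more than side k from x, so once \<delta> <
  side k the outer part of the truncated integral no longer depends on \<delta>.\<close>

lemma trunc_converges_local:
  fixes \<phi> :: "'a \<Rightarrow> real"
  assumes \<phi>[measurable]: "\<phi> \<in> borel_measurable borel" and x: "x \<in> dcube k z"
    and conv: "trunc_converges (\<lambda>y. indicator (dcube3 k z) y * \<phi> y) x"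
    and loc: "integrable lborel (\<lambda>y. indicator (dcube3 k z) y * \<phi> y)"
    and int: "\<And>\<delta>. \<delta> > 0 \<Longrightarrow> integrable lborel (\<lambda>y. tk \<delta> (x - y) * \<phi> y)"
  shows "trunc_converges \<phi> x"
proof -
  let ?in = "\<lambda>y. indicator (dcube3 k z) y * \<phi> y" and ?out = "\<lambda>y. indicator (- dcube3 k z) y * \<phi> y"
  obtain l where l: "((\<lambda>\<delta>. conv (tk \<delta>) ?in x) \<longlongrightarrow> l) (at_right 0)" using conv by (auto simp: trunc_converges_def)
  have "conv (tk \<delta>) \<phi> x = conv (tk \<delta>) ?in x + conv (tk 0) ?out x" if d: "0 < \<delta>" "\<delta> < side k" for \<delta>
  proof -
    have out: "tk \<delta> (x - y) * ?out y = tk 0 (x - y) * ?out y" for y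
    proof (cases "y \<in> dcube3 k z")
      case False
      have "dcube3 k x = dcube3 k z" by (rule dblock_cong[OF x])
      then have "\<not> norm (x - y) \<le> side k" using False dcube3_near[of x y k] by auto
      then show ?thesis using d by (auto simp: trunc_kernel_def)
    qed simp
    have i1: "integrable lborel (\<lambda>y. tk \<delta> (x - y) * ?in y)"
      by (rule conv_bound(2)[OF tk_borel tk_le[OF d(1)] loc])
    have "integrable lborel (\<lambda>y. indicator (- dcube3 k z) y * (tk \<delta> (x - y) * \<phi> y))"
      by (rule integrable_indicator_mult[OF int[OF d(1)]]) simp
    then have i2: "integrable lborel (\<lambda>y. tk \<delta> (x - y) * ?out y)" by (simp add: mult_ac)
    have "tk \<delta> (x - y) * \<phi> y = tk \<delta> (x - y) * ?in y + tk \<delta> (x - y) * ?out y" for y by (simp add: indicator_def)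
    then have "conv (tk \<delta>) \<phi> x = (\<integral>y. tk \<delta> (x - y) * ?in y + tk \<delta> (x - y) * ?out y \<partial>lborel)" by (simp add: conv_def)
    also have "\<dots> = conv (tk \<delta>) ?in x + (\<integral>y. tk \<delta> (x - y) * ?out y \<partial>lborel)"
      unfolding conv_def by (rule Bochner_Integration.integral_add[OF i1 i2])
    finally show ?thesis unfolding out conv_def .
  qed
  then have "\<forall>\<^sub>F \<delta> in at_right 0. conv (tk \<delta>) ?in x + conv (tk 0) ?out x = conv (tk \<delta>) \<phi> x"
    unfolding eventually_at_right_field using side_pos[of k] by (intro exI[of _ "side k"]) auto
  from Lim_transform_eventually[OF tendsto_add[OF l tendsto_const] this] show ?thesis
    unfolding trunc_converges_def by (rule exI)
qed

text \<open>A truncated integral that does not exist at d does not exist for any smaller \<delta>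
  either, and the Bochner integral then takes its default value 0, so the limit is 0.\<close>

lemma trunc_converges_not_integrable:
  assumes \<phi>: "\<phi> \<in> borel_measurable borel" and d: "d > 0" "\<not> integrable lborel (\<lambda>y. tk d (x - y) * \<phi> y)"
  shows "trunc_converges \<phi> x"
proof (rule trunc_converges_eventually_const[OF d(1)])
  fix \<delta> assume "0 < \<delta>" "\<delta> < d"
  then have "\<not> integrable lborel (\<lambda>y. tk \<delta> (x - y) * \<phi> y)" using trunc_integrable_mono[OF \<phi>, of \<delta> d x] d(2) by auto
  then show "conv (tk \<delta>) \<phi> x = 0" unfolding conv_def by (rule not_integrable_integral_eq)
qed

text \<open>If \<open>\<phi>\<close> is not locally integrable near \<open>x - z\<close> while \<open>K z \<noteq> 0\<close>, the truncated integrals at \<open>x\<close>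
  do not exist. By the Steinhaus theorem such a \<open>z\<close> can be found whenever the points where \<open>\<phi>\<close> fails to be
  locally integrable and all truncated integrals exist form a set of positive measure.\<close>
lemma locally_integrable_ae:
  fixes \<phi> :: "'a \<Rightarrow> real"
  assumes \<phi>[measurable]: "\<phi> \<in> borel_measurable borel"
    and K: "\<And>r. r > 0 \<Longrightarrow> \<exists>z. norm z < r \<and> K z \<noteq> 0"
  shows "AE x in lborel. (\<forall>\<delta>>0. integrable lborel (\<lambda>y. tk \<delta> (x - y) * \<phi> y)) \<longrightarrow>
    (\<exists>r>0. integrable lborel (\<lambda>y. indicator (ball x r) y * \<phi> y))"
proof -
  let ?\<eta> = "\<lambda>m::nat. 1 / real (Suc m)"
  define G where "G = {x. \<exists>r>0. integrable lborel (\<lambda>y. indicator (ball x r) y * \<phi> y)}"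
  \<comment> \<open>Running through the sequence 1 / (m + 1) instead of all \<delta> > 0 makes this
    set Borel.\<close>
  define E where "E = {x. \<forall>m. integrable lborel (\<lambda>y. tk (?\<eta> m) (x - y) * \<phi> y)}"
  have "open G" unfolding open_contains_ball
  proof
    fix x assume "x \<in> G"
    then obtain r where r: "r > 0" "integrable lborel (\<lambda>y. indicator (ball x r) y * \<phi> y)" by (auto simp: G_def)
    have "z \<in> G" if z: "z \<in> ball x (r / 2)" for z
    proof -
      have "ball z (r / 2) \<subseteq> ball x r"
      proof
        fix y assume "y \<in> ball z (r / 2)"
        then show "y \<in> ball x r" using z dist_triangle[of x y z] by simp
      qed
      then have eq: "(\<lambda>y. indicator (ball z (r / 2)) y * (indicator (ball x r) y * \<phi> y)) = (\<lambda>y. indicator (ball z (r / 2)) y * \<phi> y)"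
        by (auto simp: indicator_def subset_iff simp del: mem_ball)
      have "integrable lborel (\<lambda>y. indicator (ball z (r / 2)) y * (indicator (ball x r) y * \<phi> y))"
        by (rule integrable_indicator_mult[OF r(2)]) simp
      then show ?thesis unfolding eq G_def using r(1) by (intro CollectI exI[of _ "r / 2"]) simp
    qed
    then show "\<exists>e>0. ball x e \<subseteq> G" using r(1) by (intro exI[of _ "r / 2"]) auto
  qed
  then have Gb: "G \<in> sets borel" by simp
  have Eb: "E \<in> sets borel"
  proof -
    have "E = {x\<in>space borel. \<forall>m. (\<integral>\<^sup>+y. ennreal (norm (tk (?\<eta> m) (x - y) * \<phi> y)) \<partial>lborel) < \<infinity>}"
      unfolding E_def by (simp add: integrable_iff_bounded)
    also have "\<dots> \<in> sets borel" by measurable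
    finally show ?thesis .
  qed
  have "E - G \<in> null_sets lborel"
  proof (rule ccontr)
    assume "E - G \<notin> null_sets lborel"
    then have "emeasure lborel (E - G) > 0" using Eb Gb by (auto simp: null_sets_def zero_less_iff_neq_zero)
    then obtain r where r: "r > 0" "\<forall>z. norm z < r \<longrightarrow> (\<exists>x\<in>E - G. x - z \<in> E - G)"
      using Steinhaus_differences[of "E - G"] Eb Gb by auto
    obtain z where z: "norm z < r" "K z \<noteq> 0" using K[OF r(1)] by blast
    obtain x where x: "x \<in> E" "x - z \<notin> G" using r(2) z(1) by blast
    have z0: "z \<noteq> 0" using z(2) K0 by auto
    \<comment> \<open>By continuity K(x - y) stays above half of |K z| for y near x - z, and such y
      lie outside the truncation radius; existence of the truncated integral at x thus makes \<phi>
      integrable around x - z.\<close>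
    have "\<bar>K z\<bar> / 2 > 0" using z(2) by simp
    from K_isCont[OF z0, unfolded continuous_at_eps_delta, rule_format, OF this]
    obtain s where s: "s > 0" "\<forall>u. norm (u - z) < s \<longrightarrow> \<bar>K u - K z\<bar> < \<bar>K z\<bar> / 2" by (auto simp: dist_norm dist_real_def)
    obtain m where m: "?\<eta> m < norm z / 2" using reals_Archimedean[of "norm z / 2"] z0 by (auto simp: inverse_eq_divide)
    let ?s = "min s (norm z / 2)"
    have sp: "?s > 0" using s z0 by simp
    have "\<forall>m. integrable lborel (\<lambda>y. tk (?\<eta> m) (x - y) * \<phi> y)" using x(1) unfolding E_def by (rule CollectD)
    then have iE: "integrable lborel (\<lambda>y. tk (?\<eta> m) (x - y) * \<phi> y)" by (rule spec)
    have "integrable lborel (\<lambda>y. indicator (ball (x - z) ?s) y * \<phi> y)"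
    proof (rule Bochner_Integration.integrable_bound)
      show "integrable lborel (\<lambda>y. 2 / \<bar>K z\<bar> * (tk (?\<eta> m) (x - y) * \<phi> y))" using iE by (rule integrable_mult_right)
      show "AE y in lborel. norm (indicator (ball (x - z) ?s) y * \<phi> y) \<le> norm (2 / \<bar>K z\<bar> * (tk (?\<eta> m) (x - y) * \<phi> y))"
      proof (rule AE_I2)
        fix y
        show "norm (indicator (ball (x - z) ?s) y * \<phi> y) \<le> norm (2 / \<bar>K z\<bar> * (tk (?\<eta> m) (x - y) * \<phi> y))"
        proof (cases "y \<in> ball (x - z) ?s")
          case True
          have "norm ((x - y) - z) = dist (x - z) y" by (simp add: dist_norm algebra_simps)
          then have n: "norm ((x - y) - z) < ?s" using True by simp
          then have "\<bar>K (x - y) - K z\<bar> < \<bar>K z\<bar> / 2" using s(2) by simp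
          then have k: "\<bar>K (x - y)\<bar> \<ge> \<bar>K z\<bar> / 2" by linarith
          have "norm z \<le> norm (x - y) + norm ((x - y) - z)" using norm_triangle_sub[of z "x - y"] by (simp add: norm_minus_commute)
          then have "?\<eta> m < norm (x - y)" using n m by linarith
          then have t: "tk (?\<eta> m) (x - y) = K (x - y)" by (simp add: trunc_kernel_def)
          have "1 \<le> 2 / \<bar>K z\<bar> * \<bar>K (x - y)\<bar>" using k z(2) by (simp add: field_simps)
          then have "1 * \<bar>\<phi> y\<bar> \<le> (2 / \<bar>K z\<bar> * \<bar>K (x - y)\<bar>) * \<bar>\<phi> y\<bar>" by (rule mult_right_mono) simp
          then show ?thesis using True unfolding t by (simp add: abs_mult)
        qed simp
      qed
    qed (use \<phi> in \<open>auto intro!: borel_measurable_times borel_measurable_indicator\<close>)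
    then have "x - z \<in> G" unfolding G_def using sp by blast
    then show False using x(2) by simp
  qed
  then show ?thesis
  proof (rule AE_I')
    show "{x \<in> space lborel. \<not> ((\<forall>\<delta>>0. integrable lborel (\<lambda>y. tk \<delta> (x - y) * \<phi> y)) \<longrightarrow>
      (\<exists>r>0. integrable lborel (\<lambda>y. indicator (ball x r) y * \<phi> y)))} \<subseteq> E - G"
      unfolding E_def G_def by auto
  qed
qed

text \<open>If K vanishes near 0, truncation has no effect for small \<delta>. Otherwise almost
  every point falls into one of two cases: some truncated integral does not exist, or \<phi> is
  integrable on a small tripled cube and the theorem for integrable functions applies there.\<close>

theorem trunc_converges_ae:
  fixes \<phi> :: "'a \<Rightarrow> real"
  assumes \<phi>[measurable]: "\<phi> \<in> borel_measurable borel"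
  shows "AE x in lborel. trunc_converges \<phi> x"
proof (cases "\<forall>r>0. \<exists>z. norm z < r \<and> K z \<noteq> 0")
  case False
  then obtain r where r: "r > 0" "\<And>z. norm z < r \<Longrightarrow> K z = 0" by auto
  have "trunc_converges \<phi> x" for x
  proof (rule trunc_converges_eventually_const[OF r(1)])
    fix \<delta> assume d: "0 < \<delta>" "\<delta> < r"
    have "tk \<delta> = K" using d r(2) by (force simp: trunc_kernel_def)
    then show "conv (tk \<delta>) \<phi> x = conv K \<phi> x" by simp
  qed
  then show ?thesis by simp
next
  case True
  \<comment> \<open>A countable dense set names every dyadic cube, so the exceptional null sets of
    all cubes can be united.\<close>
  obtain D :: "'a set" where D: "countable D" "\<And>X. open X \<Longrightarrow> X \<noteq> {} \<Longrightarrow> \<exists>d\<in>D. d \<in> X"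
    using countable_dense_setE by metis
  let ?P = "\<lambda>q::int \<times> 'a. integrable lborel (\<lambda>y. indicator (dcube3 (fst q) (snd q)) y * \<phi> y)"
  let ?J = "{q\<in>UNIV \<times> D. ?P q}"
  have "countable ?J" using D(1) by (intro countable_subset[OF Collect_subset]) auto
  moreover have "AE x in lborel. x \<in> dcube (fst q) (snd q) \<longrightarrow> trunc_converges (\<lambda>y. indicator (dcube3 (fst q) (snd q)) y * \<phi> y) x"
    if "q \<in> ?J" for q
  proof -
    have "converges_ae (fst q) (snd q) (\<lambda>y. indicator (dcube3 (fst q) (snd q)) y * \<phi> y)"
      using that by (intro converges_ae_integrable) simp
    then have "converges_ae (fst q) (snd q) \<phi>" by (rule converges_ae_restrict)
    then show ?thesis by (simp add: converges_ae_def)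
  qed
  ultimately have "AE x in lborel. \<forall>q\<in>?J. x \<in> dcube (fst q) (snd q) \<longrightarrow> trunc_converges (\<lambda>y. indicator (dcube3 (fst q) (snd q)) y * \<phi> y) x"
    by (simp only: AE_ball_countable) blast
  moreover have "AE x in lborel. (\<forall>\<delta>>0. integrable lborel (\<lambda>y. tk \<delta> (x - y) * \<phi> y)) \<longrightarrow>
    (\<exists>r>0. integrable lborel (\<lambda>y. indicator (ball x r) y * \<phi> y))"
    using True by (intro locally_integrable_ae) auto
  ultimately show ?thesis
  proof eventually_elim
    case (elim x)
    show ?case
    proof (cases "\<forall>\<delta>>0. integrable lborel (\<lambda>y. tk \<delta> (x - y) * \<phi> y)")
      case False
      then show ?thesis using trunc_converges_not_integrable[OF \<phi>] by blast
    next
      case int: True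
      then obtain r where r: "r > 0" "integrable lborel (\<lambda>y. indicator (ball x r) y * \<phi> y)" using elim(2) by blast
      obtain k where k: "2 * DIM('a) * side k < r" using exists_small_side[OF r(1)] by blast
      have sub: "dcube3 k x \<subseteq> ball x r"
      proof
        fix y assume "y \<in> dcube3 k x"
        then have "norm (x - y) \<le> 2 * DIM('a) * side k" using dblock_dist[of y 1 k x] by simp
        then show "y \<in> ball x r" using k by (simp add: dist_norm)
      qed
      have "box (dcorner 0 k x) (dcorner 0 k x + side k *\<^sub>R One) \<noteq> {}"
        using side_pos[of k] by (auto simp: box_ne_empty inner_add_left)
      then obtain d where d: "d \<in> D" "d \<in> box (dcorner 0 k x) (dcorner 0 k x + side k *\<^sub>R One)"
        using D(2)[OF open_box] by blast
      then have "d \<in> dcube k x" using dblock_box(1)[of 0 k x] by auto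
      then have eq: "dcube k d = dcube k x" "dcube3 k d = dcube3 k x" by (rule dblock_cong)+
      have "(\<lambda>y. indicator (dcube3 k x) y * (indicator (ball x r) y * \<phi> y)) = (\<lambda>y. indicator (dcube3 k x) y * \<phi> y)"
        using sub by (auto simp: indicator_def subset_iff simp del: mem_ball)
      then have loc: "integrable lborel (\<lambda>y. indicator (dcube3 k d) y * \<phi> y)"
        using integrable_indicator_mult[OF r(2), of "dcube3 k x"] eq by simp
      then have "(k, d) \<in> ?J" using d(1) by simp
      moreover have xQ: "x \<in> dcube k d" using eq by (simp add: dblock_self)
      ultimately have "trunc_converges (\<lambda>y. indicator (dcube3 k d) y * \<phi> y) x" using elim(1) by fastforce
      then show ?thesis using trunc_converges_local[OF \<phi> xQ _ loc] int by blast
    qed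
  qed
qed

end

section \<open>Consequences of a finite A_p constant\<close>

lemma epowr_ennreal: "x \<ge> 0 \<Longrightarrow> epowr (ennreal x) a = ennreal (x powr a)"
  by (simp add: epowr_def)

lemma epowr_mono:
  assumes "x \<le> y" "a \<ge> 0" shows "epowr x a \<le> epowr y a"
proof (cases y)
  case (real r)
  then obtain s where s: "x = ennreal s" "s \<ge> 0" using assms(1) by (cases x) (auto simp: top_unique)
  then have "s \<le> r" using assms(1) real by (simp add: ennreal_le_iff)
  then show ?thesis using s real assms(2) by (auto simp: epowr_ennreal intro!: ennreal_leI powr_mono2)
qed (simp add: epowr_def)

lemma epowr_SUP_le:
  fixes u :: "'b \<Rightarrow> real"
  assumes p: "p > 0" and le: "\<And>i. i \<in> I \<Longrightarrow> ennreal (\<bar>u i\<bar> powr p) \<le> B"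
  shows "epowr (SUP i\<in>I. ennreal \<bar>u i\<bar>) p \<le> B"
proof (cases B)
  case (real b)
  have "(SUP i\<in>I. ennreal \<bar>u i\<bar>) \<le> ennreal (b powr (1 / p))"
  proof (rule SUP_least)
    fix i assume i: "i \<in> I"
    have "\<bar>u i\<bar> powr p \<le> b" using le[OF i] real by (simp add: ennreal_le_iff)
    then have "(\<bar>u i\<bar> powr p) powr (1 / p) \<le> b powr (1 / p)" using p by (intro powr_mono2) auto
    then show "ennreal \<bar>u i\<bar> \<le> ennreal (b powr (1 / p))" using p by (intro ennreal_leI) (simp add: powr_powr)
  qed
  then have "epowr (SUP i\<in>I. ennreal \<bar>u i\<bar>) p \<le> epowr (ennreal (b powr (1 / p))) p" using p by (intro epowr_mono) auto
  also have "\<dots> = B" using p real by (simp add: epowr_ennreal powr_powr)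
  finally show ?thesis .
qed simp

lemma is_weightD:
  assumes "is_weight w" shows "w x \<ge> 0" "w \<in> borel_measurable lebesgue" "compact S \<Longrightarrow> set_integrable lebesgue S w"
  using assms by (auto simp: is_weight_def)

lemma dual_weight_measurable:
  assumes [measurable]: "w \<in> borel_measurable lebesgue"
  shows "dual_weight p w \<in> borel_measurable lebesgue"
  unfolding dual_weight_def[abs_def] by measurable

lemma Ap_norm_cube:
  "is_cube Q \<Longrightarrow> ((\<integral>\<^sup>+x\<in>Q. ennreal (w x) \<partial>lebesgue) / emeasure lebesgue Q) *
      epowr ((\<integral>\<^sup>+x\<in>Q. dual_weight p w x \<partial>lebesgue) / emeasure lebesgue Q) (p - 1) \<le> Ap_norm p w"
  unfolding Ap_norm_def by (rule SUP_upper) simp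

lemma emeasure_cube:
  fixes a :: "'a::euclidean_space"
  assumes "h > 0" shows "emeasure lebesgue (cbox a (a + h *\<^sub>R One)) = ennreal (h ^ DIM('a))"
  using assms by (simp add: emeasure_lborel_cbox_eq inner_add_left)

text \<open>A positive average of w times an infinite dual average would make the supremum
  infinite.\<close>

lemma dual_weight_finite:
  fixes w :: "'a::euclidean_space \<Rightarrow> real"
  assumes Ap: "Ap_norm p w < \<infinity>" and h: "h > 0" and Q: "Q = cbox a (a + h *\<^sub>R One)"
    and pos: "(\<integral>\<^sup>+x\<in>Q. ennreal (w x) \<partial>lebesgue) > 0"
  shows "(\<integral>\<^sup>+x\<in>Q. dual_weight p w x \<partial>lebesgue) < \<infinity>"
proof (rule ccontr)
  assume "\<not> ?thesis"
  then have S: "(\<integral>\<^sup>+x\<in>Q. dual_weight p w x \<partial>lebesgue) = \<infinity>" by (simp add: less_top[symmetric])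
  have m: "emeasure lebesgue Q = ennreal (h ^ DIM('a))" unfolding Q by (rule emeasure_cube[OF h])
  have ctop: "a * \<infinity> = \<infinity>" if "a > 0" for a :: ennreal using that by (simp add: ennreal_mult_top)
  have "epowr ((\<integral>\<^sup>+x\<in>Q. dual_weight p w x \<partial>lebesgue) / emeasure lebesgue Q) (p - 1) = \<infinity>"
    unfolding S m by (simp add: epowr_def ennreal_top_divide)
  moreover have "(\<integral>\<^sup>+x\<in>Q. ennreal (w x) \<partial>lebesgue) / emeasure lebesgue Q > 0"
    unfolding m using pos by (simp add: ennreal_zero_less_divide)
  ultimately have "((\<integral>\<^sup>+x\<in>Q. ennreal (w x) \<partial>lebesgue) / emeasure lebesgue Q) *
      epowr ((\<integral>\<^sup>+x\<in>Q. dual_weight p w x \<partial>lebesgue) / emeasure lebesgue Q) (p - 1) = \<infinity>"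
    using ctop by (simp only:)
  moreover have "is_cube Q" unfolding is_cube_def Q using h by blast
  ultimately show False using Ap_norm_cube[of Q w p] Ap by (simp add: top_unique)
qed

text \<open>The dual weight is infinite where w vanishes. On a cube that carries some mass of w its
  integral is finite, so w is positive almost everywhere there, and centred cubes exhaust the space.
  The other alternative exists because 0 times infinity is 0 in the A_p product.\<close>

lemma weight_zero_or_positive:
  fixes w :: "'a::euclidean_space \<Rightarrow> real"
  assumes w: "is_weight w" and Ap: "Ap_norm p w < \<infinity>"
  shows "(AE x in lebesgue. w x = 0) \<or> (AE x in lebesgue. w x > 0)"
proof -
  define Q :: "nat \<Rightarrow> 'a set" where "Q m = cbox (- real (Suc m) *\<^sub>R One) (- real (Suc m) *\<^sub>R One + (2 * real (Suc m)) *\<^sub>R One)" for m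
  have [measurable]: "w \<in> borel_measurable lebesgue" "dual_weight p w \<in> borel_measurable lebesgue"
    using is_weightD(2)[OF w] dual_weight_measurable by auto
  have Qm[measurable]: "Q m \<in> sets lebesgue" for m unfolding Q_def by simp
  have Qx: "x \<in> Q m \<longleftrightarrow> (\<forall>i\<in>Basis. \<bar>x \<bullet> i\<bar> \<le> real (Suc m))" for x m
    by (auto simp: Q_def mem_box inner_add_left abs_le_iff)
  have inQ: "x \<in> Q m" if "norm x \<le> real m" for x m
    unfolding Qx using Basis_le_norm[of _ x] that by fastforce
  have mono: "Q m \<subseteq> Q m'" if "m \<le> m'" for m m'
  proof
    fix x assume "x \<in> Q m"
    moreover have "real (Suc m) \<le> real (Suc m')" using that by simp
    ultimately show "x \<in> Q m'" unfolding Qx using order_trans by blast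
  qed
  let ?W = "\<lambda>m. \<integral>\<^sup>+x\<in>Q m. ennreal (w x) \<partial>lebesgue"
  show ?thesis
  proof (cases "\<forall>m. ?W m = 0")
    case True
    have "AE x in lebesgue. x \<in> Q m \<longrightarrow> w x = 0" for m
    proof -
      have "AE x in lebesgue. ennreal (w x) * indicator (Q m) x = 0"
        using True[rule_format, of m] by (subst (asm) nn_integral_0_iff_AE) auto
      then show ?thesis by (rule eventually_mono) (use is_weightD(1)[OF w] in \<open>auto simp: indicator_def ennreal_eq_0_iff intro: antisym\<close>)
    qed
    then have "AE x in lebesgue. \<forall>m. x \<in> Q m \<longrightarrow> w x = 0" by (subst AE_all_countable) blast
    then have "AE x in lebesgue. w x = 0"
      by (rule eventually_mono) (use inQ real_arch_simple in blast)
    then show ?thesis ..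
  next
    case False
    then obtain m0 where m0: "?W m0 > 0" by (auto simp: zero_less_iff_neq_zero)
    have "AE x in lebesgue. x \<in> Q (m0 + m) \<longrightarrow> w x > 0" for m
    proof -
      have "?W m0 \<le> ?W (m0 + m)" using mono[of m0 "m0 + m"] by (intro nn_integral_mono) (auto simp: indicator_def)
      then have "?W (m0 + m) > 0" using m0 by (rule order.strict_trans2[rotated])
      then have "(\<integral>\<^sup>+x\<in>Q (m0 + m). dual_weight p w x \<partial>lebesgue) < \<infinity>"
        by (intro dual_weight_finite[OF Ap _ Q_def]) auto
      then have "AE x in lebesgue. dual_weight p w x * indicator (Q (m0 + m)) x \<noteq> \<infinity>"
        by (intro nn_integral_PInf_AE) auto
      then show ?thesis
        by (rule eventually_mono) (use is_weightD(1)[OF w] in \<open>auto simp: dual_weight_def indicator_def less_le split: if_splits\<close>)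
    qed
    then have "AE x in lebesgue. \<forall>m. x \<in> Q (m0 + m) \<longrightarrow> w x > 0" by (subst AE_all_countable) blast
    then have "AE x in lebesgue. w x > 0"
    proof (rule eventually_mono)
      fix x assume *: "\<forall>m. x \<in> Q (m0 + m) \<longrightarrow> w x > 0"
      obtain m where "norm x \<le> real m" using real_arch_simple by blast
      then have "norm x \<le> real (m0 + m)" by simp
      then show "w x > 0" using * inQ by blast
    qed
    then show ?thesis ..
  qed
qed

text \<open>The zeros of w form a null set and are overwritten by 1. A half open tripled cube lies
  in the closed cube with the same corners, which has the same volume, so the A_p product passes
  down by monotonicity.\<close>

lemma good_weight_of_Ap:
  fixes w :: "'a::euclidean_space \<Rightarrow> real"
  assumes p: "p > 1" and w: "is_weight w" and Ap: "Ap_norm p w < \<infinity>" and pos: "AE x in lebesgue. w x > 0"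
  shows "good_weight p (enn2real (Ap_norm p w)) (\<lambda>x. if w x = 0 then 1 else w x)"
proof -
  let ?n = "DIM('a)" and ?w = "\<lambda>x. if w x = 0 then 1 else w x" and ?A = "enn2real (Ap_norm p w)"
  have wm[measurable]: "w \<in> borel_measurable lebesgue" and dm[measurable]: "dual_weight p w \<in> borel_measurable lebesgue"
    using is_weightD(2)[OF w] dual_weight_measurable by auto
  have w'm[measurable]: "?w \<in> borel_measurable lebesgue" by measurable
  have AA: "Ap_norm p w = ennreal ?A" using Ap by simp
  have w'pos: "?w x > 0" for x using is_weightD(1)[OF w, of x] by auto
  \<comment> \<open>Both masses are positive and finite, so the A_p bound becomes an inequality
    between reals; the volume factors of the two averages combine to
    \<open>m powr p\<close>.\<close>
  have cube: "\<exists>W S. W > 0 \<and> S > 0 \<and> (\<integral>\<^sup>+x\<in>Q. ennreal (w x) \<partial>lebesgue) = ennreal W \<and>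
      (\<integral>\<^sup>+x\<in>Q. dual_weight p w x \<partial>lebesgue) = ennreal S \<and> W * S powr (p - 1) \<le> ?A * (h ^ ?n) powr p"
    if h: "h > 0" and Q: "Q = cbox a (a + h *\<^sub>R One)" for h a Q
  proof -
    let ?W = "\<integral>\<^sup>+x\<in>Q. ennreal (w x) \<partial>lebesgue" and ?S = "\<integral>\<^sup>+x\<in>Q. dual_weight p w x \<partial>lebesgue"
    define m where "m = h ^ ?n"
    have m: "emeasure lebesgue Q = ennreal m" unfolding Q m_def by (rule emeasure_cube[OF h])
    have m0: "m > 0" using h by (simp add: m_def)
    have Qm[measurable]: "Q \<in> sets lebesgue" unfolding Q by simp
    have nonnull: "\<not> (AE x in lebesgue. x \<notin> Q)"
    proof
      assume "AE x in lebesgue. x \<notin> Q"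
      then have "emeasure lebesgue Q = 0" using Qm by (subst (asm) AE_iff_measurable[of Q]) auto
      then show False using m m0 by simp
    qed
    have "?W \<noteq> 0"
    proof
      assume "?W = 0"
      then have "AE x in lebesgue. ennreal (w x) * indicator Q x = 0" by (subst (asm) nn_integral_0_iff_AE) auto
      then have "AE x in lebesgue. x \<notin> Q" using pos by eventually_elim (auto simp: indicator_def split: if_splits)
      then show False using nonnull by simp
    qed
    then have W0: "?W > 0" by (simp add: zero_less_iff_neq_zero)
    have "?S \<noteq> 0"
    proof
      assume "?S = 0"
      then have "AE x in lebesgue. dual_weight p w x * indicator Q x = 0" by (subst (asm) nn_integral_0_iff_AE) auto
      then have "AE x in lebesgue. x \<notin> Q" using pos by eventually_elim (auto simp: dual_weight_def indicator_def split: if_splits)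
      then show False using nonnull by simp
    qed
    have Sf: "?S < \<infinity>" by (rule dual_weight_finite[OF Ap h Q W0])
    have "set_integrable lebesgue Q w" unfolding Q by (rule is_weightD(3)[OF w compact_cbox])
    then have "(\<integral>\<^sup>+x. ennreal (norm (indicator Q x *\<^sub>R w x)) \<partial>lebesgue) < \<infinity>"
      unfolding set_integrable_def integrable_iff_bounded by blast
    also have "(\<integral>\<^sup>+x. ennreal (norm (indicator Q x *\<^sub>R w x)) \<partial>lebesgue) = ?W"
      using is_weightD(1)[OF w] by (intro nn_integral_cong) (auto simp: indicator_def)
    finally have Wf: "?W < \<infinity>" .
    obtain W where W: "?W = ennreal W" "W > 0" using W0 Wf by (cases ?W) auto
    obtain S where S: "?S = ennreal S" "S > 0" using \<open>?S \<noteq> 0\<close> Sf by (cases ?S) (auto simp: less_le)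
    have "is_cube Q" unfolding is_cube_def Q using h by blast
    from Ap_norm_cube[OF this, of w p] have "(ennreal W / ennreal m) * epowr (ennreal S / ennreal m) (p - 1) \<le> ennreal ?A"
      unfolding m W(1) S(1) AA[symmetric] .
    moreover have "ennreal W / ennreal m = ennreal (W / m)" "ennreal S / ennreal m = ennreal (S / m)"
      using W S m0 by (simp_all add: divide_ennreal)
    ultimately have "ennreal (W / m) * ennreal ((S / m) powr (p - 1)) \<le> ennreal ?A"
      using S m0 by (simp add: epowr_ennreal)
    then have "ennreal (W / m * (S / m) powr (p - 1)) \<le> ennreal ?A"
      using W m0 by (subst ennreal_mult) auto
    then have le: "W / m * (S / m) powr (p - 1) \<le> ?A" by (subst (asm) ennreal_le_iff) auto
    have mp: "m powr p = m * m powr (p - 1)" using m0 by (simp add: powr_mult_base)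
    have "W * S powr (p - 1) = W / m * (S / m) powr (p - 1) * m powr p"
      unfolding mp using m0 S(2) by (simp add: powr_divide)
    also have "\<dots> \<le> ?A * m powr p" using le by (intro mult_right_mono) auto
    finally show ?thesis unfolding m_def using W S by blast
  qed
  have A0: "?A > 0"
  proof -
    obtain W S where WS: "W > 0" "S > 0" "W * S powr (p - 1) \<le> ?A * (1 ^ ?n) powr p"
      using cube[OF zero_less_one refl, of 0] by blast
    have "0 < W * S powr (p - 1)" using WS by simp
    then show ?thesis using WS(3) by simp
  qed
  have "\<exists>W\<ge>0. \<exists>S\<ge>0. emeasure (density lebesgue (\<lambda>x. ennreal (?w x))) (dcube3 k x) = ennreal W \<and>
        emeasure (density lebesgue (\<lambda>x. ennreal (?w x powr (- 1 / (p - 1))))) (dcube3 k x) = ennreal S \<and>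
        W * S powr (p - 1) \<le> ?A * (3 ^ ?n * side k ^ ?n) powr p" for k and x :: 'a
  proof -
    define h where "h = 3 * side k"
    have h: "h > 0" using side_pos[of k] by (simp add: h_def)
    define Q where "Q = cbox (dcorner 1 k x) (dcorner 1 k x + h *\<^sub>R One)"
    have sub: "dcube3 k x \<subseteq> Q" using dblock_box(2)[of 1 k x] by (simp add: Q_def h_def)
    obtain W S where WS: "W > 0" "S > 0" "(\<integral>\<^sup>+x\<in>Q. ennreal (w x) \<partial>lebesgue) = ennreal W"
      "(\<integral>\<^sup>+x\<in>Q. dual_weight p w x \<partial>lebesgue) = ennreal S" "W * S powr (p - 1) \<le> ?A * (h ^ ?n) powr p"
      using cube[OF h Q_def] by blast
    have dL: "dcube3 k x \<in> sets lebesgue" by simp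
    have "emeasure (density lebesgue (\<lambda>x. ennreal (?w x))) (dcube3 k x) = (\<integral>\<^sup>+y. ennreal (?w y) * indicator (dcube3 k x) y \<partial>lebesgue)"
      using dL by (intro emeasure_density) auto
    also have "\<dots> = (\<integral>\<^sup>+y. ennreal (w y) * indicator (dcube3 k x) y \<partial>lebesgue)"
      using pos by (intro nn_integral_cong_AE) (auto elim!: eventually_mono)
    also have "\<dots> \<le> (\<integral>\<^sup>+x\<in>Q. ennreal (w x) \<partial>lebesgue)"
      using sub by (intro nn_integral_mono) (auto simp: indicator_def)
    finally have 1: "emeasure (density lebesgue (\<lambda>x. ennreal (?w x))) (dcube3 k x) \<le> ennreal W" unfolding WS(3) .
    have "emeasure (density lebesgue (\<lambda>x. ennreal (?w x powr (- 1 / (p - 1))))) (dcube3 k x)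
       = (\<integral>\<^sup>+y. ennreal (?w y powr (- 1 / (p - 1))) * indicator (dcube3 k x) y \<partial>lebesgue)"
      using dL by (intro emeasure_density) auto
    also have "\<dots> \<le> (\<integral>\<^sup>+x\<in>Q. dual_weight p w x \<partial>lebesgue)"
      using sub by (intro nn_integral_mono) (auto simp: indicator_def dual_weight_def)
    finally have 2: "emeasure (density lebesgue (\<lambda>x. ennreal (?w x powr (- 1 / (p - 1))))) (dcube3 k x) \<le> ennreal S" unfolding WS(4) .
    obtain W' where W': "emeasure (density lebesgue (\<lambda>x. ennreal (?w x))) (dcube3 k x) = ennreal W'" "0 \<le> W'" "W' \<le> W"
      using 1 WS(1) by (cases "emeasure (density lebesgue (\<lambda>x. ennreal (?w x))) (dcube3 k x)") (auto simp: top_unique ennreal_le_iff)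
    obtain S' where S': "emeasure (density lebesgue (\<lambda>x. ennreal (?w x powr (- 1 / (p - 1))))) (dcube3 k x) = ennreal S'" "0 \<le> S'" "S' \<le> S"
      using 2 WS(2) by (cases "emeasure (density lebesgue (\<lambda>x. ennreal (?w x powr (- 1 / (p - 1))))) (dcube3 k x)") (auto simp: top_unique ennreal_le_iff)
    have "W' * S' powr (p - 1) \<le> W * S powr (p - 1)" using W' S' p WS(1) by (intro mult_mono powr_mono2) auto
    also have "\<dots> \<le> ?A * (3 ^ ?n * side k ^ ?n) powr p" using WS(5) by (simp add: h_def power_mult_distrib)
    finally show ?thesis using W' S' by blast
  qed
  then show ?thesis unfolding good_weight_def using A0 w'pos w'm by blast
qed

text \<open>Either t is below the dual weight, or t^(p-1) w \<ge> 1. Integrated over a box this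
  shows that L^p(w) functions are locally integrable, as the dual weight is.\<close>

lemma le_weighted_powr_add_dual:
  fixes t w p :: real
  assumes p: "p > 1" and w: "w > 0" and t: "t \<ge> 0"
  shows "t \<le> t powr p * w + w powr (- 1 / (p - 1))"
proof (cases "t \<le> w powr (- 1 / (p - 1))")
  case True
  then show ?thesis using w by (simp add: add_increasing)
next
  case False
  then have tp: "t > 0" using powr_ge_zero[of w "- 1 / (p - 1)"] by linarith
  have "- 1 / (p - 1) * (p - 1) = -1" using p by simp
  then have "w powr -1 = (w powr (- 1 / (p - 1))) powr (p - 1)" by (simp only: powr_powr)
  also have "\<dots> \<le> t powr (p - 1)" using False p by (intro powr_mono2) auto
  finally have "1 \<le> t powr (p - 1) * w" using w by (simp add: powr_minus field_simps)
  then have "t * 1 \<le> t * (t powr (p - 1) * w)" using t by (rule mult_left_mono)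
  also have "\<dots> = t powr p * w" using tp powr_mult_base[of t "p - 1"] by simp
  finally show ?thesis using powr_ge_zero[of w "- 1 / (p - 1)"] by linarith
qed

section \<open>From boxes to the whole space\<close>

context cz begin

lemma dbox_exhausts: "\<exists>M. \<forall>m\<ge>M. x \<in> dbox m"
proof -
  obtain M :: nat where M: "norm x < real M" using reals_Archimedean2 by blast
  have "x \<in> dbox m" if "m \<ge> M" for m
  proof -
    have "real m < 2 ^ m" by (rule of_nat_less_two_power)
    then have "norm x < 2 ^ m" using M that by linarith
    then show ?thesis unfolding dbox_def using Basis_le_norm[of _ x] by (fastforce simp: abs_le_iff)
  qed
  then show ?thesis by blast
qed

lemma integrable_on_dbox:
  fixes \<phi> w :: "'a \<Rightarrow> real"
  assumes p: "p > 1" and gw: "good_weight p A w" and \<phi>[measurable]: "\<phi> \<in> borel_measurable borel"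
    and fin: "(\<integral>\<^sup>+x. ennreal (\<bar>\<phi> x\<bar> powr p) \<partial>density lebesgue (\<lambda>x. ennreal (w x))) < \<infinity>"
  shows "integrable lborel (\<lambda>y. indicator (dbox m) y * \<phi> y)"
proof -
  let ?s = "\<lambda>x. w x powr (- 1 / (p - 1))" and ?D = "dcube3 (- int m) (0::'a)"
  have w: "w \<in> borel_measurable lebesgue" "\<And>x. w x > 0" using gw by (auto simp: good_weight_def)
  have [measurable]: "w \<in> borel_measurable lebesgue" by (rule w)
  have \<phi>L[measurable]: "\<phi> \<in> borel_measurable lebesgue" by (rule measurable_completion) simp
  have DL[measurable]: "?D \<in> sets lebesgue" by simp
  have "(0::'a) \<in> dbox m" by (simp add: dbox_def)
  then have sub: "dbox m \<subseteq> ?D" by (rule dbox_subset_dcube3)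
  obtain S where S: "emeasure (density lebesgue (\<lambda>x. ennreal (?s x))) ?D = ennreal S"
    using gw unfolding good_weight_def by blast
  have "(\<integral>\<^sup>+y. ennreal (norm (indicator (dbox m) y * \<phi> y)) \<partial>lborel) = (\<integral>\<^sup>+y. ennreal (norm (indicator (dbox m) y * \<phi> y)) \<partial>lebesgue)"
    by (rule nn_integral_completion[symmetric])
  also have "\<dots> \<le> (\<integral>\<^sup>+y. ennreal (w y) * ennreal (\<bar>\<phi> y\<bar> powr p) + ennreal (?s y) * indicator ?D y \<partial>lebesgue)"
  proof (rule nn_integral_mono)
    fix y
    show "ennreal (norm (indicator (dbox m) y * \<phi> y)) \<le> ennreal (w y) * ennreal (\<bar>\<phi> y\<bar> powr p) + ennreal (?s y) * indicator ?D y"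
    proof (cases "y \<in> dbox m")
      case True
      have "ennreal \<bar>\<phi> y\<bar> \<le> ennreal (\<bar>\<phi> y\<bar> powr p * w y + ?s y)"
        by (intro ennreal_leI le_weighted_powr_add_dual[OF p w(2)]) simp
      also have "\<dots> = ennreal (w y) * ennreal (\<bar>\<phi> y\<bar> powr p) + ennreal (?s y)"
        using w(2)[of y] by (simp add: ennreal_plus ennreal_mult' mult.commute)
      finally show ?thesis using True sub by (auto simp: indicator_def subset_iff)
    qed simp
  qed
  also have "\<dots> = (\<integral>\<^sup>+x. ennreal (\<bar>\<phi> x\<bar> powr p) \<partial>density lebesgue (\<lambda>x. ennreal (w x))) + emeasure (density lebesgue (\<lambda>x. ennreal (?s x))) ?D"
    by (subst nn_integral_add) (simp_all add: nn_integral_density emeasure_density)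
  also have "\<dots> < \<infinity>" using fin S by simp
  finally show ?thesis unfolding integrable_iff_bounded by simp
qed

text \<open>Restrict \<phi> to the m-th box and the truncations to those from 1 / (m + 1) on, take
  the majorants there, and let m grow: Fatou's lemma bounds the lower limit of their p-th powers
  with the same constant.\<close>

theorem maximal_truncation_weighted:
  fixes \<phi> w :: "'a \<Rightarrow> real"
  assumes p: "p > 1" and gw: "good_weight p A w" and \<phi>[measurable]: "\<phi> \<in> borel_measurable borel"
    and fin: "(\<integral>\<^sup>+x. ennreal (\<bar>\<phi> x\<bar> powr p) \<partial>density lebesgue (\<lambda>x. ennreal (w x))) < \<infinity>"
  shows "\<exists>L\<in>borel_measurable lebesgue. (\<forall>x. epowr (SUP \<delta>\<in>{0<..}. ennreal \<bar>conv (tk \<delta>) \<phi> x\<bar>) p \<le> L x) \<and>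
    (\<integral>\<^sup>+x. L x \<partial>density lebesgue (\<lambda>x. ennreal (w x)))
     \<le> ennreal (2 ^ DIM('a) * (maximal_const p * A powr max 1 (1 / (p - 1))) powr p) *
        (\<integral>\<^sup>+x. ennreal (\<bar>\<phi> x\<bar> powr p) \<partial>density lebesgue (\<lambda>x. ennreal (w x)))"
proof -
  let ?wm = "density lebesgue (\<lambda>x. ennreal (w x))" and ?\<eta> = "\<lambda>m::nat. 1 / real (Suc m)"
  let ?C = "ennreal (2 ^ DIM('a) * (maximal_const p * A powr max 1 (1 / (p - 1))) powr p)"
  let ?\<phi> = "\<lambda>m y. indicator (dbox m) y * \<phi> y"
  have "\<forall>m. \<exists>H. H \<in> borel_measurable borel \<and> (\<forall>x. H x \<ge> 0) \<and> (\<forall>x\<in>dbox m. \<forall>\<delta>\<ge>?\<eta> m. \<bar>conv (tk \<delta>) (?\<phi> m) x\<bar> \<le> H x) \<and>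
    (\<integral>\<^sup>+x. ennreal (H x powr p) \<partial>?wm) \<le> ?C * (\<integral>\<^sup>+x. ennreal (\<bar>?\<phi> m x\<bar> powr p) \<partial>?wm)"
  proof
    fix m
    have i: "integrable lborel (?\<phi> m)" by (rule integrable_on_dbox[OF p gw \<phi> fin])
    have s: "y \<in> dbox m" if "?\<phi> m y \<noteq> 0" for y using that by (auto simp: indicator_def split: if_splits)
    have "?\<eta> m > 0" by simp
    from box_majorant[OF p gw i s this] show "\<exists>H. H \<in> borel_measurable borel \<and> (\<forall>x. H x \<ge> 0) \<and> (\<forall>x\<in>dbox m. \<forall>\<delta>\<ge>?\<eta> m. \<bar>conv (tk \<delta>) (?\<phi> m) x\<bar> \<le> H x) \<and>
      (\<integral>\<^sup>+x. ennreal (H x powr p) \<partial>?wm) \<le> ?C * (\<integral>\<^sup>+x. ennreal (\<bar>?\<phi> m x\<bar> powr p) \<partial>?wm)"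
      unfolding Bex_def .
  qed
  from choice[OF this] obtain H where HH: "\<forall>m. H m \<in> borel_measurable borel \<and> (\<forall>x. H m x \<ge> 0) \<and> (\<forall>x\<in>dbox m. \<forall>\<delta>\<ge>?\<eta> m. \<bar>conv (tk \<delta>) (?\<phi> m) x\<bar> \<le> H m x) \<and>
    (\<integral>\<^sup>+x. ennreal (H m x powr p) \<partial>?wm) \<le> ?C * (\<integral>\<^sup>+x. ennreal (\<bar>?\<phi> m x\<bar> powr p) \<partial>?wm)"
    by (rule exE)
  have H: "H m \<in> borel_measurable borel" "x \<in> dbox m \<Longrightarrow> ?\<eta> m \<le> \<delta> \<Longrightarrow> \<bar>conv (tk \<delta>) (?\<phi> m) x\<bar> \<le> H m x"
    "(\<integral>\<^sup>+x. ennreal (H m x powr p) \<partial>?wm) \<le> ?C * (\<integral>\<^sup>+x. ennreal (\<bar>?\<phi> m x\<bar> powr p) \<partial>?wm)" for m x \<delta>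
    using spec[OF HH, of m] by blast+
  have HL[measurable]: "H m \<in> borel_measurable lebesgue" for m using H(1)[of m] by (intro measurable_completion) simp
  \<comment> \<open>A measurable majorant of the p-th power of the supremum over all \<delta>, built
    from p-th powers so that Fatou applies directly.\<close>
  define L where "L x = liminf (\<lambda>m. ennreal (H m x powr p))" for x
  have Lm: "L \<in> borel_measurable lebesgue" unfolding L_def[abs_def] by measurable
  have point: "ennreal (\<bar>conv (tk \<delta>) \<phi> x\<bar> powr p) \<le> L x" if d: "\<delta> > 0" for \<delta> x
  proof (cases "integrable lborel (\<lambda>y. tk \<delta> (x - y) * \<phi> y)")
    case True
    have "(\<lambda>m. conv (tk \<delta>) (?\<phi> m) x) \<longlonglongrightarrow> conv (tk \<delta>) \<phi> x" unfolding conv_def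
    proof (rule integral_dominated_convergence[where w="\<lambda>y. \<bar>tk \<delta> (x - y) * \<phi> y\<bar>"])
      show "integrable lborel (\<lambda>y. \<bar>tk \<delta> (x - y) * \<phi> y\<bar>)" using True by simp
      have "(\<lambda>m. tk \<delta> (x - y) * ?\<phi> m y) \<longlonglongrightarrow> tk \<delta> (x - y) * \<phi> y" for y
      proof (rule tendsto_eventually)
        obtain M where M: "\<forall>m\<ge>M. y \<in> dbox m" using dbox_exhausts by blast
        show "\<forall>\<^sub>F m in sequentially. tk \<delta> (x - y) * ?\<phi> m y = tk \<delta> (x - y) * \<phi> y"
          using eventually_ge_at_top[of M] by eventually_elim (use M in simp)
      qed
      then show "AE y in lborel. (\<lambda>m. tk \<delta> (x - y) * ?\<phi> m y) \<longlonglongrightarrow> tk \<delta> (x - y) * \<phi> y" by simp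
      show "AE y in lborel. norm (tk \<delta> (x - y) * ?\<phi> m y) \<le> \<bar>tk \<delta> (x - y) * \<phi> y\<bar>" for m
        by (rule AE_I2) (simp add: indicator_def abs_mult)
    qed measurable
    then have "(\<lambda>m. \<bar>conv (tk \<delta>) (?\<phi> m) x\<bar> powr p) \<longlonglongrightarrow> \<bar>conv (tk \<delta>) \<phi> x\<bar> powr p"
      using p by (intro tendsto_powr' tendsto_rabs tendsto_const) auto
    then have "(\<lambda>m. ennreal (\<bar>conv (tk \<delta>) (?\<phi> m) x\<bar> powr p)) \<longlonglongrightarrow> ennreal (\<bar>conv (tk \<delta>) \<phi> x\<bar> powr p)"
      by (rule tendsto_ennrealI)
    then have "ennreal (\<bar>conv (tk \<delta>) \<phi> x\<bar> powr p) = liminf (\<lambda>m. ennreal (\<bar>conv (tk \<delta>) (?\<phi> m) x\<bar> powr p))"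
      by (intro lim_imp_Liminf[symmetric]) auto
    also have "\<dots> \<le> L x" unfolding L_def
    proof (rule Liminf_mono)
      obtain M where M: "\<forall>m\<ge>M. x \<in> dbox m" using dbox_exhausts by blast
      obtain N where N: "?\<eta> N < \<delta>" using reals_Archimedean[OF d] by (auto simp: inverse_eq_divide)
      show "\<forall>\<^sub>F m in sequentially. ennreal (\<bar>conv (tk \<delta>) (?\<phi> m) x\<bar> powr p) \<le> ennreal (H m x powr p)"
        using eventually_ge_at_top[of "max M N"]
      proof eventually_elim
        case (elim m)
        have "?\<eta> m \<le> ?\<eta> N" using elim by (intro divide_left_mono) auto
        then have "\<bar>conv (tk \<delta>) (?\<phi> m) x\<bar> \<le> H m x" using M N elim by (intro H(2)) auto
        then show ?case using p by (intro ennreal_leI powr_mono2) auto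
      qed
    qed
    finally show ?thesis .
  next
    case False
    \<comment> \<open>A truncated integral that does not exist has the value 0 and is dominated
      trivially.\<close>
    then have "conv (tk \<delta>) \<phi> x = 0" unfolding conv_def by (rule not_integrable_integral_eq)
    then show ?thesis by simp
  qed
  have "(\<integral>\<^sup>+x. L x \<partial>?wm) \<le> liminf (\<lambda>m. \<integral>\<^sup>+x. ennreal (H m x powr p) \<partial>?wm)"
    unfolding L_def by (rule nn_integral_liminf) measurable
  also have "\<dots> \<le> liminf (\<lambda>m::nat. ?C * (\<integral>\<^sup>+x. ennreal (\<bar>\<phi> x\<bar> powr p) \<partial>?wm))"
  proof (rule Liminf_mono, rule always_eventually, rule allI)
    fix m
    have "(\<integral>\<^sup>+x. ennreal (\<bar>?\<phi> m x\<bar> powr p) \<partial>?wm) \<le> (\<integral>\<^sup>+x. ennreal (\<bar>\<phi> x\<bar> powr p) \<partial>?wm)"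
      by (intro nn_integral_mono) (simp add: indicator_def)
    then show "(\<integral>\<^sup>+x. ennreal (H m x powr p) \<partial>?wm) \<le> ?C * (\<integral>\<^sup>+x. ennreal (\<bar>\<phi> x\<bar> powr p) \<partial>?wm)"
      using H(3)[of m] by (meson mult_left_mono order_trans zero_le)
  qed
  also have "\<dots> = ?C * (\<integral>\<^sup>+x. ennreal (\<bar>\<phi> x\<bar> powr p) \<partial>?wm)" by (rule Liminf_const) simp
  finally have "(\<integral>\<^sup>+x. L x \<partial>?wm) \<le> ?C * (\<integral>\<^sup>+x. ennreal (\<bar>\<phi> x\<bar> powr p) \<partial>?wm)" .
  moreover have "epowr (SUP \<delta>\<in>{0<..}. ennreal \<bar>conv (tk \<delta>) \<phi> x\<bar>) p \<le> L x" for x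
    using p point by (intro epowr_SUP_le) auto
  ultimately show ?thesis using Lm by blast
qed

text \<open>Bridge from Lebesgue measurable f to a Borel representative: the truncations agree at
  every x, since changing f on a null set affects no integral.\<close>

lemma trunc_conv_eq_conv:
  assumes f: "f \<in> borel_measurable lebesgue" and \<phi>[measurable]: "\<phi> \<in> borel_measurable borel"
    and eq: "AE x in lborel. f x = \<phi> x"
  shows "trunc_conv K \<delta> f x = conv (tk \<delta>) \<phi> x"
proof -
  have eqL: "AE x in lebesgue. f x = \<phi> x" by (rule AE_completion[OF eq])
  have b: "(\<lambda>y. \<phi> y * tk \<delta> (x - y)) \<in> borel_measurable borel" by measurable
  have "(\<lambda>y. tk \<delta> (x - y)) \<in> borel_measurable borel" by measurable
  then have t: "(\<lambda>y. tk \<delta> (x - y)) \<in> borel_measurable lebesgue" by (intro measurable_completion) simp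
  have "trunc_conv K \<delta> f x = (\<integral>y. \<phi> y * tk \<delta> (x - y) \<partial>lebesgue)"
    unfolding trunc_conv_def
  proof (rule integral_cong_AE)
    show "(\<lambda>y. f y * tk \<delta> (x - y)) \<in> borel_measurable lebesgue" using f t by (rule borel_measurable_times)
    show "(\<lambda>y. \<phi> y * tk \<delta> (x - y)) \<in> borel_measurable lebesgue" using b by (intro measurable_completion) simp
    show "AE y in lebesgue. f y * tk \<delta> (x - y) = \<phi> y * tk \<delta> (x - y)" using eqL by (rule eventually_mono) simp
  qed
  also have "\<dots> = (\<integral>y. \<phi> y * tk \<delta> (x - y) \<partial>lborel)" using b by (intro integral_completion) simp
  finally show ?thesis by (simp add: conv_def mult.commute)
qed

theorem trunc_conv_converges_ae:
  assumes f: "f \<in> borel_measurable lebesgue"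
  shows "AE x in lebesgue. \<exists>l. ((\<lambda>\<delta>. trunc_conv K \<delta> f x) \<longlongrightarrow> l) (at_right 0)"
proof -
  obtain \<phi> where \<phi>: "\<phi> \<in> borel_measurable lborel" "AE x in lborel. f x = \<phi> x"
    using completion_ex_borel_measurable_real[OF f] by blast
  have b: "\<phi> \<in> borel_measurable borel" using \<phi>(1) by simp
  show ?thesis
    using AE_completion[OF trunc_converges_ae[OF b]] unfolding trunc_converges_def trunc_conv_eq_conv[OF f b \<phi>(2)] .
qed

text \<open>The 2^n cubes of a box enter at the level of p-th powers, hence the root.\<close>

definition weighted_const :: "real \<Rightarrow> real" where
  "weighted_const p = (2 ^ DIM('a)) powr (1 / p) * maximal_const p"

lemma weighted_const_pos: "p > 1 \<Longrightarrow> weighted_const p > 0"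
  unfolding weighted_const_def using maximal_const_pos by simp

theorem max_trunc_weighted:
  assumes p: "p > 1" and w: "is_weight w" and Ap: "Ap_norm p w < \<infinity>" and f: "in_Lpw p w f"
  shows "Lpw_nn p w (max_trunc K f) \<le> ennreal (weighted_const p) * epowr (Ap_norm p w) (max 1 (1 / (p - 1))) * Lpw p w f"
proof (cases "AE x in lebesgue. w x = 0")
  \<comment> \<open>For the zero weight the left hand side vanishes, whatever the truncations
    are.\<close>
  case True
  have "(\<integral>\<^sup>+x. epowr (max_trunc K f x) p * ennreal (w x) \<partial>lebesgue) = (\<integral>\<^sup>+x. 0 \<partial>(lebesgue :: 'a measure))"
    using True by (intro nn_integral_cong_AE) (auto elim!: eventually_mono)
  then show ?thesis by (simp add: Lpw_nn_def epowr_def)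
next
  case False
  then have pos: "AE x in lebesgue. w x > 0" using weight_zero_or_positive[OF w Ap] by blast
  define w' where "w' x = (if w x = 0 then 1 else w x)" for x
  define A where "A = enn2real (Ap_norm p w)"
  have gw: "good_weight p A w'"
    using good_weight_of_Ap[OF p w Ap pos] unfolding A_def w'_def[abs_def] .
  have AA: "Ap_norm p w = ennreal A" using Ap by (simp add: A_def)
  have [measurable]: "w' \<in> borel_measurable lebesgue" using gw by (simp add: good_weight_def)
  have ww: "AE x in lebesgue. w x = w' x" using pos by (rule eventually_mono) (simp add: w'_def)
  let ?wm = "density lebesgue (\<lambda>x. ennreal (w' x))" and ?e = "max 1 (1 / (p - 1))"
  have fm: "f \<in> borel_measurable lebesgue" using f by (simp add: in_Lpw_def)
  obtain \<phi> where \<phi>: "\<phi> \<in> borel_measurable lborel" "AE x in lborel. f x = \<phi> x"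
    using completion_ex_borel_measurable_real[OF fm] by blast
  have b: "\<phi> \<in> borel_measurable borel" using \<phi>(1) by simp
  have \<phi>L[measurable]: "\<phi> \<in> borel_measurable lebesgue" using \<phi>(1) by (rule measurable_completion)
  let ?I = "\<integral>\<^sup>+x. epowr (ennreal \<bar>f x\<bar>) p * ennreal (w x) \<partial>lebesgue"
  have IY: "?I = (\<integral>\<^sup>+x. ennreal (\<bar>\<phi> x\<bar> powr p) \<partial>?wm)"
  proof -
    have "?I = (\<integral>\<^sup>+x. ennreal (w' x) * ennreal (\<bar>\<phi> x\<bar> powr p) \<partial>lebesgue)"
    proof (rule nn_integral_cong_AE)
      show "AE x in lebesgue. epowr (ennreal \<bar>f x\<bar>) p * ennreal (w x) = ennreal (w' x) * ennreal (\<bar>\<phi> x\<bar> powr p)"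
        using ww AE_completion[OF \<phi>(2)] by eventually_elim (simp add: epowr_ennreal mult.commute)
    qed
    also have "\<dots> = (\<integral>\<^sup>+x. ennreal (\<bar>\<phi> x\<bar> powr p) \<partial>?wm)" by (rule nn_integral_density[symmetric]) measurable
    finally show ?thesis .
  qed
  have Ifin: "?I < \<infinity>"
    using f unfolding in_Lpw_def Lpw_def Lpw_nn_def by (auto simp: epowr_def split: if_splits simp: less_top[symmetric])
  then obtain y where y: "?I = ennreal y" "y \<ge> 0" by (cases ?I) auto
  define B where "B = 2 ^ DIM('a) * (maximal_const p * A powr ?e) powr p"
  obtain L where L: "L \<in> borel_measurable lebesgue" "\<And>x. epowr (SUP \<delta>\<in>{0<..}. ennreal \<bar>conv (tk \<delta>) \<phi> x\<bar>) p \<le> L x"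
    "(\<integral>\<^sup>+x. L x \<partial>?wm) \<le> ennreal B * (\<integral>\<^sup>+x. ennreal (\<bar>\<phi> x\<bar> powr p) \<partial>?wm)"
    using maximal_truncation_weighted[OF p gw b Ifin[unfolded IY]] unfolding B_def by blast
  have "(\<integral>\<^sup>+x. epowr (max_trunc K f x) p * ennreal (w x) \<partial>lebesgue) \<le> (\<integral>\<^sup>+x. ennreal (w' x) * L x \<partial>lebesgue)"
  proof (rule nn_integral_mono_AE)
    show "AE x in lebesgue. epowr (max_trunc K f x) p * ennreal (w x) \<le> ennreal (w' x) * L x"
      using ww
    proof eventually_elim
      case (elim x)
      have "epowr (max_trunc K f x) p \<le> L x"
        using L(2)[of x] unfolding max_trunc_def trunc_conv_eq_conv[OF fm b \<phi>(2)] .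
      then show ?case unfolding elim by (subst mult.commute) (rule mult_left_mono, auto)
    qed
  qed
  also have "\<dots> = (\<integral>\<^sup>+x. L x \<partial>?wm)" using L(1) by (intro nn_integral_density[symmetric]) auto
  also have "\<dots> \<le> ennreal B * ennreal y" using L(3) unfolding IY[symmetric] y(1) .
  also have "\<dots> = ennreal (B * y)" using y(2) by (intro ennreal_mult[symmetric]) (auto simp: B_def)
  finally have le: "(\<integral>\<^sup>+x. epowr (max_trunc K f x) p * ennreal (w x) \<partial>lebesgue) \<le> ennreal (B * y)" .
  have B0: "B \<ge> 0" by (simp add: B_def)
  have mc: "maximal_const p > 0" by (rule maximal_const_pos[OF p])
  have "Lpw_nn p w (max_trunc K f) \<le> epowr (ennreal (B * y)) (1 / p)"
    unfolding Lpw_nn_def using p by (intro epowr_mono le) auto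
  also have "\<dots> = ennreal ((B * y) powr (1 / p))" using B0 y(2) by (intro epowr_ennreal) simp
  also have "(B * y) powr (1 / p) = B powr (1 / p) * y powr (1 / p)" by (rule powr_mult)
  also have "B powr (1 / p) = weighted_const p * A powr ?e"
  proof -
    have "B powr (1 / p) = (2 ^ DIM('a)) powr (1 / p) * ((maximal_const p * A powr ?e) powr p) powr (1 / p)"
      unfolding B_def by (rule powr_mult)
    also have "((maximal_const p * A powr ?e) powr p) powr (1 / p) = maximal_const p * A powr ?e"
      using p mc by (simp add: powr_powr del: max_def)
    finally show ?thesis by (simp only: weighted_const_def mult.assoc)
  qed
  also have "ennreal (weighted_const p * A powr ?e * y powr (1 / p)) = ennreal (weighted_const p) * ennreal (A powr ?e) * ennreal (y powr (1 / p))"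
    using weighted_const_pos[OF p] by (simp only: ennreal_mult powr_ge_zero mult_nonneg_nonneg less_imp_le)
  also have "ennreal (A powr ?e) = epowr (Ap_norm p w) ?e"
    unfolding AA by (rule epowr_ennreal[symmetric]) (simp add: A_def)
  also have "ennreal (y powr (1 / p)) = Lpw p w f"
    unfolding Lpw_def Lpw_nn_def y(1) by (rule epowr_ennreal[OF y(2), symmetric])
  finally show ?thesis .
qed

text \<open>The limit is bounded pointwise by the maximal truncation. Where no limit exists Tf is
  set to 0, so that this bound holds at every point.\<close>

theorem singular_integral_weighted:
  assumes p: "p > 1" and w: "is_weight w" and Ap: "Ap_norm p w < \<infinity>" and f: "in_Lpw p w f"
  shows "\<exists>Tf. (AE x in lebesgue. ((\<lambda>\<delta>. trunc_conv K \<delta> f x) \<longlongrightarrow> Tf x) (at_right 0)) \<and>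
    Lpw p w Tf \<le> ennreal (weighted_const p) * epowr (Ap_norm p w) (max 1 (1 / (p - 1))) * Lpw p w f"
proof -
  let ?l = "\<lambda>x l. ((\<lambda>\<delta>. trunc_conv K \<delta> f x) \<longlongrightarrow> l) (at_right 0)"
  define Tf where "Tf x = (if \<exists>l. ?l x l then SOME l. ?l x l else 0)" for x
  have lim: "?l x (Tf x)" if "\<exists>l. ?l x l" for x unfolding Tf_def if_P[OF that] by (rule someI_ex[OF that])
  have fm: "f \<in> borel_measurable lebesgue" using f by (simp add: in_Lpw_def)
  have "AE x in lebesgue. ?l x (Tf x)"
    using trunc_conv_converges_ae[OF fm] by (rule eventually_mono) (rule lim)
  moreover have "ennreal \<bar>Tf x\<bar> \<le> max_trunc K f x" for x
  proof (cases "\<exists>l. ?l x l")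
    case True
    have t: "((\<lambda>\<delta>. ennreal \<bar>trunc_conv K \<delta> f x\<bar>) \<longlongrightarrow> ennreal \<bar>Tf x\<bar>) (at_right 0)"
      by (intro tendsto_ennrealI tendsto_rabs lim[OF True])
    show ?thesis
    proof (rule tendsto_upperbound[OF t])
      show "\<forall>\<^sub>F \<delta> in at_right 0. ennreal \<bar>trunc_conv K \<delta> f x\<bar> \<le> max_trunc K f x"
        unfolding max_trunc_def using eventually_at_right_less[of 0]
        by (rule eventually_mono) (auto intro: SUP_upper2)
    qed simp
  qed (simp add: Tf_def)
  then have "Lpw p w Tf \<le> Lpw_nn p w (max_trunc K f)"
    unfolding Lpw_def Lpw_nn_def using p by (intro epowr_mono nn_integral_mono mult_right_mono) auto
  ultimately show ?thesis using max_trunc_weighted[OF p w Ap f] order_trans by blast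
qed

end

text \<open>All kernel conditions avoid the origin: it lies in no annulus, and x - y is nonzero when
  x is nonzero and |y| \<le> |x| / 2.\<close>

lemma CZ_kernel_zero_at_0:
  fixes K :: "'a::euclidean_space \<Rightarrow> real"
  assumes "CZ_kernel K c \<epsilon>" shows "CZ_kernel (K(0 := 0)) c \<epsilon>"
proof -
  let ?K = "K(0 := 0)"
  have Km: "K \<in> borel_measurable lebesgue" using assms by (simp add: CZ_kernel_def)
  then have "(\<lambda>x. if x = 0 then 0 else K x) \<in> borel_measurable lebesgue"
    by (intro measurable_If) auto
  moreover have "?K = (\<lambda>x. if x = 0 then 0 else K x)" by auto
  ultimately have "?K \<in> borel_measurable lebesgue" by simp
  moreover have "(LINT x:{x. r < norm x \<and> norm x < R}|lebesgue. ?K x) = 0" if "0 < r" "r < R" for r R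
  proof -
    have "(LINT x:{x. r < norm x \<and> norm x < R}|lebesgue. ?K x) = (LINT x:{x. r < norm x \<and> norm x < R}|lebesgue. K x)"
      unfolding set_lebesgue_integral_def using that by (intro Bochner_Integration.integral_cong) (auto simp: indicator_def)
    then show ?thesis using assms that by (simp add: CZ_kernel_def)
  qed
  moreover have "?K (x - y) = K (x - y)" if "x \<noteq> 0" "norm y \<le> norm x / 2" for x y
    using that by auto
  ultimately show ?thesis using assms unfolding CZ_kernel_def by (simp del: fun_upd_apply) simp
qed

lemma trunc_kernel_zero_at_0: "\<delta> > 0 \<Longrightarrow> trunc_kernel (K(0 := 0)) \<delta> = trunc_kernel K \<delta>"
  by (auto simp: trunc_kernel_def)

theorem theorem2:
  fixes K :: "'a::euclidean_space \<Rightarrow> real" and c \<epsilon> :: real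
  assumes "CZ_kernel K c \<epsilon>"
  shows "(\<forall>p. (1 < p \<and> p \<le> 3/2) \<or> 3 \<le> p \<longrightarrow>
           (\<exists>C>0. \<forall>w f. is_weight w \<and> Ap_norm p w < \<infinity> \<and> in_Lpw p w f \<longrightarrow>
              (\<exists>Tf. (AE x in lebesgue. ((\<lambda>\<delta>. trunc_conv K \<delta> f x) \<longlongrightarrow> Tf x) (at_right 0)) \<and>
                    Lpw p w Tf \<le> ennreal C * epowr (Ap_norm p w) (max 1 (1 / (p - 1))) * Lpw p w f)))
       \<and> (\<forall>p. 3 \<le> p \<longrightarrow>
           (\<exists>C>0. \<forall>w f. is_weight w \<and> Ap_norm p w < \<infinity> \<and> in_Lpw p w f \<longrightarrow>
              Lpw_nn p w (max_trunc K f) \<le> ennreal C * Ap_norm p w * Lpw p w f))"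
proof -
  \<comment> \<open>The estimates are proved for the kernel with value 0 at the origin; its
    truncations at \<delta> > 0 are those of K, so maximal truncation and limits at 0 from the right
    coincide.\<close>
  let ?K = "K(0 := 0)"
  interpret cz ?K c \<epsilon> by standard (simp_all add: CZ_kernel_zero_at_0[OF assms])
  have tc: "trunc_conv ?K \<delta> f = trunc_conv K \<delta> f" if "\<delta> > 0" for \<delta> and f :: "'a \<Rightarrow> real"
    using that by (simp add: trunc_conv_def[abs_def] trunc_kernel_zero_at_0)
  have mt: "max_trunc ?K f = max_trunc K f" for f
    unfolding max_trunc_def[abs_def] by (intro ext SUP_cong) (simp_all add: tc)
  have lim: "((\<lambda>\<delta>. trunc_conv ?K \<delta> f x) \<longlongrightarrow> l) (at_right 0) \<longleftrightarrow> ((\<lambda>\<delta>. trunc_conv K \<delta> f x) \<longlongrightarrow> l) (at_right 0)" for f x l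
    using eventually_at_right_less[of 0] by (intro tendsto_cong) (auto elim!: eventually_mono simp: tc)
  show ?thesis
  proof (intro conjI allI impI)
    fix p :: real assume "1 < p \<and> p \<le> 3/2 \<or> 3 \<le> p"
    then have p: "p > 1" by auto
    show "\<exists>C>0. \<forall>w f. is_weight w \<and> Ap_norm p w < \<infinity> \<and> in_Lpw p w f \<longrightarrow>
              (\<exists>Tf. (AE x in lebesgue. ((\<lambda>\<delta>. trunc_conv K \<delta> f x) \<longlongrightarrow> Tf x) (at_right 0)) \<and>
                    Lpw p w Tf \<le> ennreal C * epowr (Ap_norm p w) (max 1 (1 / (p - 1))) * Lpw p w f)"
    proof (intro exI[of _ "weighted_const p"] conjI weighted_const_pos p allI impI)
      fix w and f :: "'a \<Rightarrow> real" assume "is_weight w \<and> Ap_norm p w < \<infinity> \<and> in_Lpw p w f"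
      then have "is_weight w" "Ap_norm p w < \<infinity>" "in_Lpw p w f" by auto
      from singular_integral_weighted[OF p this]
      show "\<exists>Tf. (AE x in lebesgue. ((\<lambda>\<delta>. trunc_conv K \<delta> f x) \<longlongrightarrow> Tf x) (at_right 0)) \<and>
        Lpw p w Tf \<le> ennreal (weighted_const p) * epowr (Ap_norm p w) (max 1 (1 / (p - 1))) * Lpw p w f"
        unfolding lim .
    qed
  next
    fix p :: real assume p3: "3 \<le> p"
    then have p: "p > 1" by simp
    have "1 / (p - 1) \<le> 1" using p3 by (simp add: divide_le_eq)
    then have e: "max 1 (1 / (p - 1)) = 1" by simp
    have ep: "epowr x 1 = x" for x by (simp add: epowr_def less_top[symmetric])
    show "\<exists>C>0. \<forall>w f. is_weight w \<and> Ap_norm p w < \<infinity> \<and> in_Lpw p w f \<longrightarrow>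
              Lpw_nn p w (max_trunc K f) \<le> ennreal C * Ap_norm p w * Lpw p w f"
    proof (intro exI[of _ "weighted_const p"] conjI weighted_const_pos p allI impI)
      fix w and f :: "'a \<Rightarrow> real" assume "is_weight w \<and> Ap_norm p w < \<infinity> \<and> in_Lpw p w f"
      then have "is_weight w" "Ap_norm p w < \<infinity>" "in_Lpw p w f" by auto
      from max_trunc_weighted[OF p this] show "Lpw_nn p w (max_trunc K f) \<le> ennreal (weighted_const p) * Ap_norm p w * Lpw p w f"
        unfolding e ep mt .
    qed
  qed
qed

end
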